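(* Let $(E,w)$ be a finite vertex weighted graph, $\mathsf{k}$ a field, and $A$ a unital $\mathsf{k}$-algebra. Then $A$ is Morita equivalent to $L_{\mathsf{k}}(E,w)$ if and only if there exist a positive integer $n$ and a hair extension $(E^+,w^+)$ of $(E,w)$ such that $\mathbb{M}_n(A)\cong L_{\mathsf{k}}(E^+,w^+)$ as $\mathsf{k}$-algebras.
   Context: A (directed) graph is a quadruple $E=(E^0,E^1,s,r)$ with sets $E^0$ (vertices) and $E^1$ (edges) and maps $s,r:E^1\to E^0$ (source, range). It is finite if $E^0,E^1$ are finite, and row-finite if each vertex emits finitely many edges ($s^{-1}(v)$ is finite for all $v$). A vertex is a sink if it emits no edges; it is regular if it is not a sink and emits only finitely many edges; $E^0_{\mathrm{reg}}$ is the set of regular vertices. A weighted graph is a pair $(E,w)$ with $E$ a graph and $w:E^1\to\mathbb{N}^+$ a map ($\mathbb{N}^+$ = positive integers). It is finite (row-finite) if $E$ is. For $v\in E^0_{\mathrm{reg}}$ set $w(v):=\max\{w(e): e\in s^{-1}(v)\}$. A row-finite weighted graph is a vertex weighted graph if for every $v\in E^0_{\mathrm{reg}}$ one has $w(e)=w(e')$ for all $e,e'\in s^{-1}(v)$. For a row-finite weighted graph $(E,w)$ and a field $\mathsf{k}$, the weighted Leavitt path algebra $L_{\mathsf{k}}(E,w)$ is the (associative) $\mathsf{k}$-algebra generated by $\{v,e_i,e_i^*: v\in E^0, e\in E^1, 1\le i\le w(e)\}$ subject to the relations (i) $uv=\delta_{uv}u$ for $u,v\in E^0$; (ii) $s(e)e_i=e_i=e_ir(e)$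 and $r(e)e_i^*=e_i^*=e_i^*s(e)$ for $e\in E^1$, $1\le i\le w(e)$; (iii) $\sum_{e\in s^{-1}(v)}e_ie_j^*=\delta_{ij}v$ for $v\in E^0_{\mathrm{reg}}$, $1\le i,j\le w(v)$; (iv) $\sum_{1\le i\le w(v)}e_i^*f_i=\delta_{ef}r(e)$ for $v\in E^0_{\mathrm{reg}}$, $e,f\in s^{-1}(v)$; where in (iii),(iv) $e_i$ and $e_i^*$ are set to be zero whenever $i>w(e)$. If $(E,w)$ is finite, $L_{\mathsf{k}}(E,w)$ is unital with identity $\sum_{v\in E^0}v$. Hair extension: let $(E,w)$ be a finite weighted graph with $E^0=\{v_1,\dots,v_t\}$ and let $n_1,\dots,n_t$ be positive integers. The hair extension $(E^+(n_1,\dots,n_t),w^+)$ of $(E,w)$ is obtained from $(E,w)$ by adding, for each $i$, new vertices $v_i^1,\dots,v_i^{n_i-1}$ and new edges $e_i^1,\dots,e_i^{n_i-1}$, with $s(e_i^j)=v_i^j$ and $r(e_i^j)=v_i^{j-1}$, where $v_i^0:=v_i$ (nothing is added at $v_i$ if $n_i=1$); $w^+$ extends $w$ with $w^+(e_i^j)=1$ for all $1\le i\le t$, $1\le j\le n_i-1$. A hair extension of $(E,w)$ is any such weighted graph, for some choice of positive integers $n_1,\dots,n_t$. $\mathbb{M}_n(R)$ denotes the ring of $n\times n$ matrices over $R$. Morita equivalence is taken for $\mathsf{k}$-algebras ($\mathsf{k}$-linear equivalence of module categories). *)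

theory Defs
  imports
    "HOL-Algebra.QuotRing"
    "HOL-Algebra.Module"
    "HOL-Library.Equipollence"
    "Graph_Theory.Digraph"
    "Jordan_Normal_Form.Matrix"
begin

section \<open>Weighted graphs\<close>

text \<open>
  A directed graph is a \<^typ>\<open>('v, 'e) pre_digraph\<close> satisfying \<^const>\<open>wf_digraph\<close>: \<^const>\<open>tail\<close> is the
  source map and \<^const>\<open>head\<close> the range map; loops and parallel edges are allowed, and finite graphs
  are the \<^const>\<open>fin_digraph\<close>s.
\<close>

definition row_finite :: "('v, 'e) pre_digraph \<Rightarrow> bool" where
  "row_finite E \<longleftrightarrow> (\<forall>v\<in>verts E. finite (out_arcs E v))"

definition regular_verts :: "('v, 'e) pre_digraph \<Rightarrow> 'v set" where
  "regular_verts E = {v \<in> verts E. out_arcs E v \<noteq> {} \<and> finite (out_arcs E v)}"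

locale weighted_graph = wf_digraph E for E :: "('v, 'e) pre_digraph" +
  fixes w :: "'e \<Rightarrow> nat"
  assumes weight_pos: "e \<in> arcs E \<Longrightarrow> 0 < w e"

definition vertex_weight :: "('v, 'e) pre_digraph \<Rightarrow> ('e \<Rightarrow> nat) \<Rightarrow> 'v \<Rightarrow> nat" where
  "vertex_weight E w v = Max (w ` out_arcs E v)"

locale vertex_weighted_graph = weighted_graph +
  assumes row_finite: "row_finite E"
    and weight_eq: "\<lbrakk>v \<in> regular_verts E; e \<in> out_arcs E v; e' \<in> out_arcs E v\<rbrakk> \<Longrightarrow> w e = w e'"

text \<open>
  The hair extension of \<open>E\<close> with parameters \<open>n v\<close>: the original vertex \<open>v\<close> becomes \<open>(v, 0)\<close>, the new
  vertices are the \<open>(v, j)\<close> with \<open>1 \<le> j \<le> n v - 1\<close>; the original edge \<open>e\<close> becomes \<open>Inl e\<close>, and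
  \<open>Inr (v, j)\<close> is the new edge from \<open>(v, j)\<close> to \<open>(v, j - 1)\<close>.
\<close>

definition hair_extension ::
  "('v, 'e) pre_digraph \<Rightarrow> ('v \<Rightarrow> nat) \<Rightarrow> ('v \<times> nat, 'e + 'v \<times> nat) pre_digraph" where
  "hair_extension E n =
    \<lparr>verts = {(v, j) | v j. v \<in> verts E \<and> (j = 0 \<or> j \<in> {1..n v - 1})},
     arcs = Inl ` arcs E \<union> Inr ` {(v, j) | v j. v \<in> verts E \<and> j \<in> {1..n v - 1}},
     tail = case_sum (\<lambda>e. (tail E e, 0)) (\<lambda>(v, j). (v, j)),
     head = case_sum (\<lambda>e. (head E e, 0)) (\<lambda>(v, j). (v, j - 1))\<rparr>"

definition hair_weight :: "('e \<Rightarrow> nat) \<Rightarrow> 'e + 'v \<times> nat \<Rightarrow> nat" where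
  "hair_weight w = case_sum w (\<lambda>_. 1)"


section \<open>Algebras over a field\<close>

text \<open>
  The library locale \<^locale>\<open>algebra\<close> only covers commutative algebras. The zero algebra is allowed.
\<close>

locale unital_algebra = K: field K + module K A + A: ring A
  for K :: "'k ring" and A :: "('k, 'a) module" +
  assumes smult_mult_left:
      "\<lbrakk>c \<in> carrier K; x \<in> carrier A; y \<in> carrier A\<rbrakk> \<Longrightarrow>
        (c \<odot>\<^bsub>A\<^esub> x) \<otimes>\<^bsub>A\<^esub> y = c \<odot>\<^bsub>A\<^esub> (x \<otimes>\<^bsub>A\<^esub> y)"
    and smult_mult_right:
      "\<lbrakk>c \<in> carrier K; x \<in> carrier A; y \<in> carrier A\<rbrakk> \<Longrightarrow>
        x \<otimes>\<^bsub>A\<^esub> (c \<odot>\<^bsub>A\<^esub> y) = c \<odot>\<^bsub>A\<^esub> (x \<otimes>\<^bsub>A\<^esub> y)"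

definition algebra_isomorphic :: "'k ring \<Rightarrow> ('k, 'a) module \<Rightarrow> ('k, 'b) module \<Rightarrow> bool" where
  "algebra_isomorphic K A B \<longleftrightarrow>
    (\<exists>h \<in> ring_iso A B. \<forall>c\<in>carrier K. \<forall>x\<in>carrier A. h (c \<odot>\<^bsub>A\<^esub> x) = c \<odot>\<^bsub>B\<^esub> h x)"

definition matrix_algebra :: "nat \<Rightarrow> ('k, 'a) module \<Rightarrow> ('k, 'a mat) module" where
  "matrix_algebra n A =
    \<lparr>carrier = {M \<in> carrier_mat n n. elements_mat M \<subseteq> carrier A},
     monoid.mult = (\<lambda>M N. mat n n (\<lambda>(i, j). \<Oplus>\<^bsub>A\<^esub>k\<in>{..<n}. M $$ (i, k) \<otimes>\<^bsub>A\<^esub> N $$ (k, j))),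
     one = mat n n (\<lambda>(i, j). if i = j then \<one>\<^bsub>A\<^esub> else \<zero>\<^bsub>A\<^esub>),
     ring.zero = mat n n (\<lambda>_. \<zero>\<^bsub>A\<^esub>),
     add = (\<lambda>M N. mat n n (\<lambda>(i, j). M $$ (i, j) \<oplus>\<^bsub>A\<^esub> N $$ (i, j))),
     smult = (\<lambda>c. map_mat (\<lambda>x. c \<odot>\<^bsub>A\<^esub> x))\<rparr>"


section \<open>Algebras given by generators and relations\<close>

text \<open>
  The free associative algebra on \<open>X\<close>, without unit: finitely supported functions on the nonempty words
  over \<open>X\<close>, with convolution as product. It has no identity, so its \<open>one\<close> field is meaningless.
\<close>

definition free_algebra :: "'k ring \<Rightarrow> 'g set \<Rightarrow> ('k, 'g list \<Rightarrow> 'k) module" where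
  "free_algebra K X =
    \<lparr>carrier = {f. range f \<subseteq> carrier K \<and> finite {u. f u \<noteq> \<zero>\<^bsub>K\<^esub>} \<and>
                   {u. f u \<noteq> \<zero>\<^bsub>K\<^esub>} \<subseteq> lists X - {[]}},
     monoid.mult = (\<lambda>f g u. \<Oplus>\<^bsub>K\<^esub>i\<in>{..length u}. f (take i u) \<otimes>\<^bsub>K\<^esub> g (drop i u)),
     one = undefined,
     ring.zero = (\<lambda>_. \<zero>\<^bsub>K\<^esub>),
     add = (\<lambda>f g u. f u \<oplus>\<^bsub>K\<^esub> g u),
     smult = (\<lambda>c f u. c \<otimes>\<^bsub>K\<^esub> f u)\<rparr>"

definition free_gen :: "'k ring \<Rightarrow> 'g \<Rightarrow> 'g list \<Rightarrow> 'k" where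
  "free_gen K x = (\<lambda>u. if u = [x] then \<one>\<^bsub>K\<^esub> else \<zero>\<^bsub>K\<^esub>)"

text \<open>Two-sided ideals of a not necessarily unital algebra.\<close>

definition algebra_ideal :: "'k ring \<Rightarrow> ('k, 'a) module \<Rightarrow> 'a set \<Rightarrow> bool" where
  "algebra_ideal K F I \<longleftrightarrow>
    I \<subseteq> carrier F \<and> \<zero>\<^bsub>F\<^esub> \<in> I \<and>
    (\<forall>x\<in>I. \<forall>y\<in>I. x \<oplus>\<^bsub>F\<^esub> y \<in> I) \<and>
    (\<forall>c\<in>carrier K. \<forall>x\<in>I. c \<odot>\<^bsub>F\<^esub> x \<in> I) \<and>
    (\<forall>a\<in>carrier F. \<forall>x\<in>I. a \<otimes>\<^bsub>F\<^esub> x \<in> I \<and> x \<otimes>\<^bsub>F\<^esub> a \<in> I)"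

definition algebra_ideal_gen :: "'k ring \<Rightarrow> ('k, 'a) module \<Rightarrow> 'a set \<Rightarrow> 'a set" where
  "algebra_ideal_gen K F S = \<Inter>{I. algebra_ideal K F I \<and> S \<subseteq> I}"

text \<open>
  The quotient of \<open>F\<close> by an ideal, as in \<^const>\<open>FactRing\<close>, but where the representative \<open>e\<close> of the
  identity element of the quotient has to be supplied since \<open>F\<close> may have none.
\<close>

definition quotient_algebra :: "('k, 'a) module \<Rightarrow> 'a set \<Rightarrow> 'a \<Rightarrow> ('k, 'a set) module" where
  "quotient_algebra F I e =
    \<lparr>carrier = a_rcosets\<^bsub>F\<^esub> I,
     monoid.mult = rcoset_mult F I,
     one = I +>\<^bsub>F\<^esub> e,
     ring.zero = I,
     add = set_add F,
     smult = (\<lambda>c X. \<Union>x\<in>X. I +>\<^bsub>F\<^esub> (c \<odot>\<^bsub>F\<^esub> x))\<rparr>"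


section \<open>Weighted Leavitt path algebras\<close>

datatype ('v, 'e) lpa_gen = Vertex 'v | Edge 'e nat | Ghost 'e nat

definition lpa_gens :: "('v, 'e) pre_digraph \<Rightarrow> ('e \<Rightarrow> nat) \<Rightarrow> ('v, 'e) lpa_gen set" where
  "lpa_gens E w =
    Vertex ` verts E \<union> {Edge e i | e i. e \<in> arcs E \<and> 1 \<le> i \<and> i \<le> w e}
                     \<union> {Ghost e i | e i. e \<in> arcs E \<and> 1 \<le> i \<and> i \<le> w e}"

abbreviation lpa_free ::
  "'k ring \<Rightarrow> ('v, 'e) pre_digraph \<Rightarrow> ('e \<Rightarrow> nat) \<Rightarrow> ('k, ('v, 'e) lpa_gen list \<Rightarrow> 'k) module" where
  "lpa_free K E w \<equiv> free_algebra K (lpa_gens E w)"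

text \<open>
  \<open>lpa_gen_or_zero K E w (Edge e i)\<close> is \<open>e\<^sub>i\<close>, read as zero for \<open>i > w e\<close>; similarly for \<open>Ghost e i\<close>.
\<close>

definition lpa_gen_or_zero ::
  "'k ring \<Rightarrow> ('v, 'e) pre_digraph \<Rightarrow> ('e \<Rightarrow> nat) \<Rightarrow> ('v, 'e) lpa_gen \<Rightarrow> ('v, 'e) lpa_gen list \<Rightarrow> 'k" where
  "lpa_gen_or_zero K E w x =
    (if x \<in> lpa_gens E w then free_gen K x else \<zero>\<^bsub>lpa_free K E w\<^esub>)"

definition lpa_relators ::
  "'k ring \<Rightarrow> ('v, 'e) pre_digraph \<Rightarrow> ('e \<Rightarrow> nat) \<Rightarrow> (('v, 'e) lpa_gen list \<Rightarrow> 'k) set" where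
  "lpa_relators K E w =
    (let F = lpa_free K E w; g = lpa_gen_or_zero K E w in
      {g (Vertex u) \<otimes>\<^bsub>F\<^esub> g (Vertex v) \<ominus>\<^bsub>F\<^esub> (if u = v then g (Vertex u) else \<zero>\<^bsub>F\<^esub>) | u v.
         u \<in> verts E \<and> v \<in> verts E} \<union>
      (\<Union>e\<in>arcs E. \<Union>i\<in>{1..w e}.
         {g (Vertex (tail E e)) \<otimes>\<^bsub>F\<^esub> g (Edge e i) \<ominus>\<^bsub>F\<^esub> g (Edge e i),
          g (Edge e i) \<otimes>\<^bsub>F\<^esub> g (Vertex (head E e)) \<ominus>\<^bsub>F\<^esub> g (Edge e i),
          g (Vertex (head E e)) \<otimes>\<^bsub>F\<^esub> g (Ghost e i) \<ominus>\<^bsub>F\<^esub> g (Ghost e i),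
          g (Ghost e i) \<otimes>\<^bsub>F\<^esub> g (Vertex (tail E e)) \<ominus>\<^bsub>F\<^esub> g (Ghost e i)}) \<union>
      {(\<Oplus>\<^bsub>F\<^esub>e\<in>out_arcs E v. g (Edge e i) \<otimes>\<^bsub>F\<^esub> g (Ghost e j))
         \<ominus>\<^bsub>F\<^esub> (if i = j then g (Vertex v) else \<zero>\<^bsub>F\<^esub>) | v i j.
         v \<in> regular_verts E \<and> i \<in> {1..vertex_weight E w v} \<and> j \<in> {1..vertex_weight E w v}} \<union>
      {(\<Oplus>\<^bsub>F\<^esub>i\<in>{1..vertex_weight E w v}. g (Ghost e i) \<otimes>\<^bsub>F\<^esub> g (Edge f i))
         \<ominus>\<^bsub>F\<^esub> (if e = f then g (Vertex (head E e)) else \<zero>\<^bsub>F\<^esub>) | v e f.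
         v \<in> regular_verts E \<and> e \<in> out_arcs E v \<and> f \<in> out_arcs E v})"

text \<open>
  The weighted Leavitt path algebra of a finite weighted graph; its identity is the sum of all vertices.
\<close>

definition leavitt_path_algebra ::
  "'k ring \<Rightarrow> ('v, 'e) pre_digraph \<Rightarrow> ('e \<Rightarrow> nat) \<Rightarrow> ('k, (('v, 'e) lpa_gen list \<Rightarrow> 'k) set) module" where
  "leavitt_path_algebra K E w =
    quotient_algebra (lpa_free K E w)
      (algebra_ideal_gen K (lpa_free K E w) (lpa_relators K E w))
      (\<Oplus>\<^bsub>lpa_free K E w\<^esub>v\<in>verts E. free_gen K (Vertex v))"


section \<open>Morita equivalence\<close>

text \<open>
  Unital left modules over a not necessarily commutative ring; the library locale \<^locale>\<open>module\<close>
  requires a commutative one. As there, the \<open>mult\<close> and \<open>one\<close> fields of \<open>M\<close> play no role.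
\<close>

locale left_module = R?: ring R + M?: abelian_group M
  for R :: "('a, 'r) ring_scheme" (structure) and M :: "('a, 'm) module" (structure) +
  assumes smult_closed: "\<lbrakk>a \<in> carrier R; x \<in> carrier M\<rbrakk> \<Longrightarrow> a \<odot>\<^bsub>M\<^esub> x \<in> carrier M"
    and smult_l_distr: "\<lbrakk>a \<in> carrier R; b \<in> carrier R; x \<in> carrier M\<rbrakk> \<Longrightarrow>
      (a \<oplus>\<^bsub>R\<^esub> b) \<odot>\<^bsub>M\<^esub> x = a \<odot>\<^bsub>M\<^esub> x \<oplus>\<^bsub>M\<^esub> b \<odot>\<^bsub>M\<^esub> x"
    and smult_r_distr: "\<lbrakk>a \<in> carrier R; x \<in> carrier M; y \<in> carrier M\<rbrakk> \<Longrightarrow>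
      a \<odot>\<^bsub>M\<^esub> (x \<oplus>\<^bsub>M\<^esub> y) = a \<odot>\<^bsub>M\<^esub> x \<oplus>\<^bsub>M\<^esub> a \<odot>\<^bsub>M\<^esub> y"
    and smult_assoc: "\<lbrakk>a \<in> carrier R; b \<in> carrier R; x \<in> carrier M\<rbrakk> \<Longrightarrow>
      (a \<otimes>\<^bsub>R\<^esub> b) \<odot>\<^bsub>M\<^esub> x = a \<odot>\<^bsub>M\<^esub> (b \<odot>\<^bsub>M\<^esub> x)"
    and smult_one: "x \<in> carrier M \<Longrightarrow> \<one>\<^bsub>R\<^esub> \<odot>\<^bsub>M\<^esub> x = x"

text \<open>
  The category of left \<open>A\<close>-modules with carrier in the type \<open>'u\<close>, which serves as the universe. Morphisms
  are extensional functions, so that equality of morphisms is equality of functions.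
\<close>

definition mod_hom ::
  "('k, 'a) module \<Rightarrow> ('a, 'u) module \<Rightarrow> ('a, 'u) module \<Rightarrow> ('u \<Rightarrow> 'u) set" where
  "mod_hom A M N =
    {f \<in> carrier M \<rightarrow>\<^sub>E carrier N.
      (\<forall>x\<in>carrier M. \<forall>y\<in>carrier M. f (x \<oplus>\<^bsub>M\<^esub> y) = f x \<oplus>\<^bsub>N\<^esub> f y) \<and>
      (\<forall>a\<in>carrier A. \<forall>x\<in>carrier M. f (a \<odot>\<^bsub>M\<^esub> x) = a \<odot>\<^bsub>N\<^esub> f x)}"

definition mod_id :: "('a, 'u) module \<Rightarrow> 'u \<Rightarrow> 'u" where
  "mod_id M = (\<lambda>x\<in>carrier M. x)"

definition mod_iso ::
  "('k, 'a) module \<Rightarrow> ('a, 'u) module \<Rightarrow> ('a, 'u) module \<Rightarrow> ('u \<Rightarrow> 'u) set" where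
  "mod_iso A M N =
    {f \<in> mod_hom A M N. \<exists>g \<in> mod_hom A N M.
      compose (carrier M) g f = mod_id M \<and> compose (carrier N) f g = mod_id N}"

text \<open>
  The \<open>k\<close>-vector space structure on morphism sets; a scalar \<open>c\<close> acts on an \<open>A\<close>-module through \<open>c \<cdot> 1\<^sub>A\<close>.
\<close>

definition hom_add :: "('a, 'u) module \<Rightarrow> ('a, 'u) module \<Rightarrow> ('u \<Rightarrow> 'u) \<Rightarrow> ('u \<Rightarrow> 'u) \<Rightarrow> 'u \<Rightarrow> 'u" where
  "hom_add M N f g = (\<lambda>x\<in>carrier M. f x \<oplus>\<^bsub>N\<^esub> g x)"

definition hom_smult ::
  "('k, 'a) module \<Rightarrow> ('a, 'u) module \<Rightarrow> ('a, 'u) module \<Rightarrow> 'k \<Rightarrow> ('u \<Rightarrow> 'u) \<Rightarrow> 'u \<Rightarrow> 'u" where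
  "hom_smult A M N c f = (\<lambda>x\<in>carrier M. (c \<odot>\<^bsub>A\<^esub> \<one>\<^bsub>A\<^esub>) \<odot>\<^bsub>N\<^esub> f x)"

text \<open>
  \<open>F\<close> is the object map of a functor; \<open>\<Phi> M N\<close> is its action on morphisms from \<open>M\<close> to \<open>N\<close>.
\<close>

locale linear_functor =
  fixes K :: "'k ring" and A :: "('k, 'a) module" and B :: "('k, 'b) module"
    and F :: "('a, 'u) module \<Rightarrow> ('b, 'u) module"
    and \<Phi> :: "('a, 'u) module \<Rightarrow> ('a, 'u) module \<Rightarrow> ('u \<Rightarrow> 'u) \<Rightarrow> 'u \<Rightarrow> 'u"
  assumes obj: "left_module A M \<Longrightarrow> left_module B (F M)"
    and arr: "\<lbrakk>left_module A M; left_module A N; f \<in> mod_hom A M N\<rbrakk> \<Longrightarrow>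
      \<Phi> M N f \<in> mod_hom B (F M) (F N)"
    and map_id: "left_module A M \<Longrightarrow> \<Phi> M M (mod_id M) = mod_id (F M)"
    and map_comp: "\<lbrakk>left_module A L; left_module A M; left_module A N;
        f \<in> mod_hom A L M; g \<in> mod_hom A M N\<rbrakk> \<Longrightarrow>
      \<Phi> L N (compose (carrier L) g f) = compose (carrier (F L)) (\<Phi> M N g) (\<Phi> L M f)"
    and map_add: "\<lbrakk>left_module A M; left_module A N; f \<in> mod_hom A M N; g \<in> mod_hom A M N\<rbrakk> \<Longrightarrow>
      \<Phi> M N (hom_add M N f g) = hom_add (F M) (F N) (\<Phi> M N f) (\<Phi> M N g)"
    and map_smult: "\<lbrakk>left_module A M; left_module A N; f \<in> mod_hom A M N; c \<in> carrier K\<rbrakk> \<Longrightarrow>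
      \<Phi> M N (hom_smult A M N c f) = hom_smult B (F M) (F N) c (\<Phi> M N f)"

text \<open>
  The composite of \<open>(F, \<Phi>)\<close>, from \<open>A\<close>-modules to \<open>B\<close>-modules, and \<open>(G, \<Gamma>)\<close>, from \<open>B\<close>-modules to
  \<open>A\<close>-modules, is naturally isomorphic to the identity functor.
\<close>

definition nat_iso_id ::
  "('k, 'a) module \<Rightarrow>
   (('a, 'u) module \<Rightarrow> ('b, 'u) module) \<Rightarrow>
   (('a, 'u) module \<Rightarrow> ('a, 'u) module \<Rightarrow> ('u \<Rightarrow> 'u) \<Rightarrow> 'u \<Rightarrow> 'u) \<Rightarrow>
   (('b, 'u) module \<Rightarrow> ('a, 'u) module) \<Rightarrow>
   (('b, 'u) module \<Rightarrow> ('b, 'u) module \<Rightarrow> ('u \<Rightarrow> 'u) \<Rightarrow> 'u \<Rightarrow> 'u) \<Rightarrow> bool" where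
  "nat_iso_id A F \<Phi> G \<Gamma> \<longleftrightarrow>
    (\<exists>\<eta>. (\<forall>M. left_module A M \<longrightarrow> \<eta> M \<in> mod_iso A M (G (F M))) \<and>
         (\<forall>M N f. left_module A M \<and> left_module A N \<and> f \<in> mod_hom A M N \<longrightarrow>
            compose (carrier M) (\<eta> N) f = compose (carrier M) (\<Gamma> (F M) (F N) (\<Phi> M N f)) (\<eta> M)))"

definition morita_equivalent ::
  "'u itself \<Rightarrow> 'k ring \<Rightarrow> ('k, 'a) module \<Rightarrow> ('k, 'b) module \<Rightarrow> bool" where
  "morita_equivalent U K A B \<longleftrightarrow>
    (\<exists>(F :: ('a, 'u) module \<Rightarrow> ('b, 'u) module) \<Phi> (G :: ('b, 'u) module \<Rightarrow> ('a, 'u) module) \<Gamma>.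
       linear_functor K A B F \<Phi> \<and> linear_functor K B A G \<Gamma> \<and>
       nat_iso_id A F \<Phi> G \<Gamma> \<and> nat_iso_id B G \<Gamma> F \<Phi>)"

text \<open>
  A type is an admissible universe for \<open>R\<close> if it is infinite and can hold the regular module of \<open>R\<close>.
  The modules with carrier in \<open>'u\<close> are then, up to isomorphism, all modules of cardinality at most that
  of \<open>'u\<close>. They are closed under quotients, submodules and direct sums of at most that many modules, and
  the free module on a set of this cardinality is one of them, so that equivalence of these categories
  has the same meaning for all admissible universes.
\<close>

definition module_universe :: "'u itself \<Rightarrow> ('k, 'a) module \<Rightarrow> bool" where
  "module_universe U R \<longleftrightarrow> infinite (UNIV :: 'u set) \<and> carrier R \<lesssim> (UNIV :: 'u set)"

end

theory Submission
 imports Defs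
begin

abbreviation (input) mult_of ("_ *[_] _" [70, 0, 71] 70) where "x *[R] y \<equiv> x \<otimes>\<^bsub>R\<^esub> y"
abbreviation (input) add_of ("_ +[_] _" [65, 0, 66] 65) where "x +[R] y \<equiv> x \<oplus>\<^bsub>R\<^esub> y"
abbreviation (input) minus_of ("_ -[_] _" [65, 0, 66] 65) where "x -[R] y \<equiv> x \<ominus>\<^bsub>R\<^esub> y"
abbreviation (input) uminus_of ("-[_] _" [0, 81] 80) where "-[R] x \<equiv> \<ominus>\<^bsub>R\<^esub> x"
abbreviation (input) zero_of ("0[_]") where "0[R] \<equiv> \<zero>\<^bsub>R\<^esub>"
abbreviation (input) one_of ("1[_]") where "1[R] \<equiv> \<one>\<^bsub>R\<^esub>"
abbreviation (input) smult_of ("_ *:[_] _" [70, 0, 71] 70) where "c *:[M] x \<equiv> c \<odot>\<^bsub>M\<^esub> x"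
abbreviation (input) funcset_of (infixr "->" 60) where "A -> B \<equiv> A \<rightarrow> B"
abbreviation (input) to_carrier (infixr "->:" 60) where "A ->: M \<equiv> A \<rightarrow> carrier M"
abbreviation (input) iff_of (infixr "<->" 25) where "p <-> q \<equiv> p = q"
abbreviation (input) car where "car \<equiv> carrier"
abbreviation (input) vs where "vs \<equiv> verts"
abbreviation (input) sm where "sm \<equiv> finsum"
abbreviation (input) lmod where "lmod \<equiv> left_module"
abbreviation (input) ualg where "ualg \<equiv> unital_algebra"
abbreviation (input) elem_of (infix "<:" 50) where "x <: M \<equiv> x \<in> carrier M"

text \<open>
The generators at a regular vertex form two mutually inverse matrices. Filtering \<open>L\<close>-modules by the length
of words in these matrices (as in Bergman's coproduct theorems) shows that a finitely generated projective
\<open>L\<close>-module containing \<open>L\<close> as a direct summand has the form \<open>L \<oplus> (\<Oplus> L v)\<close>. Applied to a power of the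
bimodule of a Morita equivalence, whose endomorphism algebra is a matrix algebra over \<open>A\<close>, this gives the hairs:
the endomorphism algebra of such a module is \<open>L(E\<^sup>+)\<close>. Conversely, \<open>L\<close> is a full corner of \<open>L(E\<^sup>+)\<close>.
\<close>

section \<open>Sums, modules and algebras\<close>

text \<open>The obstacle is that a finitely generated projective module comes without any basis to
  start from, while normal forms of words are at hand only for \<open>L\<close> itself. One property
  of a filtered module, \<open>good\<close>, bridges this: the only cancellation between level
  \<open>n + 2\<close> and lower levels is the one forced by the inverse matrices. It passes to
  every module that embeds into a finite power of \<open>L\<close>, in particular to a complement of
  \<open>L\<close> in a projective module, and it suffices to turn a \<open>K\<close>-basis of what
  is new in each level, chosen vertex by vertex, into an \<open>L\<close>-basis. The injectivity
  argument behind this is used twice, the first time to embed \<open>L\<close> into its normal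
  forms. Equal weights at a vertex make the matrices full: otherwise some of their entries would be
  zero. The summand \<open>L\<close> has to be split off because a hair extension keeps every
  original vertex; the other basis elements at \<open>v\<close> become the hair at \<open>v\<close>.
  The modules of a Morita equivalence live in a fixed type, so tensor products and quotients are
  encoded in it.\<close>

lemma (in abelian_monoid) finsum_swap:
 assumes "finite A" "finite B" "!!i j. [|i : A; j : B|] ==> f i j <: G"
 shows "(\<Oplus>i\<in>A. \<Oplus>j\<in>B. f i j) = (\<Oplus>j\<in>B. \<Oplus>i\<in>A. f i j)" using assms(1,3)
proof (induction A)
 case (insert a A)
 have "(\<Oplus>i\<in>insert a A. \<Oplus>j\<in>B. f i j) = (\<Oplus>j\<in>B. f a j) \<oplus> (\<Oplus>j\<in>B. \<Oplus>i\<in>A. f i j)"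
 using insert by (subst finsum_insert) auto
 also have "... = (\<Oplus>j\<in>B. f a j \<oplus> (\<Oplus>i\<in>A. f i j))" using insert.prems by (subst finsum_addf) auto
 also have "... = (\<Oplus>j\<in>B. \<Oplus>i\<in>insert a A. f i j)" using insert by (intro finsum_cong') auto
 finally show ?case .
qed simp

lemma (in abelian_monoid) finsum_mem:
 assumes "\<zero> : S" "!!x y. [|x : S; y : S|] ==> x \<oplus> y : S" "S <= car G" "!!i. i : A ==> f i : S"
 shows "sm G f A : S" using assms(4)
proof (induction A rule: infinite_finite_induct)
 case (insert a A)
 thus ?case using assms(1-3) by (subst finsum_insert) auto
qed (use assms(1) in auto)

lemma (in abelian_monoid) finsum_delta:
 assumes "finite A" "i : A" "!!j. [|j : A; j ~= i|] ==> f j = \<zero>" "f i <: G" shows "sm G f A = f i"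
proof -
 have "sm G f A = (\<Oplus>j\<in>A. if i = j then f i else \<zero>)" using assms by (intro finsum_cong') auto
 thus ?thesis using assms finsum_singleton[of i A "%_. f i"] by simp
qed

lemmas (in abelian_group) ag = abelian_group_axioms

lemma additive_zero:
 assumes "abelian_group M" "abelian_group N" "h : car M ->: N" and "!!x y. [|x <: M; y <: M|] ==> h (x +[M] y) = h x +[N] h y"
 shows "h 0[M] = 0[N]" proof -
 interpret M: abelian_group M by fact
 interpret N: abelian_group N by fact
 have c: "h 0[M] <: N" using assms(3) by blast
 have "h 0[M] +[N] h 0[M] = h 0[M]" by (simp flip: assms(4))
 thus ?thesis using c by (metis N.add.r_cancel_one)
qed

lemma additive_minus:
 assumes "abelian_group M" "abelian_group N" "h : car M ->: N" and "!!x y. [|x <: M; y <: M|] ==> h (x +[M] y) = h x +[N] h y" and "x <: M"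
 shows "h (-[M] x) = -[N] h x" proof -
 interpret M: abelian_group M by fact
 interpret N: abelian_group N by fact
 have "h (-[M] x) +[N] h x = 0[N]" using assms additive_zero[OF assms(1-4)] by (simp flip: assms(4) add: M.l_neg)
 thus ?thesis by (rule N.minus_equality[symmetric]) (use assms(3,5) in auto)
qed

lemma add_finsum:
 assumes "abelian_group M" "abelian_group N" "h : car M ->: N" and "!!x y. [|x <: M; y <: M|] ==> h (x +[M] y) = h x +[N] h y" and "f : A ->: M"
 shows "h (sm M f A) = sm N (%i. h (f i)) A" using assms(5)
proof (induction A rule: infinite_finite_induct)
 interpret M: abelian_group M by fact
 interpret N: abelian_group N by fact
 {
 case (infinite A)
 thus ?case using additive_zero[OF assms(1-4)] by simp
 next
 case empty
 thus ?case using additive_zero[OF assms(1-4)] by simp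
 next
 case (insert a A)
 have "(%i. h (f i)) : A ->: N" "h (f a) <: N" using insert.prems assms(3) by auto
 thus ?case using insert by (simp add: assms(4))
 }
qed

context left_module
begin

declare smult_closed [simp] smult_one [simp]

lemma smult_l_zero [simp]: "x <: M ==> 0[R] *:[M] x = 0[M]" using additive_zero[of R M "%a. a *:[M] x"] smult_l_distr by (simp add: R.ag M.ag)

lemma smult_r_zero [simp]: "a <: R ==> a *:[M] 0[M] = 0[M]" using additive_zero[of M M "%x. a *:[M] x"] smult_r_distr by (simp add: M.ag)

lemma smult_r_minus: "[|a <: R; x <: M|] ==> a *:[M] (-[M] x) = -[M] (a *:[M] x)"
 using additive_minus[of M M "%x. a *:[M] x" x] smult_r_distr by (simp add: M.ag)

lemma smult_l_minus: "[|a <: R; x <: M|] ==> (-[R] a) *:[M] x = -[M] (a *:[M] x)"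
 using additive_minus[of R M "%a. a *:[M] x" a] smult_l_distr by (simp add: R.ag M.ag)

lemma smult_r_finsum: "[|a <: R; f : A ->: M|] ==> a *:[M] sm M f A = sm M (%i. a *:[M] f i) A"
 using add_finsum[of M M "%x. a *:[M] x" f A] smult_r_distr by (simp add: M.ag)

lemma smult_l_finsum: "[|x <: M; f : A ->: R|] ==> sm R f A *:[M] x = sm M (%i. f i *:[M] x) A"
 using add_finsum[of R M "%a. a *:[M] x" f A] smult_l_distr by (simp add: R.ag M.ag)

end

definition alg_map :: "'k ring => ('k, 'a) module => ('k, 'b) module => ('a => 'b) => bool" where "alg_map K A B h <-> h : car A ->: B &
 (ALL x:car A. ALL y:car A. h (x +[A] y) = h x +[B] h y & h (x *[A] y) = h x *[B] h y) &
 (ALL c:car K. ALL x:car A. h (c *:[A] x) = c *:[B] h x)"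

lemma alg_mapD:
 assumes "alg_map K A B h" shows "x <: A ==> h x <: B" and "[|x <: A; y <: A|] ==> h (x +[A] y) = h x +[B] h y"
 and "[|x <: A; y <: A|] ==> h (x *[A] y) = h x *[B] h y"
 and "[|c <: K; x <: A|] ==> h (c *:[A] x) = c *:[B] h x" using assms by (auto simp: alg_map_def)

lemma alg_map_zero:
 assumes "alg_map K A B h" "abelian_group A" "abelian_group B" shows "h 0[A] = 0[B]" using additive_zero[of A B h] assms by (auto simp: alg_map_def)

lemma alg_map_finsum:
 assumes "alg_map K A B h" "abelian_group A" "abelian_group B" "f : I ->: A" shows "h (sm A f I) = sm B (%i. h (f i)) I"
 using add_finsum[of A B h f I] assms by (auto simp: alg_map_def)

section \<open>Quotients and the free algebra\<close>

text \<open>Algebras without a unit; the \<open>one\<close> field is not constrained.\<close>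

locale pre_algebra = K: field K + module K F for K :: "'k ring" and F :: "('k, 'a) module" +
 assumes mult_closed: "[|x <: F; y <: F|] ==> x *[F] y <: F" and mult_assoc: "[|x <: F; y <: F; z <: F|] ==> (x *[F] y) *[F] z = x *[F] (y *[F] z)"
 and mult_l_distr: "[|x <: F; y <: F; z <: F|] ==> (x +[F] y) *[F] z = x *[F] z +[F] y *[F] z" and mult_r_distr: "[|x <: F; y <: F; z <: F|] ==>
 z *[F] (x +[F] y) = z *[F] x +[F] z *[F] y"
 and mult_smult_l: "[|c <: K; x <: F; y <: F|] ==> (c *:[F] x) *[F] y = c *:[F] (x *[F] y)" and mult_smult_r: "[|c <: K; x <: F; y <: F|] ==>
 x *[F] (c *:[F] y) = c *:[F] (x *[F] y)"
begin

declare mult_closed [simp]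

lemma finsum_mult: "[|f : I ->: F; y <: F|] ==> sm F f I *[F] y = sm F (%i. f i *[F] y) I"
 by (rule add_finsum[OF M.ag M.ag]) (simp_all add: mult_l_distr)

lemma mult_finsum: "[|f : I ->: F; y <: F|] ==> y *[F] sm F f I = sm F (%i. y *[F] f i) I"
 by (rule add_finsum[OF M.ag M.ag]) (simp_all add: mult_r_distr)

lemma mult_minus_l: "[|x <: F; y <: F|] ==> (-[F] x) *[F] y = -[F] (x *[F] y)" using additive_minus[of F F "%x. x *[F] y" x] mult_l_distr M.ag by auto

lemma mult_minus_r: "[|x <: F; y <: F|] ==> y *[F] (-[F] x) = -[F] (y *[F] x)" using additive_minus[of F F "%x. y *[F] x" x] mult_r_distr M.ag by auto

end

locale pre_algebra_ideal = pre_algebra K F for K :: "'k ring" and F :: "('k, 'a) module" +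
 fixes I :: "'a set" and e :: 'a
 assumes ideal: "algebra_ideal K F I" and e_closed: "e <: F"
begin

abbreviation Q where "Q \<equiv> quotient_algebra F I e"

definition cls where "cls x = I +>\<^bsub>F\<^esub> x"

lemma I_simps: "I <= car F" "0[F] : I" "[|x : I; y : I|] ==> x +[F] y : I"
 "[|c <: K; x : I|] ==> c *:[F] x : I" "[|a <: F; x : I|] ==> a *[F] x : I" "[|a <: F; x : I|] ==> x *[F] a : I"
 using ideal by (auto simp: algebra_ideal_def)

text \<open>Negation is multiplication by the scalar \<open>-1\<close>, and an
  \<open>algebra_ideal\<close> is closed under scalars.\<close>

lemma I_minus: assumes "x : I" shows "-[F] x : I"
proof -
 have "-[F] x = (-[K] 1[K]) *:[F] x" using assms I_simps(1) smult_l_minus[of "1[K]" x] by auto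
 thus ?thesis using I_simps(4)[OF _ assms] by simp
qed

lemma abelian_subgroup_I: "abelian_subgroup I F"
proof (rule abelian_subgroupI3[OF _ M.ag])
 show "additive_subgroup I F" unfolding additive_subgroup_def by (rule subgroup.intro) (use I_simps I_minus in "auto simp flip: a_inv_def")
qed

sublocale I: abelian_subgroup I F by (rule abelian_subgroup_I)

lemma cls_eq: assumes "x <: F" "y <: F" shows "cls x = cls y <-> x -[F] y : I" unfolding cls_def a_minus_def I.a_rcos_module[OF assms(2,1), symmetric]
 using I.a_repr_independence' I.a_rcos_self assms by metis

lemma carrier_Q: "car Q = cls ` car F" by (auto simp: quotient_algebra_def cls_def A_RCOSETS_def RCOSETS_def a_r_coset_def)

lemma zero_Q: "0[Q] = cls 0[F]" unfolding quotient_algebra_def cls_def using I_simps(1) by simp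

lemma one_Q: "1[Q] = cls e" by (simp add: quotient_algebra_def cls_def)

lemma add_Q: "[|x <: F; y <: F|] ==> cls x +[Q] cls y = cls (x +[F] y)" by (simp add: quotient_algebra_def cls_def I.a_rcos_sum)

lemma mem_cls: "[|x <: F; y : cls x|] ==> y <: F & cls y = cls x"
 unfolding cls_def using I.a_repr_independence' M.a_r_coset_subset_G[OF I_simps(1)] by blast

lemma self_cls: "x <: F ==> x : cls x" unfolding cls_def by (rule I.a_rcos_self)

text \<open>The product of two cosets is a union over all pairs of representatives. The ideal
  property makes all members of this union the same coset, so it collapses.\<close>

lemma mult_Q: assumes "x <: F" "y <: F" shows "cls x *[Q] cls y = cls (x *[F] y)"
proof -
 have "cls (a *[F] b) = cls (x *[F] y)" if "a : cls x" "b : cls y" for a b proof -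
 have ab: "a <: F" "b <: F" "a -[F] x : I" "b -[F] y : I" using mem_cls that assms cls_eq by metis+
 have "a *[F] b -[F] x *[F] y = (a -[F] x) *[F] b +[F] x *[F] (b -[F] y)" using ab assms
 by (simp add: a_minus_def mult_l_distr mult_r_distr mult_minus_l mult_minus_r M.a_assoc M.r_neg1)
 thus ?thesis using ab assms I_simps cls_eq by simp
 qed
 moreover have "cls x *[Q] cls y = (UN a:cls x. UN b:cls y. cls (a *[F] b))" by (simp add: quotient_algebra_def rcoset_mult_def cls_def)
 ultimately show ?thesis using self_cls[OF assms(1)] self_cls[OF assms(2)] by blast
qed

lemma smult_Q: assumes "c <: K" "x <: F" shows "c *:[Q] cls x = cls (c *:[F] x)"
proof -
 have "cls (c *:[F] a) = cls (c *:[F] x)" if "a : cls x" for a proof -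
 have a: "a <: F" "a -[F] x : I" using mem_cls that assms cls_eq by metis+
 hence "c *:[F] a -[F] c *:[F] x = c *:[F] (a -[F] x)" using assms by (simp add: a_minus_def smult_r_distr smult_r_minus)
 thus ?thesis using a assms I_simps cls_eq by simp
 qed
 moreover have "c *:[Q] cls x = (UN a:cls x. cls (c *:[F] a))" by (simp add: quotient_algebra_def cls_def)
 ultimately show ?thesis using self_cls[OF assms(2)] by blast
qed

lemmas Q_simps = carrier_Q zero_Q one_Q add_Q mult_Q smult_Q

lemma pre_algebra_Q: "pre_algebra K Q"
proof -
 have ag: "abelian_group Q"
 proof (rule abelian_groupI)
 fix x assume "x <: Q"
 then obtain f where f: "f <: F" "x = cls f" by (auto simp: carrier_Q)
 hence "cls (-[F] f) <: Q" "cls (-[F] f) +[Q] x = 0[Q]" by (auto simp: Q_simps M.l_neg)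
 thus "EX y:car Q. y +[Q] x = 0[Q]" by blast
 qed (auto simp: Q_simps M.a_ac)
 have "module K Q" by (rule moduleI[OF K.is_cring ag]) (auto simp: Q_simps smult_l_distr smult_r_distr smult_assoc1)
 thus ?thesis unfolding pre_algebra_def pre_algebra_axioms_def by (auto simp: K.field_axioms Q_simps mult_assoc mult_l_distr mult_r_distr
 mult_smult_l mult_smult_r)
qed

lemma alg_map_cls: "alg_map K F Q cls" by (auto simp: alg_map_def Q_simps)

end

lemma (in pre_algebra) unital_algebraI:
 assumes "1[F] <: F" and "!!x. x <: F ==> 1[F] *[F] x = x" and "!!x. x <: F ==> x *[F] 1[F] = x" shows "ualg K F"
proof -
 have "ring F" by (rule ringI) (auto intro!: M.ag monoidI simp: assms mult_assoc mult_l_distr mult_r_distr)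
 thus ?thesis unfolding unital_algebra_def unital_algebra_axioms_def using module_axioms K.field_axioms mult_smult_l mult_smult_r by auto
qed

sublocale unital_algebra \<subseteq> pre_algebra K A by unfold_locales (auto simp: A.m_assoc A.l_distr A.r_distr smult_mult_left smult_mult_right)

locale free_alg = K: field K for K :: "'k ring" + fixes X :: "'g set"
begin

abbreviation F where "F \<equiv> free_algebra K X"

definition mono :: "'k => 'g list => 'g list => 'k" where "mono c w = (%u. if u = w then c else 0[K])"

definition supp :: "('g list => 'k) => 'g list set" where "supp f = {u. f u ~= 0[K]}"

definition W where "W = lists X - {[]}"

lemma F_simps: "f <: F <-> (ALL u. f u <: K) & finite (supp f) & supp f <= W" "0[F] = (%_. 0[K])" "f +[F] g = (%u. f u +[K] g u)"
 "f *[F] g = (%u. sm K (%i. f (take i u) *[K] g (drop i u)) {..length u})" "c *:[F] f = (%u. c *[K] f u)"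
 by (auto simp: free_algebra_def supp_def W_def)

lemma supp_add: "[|f <: F; g <: F|] ==> supp (%u. f u +[K] g u) <= supp f \<union> supp g" by (auto simp: supp_def)

lemma supp_smult: "c <: K ==> f <: F ==> supp (%u. c *[K] f u) <= supp f" by (auto simp: supp_def)

lemma add_closed': "[|f <: F; g <: F|] ==> f +[F] g <: F" using supp_add[of f g] by (auto simp: F_simps intro: finite_subset)

lemma smult_closed': "[|c <: K; f <: F|] ==> c *:[F] f <: F" using supp_smult[of c f] by (auto simp: F_simps intro: finite_subset)

lemma module_F: "module K F"
proof (rule moduleI)
 show "abelian_group F"
 proof (rule abelian_groupI)
 fix f assume f: "f <: F"
 hence "(-[K] 1[K]) *:[F] f <: F" by (simp add: smult_closed')
 moreover have "((-[K] 1[K]) *:[F] f) +[F] f = 0[F]" using f by (auto simp: F_simps K.l_minus K.l_neg)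
 ultimately show "EX g:car F. g +[F] f = 0[F]" by blast
 qed (use add_closed' in "auto simp: F_simps K.a_ac supp_def")
qed (use smult_closed' K.is_cring in "auto simp: F_simps K.l_distr K.r_distr K.m_assoc")

lemma mult_closed':
 assumes f: "f <: F" and g: "g <: F" shows "f *[F] g <: F"
proof -
 have "supp (f *[F] g) <= (%(u, v). u @ v) ` (supp f \<times> supp g)"
 proof
 fix u assume u: "u : supp (f *[F] g)"
 have "EX i. f (take i u) *[K] g (drop i u) ~= 0[K]"
 proof (rule ccontr)
 assume "~ ?thesis"
 hence "(f *[F] g) u = 0[K]" by (simp add: F_simps)
 thus False using u by (simp add: supp_def)
 qed
 then obtain i where "f (take i u) *[K] g (drop i u) ~= 0[K]" ..
 hence "take i u : supp f" "drop i u : supp g" using f g by (auto simp: supp_def F_simps)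
 thus "u : (%(u, v). u @ v) ` (supp f \<times> supp g)" by (intro image_eqI[of _ _ "(take i u, drop i u)"]) auto
 qed
 moreover have "(%(u, v). u @ v) ` (supp f \<times> supp g) <= W" using f g unfolding F_simps(1) W_def by fastforce
 moreover have "finite ((%(u, v). u @ v) ` (supp f \<times> supp g))" using f g by (auto simp: F_simps)
 ultimately have "finite (supp (f *[F] g))" "supp (f *[F] g) <= W" using finite_subset by blast+
 moreover have "ALL u. (f *[F] g) u <: K" using f g by (auto simp: F_simps)
 ultimately show ?thesis by (simp add: F_simps(1))
qed

lemma mono_closed: "[|c <: K; w : W|] ==> mono c w <: F" unfolding F_simps by (auto simp: mono_def supp_def)

lemma mono_mult:
 assumes "c <: K" "d <: K" shows "mono c w *[F] mono d w' = mono (c *[K] d) (w @ w')"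
proof
 fix u
 show "(mono c w *[F] mono d w') u = mono (c *[K] d) (w @ w') u"
 proof (cases "u = w @ w'")
 case True
 \<comment> \<open>Only the cut of \<open>u\<close> after \<open>length w\<close> letters can
   produce the prefix \<open>w\<close>.\<close>
 have "sm K (%i. mono c w (take i u) *[K] mono d w' (drop i u)) {..length u} =
 mono c w (take (length w) u) *[K] mono d w' (drop (length w) u)"
 proof (rule K.finsum_delta)
 fix j assume "j : {..length u}" "j ~= length w"
 hence "length (take j u) ~= length w" by simp
 hence "take j u ~= w" by blast
 thus "mono c w (take j u) *[K] mono d w' (drop j u) = 0[K]" using assms by (simp add: mono_def)
 qed (use True assms in "auto simp: mono_def")
 thus ?thesis using True by (simp add: F_simps mono_def)
 next
 case False
 hence "mono c w (take i u) *[K] mono d w' (drop i u) = 0[K]" for i using assms by (auto simp: mono_def)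
 thus ?thesis using False by (simp add: F_simps mono_def)
 qed
qed

text \<open>Induction on the size of the support: one monomial is split off at a time.\<close>

lemma free_induct [consumes 1, case_names zero add]:
 assumes "f <: F" "P 0[F]" and step: "!!c w f. [|c <: K; w : W; f <: F; P f|] ==> P (mono c w +[F] f)" shows "P f" using assms(1)
proof (induction "card (supp f)" arbitrary: f)
 case 0
 hence "f = 0[F]" by (auto simp: F_simps supp_def)
 thus ?case using assms(2) by simp
next
 case (Suc n)
 then obtain w where w: "w : supp f" by (metis card.empty ex_in_conv nat.distinct(1))
 define f' where "f' = (%u. if u = w then 0[K] else f u)"
 have s: "supp f' = supp f - {w}" by (auto simp: supp_def f'_def)
 have f': "f' <: F" using Suc.prems s by (auto simp: F_simps f'_def)
 have "card (supp f') = n" using s w Suc by simp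
 hence "P f'" using Suc f' by simp
 moreover have "f = mono (f w) w +[F] f'" using Suc.prems by (auto simp: F_simps mono_def f'_def)
 ultimately show ?case using step[of "f w" w f'] w f' Suc.prems by (auto simp: F_simps)
qed

lemma distr_l: assumes "f <: F" "g <: F" "h <: F" shows "(f +[F] g) *[F] h = f *[F] h +[F] g *[F] h" using assms by (auto simp: F_simps K.l_distr)

lemma distr_r: assumes "f <: F" "g <: F" "h <: F" shows "h *[F] (f +[F] g) = h *[F] f +[F] h *[F] g" using assms by (auto simp: F_simps K.r_distr)

sublocale F: module K F by (rule module_F)

lemma smult_l: assumes "c <: K" "f <: F" "g <: F" shows "(c *:[F] f) *[F] g = c *:[F] (f *[F] g)"
 using assms by (auto simp: F_simps K.m_assoc K.finsum_rdistr)

lemma smult_r: assumes "c <: K" "f <: F" "g <: F" shows "f *[F] (c *:[F] g) = c *:[F] (f *[F] g)"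
 using assms by (auto simp: F_simps K.m_lcomm K.finsum_rdistr)

lemma zero_mult: "g <: F ==> 0[F] *[F] g = 0[F]" "g <: F ==> g *[F] 0[F] = 0[F]" by (auto simp: F_simps)

lemma W_append: "[|u : W; v : W|] ==> u @ v : W" by (auto simp: W_def)

text \<open>Reduces an identity that is additive in one argument to monomials in this argument. The
  common operation \<open>p\<close> is left open, so that both sides may take values outside the
  free algebra.\<close>

lemma mono_ext:
 assumes "f <: F" "T 0[F] = T' 0[F]" and "!!g h. [|g <: F; h <: F|] ==> T (g +[F] h) = p (T g) (T h)"
 and "!!g h. [|g <: F; h <: F|] ==> T' (g +[F] h) = p (T' g) (T' h)" and "!!c w. [|c <: K; w : W|] ==> T (mono c w) = T' (mono c w)"
 shows "T f = T' f" using assms(1) by (induction rule: free_induct) (simp_all add: assms mono_closed)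

text \<open>Additivity reduces the arguments to monomials one at a time, from the last to the first,
  until only the associativity of concatenation remains.\<close>

lemma assoc3: assumes f: "f <: F" and g: "g <: F" and h: "h <: F" shows "(f *[F] g) *[F] h = f *[F] (g *[F] h)"
proof -
 have 1: "(mono c w *[F] mono d v) *[F] h = mono c w *[F] (mono d v *[F] h)"
 if "c <: K" "w : W" "d <: K" "v : W" for c w d v using h by (rule mono_ext[where p = "(\<oplus>\<^bsub>F\<^esub>)"])
 (use that mono_closed[OF that(1,2)] mono_closed[OF that(3,4)] in
 "simp_all add: zero_mult distr_r mult_closed' mono_mult K.m_assoc mono_closed W_append")
 have 2: "(mono c w *[F] g) *[F] h = mono c w *[F] (g *[F] h)"
 if "c <: K" "w : W" for c w using g by (rule mono_ext[where p = "(\<oplus>\<^bsub>F\<^esub>)"]) (use that mono_closed[OF that(1,2)] h 1 in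
 "simp_all add: zero_mult distr_r distr_l mult_closed' mono_closed")
 show ?thesis using f by (rule mono_ext[where p = "(\<oplus>\<^bsub>F\<^esub>)"])
 (use g h 2 in "simp_all add: zero_mult distr_l mult_closed' mono_closed")
qed

lemma pre_algebra_F: "pre_algebra K F"
 apply (rule pre_algebra.intro)
 apply (rule K.field_axioms)
 apply (rule module_F)
 apply (rule pre_algebra_axioms.intro)
 apply (rule mult_closed'; assumption)
 apply (rule assoc3; assumption)
 apply (rule distr_l; assumption)
 apply (rule distr_r; assumption)
 apply (rule smult_l; assumption)
 apply (rule smult_r; assumption)
 done

lemma free_gen_mono: "free_gen K x = mono 1[K] [x]" by (simp add: free_gen_def mono_def)

lemma free_gen_closed: "x : X ==> free_gen K x <: F" unfolding free_gen_mono by (rule mono_closed) (auto simp: W_def)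

lemma mono_smult: "c <: K ==> mono c w = c *:[F] mono 1[K] w" by (auto simp: mono_def F_simps)

lemma mono_Cons: "mono 1[K] (x # w) = free_gen K x *[F] mono 1[K] w" by (simp add: free_gen_mono mono_mult)

lemma mono_snoc: "mono 1[K] (w @ [x]) = mono 1[K] w *[F] free_gen K x" by (simp add: free_gen_mono mono_mult)

text \<open>The fold starts from the unit of \<open>B\<close>, although only nonempty words occur in
  the free algebra; in this way concatenation becomes multiplication without a case
  distinction.\<close>

definition word_val :: "('k, 'b) module => ('g => 'b) => 'g list => 'b" where "word_val B b w = foldr (%x r. b x *[B] r) w 1[B]"

definition eval_free :: "('k, 'b) module => ('g => 'b) => ('g list => 'k) => 'b" where
 "eval_free B b f = sm B (%u. f u *:[B] word_val B b u) (supp f)"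

context
 fixes B :: "('k, 'b) module" and b :: "'g => 'b"
 assumes B: "ualg K B" and b: "b : X ->: B"
begin

interpretation B: unital_algebra K B by (rule B)

lemma word_val_closed: "w : lists X ==> word_val B b w <: B" by (induction w) (use b in "auto simp: word_val_def")

lemma word_val_append: "[|v : lists X; w : lists X|] ==> word_val B b (v @ w) = word_val B b v *[B] word_val B b w"
proof (induction v)
 case (Cons x v)
 have "word_val B b v <: B" "word_val B b w <: B" "b x <: B" using Cons b word_val_closed by auto
 thus ?case using Cons by (simp add: word_val_def B.mult_assoc)
qed (use word_val_closed in "simp add: word_val_def")

lemma eval_superset:
 assumes "f <: F" "finite S" "supp f <= S" "S <= W"
 shows "eval_free B b f = sm B (%u. f u *:[B] word_val B b u) S" unfolding eval_free_def using assms
 by (intro B.M.add.finprod_mono_neutral_cong_left) (auto simp: F_simps W_def subset_iff word_val_closed supp_def)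

lemma eval_mono: assumes "c <: K" "w : W" shows "eval_free B b (mono c w) = c *:[B] word_val B b w"
proof -
 have "eval_free B b (mono c w) = sm B (%u. mono c w u *:[B] word_val B b u) {w}"
 using assms by (intro eval_superset mono_closed) (auto simp: supp_def mono_def)
 thus ?thesis using assms by (simp add: mono_def W_def word_val_closed)
qed

lemma eval_closed: "f <: F ==> eval_free B b f <: B"
 unfolding eval_free_def by (intro B.M.finsum_closed) (auto simp: F_simps W_def subset_iff word_val_closed)

lemma eval_add: assumes f: "f <: F" "g <: F" shows "eval_free B b (f +[F] g) = eval_free B b f +[B] eval_free B b g"
proof -
 let ?S = "supp f \<union> supp g"
 have S: "finite ?S" "?S <= W" using f by (auto simp: F_simps)
 have c: "(%u. h u *:[B] word_val B b u) : ?S ->: B" if "h <: F" for h using that S by (auto simp: F_simps W_def subset_iff word_val_closed)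
 have "eval_free B b (f +[F] g) = sm B (%u. (f +[F] g) u *:[B] word_val B b u) ?S"
 using f supp_add[OF f] by (intro eval_superset add_closed') (auto simp: F_simps)
 also have "... = sm B (%u. f u *:[B] word_val B b u +[B] g u *:[B] word_val B b u) ?S" using f
 by (intro B.M.finsum_cong') (auto simp: F_simps W_def subset_iff word_val_closed B.smult_l_distr)
 also have "... = sm B (%u. f u *:[B] word_val B b u) ?S +[B] sm B (%u. g u *:[B] word_val B b u) ?S"
 using c f by (intro B.M.finsum_addf) auto
 finally show ?thesis using eval_superset[of f ?S] eval_superset[of g ?S] S f by auto
qed

lemma eval_zero: "eval_free B b 0[F] = 0[B]" by (simp add: eval_free_def F_simps supp_def)

lemma eval_smult: assumes f: "f <: F" and c: "c <: K" shows "eval_free B b (c *:[F] f) = c *:[B] eval_free B b f" using f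
proof (rule mono_ext[where p = "(\<oplus>\<^bsub>B\<^esub>)"])
 fix d w assume "d <: K" "w : W"
 moreover have "c *:[F] mono d w = mono (c *[K] d) w" using c by (auto simp: F_simps mono_def)
 ultimately show "eval_free B b (c *:[F] mono d w) = c *:[B] eval_free B b (mono d w)"
 using c by (simp add: eval_mono W_def word_val_closed B.smult_assoc1)
qed (use c eval_closed in "simp_all add: eval_zero eval_add F.smult_r_distr B.smult_r_distr")

lemma eval_mult: assumes f: "f <: F" and g: "g <: F" shows "eval_free B b (f *[F] g) = eval_free B b f *[B] eval_free B b g"
proof -
 have 1: "eval_free B b (mono c w *[F] mono d v) = eval_free B b (mono c w) *[B] eval_free B b (mono d v)"
 if "c <: K" "w : W" "d <: K" "v : W" for c w d v using that by (simp add: mono_mult eval_mono word_val_append W_def word_val_closed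
 B.mult_smult_l B.mult_smult_r K.m_comm[of c d] flip: B.smult_assoc1)
 have 2: "eval_free B b (mono c w *[F] g) = eval_free B b (mono c w) *[B] eval_free B b g"
 if "c <: K" "w : W" for c w using g by (rule mono_ext[where p = "(\<oplus>\<^bsub>B\<^esub>)"]) (use that mono_closed[OF that(1,2)] 1 eval_closed in
 "simp_all add: zero_mult distr_r eval_add eval_zero mult_closed' B.mult_r_distr")
 show ?thesis using f by (rule mono_ext[where p = "(\<oplus>\<^bsub>B\<^esub>)"])
 (use g 2 eval_closed in "simp_all add: zero_mult distr_l eval_add eval_zero mult_closed' B.mult_l_distr")
qed

lemma alg_map_eval: "alg_map K F B (eval_free B b)" by (auto simp: alg_map_def eval_closed eval_add eval_mult eval_smult)

lemma eval_gen: "x : X ==> eval_free B b (free_gen K x) = b x"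
 using funcset_mem[OF b, of x] by (subst free_gen_mono, subst eval_mono) (auto simp: W_def word_val_def)

end

end

lemma (in abelian_group) minus_eq_zero_iff:
 assumes "x <: G" "y <: G" shows "x \<ominus> y = \<zero> <-> x = y"
proof
 assume "x \<ominus> y = \<zero>"
 hence "(x \<ominus> y) \<oplus> y = y" using assms by simp
 thus "x = y" using assms by (simp add: a_minus_def a_assoc l_neg)
qed (use assms in "simp add: a_minus_def r_neg")

section \<open>Rows and columns of the two generator matrices at a vertex\<close>

datatype ('v, 'e) idx = Src 'v nat | Out 'e

type_synonym ('v, 'e) cell = "(('v, 'e) idx \<times> ('v, 'e) idx) list \<times> 'v"

text \<open>
 For each regular vertex \<open>v\<close> the generators form two mutually inverse matrices, with entries \<open>e\<^sub>i\<close> and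
 \<open>e\<^sub>i\<^sup>*\<close>. The row and column indices of both are treated uniformly: \<open>Src v i\<close> stands for \<open>i\<close> and
 \<open>Out e\<close> for \<open>e\<close>. A matrix entry in row \<open>p\<close> has its column \<open>q\<close> in \<open>opp p\<close>, and \<open>peer p\<close> consists of
 the indices of the same kind as \<open>p\<close>.
\<close>

fun ob :: "('v, 'e) pre_digraph => ('v, 'e) idx => 'v" where "ob E (Src v i) = v"
| "ob E (Out e) = head E e"

fun opp :: "('v, 'e) pre_digraph => ('e => nat) => ('v, 'e) idx => ('v, 'e) idx set" where "opp E w (Src v i) = Out ` out_arcs E v"
| "opp E w (Out e) = Src (tail E e) ` {1..vertex_weight E w (tail E e)}"

fun peer :: "('v, 'e) pre_digraph => ('e => nat) => ('v, 'e) idx => ('v, 'e) idx set" where "peer E w (Src v i) = Src v ` {1..vertex_weight E w v}"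
| "peer E w (Out e) = Out ` out_arcs E (tail E e)"

fun side :: "('v, 'e) idx => bool" where "side (Src v i) = True"
| "side (Out e) = False"

definition ix :: "('v, 'e) pre_digraph => ('e => nat) => ('v, 'e) idx set" where
 "ix E w = (UN v:regular_verts E. Src v ` {1..vertex_weight E w v}) \<union> Out ` arcs E"

fun letter :: "('v, 'e) idx => ('v, 'e) idx => ('v, 'e) lpa_gen" where "letter (Src v i) (Out e) = Edge e i"
| "letter (Out e) (Src v i) = Ghost e i"
| "letter _ _ = undefined"

text \<open>The incidence structure of the indices, stripped of the graph. Edges and ghost edges
  become interchangeable; what tells them apart is \<open>side\<close>, which gives the levels of
  the filtrations their parity.\<close>

locale cells =
 fixes V :: "'v set" and P :: "'p set" and opp peer :: "'p => 'p set" and ob :: "'p => 'v"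
 and side :: "'p => bool"
 assumes finite_V: "finite V" and finite_P: "finite P" and ob_closed: "p : P ==> ob p : V" and opp_sub: "p : P ==> opp p <= P"
 and opp_ne: "p : P ==> opp p ~= {}" and opp_opp: "[|p : P; q : opp p|] ==> opp q = peer p"
 and side_opp: "[|p : P; q : opp p|] ==> side q = (~ side p)" and peer_refl: "p : P ==> p : peer p"
 and opp_peer: "[|p : P; p' : peer p|] ==> opp p' = opp p"
begin

lemma opp_P: "[|p : P; q : opp p|] ==> q : P" using opp_sub by blast

lemma finite_opp: "p : P ==> finite (opp p)" using opp_sub finite_P finite_subset by blast

lemma opp_mem: "[|p : P; q : opp p; p' : peer p|] ==> p' : opp q" by (simp add: opp_opp)

lemma peer_P: "[|p : P; p' : peer p|] ==> p' : P" using opp_ne opp_opp opp_P by (metis all_not_in_conv)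

lemma finite_peer: "p : P ==> finite (peer p)" using peer_P finite_P by (metis finite_subset subsetI)

lemma peer_peer: "[|p : P; p' : peer p|] ==> peer p' = peer p" using opp_ne opp_opp opp_peer peer_P by (metis all_not_in_conv)

lemma peer_opp: "[|p : P; q : opp p|] ==> peer q = opp p" using opp_opp opp_P peer_refl by metis

lemma opp_sym: "[|p : P; q : opp p|] ==> p : opp q" using opp_mem peer_refl by blast

lemma side_peer: "[|p : P; p' : peer p|] ==> side p' = side p" using opp_ne side_opp opp_mem opp_P by (metis all_not_in_conv)

end

text \<open>\<open>g_g\<close> expresses both matrix products at once, since \<open>p\<close> may be
  an index of either kind.\<close>

locale cell_family = cells V P opp peer ob side + B: ring B
 for V :: "'v set" and P :: "'p set" and opp peer ob side and B :: "('b, 'm) ring_scheme" +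
 fixes nu :: "'v => 'b" and g :: "'p => 'p => 'b"
 assumes nu_closed: "v : V ==> nu v <: B" and g_closed: "[|p : P; q : opp p|] ==> g p q <: B"
 and nu_mult: "[|u : V; v : V|] ==> nu u *[B] nu v = (if u = v then nu u else 0[B])"
 and nu_g: "[|p : P; q : opp p|] ==> nu (ob p) *[B] g p q = g p q" and g_nu: "[|p : P; q : opp p|] ==> g p q *[B] nu (ob q) = g p q"
 and g_g: "[|p : P; p' : peer p|] ==> (sm B (%q. g p q *[B] g q p') (opp p)) = (if p = p' then nu (ob p) else 0[B])"

declare (in cell_family) nu_closed [simp] g_closed [simp]

section \<open>Relations, unit and universal property of the Leavitt path algebra\<close>

definition lpa_relations :: "('v, 'e) pre_digraph => ('e => nat) => ('k, 'b) module =>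
 ('v => 'b) => (('v, 'e) idx => ('v, 'e) idx => 'b) => bool" where "lpa_relations E w B nu g <->
 (ALL u:vs E. ALL v:vs E. nu u *[B] nu v = (if u = v then nu u else 0[B])) &
 (ALL p:ix E w. ALL q:opp E w p. nu (ob E p) *[B] g p q = g p q & g p q *[B] nu (ob E q) = g p q) & (ALL p:ix E w. ALL p':peer E w p.
 (sm B (%q. g p q *[B] g q p') (opp E w p)) = (if p = p' then nu (ob E p) else 0[B]))"

locale lpa_setup = K: field K + fin_digraph E + vertex_weighted_graph E w
 for K :: "'k ring" and E :: "('v, 'e) pre_digraph" and w
begin

lemma regularI: "e : arcs E ==> tail E e : regular_verts E" by (auto simp: regular_verts_def)

lemma out_arcsD: "e : out_arcs E v ==> e : arcs E" "e : out_arcs E v ==> tail E e = v" by auto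

lemma regular_ne: "v : regular_verts E ==> out_arcs E v ~= {} & v : vs E" by (auto simp: regular_verts_def)

text \<open>This is what the equality of weights at a vertex provides: every edge has the full
  weight of its source, so no matrix entry is zero by convention and all entries are
  generators.\<close>

lemma weight_tail: assumes "e : arcs E" shows "vertex_weight E w (tail E e) = w e"
proof -
 have e: "e : out_arcs E (tail E e)" using assms by simp
 have "w e' = w e" if "e' : out_arcs E (tail E e)" for e' by (rule weight_eq[OF regularI[OF assms] that e])
 hence "w ` out_arcs E (tail E e) = {w e}" using e by blast
 thus ?thesis by (simp add: vertex_weight_def)
qed

lemma weight_pos': assumes "v : regular_verts E" shows "vertex_weight E w v >= 1"
proof -
 obtain e where e: "e : arcs E" "tail E e = v" using regular_ne[OF assms] out_arcsD by blast
 thus ?thesis using weight_tail[OF e(1)] weight_pos[OF e(1)] by simp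
qed

sublocale cells "vs E" "ix E w" "opp E w" "peer E w" "ob E" side
proof
 show "finite (ix E w)" by (auto simp: ix_def regular_verts_def)
next
 fix p assume p: "p : ix E w"
 thus "ob E p : vs E" "opp E w p <= ix E w" "p : peer E w p" by (auto simp: ix_def regular_ne regularI)
 show "opp E w p ~= {}" using p by (auto simp: ix_def regular_ne) (use weight_pos'[OF regularI] in force)
 show "opp E w q = peer E w p" if "q : opp E w p" for q using p that by (auto simp: ix_def)
 show "side q = (~ side p)" if "q : opp E w p" for q using that by (cases p) auto
 show "opp E w p' = opp E w p" if "p' : peer E w p" for p' using p that by (auto simp: ix_def)
qed (simp add: finite_verts)

lemma letter_gens: "[|p : ix E w; q : opp E w p|] ==> letter p q : lpa_gens E w" by (auto simp: ix_def lpa_gens_def weight_tail)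

lemma Src_idxs: "[|v : regular_verts E; i : {1..vertex_weight E w v}|] ==> Src v i : ix E w" unfolding ix_def by blast

lemma arc_idxs:
 assumes "e : arcs E" "i : {1..w e}" shows "Src (tail E e) i : ix E w" "Out e : opp E w (Src (tail E e) i)"
 "Out e : ix E w" "Src (tail E e) i : opp E w (Out e)" using assms regularI[OF assms(1)]
 by (auto simp: ix_def weight_tail intro!: bexI[of _ "tail E e"])

lemma gen_cases:
 assumes "x : lpa_gens E w"
 obtains v where "v : vs E" "x = Vertex v"
 | p q where "p : ix E w" "q : opp E w p" "x = letter p q"
proof -
 have "EX p q. p : ix E w & q : opp E w p & Edge e i = letter p q" "EX p q. p : ix E w & q : opp E w p & Ghost e i = letter p q"
 if "e : arcs E" "1 <= i" "i <= w e" for e i using that arc_idxs[of e i] by (metis letter.simps atLeastAtMost_iff)+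
 thus ?thesis using assms that unfolding lpa_gens_def by blast
qed

sublocale fa: free_alg K "lpa_gens E w" ..

definition vx where "vx v = free_gen K (Vertex v :: ('v, 'e) lpa_gen)"
definition lt where "lt p q = free_gen K (letter p q :: ('v, 'e) lpa_gen)"

lemma vx_closed: "v : vs E ==> vx v <: (lpa_free K E w)" unfolding vx_def by (rule fa.free_gen_closed) (auto simp: lpa_gens_def)

lemma lt_closed: "[|p : ix E w; q : opp E w p|] ==> lt p q <: (lpa_free K E w)"
 unfolding lt_def by (rule fa.free_gen_closed) (auto simp: letter_gens)

lemma lt_lt_closed:
 assumes "p : ix E w" "q : opp E w p" "p' : peer E w p" shows "lt p q *[lpa_free K E w] lt q p' <: (lpa_free K E w)"
 by (rule fa.mult_closed'[OF lt_closed[OF assms(1,2)] lt_closed[OF opp_P[OF assms(1,2)] opp_mem[OF assms]]])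

text \<open>A pair of opposite indices consists of an edge and a position at its source, in one of
  the two possible orders.\<close>

lemma all_opp_iff: "(ALL p:ix E w. ALL q:opp E w p. Q p q) <->
 (ALL e:arcs E. ALL i:{1..w e}. Q (Src (tail E e) i) (Out e) & Q (Out e) (Src (tail E e) i))"
proof (intro iffI ballI)
 fix e i assume L: "ALL p:ix E w. ALL q:opp E w p. Q p q" and e: "e : arcs E" "i : {1..w e}"
 show "Q (Src (tail E e) i) (Out e) & Q (Out e) (Src (tail E e) i)" using L arc_idxs[OF e] by blast
next
 fix p q assume R: "ALL e:arcs E. ALL i:{1..w e}. Q (Src (tail E e) i) (Out e) & Q (Out e) (Src (tail E e) i)"
 and p: "p : ix E w" and q: "q : opp E w p"
 show "Q p q"
 proof (cases p)
 case (Src v i)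
 with p q obtain e where "q = Out e" "e : arcs E" "tail E e = v" "i : {1..vertex_weight E w v}" by (auto simp: ix_def)
 thus ?thesis using R weight_tail[of e] Src by fastforce
 next
 case (Out e)
 with p q obtain i where "q = Src (tail E e) i" "e : arcs E" "i : {1..vertex_weight E w (tail E e)}" by (auto simp: ix_def)
 thus ?thesis using R weight_tail[of e] Out by fastforce
 qed
qed

text \<open>Peers are two positions or two edges at the same regular vertex; this is how the two
  families of inversion relations become one.\<close>

lemma all_peer_iff: "(ALL p:ix E w. ALL p':peer E w p. Q p p') <->
 (ALL v:regular_verts E. ALL i:{1..vertex_weight E w v}. ALL j:{1..vertex_weight E w v}. Q (Src v i) (Src v j)) &
 (ALL v:regular_verts E. ALL e:out_arcs E v. ALL f:out_arcs E v. Q (Out e) (Out f))"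
proof (intro iffI conjI ballI)
 fix p p' assume R: "(ALL v:regular_verts E. ALL i:{1..vertex_weight E w v}. ALL j:{1..vertex_weight E w v}. Q (Src v i) (Src v j)) &
 (ALL v:regular_verts E. ALL e:out_arcs E v. ALL f:out_arcs E v. Q (Out e) (Out f))"
 and p: "p : ix E w" "p' : peer E w p"
 show "Q p p'"
 proof (cases p)
 case (Src v i)
 with p show ?thesis using R by (auto simp: ix_def)
 next
 case (Out e)
 with p have "e : out_arcs E (tail E e)" "tail E e : regular_verts E" using regularI by (auto simp: ix_def)
 with Out p show ?thesis using R by auto
 qed
next
 fix v i j assume "ALL p:ix E w. ALL p':peer E w p. Q p p'" "v : regular_verts E" "i : {1..vertex_weight E w v}" "j : {1..vertex_weight E w v}"
 moreover from this have "Src v i : ix E w" "Src v j : peer E w (Src v i)" by (auto intro: Src_idxs)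
 ultimately show "Q (Src v i) (Src v j)" by blast
next
 fix v e f assume "ALL p:ix E w. ALL p':peer E w p. Q p p'" "v : regular_verts E" "e : out_arcs E v" "f : out_arcs E v"
 moreover from this have "Out e : ix E w" "Out f : peer E w (Out e)" by (auto simp: ix_def)
 ultimately show "Q (Out e) (Out f)" by blast
qed

lemma gz: "v : vs E ==> lpa_gen_or_zero K E w (Vertex v) = vx v"
 "[|e : arcs E; i : {1..w e}|] ==> lpa_gen_or_zero K E w (Edge e i) = lt (Src (tail E e) i) (Out e)"
 "[|e : arcs E; i : {1..w e}|] ==> lpa_gen_or_zero K E w (Ghost e i) = lt (Out e) (Src (tail E e) i)"
 by (auto simp: lpa_gen_or_zero_def vx_def lt_def lpa_gens_def)

text \<open>Rewrites the set of relators in terms of matrix indices. The predicate \<open>Q\<close>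
  is arbitrary, so that membership in the free algebra and vanishing under a homomorphism are both
  instances.\<close>

lemma all_relators_iff:
 fixes Q defines "F \<equiv> lpa_free K E w"
 shows "(ALL r:lpa_relators K E w. Q r) <-> (ALL u:vs E. ALL v:vs E. Q (vx u *[F] vx v -[F] (if u = v then vx u else 0[F]))) &
 (ALL p:ix E w. ALL q:opp E w p. Q (vx (ob E p) *[F] lt p q -[F] lt p q) &
 Q (lt p q *[F] vx (ob E q) -[F] lt p q)) & (ALL p:ix E w. ALL p':peer E w p.
 Q ((sm F (%q. lt p q *[F] lt q p') (opp E w p)) -[F] (if p = p' then vx (ob E p) else 0[F])))"
proof -
 interpret F: abelian_group F unfolding F_def by (rule fa.F.ag)
 have mc: "[|p : ix E w; q : opp E w p; p' : peer E w p|] ==> lt p q *[F] lt q p' <: F" for p q p' unfolding F_def by (rule lt_lt_closed)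
 let ?g = "lpa_gen_or_zero K E w"
 have s3: "sm F (%e. ?g (Edge e i) *[F] ?g (Ghost e j)) (out_arcs E v) = (sm F (%q. lt (Src v i) q *[F] lt q (Src v j)) (opp E w (Src v i)))"
 if v: "v : regular_verts E" "i : {1..vertex_weight E w v}" "j : {1..vertex_weight E w v}" for v i j
 proof -
 have m: "Src v i : ix E w" "Src v j : peer E w (Src v i)" using v Src_idxs by auto
 have "sm F (%q. lt (Src v i) q *[F] lt q (Src v j)) (opp E w (Src v i)) =
 (sm F (%e. lt (Src v i) (Out e) *[F] lt (Out e) (Src v j)) (out_arcs E v))"
 unfolding opp.simps using mc[OF m(1) _ m(2)] by (intro F.finsum_reindex) (auto simp: inj_on_def)
 also have "... = sm F (%e. ?g (Edge e i) *[F] ?g (Ghost e j)) (out_arcs E v)"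
 using v mc[OF m(1) _ m(2)] weight_tail by (intro F.finsum_cong') (auto simp: gz)
 finally show ?thesis ..
 qed
 have s4: "sm F (%i. ?g (Ghost e i) *[F] ?g (Edge f i)) {1..vertex_weight E w v} =
 (sm F (%q. lt (Out e) q *[F] lt q (Out f)) (opp E w (Out e)))"
 if v: "v : regular_verts E" "e : out_arcs E v" "f : out_arcs E v" for v e f
 proof -
 have m: "Out e : ix E w" "Out f : peer E w (Out e)" "tail E e = v" using v by (auto simp: ix_def)
 have "sm F (%q. lt (Out e) q *[F] lt q (Out f)) (opp E w (Out e)) =
 (sm F (%i. lt (Out e) (Src v i) *[F] lt (Src v i) (Out f)) {1..vertex_weight E w v})"
 unfolding opp.simps m(3) using mc[OF m(1) _ m(2)] m(3) by (intro F.finsum_reindex) (auto simp: inj_on_def)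
 also have "... = sm F (%i. ?g (Ghost e i) *[F] ?g (Edge f i)) {1..vertex_weight E w v}"
 using v mc[OF m(1) _ m(2)] weight_tail[of e] weight_tail[of f] by (intro F.finsum_cong') (auto simp: gz)
 finally show ?thesis ..
 qed
 have "(ALL r:lpa_relators K E w. Q r) <->
 (ALL u:vs E. ALL v:vs E. Q (?g (Vertex u) *[F] ?g (Vertex v) -[F] (if u = v then ?g (Vertex u) else 0[F]))) & (ALL e:arcs E. ALL i:{1..w e}.
 Q (?g (Vertex (tail E e)) *[F] ?g (Edge e i) -[F] ?g (Edge e i)) &
 Q (?g (Edge e i) *[F] ?g (Vertex (head E e)) -[F] ?g (Edge e i)) &
 Q (?g (Vertex (head E e)) *[F] ?g (Ghost e i) -[F] ?g (Ghost e i)) &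
 Q (?g (Ghost e i) *[F] ?g (Vertex (tail E e)) -[F] ?g (Ghost e i))) &
 (ALL v:regular_verts E. ALL i:{1..vertex_weight E w v}. ALL j:{1..vertex_weight E w v}.
 Q ((sm F (%e. ?g (Edge e i) *[F] ?g (Ghost e j)) (out_arcs E v))
 -[F] (if i = j then ?g (Vertex v) else 0[F]))) & (ALL v:regular_verts E. ALL e:out_arcs E v. ALL f:out_arcs E v.
 Q ((sm F (%i. ?g (Ghost e i) *[F] ?g (Edge f i)) {1..vertex_weight E w v})
 -[F] (if e = f then ?g (Vertex (head E e)) else 0[F])))" unfolding lpa_relators_def Let_def F_def by blast
 also have "(ALL u:vs E. ALL v:vs E. Q (?g (Vertex u) *[F] ?g (Vertex v) -[F] (if u = v then ?g (Vertex u) else 0[F])))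
 <-> (ALL u:vs E. ALL v:vs E. Q (vx u *[F] vx v -[F] (if u = v then vx u else 0[F])))" by (intro ball_cong refl) (simp only: gz)
 also have "(ALL e:arcs E. ALL i:{1..w e}.
 Q (?g (Vertex (tail E e)) *[F] ?g (Edge e i) -[F] ?g (Edge e i)) &
 Q (?g (Edge e i) *[F] ?g (Vertex (head E e)) -[F] ?g (Edge e i)) &
 Q (?g (Vertex (head E e)) *[F] ?g (Ghost e i) -[F] ?g (Ghost e i)) &
 Q (?g (Ghost e i) *[F] ?g (Vertex (tail E e)) -[F] ?g (Ghost e i)))
 <-> (ALL p:ix E w. ALL q:opp E w p. Q (vx (ob E p) *[F] lt p q -[F] lt p q) &
 Q (lt p q *[F] vx (ob E q) -[F] lt p q))" unfolding all_opp_iff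
 by (intro ball_cong refl) (simp only: gz tail_in_verts head_in_verts ob.simps conj_assoc)
 also have "(ALL v:regular_verts E. ALL i:{1..vertex_weight E w v}. ALL j:{1..vertex_weight E w v}.
 Q ((sm F (%e. ?g (Edge e i) *[F] ?g (Ghost e j)) (out_arcs E v))
 -[F] (if i = j then ?g (Vertex v) else 0[F])))
 <-> (ALL v:regular_verts E. ALL i:{1..vertex_weight E w v}. ALL j:{1..vertex_weight E w v}.
 Q ((sm F (%q. lt (Src v i) q *[F] lt q (Src v j)) (opp E w (Src v i)))
 -[F] (if Src v i = Src v j then vx (ob E (Src v i)) else 0[F])))"
 by (intro ball_cong refl) (simp only: s3 gz regular_ne idx.inject ob.simps simp_thms)
 also have "(ALL v:regular_verts E. ALL e:out_arcs E v. ALL f:out_arcs E v.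
 Q ((sm F (%i. ?g (Ghost e i) *[F] ?g (Edge f i)) {1..vertex_weight E w v})
 -[F] (if e = f then ?g (Vertex (head E e)) else 0[F])))
 <-> (ALL v:regular_verts E. ALL e:out_arcs E v. ALL f:out_arcs E v.
 Q ((sm F (%q. lt (Out e) q *[F] lt q (Out f)) (opp E w (Out e)))
 -[F] (if Out e = Out f then vx (ob E (Out e)) else 0[F])))"
 by (intro ball_cong refl) (simp only: s4 gz out_arcsD head_in_verts idx.inject ob.simps)
 finally show ?thesis unfolding all_peer_iff .
qed

text \<open>Read from left to right, this yields the relations in the quotient; from right to left,
  it shows that an evaluation map kills the relators.\<close>

lemma relators_alg_map:
 assumes B: "pre_algebra K B" and h: "alg_map K (lpa_free K E w) B h"
 shows "(ALL r:lpa_relators K E w. h r = 0[B]) <-> lpa_relations E w B (%v. h (vx v)) (%p q. h (lt p q))" proof -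
 let ?F = "lpa_free K E w"
 interpret B: pre_algebra K B by (rule B)
 note hD = alg_mapD[OF h]
 have hm: "h (-[?F] x) = -[B] h x" if "x <: ?F" for x using additive_minus[OF fa.F.ag B.M.ag, of h x] hD that by auto
 have h0: "h 0[?F] = 0[B]" by (rule alg_map_zero[OF h fa.F.ag B.M.ag])
 have hz: "h (x -[?F] y) = 0[B] <-> h x = h y" if "x <: ?F" "y <: ?F" for x y
 using that hD(1) B.M.minus_eq_zero_iff[of "h x" "h y"] by (simp add: a_minus_def hD(2) hm)
 have mc: "[|p : ix E w; q : opp E w p; p' : peer E w p|] ==> lt p q *[?F] lt q p' <: ?F" for p q p' by (rule lt_lt_closed)
 have 1: "h (vx u *[?F] vx v -[?F] (if u = v then vx u else 0[?F])) = 0[B] <->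
 h (vx u) *[B] h (vx v) = (if u = v then h (vx u) else 0[B])" if "u : vs E" "v : vs E" for u v
 using that vx_closed by (subst hz) (auto simp: fa.mult_closed' hD h0)
 have 2: "h (vx (ob E p) *[?F] lt p q -[?F] lt p q) = 0[B] <-> h (vx (ob E p)) *[B] h (lt p q) = h (lt p q)"
 "h (lt p q *[?F] vx (ob E q) -[?F] lt p q) = 0[B] <-> h (lt p q) *[B] h (vx (ob E q)) = h (lt p q)"
 if "p : ix E w" "q : opp E w p" for p q using vx_closed[OF ob_closed[OF that(1)]] vx_closed[OF ob_closed[OF opp_P[OF that]]] lt_closed[OF that]
 by (simp_all add: hz fa.mult_closed' hD)
 have 3: "h ((sm ?F (%q. lt p q *[?F] lt q p') (opp E w p)) -[?F] (if p = p' then vx (ob E p) else 0[?F])) = 0[B] <->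
 (sm B (%q. h (lt p q) *[B] h (lt q p')) (opp E w p)) = (if p = p' then h (vx (ob E p)) else 0[B])"
 if "p : ix E w" "p' : peer E w p" for p p'
 proof -
 have mm: "lt p q *[?F] lt q p' <: ?F" "lt p q <: ?F" "lt q p' <: ?F"
 if "q : opp E w p" for q
 using that `p : ix E w` `p' : peer E w p` mc lt_closed[of p q] lt_closed[of q p'] opp_P[of p q] opp_mem[of p q p'] by auto
 have "h (sm ?F (%q. lt p q *[?F] lt q p') (opp E w p)) = sm B (%q. h (lt p q *[?F] lt q p')) (opp E w p)"
 using mm by (intro alg_map_finsum[OF h fa.F.ag B.M.ag]) auto
 also have "... = sm B (%q. h (lt p q) *[B] h (lt q p')) (opp E w p)" using mm by (intro B.M.finsum_cong') (auto simp: hD)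
 finally have e: "h (sm ?F (%q. lt p q *[?F] lt q p') (opp E w p)) = sm B (%q. h (lt p q) *[B] h (lt q p')) (opp E w p)" .
 show ?thesis using vx_closed[OF ob_closed[OF that(1)]] mm by (subst hz) (auto simp: e h0)
 qed
 show ?thesis unfolding all_relators_iff lpa_relations_def by (intro arg_cong2[where f = "(&)"] ball_cong refl) (simp_all add: 1 2 3)
qed

abbreviation L where "L \<equiv> leavitt_path_algebra K E w"

definition lpa_ideal where "lpa_ideal = algebra_ideal_gen K (lpa_free K E w) (lpa_relators K E w)"

lemma relators_closed: "lpa_relators K E w <= car (lpa_free K E w)"
proof -
 have 1: "vx (ob E p) <: (lpa_free K E w)" if "p : ix E w" for p by (rule vx_closed[OF ob_closed[OF that]])
 have 2: "sm (lpa_free K E w) (%q. lt p q *[lpa_free K E w] lt q p') (opp E w p) <: (lpa_free K E w)"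
 if "p : ix E w" "p' : peer E w p" for p p' using lt_lt_closed[OF that(1) _ that(2)] by (intro fa.F.finsum_closed) simp
 have 3: "vx (ob E q) <: (lpa_free K E w)" if "p : ix E w" "q : opp E w p" for p q by (rule 1[OF opp_P[OF that]])
 have "ALL r:lpa_relators K E w. r <: (lpa_free K E w)" unfolding all_relators_iff
 by (intro conjI ballI fa.F.minus_closed) (auto simp: 1 2 3 vx_closed lt_closed fa.mult_closed')
 thus ?thesis by blast
qed

lemma lpa_ideal_ideal: "algebra_ideal K (lpa_free K E w) lpa_ideal" and relators_ideal: "lpa_relators K E w <= lpa_ideal"
 and lpa_ideal_least: "[|algebra_ideal K (lpa_free K E w) I; lpa_relators K E w <= I|] ==> lpa_ideal <= I"
proof -
 have "algebra_ideal K (lpa_free K E w) (car (lpa_free K E w))" by (auto simp: algebra_ideal_def fa.mult_closed')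
 thus "algebra_ideal K (lpa_free K E w) lpa_ideal" using relators_closed unfolding lpa_ideal_def algebra_ideal_gen_def algebra_ideal_def by auto
qed (auto simp: lpa_ideal_def algebra_ideal_gen_def)

definition unit_rep where "unit_rep = sm (lpa_free K E w) (%v. free_gen K (Vertex v)) (vs E)"

lemma L_eq: "L = quotient_algebra (lpa_free K E w) lpa_ideal unit_rep" by (simp add: leavitt_path_algebra_def lpa_ideal_def unit_rep_def)

lemma pre_algebra_ideal_lpa: "pre_algebra_ideal K (lpa_free K E w) lpa_ideal unit_rep"
proof -
 have "unit_rep <: (lpa_free K E w)" unfolding unit_rep_def using vx_closed by (intro fa.F.finsum_closed) (auto simp: vx_def)
 thus ?thesis unfolding pre_algebra_ideal_def pre_algebra_ideal_axioms_def using fa.pre_algebra_F lpa_ideal_ideal by blast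
qed

interpretation pi: pre_algebra_ideal K "lpa_free K E w" lpa_ideal unit_rep by (rule pre_algebra_ideal_lpa)

definition nu where "nu v = pi.cls (vx v)"
definition g where "g p q = pi.cls (lt p q)"

lemma pre_L: "pre_algebra K L" unfolding L_eq by (rule pi.pre_algebra_Q)

lemma alg_map_cls: "alg_map K (lpa_free K E w) L pi.cls" unfolding L_eq by (rule pi.alg_map_cls)

lemma lpa_relations_L: "lpa_relations E w L nu g"
proof -
 have "ALL r:lpa_relators K E w. pi.cls r = 0[L]" unfolding L_eq pi.zero_Q using relators_ideal by (auto simp: pi.cls_eq a_minus_def subset_iff)
 thus ?thesis using relators_alg_map[OF pre_L alg_map_cls] unfolding nu_def[abs_def] g_def[abs_def] by blast
qed

interpretation pL: pre_algebra K L by (rule pre_L)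

lemma nu_L [simp]: "v : vs E ==> nu v <: L" unfolding nu_def by (rule alg_mapD(1)[OF alg_map_cls vx_closed])

lemma g_L [simp]: "[|p : ix E w; q : opp E w p|] ==> g p q <: L" unfolding g_def by (rule alg_mapD(1)[OF alg_map_cls lt_closed])

lemma one_L: "1[L] = sm L (%v. nu v) (vs E)"
proof -
 have "1[L] = pi.cls unit_rep" unfolding L_eq by (rule pi.one_Q)
 also have "... = sm L (%v. pi.cls (vx v)) (vs E)" unfolding unit_rep_def vx_def[symmetric]
 by (rule alg_map_finsum[OF alg_map_cls fa.F.ag pL.M.ag]) (use vx_closed in blast)
 finally show ?thesis by (simp add: nu_def)
qed

lemma nu_sum:
 assumes "u : vs E" shows "sm L (%v. nu v) (vs E) *[L] nu u = nu u" "nu u *[L] sm L (%v. nu v) (vs E) = nu u"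
proof -
 have m: "nu u *[L] nu v = (if u = v then nu u else 0[L])" if "u : vs E" "v : vs E" for u v
 using lpa_relations_L that unfolding lpa_relations_def by blast
 have "sm L (%v. nu v) (vs E) *[L] nu u = sm L (%v. nu v *[L] nu u) (vs E)" using assms pL.mult_l_distr
 by (intro add_finsum[of L L "%x. x *[L] nu u"] pL.M.ag) auto
 also have "... = nu u *[L] nu u" using assms m by (intro pL.M.finsum_delta finite_verts) auto
 finally show "sm L (%v. nu v) (vs E) *[L] nu u = nu u" using m assms by simp
 have "nu u *[L] sm L (%v. nu v) (vs E) = sm L (%v. nu u *[L] nu v) (vs E)" using assms pL.mult_r_distr
 by (intro add_finsum[of L L "%x. nu u *[L] x"] pL.M.ag) auto
 also have "... = nu u *[L] nu u" using assms m by (intro pL.M.finsum_delta finite_verts) auto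
 finally show "nu u *[L] sm L (%v. nu v) (vs E) = nu u" using m assms by simp
qed

lemma one_L_closed: "1[L] <: L" unfolding one_L using nu_L by (intro pL.M.finsum_closed) blast

lemma cls_gen: assumes "x : lpa_gens E w" shows "pi.cls (free_gen K x) <: L" "1[L] *[L] pi.cls (free_gen K x) = pi.cls (free_gen K x)"
 "pi.cls (free_gen K x) *[L] 1[L] = pi.cls (free_gen K x)"
proof -
 let ?x = "pi.cls (free_gen K x)"
 have "?x <: L & 1[L] *[L] ?x = ?x & ?x *[L] 1[L] = ?x" using assms
 proof (cases rule: gen_cases)
 case (1 v)
 hence "?x = nu v" by (simp add: nu_def vx_def)
 thus ?thesis using 1 nu_L nu_sum one_L by simp
 next
 case (2 p q)
 hence x: "?x = g p q" by (simp add: g_def lt_def)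
 have gpq: "nu (ob E p) *[L] g p q = g p q" "g p q *[L] nu (ob E q) = g p q" using lpa_relations_L 2 unfolding lpa_relations_def by blast+
 have c: "ob E p : vs E" "ob E q : vs E" "nu (ob E p) <: L" "nu (ob E q) <: L" "g p q <: L" using 2 ob_closed opp_P[OF 2(1,2)] nu_L g_L by auto
 have "1[L] *[L] g p q = g p q" using pL.mult_assoc[OF one_L_closed c(3,5)] nu_sum(1)[OF c(1)] gpq by (simp add: one_L)
 moreover have "g p q *[L] 1[L] = g p q" using pL.mult_assoc[OF c(5,4) one_L_closed] nu_sum(2)[OF c(2)] gpq by (simp add: one_L)
 ultimately show ?thesis using c x by simp
 qed
 thus "?x <: L" "1[L] *[L] ?x = ?x" "?x *[L] 1[L] = ?x" by auto
qed

text \<open>The candidate unit meets only the first letter from the left and only the last one from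
  the right, so \<open>cls_gen\<close> decides.\<close>

lemma one_mult_word: assumes "u : fa.W" shows "1[L] *[L] pi.cls (fa.mono 1[K] u) = pi.cls (fa.mono 1[K] u)"
 "pi.cls (fa.mono 1[K] u) *[L] 1[L] = pi.cls (fa.mono 1[K] u)"
proof -
 note cD = alg_mapD[OF alg_map_cls]
 obtain x v where u: "u = x # v" and x: "x : lpa_gens E w" using assms by (cases u) (auto simp: fa.W_def)
 show "1[L] *[L] pi.cls (fa.mono 1[K] u) = pi.cls (fa.mono 1[K] u)"
 proof (cases "v = []")
 case True
 thus ?thesis using cls_gen[OF x] u by (simp add: fa.free_gen_mono)
 next
 case False
 hence v: "v : fa.W" using assms u by (auto simp: fa.W_def)
 have "pi.cls (fa.mono 1[K] u) = pi.cls (free_gen K x) *[L] pi.cls (fa.mono 1[K] v)"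
 unfolding u fa.mono_Cons by (intro cD fa.free_gen_closed x fa.mono_closed v) simp
 thus ?thesis using pL.mult_assoc[OF one_L_closed cls_gen(1)[OF x] cD(1)[OF fa.mono_closed[OF _ v]]]
 cls_gen[OF x] by simp
 qed
 obtain y t where u: "u = t @ [y]" and y: "y : lpa_gens E w" using assms by (cases u rule: rev_cases) (auto simp: fa.W_def)
 show "pi.cls (fa.mono 1[K] u) *[L] 1[L] = pi.cls (fa.mono 1[K] u)"
 proof (cases "t = []")
 case True
 thus ?thesis using cls_gen[OF y] u by (simp add: fa.free_gen_mono)
 next
 case False
 hence t: "t : fa.W" using assms u by (auto simp: fa.W_def)
 have "pi.cls (fa.mono 1[K] u) = pi.cls (fa.mono 1[K] t) *[L] pi.cls (free_gen K y)"
 unfolding u fa.mono_snoc by (intro cD fa.free_gen_closed y fa.mono_closed t) simp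
 thus ?thesis using pL.mult_assoc[OF cD(1)[OF fa.mono_closed[OF _ t]] cls_gen(1)[OF y] one_L_closed]
 cls_gen[OF y] by simp
 qed
qed

lemma carrier_L: "car L = pi.cls ` car (lpa_free K E w)" unfolding L_eq by (rule pi.carrier_Q)

lemma unital_L: "ualg K L"
proof (rule pL.unital_algebraI[OF one_L_closed])
 note cD = alg_mapD[OF alg_map_cls]
 have z: "pi.cls 0[lpa_free K E w] = 0[L]" unfolding L_eq by (rule pi.zero_Q[symmetric])
 have mono: "pi.cls (fa.mono c u) = c *:[L] pi.cls (fa.mono 1[K] u)" "pi.cls (fa.mono 1[K] u) <: L"
 if "c <: K" "u : fa.W" for c u using cD(4)[OF that(1) fa.mono_closed[OF _ that(2)]] fa.mono_smult[OF that(1), of u]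
 cD(1) fa.mono_closed that by auto
 have m1: "1[L] *[L] pi.cls (fa.mono c u) = pi.cls (fa.mono c u)"
 "pi.cls (fa.mono c u) *[L] 1[L] = pi.cls (fa.mono c u)" if "c <: K" "u : fa.W" for c u unfolding mono(1)[OF that] using that mono(2)
 by (simp_all add: pL.mult_smult_r pL.mult_smult_l one_L_closed one_mult_word)
 fix x assume "x <: L"
 then obtain f where x: "x = pi.cls f" and f: "f <: (lpa_free K E w)" unfolding carrier_L by blast
 show "1[L] *[L] x = x" unfolding x using f by (rule fa.mono_ext[where p = "(\<oplus>\<^bsub>L\<^esub>)"])
 (simp_all add: z cD(1,2) pL.mult_r_distr one_L_closed m1
 additive_zero[OF pL.M.ag pL.M.ag, of "%x. 1[L] *[L] x"])
 show "x *[L] 1[L] = x" unfolding x using f by (rule fa.mono_ext[where p = "(\<oplus>\<^bsub>L\<^esub>)"])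
 (simp_all add: z cD(1,2) pL.mult_l_distr one_L_closed m1
 additive_zero[OF pL.M.ag pL.M.ag, of "%x. x *[L] 1[L]"])
qed

text \<open>An induction principle for \<open>L\<close>: every word is built up from
  \<open>1[L]\<close> by multiplying with generators from the left.\<close>

lemma L_generated:
 assumes S: "S <= car L" "0[L] : S" "1[L] : S" "!!x y. [|x : S; y : S|] ==> x +[L] y : S"
 "!!c x. [|c <: K; x : S|] ==> c *:[L] x : S" "!!v x. [|v : vs E; x : S|] ==> nu v *[L] x : S"
 "!!p q x. [|p : ix E w; q : opp E w p; x : S|] ==> g p q *[L] x : S"
 shows "car L = S" proof -
 note cD = alg_mapD[OF alg_map_cls]
 interpret L: unital_algebra K L by (rule unital_L)
 have gen: "pi.cls (free_gen K x) *[L] s : S" if "x : lpa_gens E w" "s : S" for x s using that(1)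
 proof (cases rule: gen_cases)
 case (1 v) thus ?thesis using S(6)[OF 1(1) that(2)] by (simp add: nu_def vx_def)
 next
 case (2 p q) thus ?thesis using S(7)[OF 2(1,2) that(2)] by (simp add: g_def lt_def)
 qed
 have word: "pi.cls (fa.mono 1[K] u) : S" if "u : fa.W" for u using that
 proof (induction u)
 case (Cons x u)
 hence x: "x : lpa_gens E w" by (simp add: fa.W_def)
 show ?case
 proof (cases "u = []")
 case True
 thus ?thesis using gen[OF x S(3)] L.A.r_one[OF cls_gen(1)[OF x]] by (simp add: fa.free_gen_mono)
 next
 case False
 hence u: "u : fa.W" using Cons by (simp add: fa.W_def)
 have "pi.cls (fa.mono 1[K] (x # u)) = pi.cls (free_gen K x) *[L] pi.cls (fa.mono 1[K] u)"
 unfolding fa.mono_Cons by (intro cD fa.free_gen_closed x fa.mono_closed u) simp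
 thus ?thesis using gen[OF x Cons.IH[OF u]] by simp
 qed
 qed (simp add: fa.W_def)
 have "pi.cls f : S" if "f <: (lpa_free K E w)" for f using that
 proof (induction rule: fa.free_induct)
 case zero
 thus ?case using S(2) pi.zero_Q unfolding L_eq by simp
 next
 case (add c u f)
 have "pi.cls (fa.mono c u) = c *:[L] pi.cls (fa.mono 1[K] u)"
 using cD(4)[OF add(1) fa.mono_closed[OF _ add(2)]] fa.mono_smult[OF add(1), of u] by simp
 thus ?case using S(4,5) add word cD(2)[OF fa.mono_closed[OF add(1,2)] add(3)] by simp
 qed
 thus ?thesis using S(1) unfolding carrier_L by blast
qed

text \<open>The kernel of the evaluation map is an ideal that contains the relators, so evaluation
  factors through the quotient. The resulting map may send \<open>1[L]\<close> to a proper
  idempotent of \<open>B\<close>, which is what the embeddings onto corners do later.\<close>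

lemma L_universal:
 fixes B :: "('k, 'b) module"
 assumes B: "ualg K B" and rel: "lpa_relations E w B nu' g'" and nu': "!!v. v : vs E ==> nu' v <: B"
 and g': "!!p q. [|p : ix E w; q : opp E w p|] ==> g' p q <: B"
 obtains h where "alg_map K L B h" "!!v. v : vs E ==> h (nu v) = nu' v" "!!p q. [|p : ix E w; q : opp E w p|] ==> h (g p q) = g' p q"
proof -
 let ?F = "lpa_free K E w"
 interpret B: unital_algebra K B by (rule B)
 define b where "b x = (case x of Vertex v => nu' v | Edge e i => g' (Src (tail E e) i) (Out e)
 | Ghost e i => g' (Out e) (Src (tail E e) i))" for x
 have bl: "b (letter p q) = g' p q" if "p : ix E w" "q : opp E w p" for p q using that by (cases p; cases q) (auto simp: b_def)
 have b: "b : lpa_gens E w ->: B"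
 proof
 fix x assume "x : lpa_gens E w"
 thus "b x <: B" by (cases rule: gen_cases) (use nu' g' bl in "auto simp: b_def")
 qed
 let ?ev = "fa.eval_free B b"
 have ev: "alg_map K ?F B ?ev" by (rule fa.alg_map_eval[OF B b])
 note eD = alg_mapD[OF ev]
 have ev_v: "?ev (vx v) = nu' v" if "v : vs E" for v using fa.eval_gen[OF B b, of "Vertex v"] that by (simp add: vx_def lpa_gens_def b_def)
 have ev_l: "?ev (lt p q) = g' p q" if "p : ix E w" "q : opp E w p" for p q
 using fa.eval_gen[OF B b letter_gens[OF that]] bl[OF that] by (simp add: lt_def)
 have rel': "lpa_relations E w B (%v. ?ev (vx v)) (%p q. ?ev (lt p q))" proof -
 have s: "sm B (%q. ?ev (lt p q) *[B] ?ev (lt q p')) (opp E w p) = sm B (%q. g' p q *[B] g' q p') (opp E w p)"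
 if p: "p : ix E w" "p' : peer E w p" for p p'
 proof (rule B.M.finsum_cong')
 fix q assume q: "q : opp E w p"
 show "?ev (lt p q) *[B] ?ev (lt q p') = g' p q *[B] g' q p'" using ev_l[OF p(1) q] ev_l[OF opp_P[OF p(1) q] opp_mem[OF p(1) q p(2)]] by simp
 next
 show "(%q. g' p q *[B] g' q p') : opp E w p ->: B" using g'[OF p(1)] g'[OF opp_P[OF p(1)] opp_mem[OF p(1) _ p(2)]] by simp
 qed simp
 have o: "?ev (vx (ob E p)) = nu' (ob E p)" if "p : ix E w" for p using ev_v[OF ob_closed[OF that]] .
 have o': "?ev (vx (ob E q)) = nu' (ob E q)" if "p : ix E w" "q : opp E w p" for p q by (rule o[OF opp_P[OF that]])
 show ?thesis using rel unfolding lpa_relations_def by (intro conjI ballI) (auto simp: ev_v ev_l s o o')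
 qed
 have kill: "ALL r:lpa_relators K E w. ?ev r = 0[B]" using relators_alg_map[OF B.pre_algebra_axioms ev] rel' by blast
 have ev0: "?ev 0[?F] = 0[B]" by (rule fa.eval_zero[OF B b])
 have "lpa_ideal <= {f : car ?F. ?ev f = 0[B]}" using kill relators_closed by (intro lpa_ideal_least) (auto simp: algebra_ideal_def eD ev0)
 hence ker: "?ev f = 0[B]" if "f : lpa_ideal" for f using that by blast
 \<comment> \<open>Two representatives of a coset differ by an element of the ideal, where
   evaluation vanishes.\<close>
 have wd: "?ev f = ?ev f'" if "f <: ?F" "f' <: ?F" "pi.cls f = pi.cls f'" for f f' proof -
 have "f -[?F] f' : lpa_ideal" using that pi.cls_eq by blast
 hence "?ev (f -[?F] f') = 0[B]" by (rule ker)
 moreover have "?ev (f -[?F] f') = ?ev f -[B] ?ev f'" using that additive_minus[OF fa.F.ag B.M.ag, of ?ev f'] eD by (simp add: a_minus_def)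
 ultimately show ?thesis using that eD(1) B.M.minus_eq_zero_iff by simp
 qed
 define h where "h x = ?ev (SOME f. f <: ?F & pi.cls f = x)" for x
 have hc: "h (pi.cls f) = ?ev f" if "f <: ?F" for f proof -
 have "(SOME f'. f' <: ?F & pi.cls f' = pi.cls f) <: ?F &
 pi.cls (SOME f'. f' <: ?F & pi.cls f' = pi.cls f) = pi.cls f" by (rule someI[of _ f]) (use that in simp)
 thus ?thesis unfolding h_def using that wd by blast
 qed
 have "alg_map K L B h" unfolding alg_map_def carrier_L by (auto simp: hc eD simp flip: alg_mapD(2-4)[OF alg_map_cls])
 moreover have "h (nu v) = nu' v" if "v : vs E" for v using that by (simp add: nu_def hc vx_closed ev_v)
 moreover have "h (g p q) = g' p q" if "p : ix E w" "q : opp E w p" for p q using that by (simp add: g_def hc lt_closed ev_l)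
 ultimately show ?thesis by (rule that)
qed

sublocale fam: cell_family "vs E" "ix E w" "opp E w" "peer E w" "ob E" side L nu g
proof -
 interpret L: unital_algebra K L by (rule unital_L)
 show "cell_family (vs E) (ix E w) (opp E w) (peer E w) (ob E) side L nu g"
 by unfold_locales (use lpa_relations_L nu_L g_L in "auto simp: lpa_relations_def")
qed

end

section \<open>Filtered modules\<close>

locale leavitt = U: unital_algebra K L + cell_family V P opp peer ob side L nu g
 for K :: "'k ring" and L :: "('k, 'l) module" and V :: "'v set" and P :: "'p set"
 and opp peer ob side nu g +
 assumes one_sum: "1[L] = sm L (%v. nu v) V" and generated: "!!S. [|S <= car L; 0[L] : S; 1[L] : S; !!x y. [|x : S; y : S|] ==> x +[L] y : S;
 !!c x. [|c <: K; x : S|] ==> c *:[L] x : S;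
 !!v x. [|v : V; x : S|] ==> nu v *[L] x : S;
 !!p q x. [|p : P; q : opp p; x : S|] ==> g p q *[L] x : S|] ==> car L = S"
begin

text \<open>Scalars act on an \<open>L\<close>-module through these elements, as a left module
  carries no scalar multiplication of its own.\<close>

definition ka :: "'k => 'l" where "ka c = c *:[L] 1[L]"

lemma ka_closed [simp]: "c <: K ==> ka c <: L" by (simp add: ka_def)

lemma ka_mult: "[|c <: K; x <: L|] ==> ka c *[L] x = c *:[L] x" by (simp add: ka_def U.mult_smult_l)

lemma mult_kap: "[|c <: K; x <: L|] ==> x *[L] ka c = c *:[L] x" by (simp add: ka_def U.mult_smult_r)

lemma ka_one: "ka 1[K] = 1[L]" by (simp add: ka_def)

lemma ka_add: "[|c <: K; d <: K|] ==> ka (c +[K] d) = ka c +[L] ka d" by (simp add: ka_def U.smult_l_distr)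

lemma ka_kap: "[|c <: K; d <: K|] ==> ka (c *[K] d) = ka c *[L] ka d" by (simp add: ka_mult) (simp add: ka_def U.smult_assoc1)

lemma ka_zero: "ka 0[K] = 0[L]" by (simp add: ka_def)

lemma ka_minus: "c <: K ==> ka (-[K] c) = -[L] ka c" by (simp add: ka_def U.smult_l_minus)

text \<open>Level \<open>n\<close> adjoins letters of one side only, and the side alternates with
  \<open>n\<close>. Behind a letter \<open>g p q\<close> of level \<open>n + 1\<close>, the letters
  of level \<open>n\<close> have row indices on the side of \<open>q\<close>, which is where the
  inversion relations can apply.\<close>

definition level :: "nat => 'p set" where "level n = {p : P. side p = odd n}"

lemma levelD: "p : level n ==> p : P" "p : level n ==> side p = odd n" by (auto simp: level_def)

lemma finite_level: "finite (level n)" by (simp add: level_def finite_P)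

lemma level_opp: "[|p : level (Suc n); q : opp p|] ==> q : level n" using side_opp opp_P by (auto simp: level_def)

end

locale lv_module = leavitt K L V P opp peer ob side nu g + M: left_module L M
 for K :: "'k ring" and L :: "('k, 'l) module" and V :: "'v set" and P :: "'p set"
 and opp peer ob side nu g and M :: "('l, 'm) module"
begin

lemma nu_act: "[|v : V; x <: M|] ==> nu v *:[M] x <: M" by (rule M.smult_closed[OF nu_closed])

lemma g_act: "[|p : P; q : opp p; x <: M|] ==> g p q *:[M] x <: M" by (rule M.smult_closed[OF g_closed])

lemma ka_act: "[|c <: K; x <: M|] ==> ka c *:[M] x <: M" by (rule M.smult_closed[OF ka_closed])

lemma minus_kap: "x <: M ==> -[M] x = ka (-[K] 1[K]) *:[M] x" by (simp add: ka_minus ka_one M.smult_l_minus)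

lemma sum_nu_act: assumes "x <: M" shows "x = sm M (%v. nu v *:[M] x) V"
proof -
 have "x = sm L (%v. nu v) V *:[M] x" using assms by (simp flip: one_sum)
 also have "... = sm M (%v. nu v *:[M] x) V" using assms by (intro M.smult_l_finsum) auto
 finally show ?thesis .
qed

text \<open>The multipliers that preserve \<open>S\<close> form a set to which
  \<open>generated\<close> applies.\<close>

lemma submodule_closed:
 assumes S: "S <= car M" "0[M] : S" "!!x y. [|x : S; y : S|] ==> x +[M] y : S"
 "!!c x. [|c <: K; x : S|] ==> ka c *:[M] x : S" "!!v x. [|v : V; x : S|] ==> nu v *:[M] x : S"
 "!!p q x. [|p : P; q : opp p; x : S|] ==> g p q *:[M] x : S"
 and l: "l <: L" and x: "x : S" shows "l *:[M] x : S"
proof -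
 have "car L = {l : car L. ALL x:S. l *:[M] x : S}"
 proof (rule generated)
 show "c *:[L] l : {l : car L. ALL x:S. l *:[M] x : S}"
 if "c <: K" "l : {l : car L. ALL x:S. l *:[M] x : S}" for c l
 proof -
 have "(c *:[L] l) *:[M] x = ka c *:[M] (l *:[M] x)" if "x : S" for x using `c <: K` `l : _` that S(1) by (auto simp flip: M.smult_assoc ka_mult)
 thus ?thesis using that S(4) by auto
 qed
 qed (use S nu_closed g_closed in "auto simp: M.smult_l_distr M.smult_assoc M.smult_one subset_iff")
 thus ?thesis using l x by blast
qed

text \<open>A matrix times its inverse, after interchanging two sums; the diagonal entry of the
  product is \<open>nu (ob p)\<close>.\<close>

lemma matrix_inverse:
 assumes p: "p : P" and y: "!!p'. p' : peer p ==> y p' <: M"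
 shows "sm M (%q. g p q *:[M] sm M (%p'. g q p' *:[M] y p') (peer p)) (opp p) = nu (ob p) *:[M] y p" proof -
 have gc: "g p q <: L" "p' : peer p ==> g q p' <: L" if "q : opp p" for q p' using that p opp_P[OF p that] opp_mem[OF p that] by auto
 have "sm M (%q. g p q *:[M] sm M (%p'. g q p' *:[M] y p') (peer p)) (opp p) =
 (sm M (%q. sm M (%p'. (g p q *[L] g q p') *:[M] y p') (peer p)) (opp p))"
 proof (rule M.finsum_cong')
 fix q assume q: "q : opp p"
 have "g p q *:[M] sm M (%p'. g q p' *:[M] y p') (peer p) = sm M (%p'. g p q *:[M] (g q p' *:[M] y p')) (peer p)"
 using gc q y by (intro M.smult_r_finsum) auto
 also have "... = sm M (%p'. (g p q *[L] g q p') *:[M] y p') (peer p)" using gc q y by (intro M.finsum_cong') (auto simp: M.smult_assoc)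
 finally show "g p q *:[M] sm M (%p'. g q p' *:[M] y p') (peer p) = sm M (%p'. (g p q *[L] g q p') *:[M] y p') (peer p)" .
 qed (use gc y in "auto intro!: M.finsum_closed M.smult_closed")
 also have "... = sm M (%p'. sm M (%q. (g p q *[L] g q p') *:[M] y p') (opp p)) (peer p)"
 using gc y p by (intro M.finsum_swap finite_opp finite_peer) auto
 also have "... = sm M (%p'. (if p = p' then nu (ob p) else 0[L]) *:[M] y p') (peer p)"
 proof (rule M.finsum_cong')
 fix p' assume p': "p' : peer p"
 have "sm M (%q. (g p q *[L] g q p') *:[M] y p') (opp p) = sm L (%q. g p q *[L] g q p') (opp p) *:[M] y p'"
 using gc y p' by (intro M.smult_l_finsum[symmetric]) auto
 thus "sm M (%q. (g p q *[L] g q p') *:[M] y p') (opp p) = (if p = p' then nu (ob p) else 0[L]) *:[M] y p'" using g_g[OF p p'] by simp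
 qed (use y p in "auto intro!: M.smult_closed nu_closed ob_closed")
 also have "... = (if p = p then nu (ob p) else 0[L]) *:[M] y p"
 using p y by (intro M.finsum_delta finite_peer peer_refl) (auto simp: peer_refl intro!: nu_act ob_closed)
 finally show ?thesis by simp
qed

definition step :: "nat => ('p => 'p => 'm) => 'm" where "step n b = sm M (%p. sm M (%q. g p q *:[M] b p q) (opp p)) (level n)"

definition into :: "nat => 'm set => ('p => 'p => 'm) => bool" where "into n S b <-> (ALL p:level n. ALL q:opp p. b p q : S)"

lemma into_mono: "[|into n S b; S <= T|] ==> into n T b" by (auto simp: into_def)

lemma row_closed: "[|into n (car M) b; p : level n|] ==> (%q. g p q *:[M] b p q) : opp p ->: M"
 by (auto simp: into_def intro!: g_act dest: levelD)

lemma step_closed: "into n (car M) b ==> step n b <: M" unfolding step_def using row_closed by (intro M.finsum_closed) auto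

lemma step_add: assumes b: "into n (car M) b" and c: "into n (car M) c" shows "step n (%p q. b p q +[M] c p q) = step n b +[M] step n c"
proof -
 have "step n (%p q. b p q +[M] c p q) =
 (sm M (%p. sm M (%q. g p q *:[M] b p q) (opp p) +[M] sm M (%q. g p q *:[M] c p q) (opp p)) (level n))" unfolding step_def
 proof (rule M.finsum_cong')
 fix p assume p: "p : level n"
 have "sm M (%q. g p q *:[M] (b p q +[M] c p q)) (opp p) = sm M (%q. g p q *:[M] b p q +[M] g p q *:[M] c p q) (opp p)" using b c p levelD
 by (intro M.finsum_cong') (auto simp: into_def M.smult_r_distr)
 also have "... = sm M (%q. g p q *:[M] b p q) (opp p) +[M] sm M (%q. g p q *:[M] c p q) (opp p)"
 using row_closed[OF b p] row_closed[OF c p] by (rule M.finsum_addf)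
 finally show "sm M (%q. g p q *:[M] (b p q +[M] c p q)) (opp p) =
 (sm M (%q. g p q *:[M] b p q) (opp p)) +[M] sm M (%q. g p q *:[M] c p q) (opp p)" .
 qed (use row_closed[OF b] row_closed[OF c] in "auto intro!: M.finsum_closed")
 also have "... = step n b +[M] step n c" unfolding step_def using row_closed[OF b] row_closed[OF c] by (intro M.finsum_addf) auto
 finally show ?thesis .
qed

lemma step_zero: "step n (%p q. 0[M]) = 0[M]" unfolding step_def by (intro M.add.finprod_one_eqI) (auto simp: levelD)

lemma act_step:
 assumes b: "into n (car M) b" and l: "l <: L"
 shows "l *:[M] step n b = sm M (%p. sm M (%q. (l *[L] g p q) *:[M] b p q) (opp p)) (level n)" proof -
 have "l *:[M] step n b = sm M (%p. l *:[M] sm M (%q. g p q *:[M] b p q) (opp p)) (level n)"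
 unfolding step_def using row_closed[OF b] l by (intro M.smult_r_finsum) auto
 also have "... = sm M (%p. sm M (%q. (l *[L] g p q) *:[M] b p q) (opp p)) (level n)"
 proof (rule M.finsum_cong')
 fix p assume p: "p : level n"
 have cl: "(l *[L] g p q) *:[M] b p q <: M" "(l *[L] g p q) *:[M] b p q = l *:[M] (g p q *:[M] b p q)"
 if "q : opp p" for q using b p l levelD[OF p] that by (auto simp: into_def M.smult_assoc)
 have "l *:[M] sm M (%q. g p q *:[M] b p q) (opp p) = sm M (%q. l *:[M] (g p q *:[M] b p q)) (opp p)"
 using row_closed[OF b p] l by (intro M.smult_r_finsum) auto
 also have "... = sm M (%q. (l *[L] g p q) *:[M] b p q) (opp p)" using cl by (intro M.finsum_cong') auto
 finally show "l *:[M] sm M (%q. g p q *:[M] b p q) (opp p) = sm M (%q. (l *[L] g p q) *:[M] b p q) (opp p)" .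
 qed (use b l levelD g_closed in "auto simp: into_def intro!: M.finsum_closed M.smult_closed")
 finally show ?thesis .
qed

lemma ka_step: assumes b: "into n (car M) b" and c: "c <: K" shows "ka c *:[M] step n b = step n (%p q. ka c *:[M] b p q)"
proof -
 have "(ka c *[L] g p q) *:[M] b p q = g p q *:[M] (ka c *:[M] b p q)" if "p : level n" "q : opp p" for p q
 using that b c levelD by (simp add: into_def ka_mult flip: M.smult_assoc mult_kap)
 moreover have "g p q *:[M] (ka c *:[M] b p q) <: M" if "p : level n" "q : opp p" for p q using that b c levelD by (auto simp: into_def)
 ultimately show ?thesis unfolding act_step[OF b ka_closed[OF c]] unfolding step_def by (intro M.finsum_cong') auto
qed

lemma nu_step: assumes b: "into n (car M) b" and v: "v : V" shows "nu v *:[M] step n b = step n (%p q. if ob p = v then b p q else 0[M])"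
proof -
 have 1: "nu v *[L] g p q = (if ob p = v then g p q else 0[L])" if "p : P" "q : opp p" for p q proof -
 have "nu v *[L] g p q = (nu v *[L] nu (ob p)) *[L] g p q" using that v ob_closed by (simp add: U.mult_assoc nu_g)
 also have "... = (if ob p = v then g p q else 0[L])" unfolding nu_mult[OF v ob_closed[OF that(1)]] using nu_g[OF that] g_closed[OF that] by auto
 finally show ?thesis .
 qed
 have "(nu v *[L] g p q) *:[M] b p q = g p q *:[M] (if ob p = v then b p q else 0[M])" if "p : level n" "q : opp p" for p q
 using that b levelD g_closed 1 by (simp add: into_def)
 moreover have "g p q *:[M] (if ob p = v then b p q else 0[M]) <: M" if "p : level n" "q : opp p" for p q using that b levelD by (auto simp: into_def)
 ultimately show ?thesis unfolding act_step[OF b nu_closed[OF v]] unfolding step_def by (intro M.finsum_cong') auto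
qed

lemma single_step:
 assumes p: "p : level n" and q: "q : opp p" and x: "x <: M" shows "step n (%p' q'. if p' = p & q' = q then x else 0[M]) = g p q *:[M] x"
proof -
 have "step n (%p' q'. if p' = p & q' = q then x else 0[M]) = (sm M (%q'. g p q' *:[M] (if p = p & q' = q then x else 0[M])) (opp p))"
 unfolding step_def using assms levelD(1) by (intro M.finsum_delta finite_level) (auto intro!: M.add.finprod_one_eqI)
 also have "... = g p q *:[M] (if p = p & q = q then x else 0[M])" using assms levelD[OF p] by (intro M.finsum_delta finite_opp) auto
 finally show ?thesis by simp
qed

end

context lv_module
begin

definition subspace :: "'m set => bool" where "subspace S <-> S <= car M & 0[M] : S & (ALL x:S. ALL y:S. x +[M] y : S) &
 (ALL c:car K. ALL x:S. ka c *:[M] x : S) & (ALL v:V. ALL x:S. nu v *:[M] x : S)"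

lemma subspaceD:
 assumes "subspace S" shows "S <= car M" "0[M] : S" "[|x : S; y : S|] ==> x +[M] y : S"
 "[|c <: K; x : S|] ==> ka c *:[M] x : S" "[|v : V; x : S|] ==> nu v *:[M] x : S" "x : S ==> x <: M" "x : S ==> -[M] x : S"
proof -
 show "x : S ==> -[M] x : S" using assms minus_kap[of x] by (auto simp: subspace_def)
qed (use assms in "auto simp: subspace_def")

lemma subspace_finsum: "[|subspace S; !!i. i : A ==> f i : S|] ==> sm M f A : S" by (rule M.finsum_mem) (auto dest: subspaceD)

lemma subspace_zero: "subspace {0[M]}" by (auto simp: subspace_def)

lemma step_mem:
 assumes "subspace S" "!!p q. [|p : level n; q : opp p|] ==> g p q *:[M] b p q : S"
 shows "step n b : S" unfolding step_def using assms by (intro subspace_finsum) auto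

end

lemma (in left_module) hom_finsum:
 assumes N: "abelian_group N" and h: "h : car M ->: N" and add: "!!x y. [|x <: M; y <: M|] ==> h (x +[M] y) = h x +[N] h y" and f: "f : A ->: M"
 shows "h (sm M f A) = sm N (%i. h (f i)) A" by (rule add_finsum[OF M.ag N h add f])

text \<open>
 The last condition says that, modulo \<open>Fil n\<close>, the level \<open>n + 2\<close> is freely generated from
 level \<open>n + 1\<close> by adjoining the rows of the matrices \<open>g\<close> of one of the two sides.
\<close>

locale good_module = lv_module K L V P opp peer ob side nu g M
 for K :: "'k ring" and L :: "('k, 'l) module" and V :: "'v set" and P :: "'p set"
 and opp peer ob side nu g and M :: "('l, 'm) module" +
 fixes Fil :: "nat => 'm set"
 assumes Fil_subspace: "subspace (Fil n)" and Fil_0: "Fil 0 = {0[M]}" and Fil_mono: "Fil n <= Fil (Suc n)"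
 and Fil_step: "[|x : Fil n; p : level (Suc n); q : opp p|] ==> g p q *:[M] x : Fil (Suc n)" and Fil_ex: "x <: M ==> EX n. x : Fil n"
 and good: "[|a : Fil (Suc n); into (Suc (Suc n)) (Fil (Suc n)) b;
 a +[M] step (Suc (Suc n)) b : Fil n; p : level (Suc (Suc n)); p' : peer p|] ==> (sm M (%q. g p' q *:[M] b p q) (opp p)) : Fil n"
begin

lemmas FilD = subspaceD[OF Fil_subspace]

lemma Fil_mono_le: "m <= n ==> Fil m <= Fil n" using Fil_mono by (rule lift_Suc_mono_le)

end

locale leavitt_hom = lv_module K L V P opp peer ob side nu g M + W: lv_module K L V P opp peer ob side nu g W
 for K :: "'k ring" and L :: "('k, 'l) module" and V :: "'v set" and P :: "'p set"
 and opp peer ob side nu g and M :: "('l, 'm) module" and W :: "('l, 'w) module" +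
 fixes pr :: "'w => 'm"
 assumes pr_closed: "x <: W ==> pr x <: M" and pr_add: "[|x <: W; y <: W|] ==> pr (x +[W] y) = pr x +[M] pr y"
 and pr_smult: "[|l <: L; x <: W|] ==> pr (l *:[W] x) = l *:[M] pr x"
begin

lemma pr_finsum: "f : A ->: W ==> pr (sm W f A) = sm M (%i. pr (f i)) A" by (rule W.M.hom_finsum[OF M.ag]) (auto simp: pr_closed pr_add)

lemma pr_step: assumes "W.into n (car W) b" shows "pr (W.step n b) = step n (%p q. pr (b p q))"
proof -
 have m: "into n (car M) (%p q. pr (b p q))" using assms by (auto simp: into_def W.into_def pr_closed)
 have "pr (W.step n b) = sm M (%p. pr (sm W (%q. g p q *:[W] b p q) (opp p))) (level n)"
 unfolding W.step_def using W.row_closed[OF assms] by (intro pr_finsum) auto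
 also have "... = sm M (%p. sm M (%q. g p q *:[M] pr (b p q)) (opp p)) (level n)"
 proof (rule M.finsum_cong')
 fix p assume p: "p : level n"
 have "pr (sm W (%q. g p q *:[W] b p q) (opp p)) = sm M (%q. pr (g p q *:[W] b p q)) (opp p)"
 by (rule pr_finsum[OF W.row_closed[OF assms p]])
 also have "... = sm M (%q. g p q *:[M] pr (b p q)) (opp p)" using row_closed[OF m p] assms p levelD[OF p]
 by (intro M.finsum_cong') (auto simp: W.into_def pr_smult)
 finally show "pr (sm W (%q. g p q *:[W] b p q) (opp p)) = sm M (%q. g p q *:[M] pr (b p q)) (opp p)" .
 qed (use row_closed[OF m] in "auto intro!: M.finsum_closed")
 finally show ?thesis by (simp add: step_def)
qed

lemma pr_zero: "pr 0[W] = 0[M]" by (rule additive_zero[OF W.M.ag M.ag]) (auto simp: pr_closed pr_add)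

lemma pr_row:
 assumes "p : P" "!!q. q : opp p ==> b q <: W" shows "pr (sm W (%q. g p q *:[W] b q) (opp p)) = sm M (%q. g p q *:[M] pr (b q)) (opp p)"
proof -
 have "pr (sm W (%q. g p q *:[W] b q) (opp p)) = sm M (%q. pr (g p q *:[W] b q)) (opp p)" using assms by (intro pr_finsum) auto
 also have "... = sm M (%q. g p q *:[M] pr (b q)) (opp p)" using assms pr_closed by (intro M.finsum_cong') (auto simp: pr_smult)
 finally show ?thesis .
qed

end

text \<open>\<open>pr\<close> maps \<open>Y (Suc n)\<close> isomorphically onto a complement, in
  \<open>Fil (Suc n)\<close>, of what \<open>Fil n\<close> generates there. \<open>W\<close> has no
  filtration of its own until \<open>Gam\<close> supplies one. The aim is that \<open>pr\<close> is
  injective on the submodule generated by all the \<open>Y n\<close>.\<close>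

locale lifting = good_module K L V P opp peer ob side nu g M Fil + leavitt_hom K L V P opp peer ob side nu g M W pr
 for K :: "'k ring" and L :: "('k, 'l) module" and V :: "'v set" and P :: "'p set"
 and opp peer ob side nu g and M :: "('l, 'm) module" and Fil and W :: "('l, 'w) module" and pr +
 fixes Y :: "nat => 'w set"
 assumes Y_subspace: "W.subspace (Y n)" and pr_Y: "y : Y n ==> pr y : Fil n"
 and span: "m : Fil (Suc n) ==> EX a b y. a : Fil n & into (Suc n) (Fil n) b & y : Y (Suc n) &
 m = a +[M] step (Suc n) b +[M] pr y"
 and indep: "[|a : Fil n; into (Suc n) (Fil n) b; y : Y (Suc n);
 a +[M] step (Suc n) b +[M] pr y = 0[M]|] ==> y = 0[W]"
begin

lemmas YD = W.subspaceD[OF Y_subspace]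

primrec Gam :: "nat => 'w set" where "Gam 0 = {0[W]}"
| "Gam (Suc n) = {a +[W] W.step (Suc n) b +[W] y | a b y. a : Gam n & W.into (Suc n) (Gam n) b & y : Y (Suc n)}"

lemma Gam_SucI: "[|a : Gam n; W.into (Suc n) (Gam n) b; y : Y (Suc n); x = a +[W] W.step (Suc n) b +[W] y|] ==> x : Gam (Suc n)" by auto

lemma Gam_subspace: "W.subspace (Gam n)"
proof (induction n)
 case 0
 thus ?case by (simp add: W.subspace_zero)
next
 case (Suc n)
 note D = W.subspaceD[OF Suc]
 have cl: "a <: W" "W.into (Suc n) (car W) b" "W.step (Suc n) b <: W" "y <: W"
 if "a : Gam n" "W.into (Suc n) (Gam n) b" "y : Y (Suc n)" for a b y
 using D(6)[OF that(1)] W.into_mono[OF that(2) D(1)] W.step_closed[OF W.into_mono[OF that(2) D(1)]]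
 YD(6)[OF that(3)] by auto
 have "Gam (Suc n) <= car W" using cl by auto
 moreover have "0[W] : Gam (Suc n)" unfolding Gam.simps using D(2) YD(2)
 by (intro CollectI exI[of _ "0[W]"] exI[of _ "%p q. 0[W]"]) (auto simp: W.step_zero W.into_def)
 moreover have "x +[W] x' : Gam (Suc n)" if x: "x : Gam (Suc n)" "x' : Gam (Suc n)" for x x' proof -
 obtain a b y where 1: "a : Gam n" "W.into (Suc n) (Gam n) b" "y : Y (Suc n)" "x = a +[W] W.step (Suc n) b +[W] y" using x(1) by auto
 obtain a' b' y' where 2: "a' : Gam n" "W.into (Suc n) (Gam n) b'" "y' : Y (Suc n)" "x' = a' +[W] W.step (Suc n) b' +[W] y'" using x(2) by auto
 note c = cl[OF 1(1-3)] cl[OF 2(1-3)]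
 have "x +[W] x' = (a +[W] a') +[W] (W.step (Suc n) b +[W] W.step (Suc n) b') +[W] (y +[W] y')" unfolding 1(4) 2(4) using c by (simp add: W.M.a_ac)
 also have "W.step (Suc n) b +[W] W.step (Suc n) b' = W.step (Suc n) (%p q. b p q +[W] b' p q)" using c by (simp add: W.step_add)
 finally have e: "x +[W] x' = (a +[W] a') +[W] W.step (Suc n) (%p q. b p q +[W] b' p q) +[W] (y +[W] y')" .
 have i: "W.into (Suc n) (Gam n) (%p q. b p q +[W] b' p q)" using 1(2) 2(2) D(3) unfolding W.into_def by blast
 show ?thesis by (rule Gam_SucI[OF D(3)[OF 1(1) 2(1)] i YD(3)[OF 1(3) 2(3)] e])
 qed
 moreover have "ka c *:[W] x : Gam (Suc n)" if x: "c <: K" "x : Gam (Suc n)" for c x proof -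
 obtain a b y where 1: "a : Gam n" "W.into (Suc n) (Gam n) b" "y : Y (Suc n)" "x = a +[W] W.step (Suc n) b +[W] y" using x(2) by auto
 note c = cl[OF 1(1-3)]
 have "ka c *:[W] x = ka c *:[W] a +[W] W.step (Suc n) (%p q. ka c *:[W] b p q) +[W] ka c *:[W] y"
 unfolding 1(4) using c x by (simp add: W.M.smult_r_distr W.ka_step)
 moreover have "W.into (Suc n) (Gam n) (%p q. ka c *:[W] b p q)" using 1(2) x D(4) unfolding W.into_def by blast
 ultimately show ?thesis using Gam_SucI D(4)[OF x(1) 1(1)] YD(4)[OF x(1) 1(3)] by blast
 qed
 moreover have "nu v *:[W] x : Gam (Suc n)" if x: "v : V" "x : Gam (Suc n)" for v x proof -
 obtain a b y where 1: "a : Gam n" "W.into (Suc n) (Gam n) b" "y : Y (Suc n)" "x = a +[W] W.step (Suc n) b +[W] y" using x(2) by auto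
 note c = cl[OF 1(1-3)]
 have "nu v *:[W] x = nu v *:[W] a +[W] W.step (Suc n) (%p q. if ob p = v then b p q else 0[W]) +[W] nu v *:[W] y"
 unfolding 1(4) using c x by (simp add: W.M.smult_r_distr W.nu_step)
 moreover have "W.into (Suc n) (Gam n) (%p q. if ob p = v then b p q else 0[W])" using 1(2) D(2) by (auto simp: W.into_def)
 ultimately show ?thesis using Gam_SucI D(5)[OF x(1) 1(1)] YD(5)[OF x(1) 1(3)] by blast
 qed
 ultimately show ?case unfolding W.subspace_def by blast
qed

lemmas GamD = W.subspaceD[OF Gam_subspace]

lemma Gam_mono: "Gam n <= Gam (Suc n)"
proof
 fix x assume x: "x : Gam n"
 have "x = x +[W] W.step (Suc n) (%p q. 0[W]) +[W] 0[W]" using GamD(6)[OF x] by (simp add: W.step_zero)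
 moreover have "W.into (Suc n) (Gam n) (%p q. 0[W])" using GamD(2) by (simp add: W.into_def)
 ultimately show "x : Gam (Suc n)" using Gam_SucI x YD(2) by blast
qed

lemma Gam_Y: assumes y: "y : Y (Suc n)" shows "y : Gam (Suc n)"
proof -
 have "y = 0[W] +[W] W.step (Suc n) (%p q. 0[W]) +[W] y" using YD(6)[OF y] by (simp add: W.step_zero)
 moreover have "W.into (Suc n) (Gam n) (%p q. 0[W])" using GamD(2) by (simp add: W.into_def)
 ultimately show ?thesis using Gam_SucI y GamD(2) by blast
qed

lemma Gam_step: assumes "x : Gam n" "p : level (Suc n)" "q : opp p" shows "g p q *:[W] x : Gam (Suc n)"
proof -
 let ?b = "%p' q'. if p' = p & q' = q then x else 0[W]"
 have x: "x <: W" by (rule GamD(6)[OF assms(1)])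
 have "g p q *:[W] x <: W" using W.g_act levelD(1)[OF assms(2)] assms(3) x by blast
 hence "g p q *:[W] x = 0[W] +[W] W.step (Suc n) ?b +[W] 0[W]" using W.single_step[OF assms(2,3) x] by simp
 moreover have "W.into (Suc n) (Gam n) ?b" using assms(1) GamD(2) by (simp add: W.into_def)
 ultimately show ?thesis using Gam_SucI YD(2) GamD(2) by blast
qed

text \<open>By induction on the level: \<open>span\<close> writes an element of the next level with
  coefficients from the previous one, and these have preimages by hypothesis.\<close>

lemma pr_Gam: "pr ` Gam n = Fil n"
proof (induction n)
 case 0
 thus ?case by (simp add: pr_zero Fil_0)
next
 case (Suc n)
 show ?case
 proof (intro equalityI subsetI)
 fix z assume "z : pr ` Gam (Suc n)"
 then obtain a b y where 1: "a : Gam n" "W.into (Suc n) (Gam n) b" "y : Y (Suc n)"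
 and z: "z = pr (a +[W] W.step (Suc n) b +[W] y)" by auto
 have c: "a <: W" "W.into (Suc n) (car W) b" "y <: W" using GamD(6)[OF 1(1)] W.into_mono[OF 1(2) GamD(1)] YD(6)[OF 1(3)] by auto
 have "pr a : Fil (Suc n)" "pr y : Fil (Suc n)" using 1 Suc Fil_mono pr_Y by blast+
 moreover have "step (Suc n) (%p q. pr (b p q)) : Fil (Suc n)" using 1(2) Suc by (intro step_mem[OF Fil_subspace] Fil_step) (auto simp: W.into_def)
 moreover have "z = pr a +[M] step (Suc n) (%p q. pr (b p q)) +[M] pr y" using z c W.step_closed by (simp add: pr_add pr_step)
 ultimately show "z : Fil (Suc n)" using FilD(3) by blast
 next
 fix x assume "x : Fil (Suc n)"
 then obtain a b y where 1: "a : Fil n" "into (Suc n) (Fil n) b" "y : Y (Suc n)" "x = a +[M] step (Suc n) b +[M] pr y" using span by blast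
 have "a : pr ` Gam n" using 1(1) Suc by simp
 then obtain a' where a': "a' : Gam n" "pr a' = a" by blast
 define b' where "b' p q = inv_into (Gam n) pr (b p q)" for p q
 have b': "b' p q : Gam n & pr (b' p q) = b p q" if "p : level (Suc n)" "q : opp p" for p q proof -
 have "b p q : pr ` Gam n" using 1(2) that unfolding Suc into_def by simp
 thus ?thesis unfolding b'_def by (simp add: inv_into_into f_inv_into_f)
 qed
 have i: "W.into (Suc n) (Gam n) b'" using b' by (simp add: W.into_def)
 have c: "a' <: W" "W.into (Suc n) (car W) b'" "y <: W" using GamD(6)[of a' n] a' W.into_mono[OF i GamD(1)] YD(6)[OF 1(3)] by auto
 have "step (Suc n) (%p q. pr (b' p q)) = step (Suc n) b" proof -
 have "into (Suc n) (car M) b" using 1(2) FilD(1) into_mono by blast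
 thus ?thesis unfolding step_def using b' row_closed by (intro M.finsum_cong') auto
 qed
 hence "x = pr (a' +[W] W.step (Suc n) b' +[W] y)" using 1(4) a' c W.step_closed by (simp add: pr_add pr_step)
 thus "x : pr ` Gam (Suc n)" using a' i 1(3) by auto
 qed
qed

text \<open>
 If \<open>a + \<Sum> g p q ** b p q\<close> is mapped to \<open>0\<close>, then the products of the rows of \<open>b\<close> with the matrices
 already lie two levels lower, and multiplying back with the inverse matrix shows that the sum
 itself lies one level lower.
\<close>

theorem pr_inj: "[|x : Gam n; pr x = 0[M]|] ==> x = 0[W]"
proof (induction n arbitrary: x)
 case 0
 thus ?case by simp
next
 case (Suc n)
 obtain a b y where 1: "a : Gam n" "W.into (Suc n) (Gam n) b" "y : Y (Suc n)"
 and x: "x = a +[W] W.step (Suc n) b +[W] y" using Suc.prems(1) by auto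
 have c: "a <: W" "W.into (Suc n) (car W) b" "y <: W" "W.step (Suc n) b <: W" using GamD(6)[OF 1(1)] W.into_mono[OF 1(2) GamD(1)] YD(6)[OF 1(3)]
 W.step_closed[OF W.into_mono[OF 1(2) GamD(1)]] by auto
 let ?b = "%p q. pr (b p q)"
 have Fb: "into (Suc n) (Fil n) ?b" using 1(2) unfolding pr_Gam[symmetric] by (simp add: into_def W.into_def)
 have Fa: "pr a : Fil n" using 1(1) unfolding pr_Gam[symmetric] by (rule imageI)
 have z: "pr a +[M] step (Suc n) ?b +[M] pr y = 0[M]" using Suc.prems(2) c unfolding x by (simp add: pr_add pr_step)
 have y0: "y = 0[W]" by (rule indep[OF Fa Fb 1(3) z])
 have x': "x = a +[W] W.step (Suc n) b" using x y0 c by simp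
 have z': "pr a +[M] step (Suc n) ?b = 0[M]" using Suc.prems(2) c unfolding x' by (simp add: pr_add pr_step)
 have "x : Gam n"
 proof (cases n)
 case 0
 \<comment> \<open>\<open>good\<close> speaks about two consecutive levels, so the lowest one is
   treated apart: here all coefficients lie in \<open>Gam 0\<close> and vanish.\<close>
 have "W.step (Suc n) b = 0[W]" proof -
 have "W.step (Suc n) b : {0[W]}" using 1(2) 0 by (intro W.step_mem[OF W.subspace_zero]) (auto simp: W.into_def levelD)
 thus ?thesis by simp
 qed
 thus ?thesis using x' c 1(1) by simp
 next
 case (Suc m)
 have "(sm M (%q. g p' q *:[M] ?b p q) (opp p)) : Fil m"
 if "p : level (Suc n)" "p' : peer p" for p p' using good[of "pr a" m ?b p p'] Fa Fb z' FilD(2) that Suc by simp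
 hence mem: "(sm M (%q. g p' q *:[M] ?b p q) (opp p)) : pr ` Gam m"
 if "p : level (Suc n)" "p' : peer p" for p p' unfolding pr_Gam using that by simp
 \<comment> \<open>Goodness puts these sums one level below the coefficients; \<open>yy\<close>
   collects preimages of them in \<open>Gam m\<close>.\<close>
 define yy where "yy p p' = inv_into (Gam m) pr (sm M (%q. g p' q *:[M] ?b p q) (opp p))" for p p'
 have yy: "yy p p' : Gam m & pr (yy p p') = sm M (%q. g p' q *:[M] ?b p q) (opp p)"
 if "p : level (Suc n)" "p' : peer p" for p p' unfolding yy_def using mem[OF that] by (simp add: inv_into_into f_inv_into_f)
 have row: "(sm W (%q. g p q *:[W] b p q) (opp p)) : Gam n" if p: "p : level (Suc n)" for p proof -
 note pP = levelD(1)[OF p]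
 have yyc: "yy p p' <: W" if "p' : peer p" for p' using yy[OF p that] GamD(6) by blast
 have bc: "b p q : Gam n" "b p q <: W" if "q : opp p" for q using 1(2) c(2) p that by (auto simp: W.into_def)
 \<comment> \<open>The vector \<open>b p\<close> is recovered from \<open>yy p\<close> by the
   inverse matrix. The identity holds after applying \<open>pr\<close>, and both sides lie in
   \<open>Gam n\<close>, where \<open>pr\<close> is injective by induction.\<close>
 have eq: "nu (ob q) *:[W] b p q = sm W (%p'. g q p' *:[W] yy p p') (peer p)" if q: "q : opp p" for q proof -
 note qP = opp_P[OF pP q] and qlev = level_opp[OF p q]
 let ?z = "sm W (%p'. g q p' *:[W] yy p p') (peer p)"
 have gy: "g q p' *:[W] yy p p' : Gam n" "g q p' *:[W] yy p p' <: W" if "p' : peer p" for p'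
 using Gam_step[of "yy p p'" m q p'] yy[OF p that] opp_mem[OF pP q that] qlev Suc
 GamD(6)[of "g q p' *:[W] yy p p'" n] by (simp_all del: Gam.simps)
 have zG: "?z : Gam n" using gy by (intro W.subspace_finsum[OF Gam_subspace])
 have nG: "nu (ob q) *:[W] b p q : Gam n" by (rule GamD(5)[OF ob_closed[OF qP] bc(1)[OF q]])
 have "pr ?z = sm M (%p'. pr (g q p' *:[W] yy p p')) (peer p)" using gy by (intro pr_finsum) auto
 also have "... = sm M (%p'. g q p' *:[M] sm M (%q'. g p' q' *:[M] ?b p q') (peer q)) (opp q)" unfolding opp_opp[OF pP q] peer_opp[OF pP q]
 proof (rule M.finsum_cong'[OF refl])
 fix p' assume p': "p' : peer p"
 have gq: "g q p' <: L" using g_closed[OF qP opp_mem[OF pP q p']] .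
 show "pr (g q p' *:[W] yy p p') = g q p' *:[M] sm M (%q'. g p' q' *:[M] ?b p q') (opp p)"
 using pr_smult[OF gq yyc[OF p']] yy[OF p p'] by simp
 next
 show "(%p'. g q p' *:[M] sm M (%q'. g p' q' *:[M] ?b p q') (opp p)) : peer p ->: M" using bc(2) pr_closed opp_peer[OF pP] peer_P[OF pP]
 by (auto intro!: g_act[OF qP] opp_mem[OF pP q])
 qed
 also have "... = nu (ob q) *:[M] ?b p q" using bc(2) pr_closed peer_opp[OF pP q] by (intro matrix_inverse[OF qP]) auto
 also have "... = pr (nu (ob q) *:[W] b p q)" using bc(2)[OF q] by (simp add: pr_smult ob_closed[OF qP])
 finally have pz: "pr ?z = pr (nu (ob q) *:[W] b p q)" .
 have cc: "?z <: W" "nu (ob q) *:[W] b p q <: W" using zG nG GamD(6) by blast+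
 have d: "nu (ob q) *:[W] b p q -[W] ?z : Gam n" unfolding a_minus_def by (rule GamD(3)[OF nG GamD(7)[OF zG]])
 have "pr (-[W] ?z) = -[M] pr ?z" by (rule additive_minus[OF W.M.ag M.ag]) (use cc pr_closed pr_add in auto)
 hence "pr (nu (ob q) *:[W] b p q -[W] ?z) = 0[M]" using cc pz by (simp add: a_minus_def pr_add pr_closed M.r_neg)
 hence "nu (ob q) *:[W] b p q -[W] ?z = 0[W]" by (rule Suc.IH[OF d])
 thus ?thesis using W.M.minus_eq_zero_iff[OF cc(2,1)] by simp
 qed
 have gn: "g p q *:[W] (nu (ob q) *:[W] b p q) = g p q *:[W] b p q" "g p q *:[W] b p q <: W"
 if q: "q : opp p" for q using W.M.smult_assoc[OF g_closed[OF pP q] nu_closed[OF ob_closed[OF opp_P[OF pP q]]] bc(2)[OF q]]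
 g_nu[OF pP q] W.g_act[OF pP q bc(2)[OF q]] by simp_all
 \<comment> \<open>Multiplying back with the original matrix collapses the whole row to the single
   element \<open>yy p p\<close>.\<close>
 have "sm W (%q. g p q *:[W] b p q) (opp p) = sm W (%q. g p q *:[W] (nu (ob q) *:[W] b p q)) (opp p)"
 using gn by (intro W.M.finsum_cong') auto
 also have "... = sm W (%q. g p q *:[W] sm W (%p'. g q p' *:[W] yy p p') (peer p)) (opp p)" using eq yyc opp_P[OF pP] opp_mem[OF pP]
 by (intro W.M.finsum_cong') (auto intro!: W.g_act[OF pP])
 also have "... = nu (ob p) *:[W] yy p p" by (rule W.matrix_inverse[OF pP yyc])
 also have "... : Gam n" using GamD(5)[OF ob_closed[OF pP]] yy[OF p peer_refl[OF pP]] Gam_mono Suc by blast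
 finally show ?thesis .
 qed
 have "W.step (Suc n) b : Gam n" unfolding W.step_def by (rule W.subspace_finsum[OF Gam_subspace row])
 thus ?thesis unfolding x' using 1(1) GamD(3) by blast
 qed
 thus ?case using Suc.IH Suc.prems(2) by blast
qed

lemma Gam_mono_le: "m <= n ==> Gam m <= Gam n" using Gam_mono by (rule lift_Suc_mono_le)

lemma act_Gam: assumes "l <: L" "x : (UN n. Gam n)" shows "l *:[W] x : (UN n. Gam n)"
proof (rule W.submodule_closed[OF _ _ _ _ _ _ assms])
 show "(UN n. Gam n) <= car W" using GamD(1) by blast
 show "0[W] : (UN n. Gam n)" using GamD(2) by blast
 show "x +[W] y : (UN n. Gam n)" if xy: "x : (UN n. Gam n)" "y : (UN n. Gam n)" for x y proof -
 obtain m n where "x : Gam m" "y : Gam n" using xy by blast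
 hence "x : Gam (max m n)" "y : Gam (max m n)" using Gam_mono_le max.cobounded1 max.cobounded2 by blast+
 thus ?thesis using GamD(3) by blast
 qed
 show "g p q *:[W] x : (UN n. Gam n)" if x: "p : P" "q : opp p" "x : (UN n. Gam n)" for p q x proof -
 obtain n where n: "x : Gam n" using x by blast
 \<comment> \<open>A letter on the wrong side for level \<open>n + 1\<close> has to wait one level,
   with \<open>x\<close> regarded as an element of \<open>Gam (Suc n)\<close>.\<close>
 show ?thesis
 proof (cases "side p = odd (Suc n)")
 case True
 thus ?thesis using Gam_step[OF n, of p q] x by (auto simp: level_def simp del: Gam.simps)
 next
 case False
 thus ?thesis using Gam_step[of x "Suc n" p q] Gam_mono[of n] n x by (auto simp: level_def simp del: Gam.simps)
 qed
 qed
 show "ka c *:[W] x : (UN n. Gam n)" if "c <: K" "x : (UN n. Gam n)" for c x using that GamD(4) by blast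
 show "nu v *:[W] x : (UN n. Gam n)" if "v : V" "x : (UN n. Gam n)" for v x using that GamD(5) by blast
qed

lemma pr_inj_Union: "[|x : (UN n. Gam n); pr x = 0[M]|] ==> x = 0[W]" using pr_inj by blast

end

section \<open>Normal forms\<close>

text \<open>
 In each row \<open>opp p\<close> one index is special. A word is in normal form if it has no factor
 \<open>g p q ** g q p'\<close> with \<open>q\<close> special; such a factor is rewritten using the relation
 \<open>\<Sum>q\<in>opp p. g p q ** g q p' = dlt\<close>.
\<close>

type_synonym ('a, 'b, 'c) fn = "('a \<times> 'a) list \<times> 'b => 'c"

locale normal_forms = cells V P opp peer ob side + K: field K
 for V :: "'v set" and P :: "'p set" and opp peer ob side and K :: "'k ring"
begin

definition star :: "'p set => 'p" where "star S = (SOME q. q : S)"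

text \<open>For \<open>q\<close> in the row \<open>opp p\<close>, the set \<open>peer q\<close> is
  this row, so whether \<open>q\<close> is special does not depend on \<open>p\<close>.\<close>

definition sp :: "'p => bool" where "sp q <-> q = star (peer q)"

lemma star_opp: "p : P ==> star (opp p) : opp p" unfolding star_def using opp_ne[of p] by (metis all_not_in_conv someI_ex)

lemma sp_iff: "[|p : P; q : opp p|] ==> sp q <-> q = star (opp p)" by (simp add: sp_def peer_opp)

lemma sp_peer: "[|p : P; p' : peer p; sp p; sp p'|] ==> p = p'" unfolding sp_def using peer_peer by metis

fun hob :: "('p \<times> 'p) list => 'v => 'v" where "hob [] v = v"
| "hob ((p, q) # w) v = ob p"

fun begins :: "('p \<times> 'p) list => 'p => bool" where "begins [] q = False"
| "begins ((p, q') # w) q = (p = q)"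

text \<open>The vertex \<open>v\<close> is where the word ends; it is kept with the word since the
  empty word consists of nothing else.\<close>

fun nrm :: "('p \<times> 'p) list => 'v => bool" where "nrm [] v = (v : V)"
| "nrm ((p, q) # w) v = (p : P & q : opp p & nrm w v & ob q = hob w v & ~ (sp q & begins w q))"

text \<open>The degree is the least level (with parity the side of the first letter) containing the word.\<close>

fun deg :: "('p \<times> 'p) list => nat" where "deg [] = 1"
| "deg ((p, q) # w) = (if side p = odd (Suc (deg w)) then Suc (deg w) else Suc (Suc (deg w)))"

definition act1 :: "'p => 'p => ('p, 'v, 'k) fn => ('p \<times> 'p) list => 'v => 'k" where
 "act1 p q f w v = (case w of (p1, q1) # w' => if p1 = p & q1 = q then f (w', v) else 0[K] | _ => 0[K])"

text \<open>The off-diagonal part of the rewriting rule for \<open>g p q ** g q p2\<close> with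
  \<open>q\<close> special: each other index \<open>q1\<close> of the row contributes
  \<open>g p q1 ** g q1 p2\<close> with a minus sign, so the word \<open>(q, p2) # w'\<close> feeds
  the words \<open>(p, q1) # (q1, p2) # w'\<close>.\<close>

definition act2 :: "'p => 'p => ('p, 'v, 'k) fn => ('p \<times> 'p) list => 'v => 'k" where "act2 p q f w v = (case w of (p1, q1) # (q2, p2) # w' =>
 if p1 = p & q2 = q1 & q1 ~= q & sp q then -[K] f ((q, p2) # w', v) else 0[K] | _ => 0[K])"

text \<open>The diagonal part of the same rule: rewriting \<open>g p q ** g q p\<close> in front of
  \<open>w\<close> produces \<open>w\<close> itself.\<close>

definition act3 :: "'p => 'p => ('p, 'v, 'k) fn => ('p \<times> 'p) list => 'v => 'k" where
 "act3 p q f w v = (if sp q & nrm ((q, p) # w) v then f ((q, p) # w, v) else 0[K])"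

text \<open>
 The coefficient of \<open>w\<close> in \<open>g p q ** f\<close>: either \<open>w\<close> arises by prepending \<open>g p q\<close>, or, if \<open>q\<close> is special,
 by rewriting a product \<open>g p q ** g q p2 ** w'\<close>.
\<close>

definition act :: "'p => 'p => ('p, 'v, 'k) fn => ('p, 'v, 'k) fn" where
 "act p q f = (%(w, v). if nrm w v then act1 p q f w v +[K] act2 p q f w v +[K] act3 p q f w v else 0[K])"

definition nact :: "'v => ('p, 'v, 'k) fn => ('p, 'v, 'k) fn" where "nact u f = (%(w, v). if nrm w v & hob w v = u then f (w, v) else 0[K])"

definition NF :: "nat => ('p, 'v, 'k) fn set" where "NF n = {f. (ALL x. f x <: K) & (ALL w v. f (w, v) ~= 0[K] --> nrm w v & deg w <= n)}"

definition NM :: "('k, ('p, 'v, 'k) fn) module" where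
 "NM = \<lparr>carrier = (UN n. NF n), monoid.mult = undefined, one = undefined, ring.zero = (%_. 0[K]),
 add = (%f h x. f x +[K] h x), smult = (%c f x. c *[K] f x)\<rparr>"

lemma NM_simps: "car NM = (UN n. NF n)" "0[NM] = (%_. 0[K])" "f +[NM] h = (%x. f x +[K] h x)"
 "c *:[NM] f = (%x. c *[K] f x)" by (simp_all add: NM_def)

lemma NF_D: "f : NF n ==> f x <: K" "[|f : NF n; ~ nrm w v|] ==> f (w, v) = 0[K]" "[|f : NF n; deg w > n|] ==> f (w, v) = 0[K]"
 unfolding NF_def by (blast, blast, metis (mono_tags, lifting) mem_Collect_eq leD)

lemma NF_I:
 assumes "!!x. f x <: K" "!!w v. ~ nrm w v ==> f (w, v) = 0[K]" "!!w v. [|nrm w v; deg w > n|] ==> f (w, v) = 0[K]" shows "f : NF n"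
proof -
 have "nrm w v & deg w <= n" if "f (w, v) ~= 0[K]" for w v using assms(2,3)[of w v] that by fastforce
 thus ?thesis using assms(1) by (simp add: NF_def)
qed

lemma NF_mono: "m <= n ==> NF m <= NF n" by (fastforce simp: NF_def)

lemma NM_values: "f <: NM ==> f x <: K" "[|f <: NM; ~ nrm w v|] ==> f (w, v) = 0[K]" by (auto simp: NM_simps NF_D)

lemma deg_pos: "deg w >= 1" by (cases w) auto

lemma deg_less: "deg w < deg (x # w)" by (cases x) auto

lemma deg_le: "[|deg w <= n; side p = odd (Suc n)|] ==> deg ((p, q) # w) <= Suc n" by (cases "deg w = n") auto

lemma deg_change: "side p = side p' ==> deg ((p, q) # w) = deg ((p', q') # w)" by simp

context
 fixes f :: "('p, 'v, 'k) fn" assumes f: "!!x. f x <: K"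
begin

lemma act_closed: "act1 p q f w v <: K" "act2 p q f w v <: K" "act3 p q f w v <: K" "act p q f x <: K"
proof -
 show 1: "act1 p q f w v <: K" for w v using f by (auto simp: act1_def split: list.splits)
 show 2: "act2 p q f w v <: K" for w v using f by (auto simp: act2_def split: list.splits)
 show 3: "act3 p q f w v <: K" for w v using f by (auto simp: act3_def)
 show "act p q f x <: K" using 1 2 3 by (auto simp: act_def split: prod.splits)
qed

lemma nact_closed: "nact u f x <: K" using f by (auto simp: nact_def split: prod.splits)

end

lemma act_add:
 assumes "!!x. f x <: K" "!!x. h x <: K" shows "act p q (%x. f x +[K] h x) = (%x. act p q f x +[K] act p q h x)"
proof
 fix x :: "('p \<times> 'p) list \<times> 'v"
 obtain w v where x: "x = (w, v)" by force
 have 1: "act1 p q (%x. f x +[K] h x) w v = act1 p q f w v +[K] act1 p q h w v" by (auto simp: act1_def split: list.splits)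
 have 2: "act2 p q (%x. f x +[K] h x) w v = act2 p q f w v +[K] act2 p q h w v" using assms by (auto simp: act2_def K.minus_add split: list.splits)
 have 3: "act3 p q (%x. f x +[K] h x) w v = act3 p q f w v +[K] act3 p q h w v" by (auto simp: act3_def)
 show "act p q (%x. f x +[K] h x) x = act p q f x +[K] act p q h x"
 unfolding x act_def using act_closed[OF assms(1)] act_closed[OF assms(2)] by (auto simp: 1 2 3 K.a_ac)
qed

lemma act_smult:
 assumes "!!x. f x <: K" "c <: K" shows "act p q (%x. c *[K] f x) = (%x. c *[K] act p q f x)"
proof
 fix x :: "('p \<times> 'p) list \<times> 'v"
 obtain w v where x: "x = (w, v)" by force
 have 1: "act1 p q (%x. c *[K] f x) w v = c *[K] act1 p q f w v" using assms by (auto simp: act1_def split: list.splits)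
 have 2: "act2 p q (%x. c *[K] f x) w v = c *[K] act2 p q f w v" using assms by (auto simp: act2_def K.r_minus split: list.splits)
 have 3: "act3 p q (%x. c *[K] f x) w v = c *[K] act3 p q f w v" using assms by (auto simp: act3_def)
 show "act p q (%x. c *[K] f x) x = c *[K] act p q f x" unfolding x act_def using act_closed[OF assms(1)] assms(2) by (auto simp: 1 2 3 K.r_distr)
qed

lemma nrm_opp:
 assumes "p : P" "q : opp p" shows "nrm ((q, p) # w) v <-> nrm w v & ob p = hob w v & ~ (sp p & begins w p)"
 using opp_P[OF assms] opp_sym[OF assms] by simp

lemma nrm_peer:
 assumes "p : P" "p' : peer p" shows "nrm ((p', q) # w) v <-> nrm ((p, q) # w) v" using assms peer_P[OF assms] opp_peer[OF assms] by simp

text \<open>Rewriting replaces an index by another one on the same side, so it raises the degree no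
  more than prepending does, and the diagonal term shortens the word.\<close>

lemma act_NF:
 assumes f: "f : NF n" and p: "p : P" "q : opp p" "side p = odd (Suc n)" shows "act p q f : NF (Suc n)"
proof (rule NF_I)
 note fK = NF_D(1)[OF f]
 show "act p q f x <: K" for x by (rule act_closed[OF fK])
 show "act p q f (w, v) = 0[K]" if "~ nrm w v" for w v using that by (simp add: act_def)
 fix w v assume w: "nrm w v" "Suc n < deg w"
 have "act1 p q f w v = 0[K]"
 proof (cases w)
 case (Cons x w')
 show ?thesis
 proof (cases "x = (p, q)")
 case True
 hence "deg w' > n" using w Cons p(3) deg_le[of w' n p q] by force
 thus ?thesis using Cons True NF_D(3)[OF f] by (simp add: act1_def)
 qed (auto simp: act1_def Cons split: prod.splits)
 qed (simp add: act1_def)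
 moreover have "act2 p q f w v = 0[K]"
 proof (cases "EX q1 p2 w'. w = (p, q1) # (q1, p2) # w'")
 case True
 then obtain q1 p2 w' where w': "w = (p, q1) # (q1, p2) # w'" by blast
 have "side q1 = side q" using w(1) p side_opp[OF p(1)] unfolding w' by simp
 hence "deg ((q1, p2) # w') = deg ((q, p2) # w')" by simp
 moreover have "deg ((q1, p2) # w') > n" using w(2) deg_le[of "(q1, p2) # w'" n p q1] p(3) unfolding w' by linarith
 ultimately have "f ((q, p2) # w', v) = 0[K]" using NF_D(3)[OF f] by simp
 thus ?thesis by (simp add: act2_def w')
 next
 case False
 thus ?thesis by (auto simp: act2_def split: list.splits)
 qed
 moreover have "act3 p q f w v = 0[K]" using NF_D(3)[OF f, of "(q, p) # w" v] w(2) by (simp add: act3_def)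
 ultimately show "act p q f (w, v) = 0[K]" by (simp add: act_def)
qed

lemma nact_NF: "f : NF n ==> nact u f : NF n" by (rule NF_I) (auto simp: nact_def NF_D)

lemma NF_subspace: "f : NF n ==> h : NF n ==> (%x. f x +[K] h x) : NF n"
 "[|c <: K; f : NF n|] ==> (%x. c *[K] f x) : NF n" "(%_. 0[K]) : NF n" by (rule NF_I; simp add: NF_D)+

text \<open>The value of \<open>g q p' ** f\<close> at a word beginning with \<open>g q p2\<close>, for \<open>q\<close> special.\<close>

definition top :: "'p => ('p, 'v, 'k) fn => 'p => ('p \<times> 'p) list => 'v => 'k" where
 "top p' f p2 w v = (if p2 = p' then f (w, v) else if sp p' then
 (case w of (p3, q3) # w3 => if p3 = p2 then -[K] f ((p', q3) # w3, v) else 0[K] | _ => 0[K]) else 0[K])"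

lemma top_closed: "(!!x. f x <: K) ==> top p' f p2 w v <: K" by (auto simp: top_def split: list.splits)

text \<open>Prepending and off-diagonal rewriting combine to \<open>top\<close>; the remaining
  summand is the diagonal term.\<close>

lemma act_top:
 assumes f: "!!x. f x <: K" and n: "nrm ((q, p2) # w) v" shows "act q p' f ((q, p2) # w, v) =
 top p' f p2 w v +[K] (if sp p' & nrm ((p', q) # (q, p2) # w) v then f ((p', q) # (q, p2) # w, v) else 0[K])"
proof -
 have "act1 q p' f ((q, p2) # w) v +[K] act2 q p' f ((q, p2) # w) v = top p' f p2 w v" using f by (cases w) (auto simp: act1_def act2_def top_def)
 thus ?thesis using n by (simp add: act_def act3_def)
qed

lemma sum_act1:
 assumes p: "p : P" and F: "!!q x. q : opp p ==> F q x <: K" and n: "nrm w v" shows "sm K (%q. act1 p q (F q) w v) (opp p) =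
 (case w of (p1, q1) # w' => if p1 = p then F q1 (w', v) else 0[K] | _ => 0[K])"
proof (cases "EX q1 w'. w = (p, q1) # w'")
 case True
 then obtain q1 w' where w: "w = (p, q1) # w'" by blast
 have "sm K (%q. act1 p q (F q) w v) (opp p) = act1 p q1 (F q1) w v"
 using n F finite_opp[OF p] unfolding w by (intro K.finsum_delta) (auto simp: act1_def)
 thus ?thesis by (simp add: w act1_def)
next
 case False
 hence "act1 p q (F q) w v = 0[K]" for q by (auto simp: act1_def split: list.splits)
 thus ?thesis using False by (auto split: list.splits)
qed

lemma sum_act2:
 assumes p: "p : P" and F: "!!q x. q : opp p ==> F q x <: K"
 shows "sm K (%q. act2 p q (F q) w v) (opp p) = act2 p (star (opp p)) (F (star (opp p))) w v"
proof (rule K.finsum_delta[OF finite_opp[OF p] star_opp[OF p]])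
 show "act2 p j (F j) w v = 0[K]" if "j : opp p" "j ~= star (opp p)" for j
 using sp_iff[OF p that(1)] that(2) by (auto simp: act2_def split: list.splits)
qed (rule act_closed[OF F[OF star_opp[OF p]]])

lemma sum_act3:
 assumes p: "p : P" and F: "!!q x. q : opp p ==> F q x <: K"
 shows "sm K (%q. act3 p q (F q) w v) (opp p) = act3 p (star (opp p)) (F (star (opp p))) w v"
proof (rule K.finsum_delta[OF finite_opp[OF p] star_opp[OF p]])
 show "act3 p j (F j) w v = 0[K]" if "j : opp p" "j ~= star (opp p)" for j using sp_iff[OF p that(1)] that(2) by (auto simp: act3_def)
qed (rule act_closed[OF F[OF star_opp[OF p]]])

text \<open>In a sum over a row, prepending singles out the index that is read off from
  \<open>w\<close>, while rewriting occurs for the special index only.\<close>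

lemma sum_act:
 assumes p: "p : P" and F: "!!q x. q : opp p ==> F q x <: K" and n: "nrm w v" shows "sm K (%q. act p q (F q) (w, v)) (opp p) =
 (case w of (p1, q1) # w' => if p1 = p then F q1 (w', v) else 0[K] | _ => 0[K]) +[K]
 act2 p (star (opp p)) (F (star (opp p))) w v +[K] act3 p (star (opp p)) (F (star (opp p))) w v"
proof -
 have "sm K (%q. act p q (F q) (w, v)) (opp p) = (sm K (%q. act1 p q (F q) w v +[K] act2 p q (F q) w v +[K] act3 p q (F q) w v) (opp p))"
 using n act_closed[OF F] by (intro K.finsum_cong') (auto simp: act_def)
 also have "... = sm K (%q. act1 p q (F q) w v) (opp p) +[K] sm K (%q. act2 p q (F q) w v) (opp p) +[K]
 (sm K (%q. act3 p q (F q) w v) (opp p))" using act_closed[OF F] by simp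
 finally show ?thesis using sum_act1[OF p F n] sum_act2[OF p F] sum_act3[OF p F] by simp
qed

text \<open>The inversion relation on normal forms. Words obtained by prepending
  \<open>g p q1\<close> cancel against the rewriting through the special index. What survives is the
  contribution \<open>A\<close>, present only for special \<open>p'\<close>, and the diagonal term
  \<open>B\<close>. For \<open>p = p'\<close> the two complement each other to \<open>f\<close>; for
  \<open>p \<noteq> p'\<close> they cancel, since at most one of two peers is special.\<close>

lemma act_act:
 assumes p: "p : P" "p' : peer p" and f: "!!x. f x <: K" and n: "nrm w v"
 shows "sm K (%q. act p q (act q p' f) (w, v)) (opp p) = (if p = p' then nact (ob p) f (w, v) else 0[K])" proof -
 let ?s = "star (opp p)"
 note s = star_opp[OF p(1)]
 have sps: "sp ?s" using sp_iff[OF p(1) s] by simp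
 have aK: "!!q x. act q p' f x <: K" by (rule act_closed[OF f])
 \<comment> \<open>There is no diagonal term here, because \<open>g p' ?s\<close> in front of a word
   beginning with the special index \<open>?s\<close> is not normal.\<close>
 have at_s: "act ?s p' f ((?s, p2) # w2, v) = top p' f p2 w2 v" if "nrm ((?s, p2) # w2) v" for p2 w2
 using act_top[OF f that] top_closed[OF f] sps by simp
 have A: "(case w of (p1, q1) # w' => if p1 = p then act q1 p' f (w', v) else 0[K] | _ => 0[K]) +[K]
 act2 p ?s (act ?s p' f) w v = (case w of (p1, q1) # w' => if p1 = p & sp p' then f ((p', q1) # w', v) else 0[K] | _ => 0[K])"
 proof (cases "EX q1 w'. w = (p, q1) # w'")
 case True
 then obtain q1 w' where w: "w = (p, q1) # w'" by blast
 have q1: "q1 : opp p" "nrm w' v" "nrm ((p', q1) # w') v" using n nrm_peer[OF p] unfolding w by auto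
 show ?thesis
 proof (cases "begins w' q1")
 case True
 then obtain p2 w2 where w': "w' = (q1, p2) # w2" by (cases w'; cases "hd w'") auto
 have ns: "~ sp q1" using n unfolding w w' by simp
 hence q1s: "q1 ~= ?s" using sps by auto
 have "nrm ((?s, p2) # w2) v" using q1(2) nrm_peer[OF opp_P[OF p(1) q1(1)], of ?s] s
 peer_opp[OF p(1) q1(1)] unfolding w' by blast
 hence "act2 p ?s (act ?s p' f) w v = -[K] top p' f p2 w2 v" using q1s sps by (simp add: act2_def w w' at_s)
 moreover have "act q1 p' f (w', v) = top p' f p2 w2 v +[K] (if sp p' then f ((p', q1) # w', v) else 0[K])"
 using act_top[of f q1 p2 w2 v p'] f q1 unfolding w' by auto
 ultimately show ?thesis using w top_closed[of f p' p2 w2 v] f by (auto simp: K.a_ac K.r_neg2)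
 next
 case False
 hence "act2 p ?s (act ?s p' f) w v = 0[K]" by (auto simp: act2_def w split: list.splits)
 moreover have "act1 q1 p' f w' v = 0[K]" "act2 q1 p' f w' v = 0[K]" using False by (auto simp: act1_def act2_def split: list.splits)
 ultimately show ?thesis using q1 f by (auto simp: w act_def act3_def)
 qed
 next
 case False
 thus ?thesis by (auto simp: act2_def split: list.splits)
 qed
 have B: "act3 p ?s (act ?s p' f) w v = (if nrm ((?s, p) # w) v then top p' f p w v else 0[K])" using sps at_s by (simp add: act3_def del: nrm.simps)
 have N: "nrm ((?s, p) # w) v <-> ob p = hob w v & ~ (sp p & begins w p)" using nrm_opp[OF p(1) s, of w v] n by simp
 have "sm K (%q. act p q (act q p' f) (w, v)) (opp p) =
 (case w of (p1, q1) # w' => if p1 = p & sp p' then f ((p', q1) # w', v) else 0[K] | _ => 0[K]) +[K]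
 (if ob p = hob w v & ~ (sp p & begins w p) then top p' f p w v else 0[K])" unfolding sum_act[OF p(1) aK n] A B N ..
 also have "... = (if p = p' then nact (ob p) f (w, v) else 0[K])"
 proof (cases "p = p'")
 case True
 thus ?thesis using n f by (cases w) (auto simp: top_def nact_def)
 next
 case False
 hence "~ (sp p & sp p')" using sp_peer p by blast
 thus ?thesis using False f by (cases w) (auto simp: top_def K.r_neg)
 qed
 finally show ?thesis .
qed

lemma nact_act: assumes "p : P" "q : opp p" "!!x. f x <: K" shows "nact (ob p) (act p q f) = act p q f"
proof -
 have "act p q f (w, v) = 0[K]" if "nrm w v" "hob w v ~= ob p" for w v proof -
 have "act1 p q f w v = 0[K]" "act2 p q f w v = 0[K]" "act3 p q f w v = 0[K]"
 using that by (auto simp: act1_def act2_def act3_def split: list.splits)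
 thus ?thesis by (simp add: act_def)
 qed
 thus ?thesis by (auto simp: nact_def act_def)
qed

lemma act_nact: assumes p: "p : P" "q : opp p" shows "act p q (nact (ob q) f) = act p q f"
proof -
 have "act1 p q (nact (ob q) f) w v = act1 p q f w v" "act2 p q (nact (ob q) f) w v = act2 p q f w v"
 "act3 p q (nact (ob q) f) w v = act3 p q f w v" if n: "nrm w v" for w v
 proof -
 show "act1 p q (nact (ob q) f) w v = act1 p q f w v" using n by (auto simp: act1_def nact_def split: list.splits)
 show "act2 p q (nact (ob q) f) w v = act2 p q f w v"
 proof (cases "EX q1 p2 w'. w = (p, q1) # (q1, p2) # w' & sp q")
 case True
 then obtain q1 p2 w' where w: "w = (p, q1) # (q1, p2) # w'" by blast
 have "q1 : opp p" "nrm ((q1, p2) # w') v" using n unfolding w by auto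
 hence "nrm ((q, p2) # w') v" using nrm_peer[OF opp_P[OF p(1)], of q1 q] p peer_opp[OF p(1)] by blast
 thus ?thesis unfolding w act2_def by (simp add: nact_def del: nrm.simps)
 next
 case False
 thus ?thesis by (auto simp: act2_def split: list.splits)
 qed
 show "act3 p q (nact (ob q) f) w v = act3 p q f w v" by (auto simp: act3_def nact_def)
 qed
 thus ?thesis by (auto simp: act_def)
qed

lemma nact_nact: "nact u (nact v f) = (if u = v then nact u f else (%_. 0[K]))" by (auto simp: nact_def)

lemma deg_parity: "odd (deg ((p, q) # w)) = side p" by auto

text \<open>At a word of degree above \<open>n + 1\<close> that begins with \<open>g p q\<close>,
  the hypothesis says that \<open>b p q\<close> cancels against the rewriting term, since rows with
  another first index contribute nothing. The same equation, with \<open>p'\<close> in place of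
  \<open>p\<close>, is what is claimed. Diagonal terms would involve coefficients of too high a
  degree and vanish.\<close>

lemma NF_good:
 assumes b: "!!p q. [|p : P; side p = odd (Suc (Suc n)); q : opp p|] ==> b p q : NF (Suc n)" and z: "!!w v. [|nrm w v; deg w > Suc n|] ==>
 (sm K (%p. sm K (%q. act p q (b p q) (w, v)) (opp p)) {p : P. side p = odd (Suc (Suc n))}) = 0[K]"
 and p: "p : P" "side p = odd (Suc (Suc n))" "p' : peer p" and w: "nrm w v" "deg w > n" shows "sm K (%q. act p' q (b p q) (w, v)) (opp p) = 0[K]"
proof -
 let ?lev = "{p : P. side p = odd (Suc (Suc n))}"
 let ?s = "star (opp p)"
 have bK: "b p q x <: K" if "p : P" "side p = odd (Suc (Suc n))" "q : opp p" for p q x using NF_D(1)[OF b[OF that]] .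
 note p'P = peer_P[OF p(1,3)]
 have a3: "act3 r (star (opp p)) (b p (star (opp p))) u v = 0[K]"
 if "p : P" "side p = odd (Suc (Suc n))" "deg u > n" for p r u using NF_D(3)[OF b[OF that(1,2) star_opp[OF that(1)]], of "(star (opp p), r) # u" v]
 that(3) by (simp add: act3_def)
 have key: "b p q (w', v) +[K] act2 p ?s (b p ?s) ((p, q) # w') v = 0[K]"
 if n: "nrm ((p, q) # w') v" "deg ((p, q) # w') > Suc n" for q w'
 proof -
 let ?w = "(p, q) # w'"
 have q: "q : opp p" using n by simp
 have "sm K (%r. sm K (%q. act r q (b r q) (?w, v)) (opp r)) ?lev = sm K (%q. act p q (b p q) (?w, v)) (opp p)"
 proof (rule K.finsum_delta)
 show "p : ?lev" using p by simp
 show "sm K (%q. act p q (b p q) (?w, v)) (opp p) <: K" using bK[OF p(1,2)] by (intro K.finsum_closed) (auto intro: act_closed)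
 fix r assume r: "r : ?lev" "r ~= p"
 have "sm K (%q. act r q (b r q) (?w, v)) (opp r) = (case ?w of (p1, q1) # w' => if p1 = r then b r q1 (w', v) else 0[K] | _ => 0[K]) +[K]
 act2 r (star (opp r)) (b r (star (opp r))) ?w v +[K] act3 r (star (opp r)) (b r (star (opp r))) ?w v" by (rule sum_act) (use r bK n in auto)
 also have "act3 r (star (opp r)) (b r (star (opp r))) ?w v = 0[K]" using r n(2) by (intro a3) auto
 also have "act2 r (star (opp r)) (b r (star (opp r))) ?w v = 0[K]" using r by (auto simp: act2_def split: list.splits)
 finally show "sm K (%q. act r q (b r q) (?w, v)) (opp r) = 0[K]" using r by simp
 qed (simp add: finite_P)
 also have "... = (case ?w of (p1, q1) # w' => if p1 = p then b p q1 (w', v) else 0[K] | _ => 0[K]) +[K]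
 act2 p ?s (b p ?s) ?w v +[K] act3 p ?s (b p ?s) ?w v" by (rule sum_act) (use p bK n in auto)
 also have "act3 p ?s (b p ?s) ?w v = 0[K]" using p n(2) by (intro a3) auto
 finally show ?thesis using z[OF n] bK[OF p(1,2) q] act_closed(2)[of "b p ?s"] bK[OF p(1,2) star_opp[OF p(1)]] by simp
 qed
 have "sm K (%q. act p' q (b p q) (w, v)) (opp p') = (case w of (p1, q1) # w' => if p1 = p' then b p q1 (w', v) else 0[K] | _ => 0[K]) +[K]
 act2 p' (star (opp p')) (b p (star (opp p'))) w v +[K] act3 p' (star (opp p')) (b p (star (opp p'))) w v"
 by (rule sum_act[OF p'P _ w(1)]) (use bK[OF p(1,2)] opp_peer[OF p(1,3)] in auto)
 also have "act3 p' (star (opp p')) (b p (star (opp p'))) w v = 0[K]" unfolding opp_peer[OF p(1,3)] using p w(2) by (intro a3) auto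
 finally have e: "sm K (%q. act p' q (b p q) (w, v)) (opp p) =
 (case w of (p1, q1) # w' => if p1 = p' then b p q1 (w', v) else 0[K] | _ => 0[K]) +[K]
 act2 p' ?s (b p ?s) w v +[K] 0[K]" unfolding opp_peer[OF p(1,3)] .
 show ?thesis
 proof (cases "EX q w'. w = (p', q) # w'")
 case True
 then obtain q w' where w': "w = (p', q) # w'" by blast
 have n: "nrm ((p, q) # w') v" using w(1) nrm_peer[OF p(1,3)] unfolding w' by blast
 have q: "q : opp p" using n by simp
 have d: "deg ((p, q) # w') = deg w" unfolding w' by (rule deg_change) (simp add: side_peer[OF p(1,3)])
 \<comment> \<open>Only \<open>deg w > n\<close> is known, but a word beginning on the side of level
   \<open>n + 2\<close> has a degree of this parity, which excludes \<open>n + 1\<close>.\<close>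
 have "deg ((p, q) # w') > Suc n" using deg_parity[of p q w'] d w(2) p(2) by (cases "deg w = Suc n") auto
 hence "b p q (w', v) +[K] act2 p ?s (b p ?s) ((p, q) # w') v = 0[K]" by (rule key[OF n])
 moreover have "act2 p ?s (b p ?s) ((p, q) # w') v = act2 p' ?s (b p ?s) w v" unfolding w' by (auto simp: act2_def split: list.splits)
 ultimately show ?thesis unfolding e by (simp add: w')
 next
 case False
 hence "act2 p' ?s (b p ?s) w v = 0[K]" by (auto simp: act2_def split: list.splits)
 thus ?thesis unfolding e using False by (auto split: list.splits)
 qed
qed

text \<open>Every function is, modulo lower degree, of the form \<open>\<Sum> g p q ** b p q\<close>, with \<open>b p q\<close> read off from its
 coefficients at the words beginning with \<open>g p q\<close>.\<close>

lemma NF_span: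
 assumes f: "f : NF (Suc n)" and n: "n > 0" shows "EX b. (ALL p q. p : P --> side p = odd (Suc n) --> q : opp p --> b p q : NF n) &
 (ALL w v. nrm w v --> deg w > n -->
 f (w, v) = sm K (%p. sm K (%q. act p q (b p q) (w, v)) (opp p)) {p : P. side p = odd (Suc n)})"
proof -
 let ?lev = "{p : P. side p = odd (Suc n)}"
 define b where "b p q = (%(w', v). if nrm ((p, q) # w') v then f ((p, q) # w', v) else 0[K])" for p q
 have bN: "b p q : NF n" for p q
 proof (rule NF_I)
 show "b p q x <: K" for x using NF_D(1)[OF f] by (auto simp: b_def split: prod.splits)
 show "b p q (w, v) = 0[K]" if "~ nrm w v" for w v using that by (simp add: b_def)
 show "b p q (w, v) = 0[K]" if "n < deg w" for w v using NF_D(3)[OF f, of "(p, q) # w" v] that by (simp add: b_def)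
 qed
 have bK: "b p q x <: K" for p q x using NF_D(1)[OF bN] .
 have "f (w, v) = sm K (%p. sm K (%q. act p q (b p q) (w, v)) (opp p)) ?lev"
 if w: "nrm w v" "deg w > n" for w v
 proof -
 have in1: "sm K (%q. act p q (b p q) (w, v)) (opp p) =
 (case w of (p1, q1) # w' => if p1 = p then b p q1 (w', v) else 0[K] | _ => 0[K])" if p: "p : ?lev" for p
 proof -
 let ?s = "star (opp p)"
 have pP: "p : P" using p by simp
 have "sm K (%q. act p q (b p q) (w, v)) (opp p) = (case w of (p1, q1) # w' => if p1 = p then b p q1 (w', v) else 0[K] | _ => 0[K]) +[K]
 act2 p ?s (b p ?s) w v +[K] act3 p ?s (b p ?s) w v" by (rule sum_act) (use pP bK w in auto)
 \<comment> \<open>No rewriting takes place: \<open>b p ?s\<close> is zero at every word in front of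
   which \<open>g p ?s\<close> would not be normal.\<close>
 also have "act2 p ?s (b p ?s) w v = 0[K]" by (auto simp: act2_def b_def split: list.splits)
 also have "act3 p ?s (b p ?s) w v = 0[K]" using NF_D(3)[OF bN[of p ?s], of "(?s, p) # w" v] w(2) by (simp add: act3_def)
 finally show ?thesis using bK by (auto split: list.splits)
 qed
 have "w ~= []" using w(2) n by auto
 then obtain p q w' where w': "w = (p, q) # w'" by (cases w) auto
 have "deg w = Suc n | f (w, v) = 0[K]" using NF_D(3)[OF f, of w v] w(2) by linarith
 have pP: "p : P" using w(1) w' by simp
 show ?thesis
 proof (cases "p : ?lev")
 case True
 have "sm K (%r. sm K (%q. act r q (b r q) (w, v)) (opp r)) ?lev = sm K (%q. act p q (b p q) (w, v)) (opp p)"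
 using True bK in1 finite_P by (intro K.finsum_delta) (auto simp: w')
 thus ?thesis using in1[OF True] w(1) by (simp add: w' b_def del: nrm.simps)
 next
 case False
 hence "deg w ~= Suc n" using pP w' by auto
 hence "f (w, v) = 0[K]" using `deg w = Suc n | _` by simp
 moreover have "sm K (%r. sm K (%q. act r q (b r q) (w, v)) (opp r)) ?lev = 0[K]"
 proof (rule K.add.finprod_one_eqI)
 fix r assume r: "r : ?lev"
 hence "r ~= p" using False by blast
 thus "sm K (%q. act r q (b r q) (w, v)) (opp r) = 0[K]" using in1[OF r] by (simp add: w')
 qed
 ultimately show ?thesis by simp
 qed
 qed
 thus ?thesis using bN by blast
qed

end

section \<open>Endomorphism algebras, representations and pulled back filtrations\<close>

definition end_algebra :: "'k ring => ('k, 'm) module => ('k, 'm => 'm) module" where "end_algebra K M =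
 \<lparr>carrier = {h : car M \<rightarrow>\<^sub>E car M. (ALL x:car M. ALL y:car M. h (x +[M] y) = h x +[M] h y) &
 (ALL c:car K. ALL x:car M. h (c *:[M] x) = c *:[M] h x)},
 monoid.mult = (%h h'. \<lambda>x\<in>car M. h (h' x)),
 one = (\<lambda>x\<in>car M. x),
 ring.zero = (\<lambda>x\<in>car M. 0[M]),
 add = (%h h'. \<lambda>x\<in>car M. h x +[M] h' x),
 smult = (%c h. \<lambda>x\<in>car M. c *:[M] h x)\<rparr>"

lemma end_simps: "h <: (end_algebra K M) <-> h : car M \<rightarrow>\<^sub>E car M &
 (ALL x:car M. ALL y:car M. h (x +[M] y) = h x +[M] h y) & (ALL c:car K. ALL x:car M. h (c *:[M] x) = c *:[M] h x)"
 "h *[end_algebra K M] h' = (\<lambda>x\<in>car M. h (h' x))"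
 "1[end_algebra K M] = (\<lambda>x\<in>car M. x)" "0[end_algebra K M] = (\<lambda>x\<in>car M. 0[M])"
 "h +[end_algebra K M] h' = (\<lambda>x\<in>car M. h x +[M] h' x)"
 "c *:[end_algebra K M] h = (\<lambda>x\<in>car M. c *:[M] h x)" by (simp_all add: end_algebra_def)

lemma end_unital:
 assumes "field K" "module K M" shows "ualg K (end_algebra K M)"
proof -
 interpret K: field K by fact
 interpret M: module K M by fact
 let ?E = "end_algebra K M"
 have ext: "h = h'" if "h : car M \<rightarrow>\<^sub>E car M" "h' : car M \<rightarrow>\<^sub>E car M" "!!x. x <: M ==> h x = h' x" for h h'
 using that by (intro extensionalityI[of h "car M" h']) (auto simp: PiE_def)
 have hc: "h x <: M" if "h <: ?E" "x <: M" for h x using that by (auto simp: end_simps)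
 have ha: "h (x +[M] y) = h x +[M] h y" if "h <: ?E" "x <: M" "y <: M" for h x y using that by (auto simp: end_simps)
 have hs: "h (c *:[M] x) = c *:[M] h x" if "h <: ?E" "c <: K" "x <: M" for h c x using that by (auto simp: end_simps)
 have hE: "h = (\<lambda>x\<in>car M. h x)" if "h <: ?E" for h using that by (auto simp: end_simps PiE_def extensional_def)
 have ag: "abelian_group ?E"
 proof (rule abelian_groupI)
 fix h assume h: "h <: ?E"
 have "(\<lambda>x\<in>car M. -[M] h x) <: ?E" using h hc by (auto simp: end_simps M.minus_add M.smult_r_minus)
 moreover have "(\<lambda>x\<in>car M. -[M] h x) +[?E] h = 0[?E]" using h hc by (auto simp: end_simps M.l_neg)
 ultimately show "EX y:car ?E. y +[?E] h = 0[?E]" by blast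
 next
 fix h h' assume h: "h <: ?E" "h' <: ?E"
 show "h +[?E] h' <: ?E" using hc[OF h(1)] hc[OF h(2)] ha[OF h(1)] ha[OF h(2)] hs[OF h(1)] hs[OF h(2)]
 by (auto simp: end_simps(1,5) M.a_ac M.smult_r_distr)
 show "h +[?E] h' = h' +[?E] h" using h hc by (auto simp: end_simps(5) M.a_ac)
 next
 fix h h' k assume h: "h <: ?E" "h' <: ?E" "k <: ?E"
 show "h +[?E] h' +[?E] k = h +[?E] (h' +[?E] k)" using h hc by (auto simp: end_simps(5) M.a_ac)
 next
 show "0[?E] <: ?E" by (auto simp: end_simps)
 fix h assume h: "h <: ?E"
 show "0[?E] +[?E] h = h" by (subst (2) hE[OF h]) (use h hc in "auto simp: end_simps(4,5)")
 qed
 have "module K ?E"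
 proof (rule moduleI[OF K.is_cring ag])
 fix c h assume c: "c <: K" "h <: ?E"
 show "c *:[?E] h <: ?E" using hc[OF c(2)] ha[OF c(2)] hs[OF c(2)] c(1)
 by (auto simp: end_simps(1,6) M.smult_r_distr K.m_comm simp flip: M.smult_assoc1)
 next
 fix h assume h: "h <: ?E"
 show "1[K] *:[?E] h = h" by (subst (2) hE[OF h]) (use h hc in "auto simp: end_simps(6)")
 next
 fix c d h assume "c <: K" "d <: K" "h <: ?E"
 thus "(c +[K] d) *:[?E] h = c *:[?E] h +[?E] d *:[?E] h" "(c *[K] d) *:[?E] h = c *:[?E] (d *:[?E] h)"
 using hc by (auto simp: end_simps(5,6) M.smult_l_distr M.smult_assoc1)
 next
 fix c h h' assume "c <: K" "h <: ?E" "h' <: ?E"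
 thus "c *:[?E] (h +[?E] h') = c *:[?E] h +[?E] c *:[?E] h'" using hc by (auto simp: end_simps(5,6) M.smult_r_distr)
 qed
 moreover have "ring ?E"
 proof (rule ringI[OF ag])
 show "Group.monoid ?E"
 proof (rule monoidI)
 fix h h' assume h: "h <: ?E" "h' <: ?E"
 show "h *[?E] h' <: ?E" using hc[OF h(1)] hc[OF h(2)] ha[OF h(1)] ha[OF h(2)] hs[OF h(1)] hs[OF h(2)] by (auto simp: end_simps(1,2))
 next
 show "1[?E] <: ?E" by (auto simp: end_simps)
 next
 fix h h' k assume "h <: ?E" "h' <: ?E" "k <: ?E"
 thus "h *[?E] h' *[?E] k = h *[?E] (h' *[?E] k)" using hc by (auto simp: end_simps(2))
 next
 fix h assume h: "h <: ?E"
 show "1[?E] *[?E] h = h" by (subst (2) hE[OF h]) (use h hc in "auto simp: end_simps(2,3)")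
 show "h *[?E] 1[?E] = h" by (subst (2) hE[OF h]) (use h hc in "auto simp: end_simps(2,3)")
 qed
 next
 fix h h' k assume "h <: ?E" "h' <: ?E" "k <: ?E"
 thus "(h +[?E] h') *[?E] k = h *[?E] k +[?E] h' *[?E] k"
 "k *[?E] (h +[?E] h') = k *[?E] h +[?E] k *[?E] h'" using hc ha by (auto simp: end_simps(2,5))
 qed
 ultimately show ?thesis unfolding unital_algebra_def unital_algebra_axioms_def using K.field_axioms hc hs by (auto simp: end_simps(2,6))
qed

lemma end_finsum:
 assumes "field K" "module K M" "f : A ->: (end_algebra K M)" "x <: M" shows "sm (end_algebra K M) f A x = sm M (%i. f i x) A"
proof -
 interpret E: unital_algebra K "end_algebra K M" by (rule end_unital[OF assms(1,2)])
 interpret M: module K M by fact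
 show ?thesis by (rule add_finsum[OF E.M.ag M.ag, of "%h. h x"]) (use assms in "auto simp: end_simps")
qed

definition rep_mod :: "('k, 'm) module => ('l => 'm => 'm) => ('l, 'm) module" where
 "rep_mod M h = \<lparr>carrier = car M, monoid.mult = undefined, one = undefined,
 ring.zero = 0[M], add = (\<oplus>\<^bsub>M\<^esub>), smult = h\<rparr>"

lemma rep_mod_simps: "car (rep_mod M h) = car M" "0[rep_mod M h] = 0[M]"
 "x +[rep_mod M h] y = x +[M] y" "l *:[rep_mod M h] x = h l x" by (simp_all add: rep_mod_def)

lemma abelian_group_rep_mod: "abelian_group M ==> abelian_group (rep_mod M h)"
proof -
 assume "abelian_group M"
 then interpret M: abelian_group M .
 show ?thesis by (rule abelian_groupI) (auto simp: rep_mod_simps M.a_ac)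
qed

lemma left_module_rep:
 assumes K: "field K" "module K M" "ring L" and h: "alg_map K L (end_algebra K M) h" "!!x. x <: M ==> h 1[L] x = x"
 shows "lmod L (rep_mod M h)" proof -
 interpret M: module K M by fact
 interpret L: ring L by fact
 have hc: "h l x <: M" if "l <: L" "x <: M" for l x using alg_mapD(1)[OF h(1) that(1)] that(2) by (auto simp: end_simps)
 show ?thesis unfolding left_module_def left_module_axioms_def using alg_mapD[OF h(1)] h(2) hc
 by (auto simp: rep_mod_simps end_simps abelian_group_rep_mod M.ag L.ring_axioms)
qed

definition rmod :: "('a, 'r) ring_scheme => ('a, 'a) module" where
 "rmod R = \<lparr>carrier = car R, monoid.mult = undefined, one = undefined,
 ring.zero = 0[R], add = (\<oplus>\<^bsub>R\<^esub>), smult = (\<otimes>\<^bsub>R\<^esub>)\<rparr>"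

lemma rmod_simps: "car (rmod R) = car R" "0[rmod R] = 0[R]"
 "x +[rmod R] y = x +[R] y" "l *:[rmod R] x = l *[R] x" by (simp_all add: rmod_def)

lemma left_module_regular: assumes "ring R" shows "lmod R (rmod R)"
proof -
 interpret R: ring R by fact
 have "abelian_group (rmod R)" by (rule abelian_groupI) (auto simp: rmod_simps R.a_ac)
 thus ?thesis unfolding left_module_def left_module_axioms_def by (auto simp: rmod_simps assms R.l_distr R.r_distr R.m_assoc)
qed

text \<open>Every condition can be tested through the maps \<open>h i\<close>, as they commute with
  \<open>step\<close>. Joint injectivity makes level zero trivial, and the finiteness of
  \<open>I\<close> bounds the levels of all \<open>h i x\<close> at once. This is how goodness
  reaches submodules of finite powers.\<close>

lemma good_pullback:
 fixes M :: "('l, 'm) module" and N :: "('l, 'n) module" and opp peer ob side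
 assumes M: "good_module K L V P opp peer ob side nu g M Fil" and N: "lv_module K L V P opp peer ob side nu g N" and I: "finite I"
 and h: "!!i x. [|i : I; x <: N|] ==> h i x <: M" "!!i x y. [|i : I; x <: N; y <: N|] ==> h i (x +[N] y) = h i x +[M] h i y"
 "!!i l x. [|i : I; l <: L; x <: N|] ==> h i (l *:[N] x) = l *:[M] h i x"
 and inj: "!!x. [|x <: N; !!i. i : I ==> h i x = 0[M]|] ==> x = 0[N]"
 shows "good_module K L V P opp peer ob side nu g N (%n. {x : car N. ALL i:I. h i x : Fil n})" proof -
 interpret M: good_module K L V P opp peer ob side nu g M Fil by fact
 interpret N: lv_module K L V P opp peer ob side nu g N by fact
 have hom: "leavitt_hom K L V P opp peer ob side nu g M N (h i)" if "i : I" for i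
 by (intro leavitt_hom.intro leavitt_hom_axioms.intro M.lv_module_axioms N) (use h that in auto)
 let ?F = "%n. {x : car N. ALL i:I. h i x : Fil n}"
 have h0: "h i 0[N] = 0[M]" if "i : I" for i by (rule leavitt_hom.pr_zero[OF hom[OF that]])
 show ?thesis
 proof (intro good_module.intro[OF N] good_module_axioms.intro)
 show "N.subspace (?F n)" for n unfolding N.subspace_def using h h0 M.FilD(2-5) by auto
 show "?F 0 = {0[N]}" using inj h0 by (auto simp: M.Fil_0)
 show "?F n <= ?F (Suc n)" for n using M.Fil_mono[of n] by auto
 show "g p q *:[N] x : ?F (Suc n)" if "x : ?F n" "p : M.level (Suc n)" "q : opp p" for x n p q
 using that M.Fil_step[of _ n p q] h(3)[OF _ M.g_closed] M.levelD(1)[OF that(2)] by auto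
 show "EX n. x : ?F n" if x: "x <: N" for x proof -
 have "ALL i:I. EX n. h i x : Fil n" using M.Fil_ex h(1) x by blast
 then obtain m where m: "!!i. i : I ==> h i x : Fil (m i)" by metis
 define k where "k = Max (insert 0 (m ` I))"
 have "h i x : Fil k" if "i : I" for i using m[OF that] M.Fil_mono_le[of "m i" k] I that by (auto simp: k_def)
 thus ?thesis using x by blast
 qed
 next
 fix a n b p p'
 assume a: "a : ?F (Suc n)" and b: "N.into (Suc (Suc n)) (?F (Suc n)) b"
 and s: "a +[N] N.step (Suc (Suc n)) b : ?F n" and p: "p : M.level (Suc (Suc n))" "p' : peer p"
 have bc: "N.into (Suc (Suc n)) (car N) b" by (rule N.into_mono[OF b]) auto
 have bp: "b p q <: N" if "q : opp p" for q using bc p(1) that by (auto simp: N.into_def)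
 have op: "opp p' = opp p" by (rule M.opp_peer[OF M.levelD(1)[OF p(1)] p(2)])
 have p'P: "p' : P" by (rule M.peer_P[OF M.levelD(1)[OF p(1)] p(2)])
 have "h i (sm N (%q. g p' q *:[N] b p q) (opp p)) : Fil n" if i: "i : I" for i proof -
 interpret h: leavitt_hom K L V P opp peer ob side nu g M N "h i" by (rule hom[OF i])
 have "(sm M (%q. g p' q *:[M] h i (b p q)) (opp p)) : Fil n"
 proof (rule M.good[OF _ _ _ p])
 show "h i a : Fil (Suc n)" using a i by blast
 show "M.into (Suc (Suc n)) (Fil (Suc n)) (%p q. h i (b p q))" using b i by (auto simp: M.into_def N.into_def)
 show "h i a +[M] M.step (Suc (Suc n)) (%p q. h i (b p q)) : Fil n"
 using s i a N.step_closed[OF bc] by (auto simp: h.pr_add simp flip: h.pr_step[OF bc])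
 qed
 thus ?thesis using h.pr_row[OF p'P, of "b p"] bp unfolding op by simp
 qed
 moreover have "sm N (%q. g p' q *:[N] b p q) (opp p) <: N" using bp N.g_act[OF p'P] op by (intro N.M.finsum_closed) auto
 ultimately show "(sm N (%q. g p' q *:[N] b p q) (opp p)) : ?F n" by blast
 qed
qed

section \<open>The action of the algebra on normal forms\<close>

context normal_forms
begin

lemma carrier_NM_I: "f : NF n ==> f <: NM" by (auto simp: NM_simps)

lemma abelian_group_NM: "abelian_group NM"
proof (rule abelian_groupI)
 fix f h assume fh: "f <: NM" "h <: NM"
 then obtain m n where "f : NF m" "h : NF n" by (auto simp: NM_simps)
 hence "f : NF (max m n)" "h : NF (max m n)" using NF_mono[of m "max m n"] NF_mono[of n "max m n"] by auto
 from NF_subspace(1)[OF this] show "f +[NM] h <: NM" unfolding NM_simps(3) by (rule carrier_NM_I)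
 show "f +[NM] h = h +[NM] f" using fh NM_values by (simp add: NM_simps(3) K.a_ac)
next
 fix f h k assume "f <: NM" "h <: NM" "k <: NM"
 thus "f +[NM] h +[NM] k = f +[NM] (h +[NM] k)" using NM_values by (simp add: NM_simps(3) K.a_ac)
next
 show "0[NM] <: NM" unfolding NM_simps(2) by (rule carrier_NM_I[OF NF_subspace(3)])
 fix f assume f: "f <: NM"
 show "0[NM] +[NM] f = f" using f NM_values by (simp add: NM_simps(2,3))
 obtain n where n: "f : NF n" using f by (auto simp: NM_simps)
 have "(%x. (-[K] 1[K]) *[K] f x) : NF n" by (rule NF_subspace(2)[OF _ n]) simp
 hence "(%x. (-[K] 1[K]) *[K] f x) <: NM" by (rule carrier_NM_I)
 moreover have "(%x. (-[K] 1[K]) *[K] f x) +[NM] f = 0[NM]" using f NM_values by (simp add: NM_simps(2,3) K.l_minus K.l_neg)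
 ultimately show "EX h:car NM. h +[NM] f = 0[NM]" by blast
qed

lemma module_NM: "module K NM"
proof (rule moduleI[OF K.is_cring abelian_group_NM])
 fix c f assume cf: "c <: K" "f <: NM"
 then obtain n where n: "f : NF n" by (auto simp: NM_simps)
 show "c *:[NM] f <: NM" unfolding NM_simps(4) by (rule carrier_NM_I[OF NF_subspace(2)[OF cf(1) n]])
qed (use NM_values in "simp_all add: NM_simps(3,4) K.l_distr K.r_distr K.m_assoc")

lemma NM_finsum:
 assumes "f : A ->: NM" shows "sm NM f A x = sm K (%i. f i x) A" by (rule add_finsum[OF abelian_group_NM K.ag, of "%h. h x"])
 (use assms NM_values in "auto simp: NM_simps(3)")

lemma act_NM: assumes "p : P" "q : opp p" "f <: NM" shows "act p q f <: NM"
proof -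
 obtain n where n: "f : NF n" using assms by (auto simp: NM_simps)
 show ?thesis
 proof (cases "side p = odd (Suc n)")
 case True
 show ?thesis by (rule carrier_NM_I[OF act_NF[OF n assms(1,2) True]])
 next
 case False
 have "f : NF (Suc n)" using n NF_mono[of n "Suc n"] by auto
 thus ?thesis using False by (intro carrier_NM_I[OF act_NF[OF _ assms(1,2)]]) auto
 qed
qed

lemma nact_NM: "f <: NM ==> nact u f <: NM" using nact_NF by (fastforce simp: NM_simps(1))

definition Eg where "Eg p q = (\<lambda>f\<in>car NM. act p q f)"
definition En where "En u = (\<lambda>f\<in>car NM. nact u f)"

lemma Eg_closed: assumes pq: "p : P" "q : opp p" shows "Eg p q <: (end_algebra K NM)"
proof -
 interpret NM: module K NM by (rule module_NM)
 have "act p q (f +[NM] h) = act p q f +[NM] act p q h" if "f <: NM" "h <: NM" for f h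
 unfolding NM_simps(3) by (rule act_add) (use that NM_values in auto)
 moreover have "act p q (c *:[NM] f) = c *:[NM] act p q f" if "c <: K" "f <: NM" for c f
 unfolding NM_simps(4) by (rule act_smult) (use that NM_values in auto)
 ultimately show ?thesis using act_NM[OF pq] by (auto simp: end_simps(1) Eg_def)
qed

lemma En_closed: "En u <: (end_algebra K NM)"
proof -
 interpret NM: module K NM by (rule module_NM)
 have "nact u (f +[NM] h) = nact u f +[NM] nact u h" if "f <: NM" "h <: NM" for f h unfolding NM_simps(3) by (auto simp: nact_def)
 moreover have "nact u (c *:[NM] f) = c *:[NM] nact u f" if "c <: K" "f <: NM" for c f unfolding NM_simps(4) using that by (auto simp: nact_def)
 ultimately show ?thesis using nact_NM by (auto simp: end_simps(1) En_def)
qed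

text \<open>The input for the universal property, through which \<open>L\<close> acts on normal
  forms.\<close>

lemma cell_family_End: "cell_family V P opp peer ob side (end_algebra K NM) En Eg"
proof -
 let ?E = "end_algebra K NM"
 interpret NM: module K NM by (rule module_NM)
 interpret E: unital_algebra K ?E by (rule end_unital[OF K.field_axioms module_NM])
 have ext: "h = h'" if "h <: ?E" "h' <: ?E" "!!f. f <: NM ==> h f = h' f" for h h'
 using that by (intro extensionalityI[of h "car NM" h']) (auto simp: end_simps(1) PiE_def)
 show ?thesis
 proof (unfold_locales)
 show "En u *[?E] En v = (if u = v then En u else 0[?E])" for u v using nact_NM by (auto simp: end_simps(2,4) En_def nact_nact NM_simps(2))
 show "En (ob p) *[?E] Eg p q = Eg p q" if "p : P" "q : opp p" for p q
 proof (rule ext)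
 show "(En (ob p) *[?E] Eg p q) f = Eg p q f" if f: "f <: NM" for f
 using act_NM[OF `p : P` `q : opp p` f] NM_values(1)[OF f] nact_act[OF `p : P` `q : opp p`] by (simp add: end_simps(2) En_def Eg_def)
 qed (use that En_closed Eg_closed in auto)
 show "Eg p q *[?E] En (ob q) = Eg p q" if "p : P" "q : opp p" for p q
 proof (rule ext)
 show "(Eg p q *[?E] En (ob q)) f = Eg p q f" if f: "f <: NM" for f
 using nact_NM[OF f] act_nact[OF `p : P` `q : opp p`] by (simp add: end_simps(2) En_def Eg_def)
 qed (use that En_closed Eg_closed in auto)
 show "sm ?E (%q. Eg p q *[?E] Eg q p') (opp p) = (if p = p' then En (ob p) else 0[?E])"
 if p: "p : P" "p' : peer p" for p p'
 proof (rule ext)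
 have c: "Eg p q *[?E] Eg q p' <: ?E" if "q : opp p" for q
 using Eg_closed[OF p(1) that] Eg_closed[OF opp_P[OF p(1) that] opp_mem[OF p(1) that p(2)]] by (rule E.mult_closed)
 show "sm ?E (%q. Eg p q *[?E] Eg q p') (opp p) <: ?E" using c by (intro E.M.finsum_closed) auto
 show "(if p = p' then En (ob p) else 0[?E]) <: ?E" using En_closed by auto
 fix f assume f: "f <: NM"
 have a: "act q p' f <: NM" "act p q (act q p' f) <: NM" if "q : opp p" for q
 using act_NM[OF opp_P[OF p(1) that] opp_mem[OF p(1) that p(2)] f] act_NM[OF p(1) that] by auto
 have "(sm ?E (%q. Eg p q *[?E] Eg q p') (opp p)) f = sm NM (%q. (Eg p q *[?E] Eg q p') f) (opp p)"
 using c by (intro end_finsum[OF K.field_axioms module_NM _ f]) auto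
 also have "... = sm NM (%q. act p q (act q p' f)) (opp p)" using a f by (intro NM.M.finsum_cong') (auto simp: end_simps(2) Eg_def)
 also have "... = (if p = p' then nact (ob p) f else 0[NM])"
 proof
 fix x :: "('p \<times> 'p) list \<times> 'v"
 obtain w v where x: "x = (w, v)" by force
 have "(sm NM (%q. act p q (act q p' f)) (opp p)) x = sm K (%q. act p q (act q p' f) x) (opp p)" using a by (intro NM_finsum) auto
 also have "... = (if p = p' then nact (ob p) f else 0[NM]) x"
 proof (cases "nrm w v")
 case True
 thus ?thesis unfolding x using act_act[OF p NM_values(1)[OF f]] by (simp add: NM_simps(2))
 next
 case False
 thus ?thesis unfolding x by (simp add: act_def nact_def NM_simps(2))
 qed
 finally show "(sm NM (%q. act p q (act q p' f)) (opp p)) x = (if p = p' then nact (ob p) f else 0[NM]) x" .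
 qed
 finally show "(sm ?E (%q. Eg p q *[?E] Eg q p') (opp p)) f = (if p = p' then En (ob p) else 0[?E]) f"
 using f by (simp add: En_def end_simps(4))
 qed
 qed (use En_closed Eg_closed in auto)
qed

end

lemma (in lpa_setup) leavitt_L: "leavitt K L (vs E) (ix E w) (opp E w) (peer E w) (ob E) side nu g"
 by (intro leavitt.intro leavitt_axioms.intro unital_L fam.cell_family_axioms one_L L_generated) auto

lemma (in normal_forms) hob_V: "nrm w v ==> hob w v : V" by (cases w) (auto simp: ob_closed)

lemma (in normal_forms) deg_Nil_iff: "deg w <= Suc 0 <-> w = []"
proof (cases w)
 case (Cons x u)
 thus ?thesis using deg_less[of u x] deg_pos[of u] by auto
qed simp

context leavitt
begin

definition vsum :: "('v => 'k) => 'l" where "vsum c = sm L (%v. c v *:[L] nu v) V"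

lemma vsum_closed: "c : V ->: K ==> vsum c <: L" unfolding vsum_def  by (intro U.M.finsum_closed) auto

lemma vsum_add: assumes "c : V ->: K" "d : V ->: K" shows "vsum c +[L] vsum d = vsum (%v. c v +[K] d v)"
proof -
 have "vsum (%v. c v +[K] d v) = sm L (%v. c v *:[L] nu v +[L] d v *:[L] nu v) V"
 unfolding vsum_def using assms by (intro U.M.finsum_cong') (auto simp: U.smult_l_distr Pi_def)
 also have "... = vsum c +[L] vsum d" unfolding vsum_def using assms by (intro U.M.finsum_addf) auto
 finally show ?thesis ..
qed

lemma mult_vsum: assumes "c : V ->: K" "l <: L" shows "l *[L] vsum c = sm L (%v. c v *:[L] (l *[L] nu v)) V"
proof -
 have "l *[L] vsum c = sm L (%v. l *[L] (c v *:[L] nu v)) V" unfolding vsum_def using assms U.mult_r_distr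
 by (intro add_finsum[of L L "%x. l *[L] x"] U.M.ag) auto
 also have "... = sm L (%v. c v *:[L] (l *[L] nu v)) V" using assms by (intro U.M.finsum_cong') (auto simp: U.mult_smult_r Pi_def)
 finally show ?thesis .
qed

lemma ka_vsum: assumes "c : V ->: K" "k <: K" shows "ka k *[L] vsum c = vsum (%v. k *[K] c v)"
 unfolding mult_vsum[OF assms(1) ka_closed[OF assms(2)]]  unfolding vsum_def using assms
 by (intro U.M.finsum_cong') (auto simp: Pi_def ka_mult U.K.m_comm simp flip: U.smult_assoc1)

lemma nu_vsum: assumes "c : V ->: K" "u : V" shows "nu u *[L] vsum c = vsum (%v. if v = u then c v else 0[K])"
 unfolding mult_vsum[OF assms(1) nu_closed[OF assms(2)]]  unfolding vsum_def using assms by (intro U.M.finsum_cong') (auto simp: Pi_def nu_mult)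

lemma vsum_zero: "vsum (%_. 0[K]) = 0[L]" unfolding vsum_def by (intro U.M.add.finprod_one_eqI) simp

lemma vsum_one: "vsum (%_. 1[K]) = 1[L]" unfolding vsum_def one_sum by (intro U.M.finsum_cong') auto

lemma lv_module_regular: "lv_module K L V P opp peer ob side nu g (rmod L)"
 by (intro lv_module.intro leavitt_axioms left_module_regular U.A.ring_axioms)

end

section \<open>A good filtration of the regular module\<close>

context lpa_setup
begin

sublocale lv: leavitt K L "vs E" "ix E w" "opp E w" "peer E w" "ob E" side nu g by (rule leavitt_L)

sublocale nf: normal_forms "vs E" "ix E w" "opp E w" "peer E w" "ob E" side K by unfold_locales

abbreviation "leavitt_mod \<equiv> lv_module K L (vs E) (ix E w) (opp E w) (peer E w) (ob E) side nu g"
abbreviation "good_mod \<equiv> good_module K L (vs E) (ix E w) (opp E w) (peer E w) (ob E) side nu g"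

lemma lpa_relations_family:
 assumes "cell_family (vs E) (ix E w) (opp E w) (peer E w) (ob E) side B nu' g'" shows "lpa_relations E w B nu' g'"
proof -
 interpret cell_family "vs E" "ix E w" "opp E w" "peer E w" "ob E" side B nu' g' by fact
 show ?thesis unfolding lpa_relations_def using nu_mult nu_g g_nu g_g by blast
qed

text \<open>The action is unital because \<open>1[L]\<close> is the sum of the vertices, and a
  normal word is fixed by the vertex at which it starts and killed by all others.\<close>

lemma NM_rep:
 obtains H where "leavitt_mod (rep_mod nf.NM H)" "!!p q f. [|p : ix E w; q : opp E w p; f <: nf.NM|] ==> H (g p q) f = nf.act p q f"
 "!!u f. [|u : vs E; f <: nf.NM|] ==> H (nu u) f = nf.nact u f" "!!c f. [|c <: K; f <: nf.NM|] ==> H (lv.ka c) f = c *:[nf.NM] f"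
proof -
 let ?E = "end_algebra K nf.NM"
 interpret NM: module K nf.NM by (rule nf.module_NM)
 interpret E: unital_algebra K ?E by (rule end_unital[OF K.field_axioms nf.module_NM])
 obtain H where H: "alg_map K L ?E H" "!!v. v : vs E ==> H (nu v) = nf.En v" "!!p q. [|p : ix E w; q : opp E w p|] ==> H (g p q) = nf.Eg p q"
 by (rule L_universal[OF end_unital[OF K.field_axioms nf.module_NM] lpa_relations_family[OF nf.cell_family_End]])
 (use nf.En_closed nf.Eg_closed in auto)
 have one: "H 1[L] f = f" if f: "f <: nf.NM" for f proof -
 have "H 1[L] = sm ?E (%v. H (nu v)) (vs E)" unfolding lv.one_sum by (rule alg_map_finsum[OF H(1) fam.B.ag E.M.ag]) (use nu_L in auto)
 also have "... = sm ?E (%v. nf.En v) (vs E)" using nf.En_closed by (intro E.M.finsum_cong') (auto simp: H(2))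
 finally have "H 1[L] f = sm nf.NM (%v. nf.En v f) (vs E)"
 using end_finsum[OF K.field_axioms nf.module_NM _ f, of nf.En "vs E"] nf.En_closed by auto
 also have "... = sm nf.NM (%v. nf.nact v f) (vs E)" using nf.nact_NM[OF f] f by (intro NM.M.finsum_cong') (auto simp: nf.En_def)
 also have "... = f"
 proof
 fix x :: "('v, 'e) cell"
 obtain u v where x: "x = (u, v)" by force
 have "(sm nf.NM (%v. nf.nact v f) (vs E)) x = sm K (%v. nf.nact v f x) (vs E)" using nf.nact_NM[OF f] by (intro nf.NM_finsum) auto
 also have "... = f x"
 proof (cases "nf.nrm u v")
 case True
 have "sm K (%v. nf.nact v f x) (vs E) = nf.nact (nf.hob u v) f x" using nf.hob_V[OF True] nf.NM_values(1)[OF f]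
 by (intro K.finsum_delta finite_verts) (auto simp: x nf.nact_def)
 thus ?thesis using True by (simp add: x nf.nact_def)
 next
 case False
 thus ?thesis using nf.NM_values(2)[OF f False] by (simp add: x nf.nact_def)
 qed
 finally show "(sm nf.NM (%v. nf.nact v f) (vs E)) x = f x" .
 qed
 finally show ?thesis .
 qed
 have lm: "lmod L (rep_mod nf.NM H)" by (rule left_module_rep[OF K.field_axioms nf.module_NM fam.B.ring_axioms H(1) one])
 show ?thesis
 proof (rule that)
 show "leavitt_mod (rep_mod nf.NM H)" by (intro lv_module.intro lv.leavitt_axioms lm)
 show "H (lv.ka c) f = c *:[nf.NM] f" if "c <: K" "f <: nf.NM" for c f using that one by (simp add: lv.ka_def alg_mapD(4)[OF H(1)] end_simps(6))
 qed (use H in "auto simp: nf.En_def nf.Eg_def")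
qed

text \<open>Normal forms are good by \<open>NF_good\<close>. Letting \<open>L\<close> act on the sum
  of the empty words defines a map \<open>tht\<close> from \<open>L\<close> to the normal forms; the
  lifting theorem shows that it is injective, and the filtration is pulled back along it.\<close>

lemma regular_good: obtains Fil where "good_mod (rmod L) Fil"
proof -
 obtain H where H: "leavitt_mod (rep_mod nf.NM H)"
 and Hg: "!!p q f. [|p : ix E w; q : opp E w p; f <: nf.NM|] ==> H (g p q) f = nf.act p q f"
 and Hn: "!!u f. [|u : vs E; f <: nf.NM|] ==> H (nu u) f = nf.nact u f"
 and Hk: "!!c f. [|c <: K; f <: nf.NM|] ==> H (lv.ka c) f = c *:[nf.NM] f" using NM_rep by blast
 let ?M = "rep_mod nf.NM H"
 interpret M: lv_module K L "vs E" "ix E w" "opp E w" "peer E w" "ob E" side nu g ?M by (rule H)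
 interpret NM: module K nf.NM by (rule nf.module_NM)
 note Ms = rep_mod_simps
 have lev: "lv.level n = {p : ix E w. side p = odd n}" for n by (simp add: lv.level_def)
 have row_at: "(sm ?M (%q. g p q *:[?M] b q) (opp E w p)) x = sm K (%q. nf.act p q (b q) x) (opp E w p)"
 if p: "p : ix E w" and b: "!!q. q : opp E w p ==> b q <: nf.NM" for p b x
 proof -
 have "(sm ?M (%q. g p q *:[?M] b q) (opp E w p)) x = sm K (%q. (g p q *:[?M] b q) x) (opp E w p)"
 by (rule add_finsum[OF M.M.ag K.ag, of "%f. f x"]) (use M.g_act[OF p] b nf.NM_values(1) in "auto simp: Ms nf.NM_simps(3)")
 also have "... = sm K (%q. nf.act p q (b q) x) (opp E w p)"
 using Hg[OF p _ b] nf.act_closed(4)[OF nf.NM_values(1)[OF b]] by (intro K.finsum_cong') (auto simp: Ms)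
 finally show ?thesis .
 qed
 have step_at: "M.step n b x = sm K (%p. sm K (%q. nf.act p q (b p q) x) (opp E w p)) {p : ix E w. side p = odd n}"
 if b: "M.into n (car nf.NM) b" for n b x
 proof -
 have b': "b p q <: nf.NM" if "p : lv.level n" "q : opp E w p" for p q using b that by (auto simp: M.into_def)
 have rc: "sm ?M (%q. g p q *:[?M] b p q) (opp E w p) <: ?M" if "p : lv.level n" for p
 using M.g_act[OF lv.levelD(1)[OF that]] b'[OF that] by (intro M.M.finsum_closed) (auto simp: Ms)
 have "M.step n b x = sm K (%p. (sm ?M (%q. g p q *:[?M] b p q) (opp E w p)) x) (lv.level n)"
 unfolding M.step_def by (rule add_finsum[OF M.M.ag K.ag, of "%f. f x"]) (use rc nf.NM_values(1) in "auto simp: Ms nf.NM_simps(3)")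
 also have "... = sm K (%p. sm K (%q. nf.act p q (b p q) x) (opp E w p)) (lv.level n)"
 using row_at[OF lv.levelD(1) b'] nf.act_closed(4)[OF nf.NM_values(1)[OF b']] by (intro K.finsum_cong') auto
 finally show ?thesis by (simp add: lev)
 qed
 have NFs: "M.subspace (nf.NF n)" for n unfolding M.subspace_def Ms
 using nf.NF_subspace nf.nact_NF Hn Hk nf.carrier_NM_I by (auto simp: nf.NM_simps(2,3,4))
 have into: "M.into n (car nf.NM) b" if "M.into n (nf.NF m) b" for n m b using M.into_mono[OF that] nf.carrier_NM_I by blast
 have NF0: "f = (%_. 0[K])" if "f : nf.NF 0" for f
 proof
 fix x :: "('v, 'e) cell"
 show "f x = 0[K]" using nf.NF_D(3)[OF that, of "fst x" "snd x"] nf.deg_pos[of "fst x"] by simp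
 qed
 have good: "good_mod ?M nf.NF"
 proof (intro good_module.intro[OF H] good_module_axioms.intro NFs)
 show "nf.NF 0 = {0[?M]}" unfolding Ms nf.NM_simps(2)
 proof (intro equalityI subsetI)
 fix f assume "f : nf.NF 0"
 from NF0[OF this] show "f : {%_. 0[K]}" by (rule singleton_iff[THEN iffD2])
 qed (use nf.NF_subspace(3)[of 0] in simp)
 show "nf.NF n <= nf.NF (Suc n)" for n by (rule nf.NF_mono) simp
 show "g p q *:[?M] f : nf.NF (Suc n)" if "f : nf.NF n" "p : lv.level (Suc n)" "q : opp E w p" for f n p q
 using that nf.act_NF[OF that(1), of p q] Hg nf.carrier_NM_I[OF that(1)] by (auto simp: lev Ms)
 show "EX n. f : nf.NF n" if "f <: ?M" for f using that by (auto simp: Ms nf.NM_simps)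
 next
 fix a n b p p'
 assume a: "a : nf.NF (Suc n)" and b: "M.into (Suc (Suc n)) (nf.NF (Suc n)) b"
 and s: "a +[?M] M.step (Suc (Suc n)) b : nf.NF n" and p: "p : lv.level (Suc (Suc n))" "p' : peer E w p"
 have b': "b p q : nf.NF (Suc n)" if "p : ix E w" "side p = odd (Suc (Suc n))" "q : opp E w p" for p q using b that by (auto simp: M.into_def lev)
 have pP: "p : ix E w" "side p = odd (Suc (Suc n))" using p by (auto simp: lev)
 have p': "p' : ix E w" "opp E w p' = opp E w p" using peer_P opp_peer pP p by auto
 have bp: "b p q <: nf.NM" if "q : opp E w p" for q by (rule nf.carrier_NM_I[OF b'[OF pP that]])
 let ?c = "sm ?M (%q. g p' q *:[?M] b p q) (opp E w p)"
 have cM: "?c <: nf.NM" proof -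
 have "?c <: ?M" using M.g_act[OF p'(1)] p'(2) bp by (intro M.M.finsum_closed) (auto simp: Ms)
 thus ?thesis by (simp add: Ms)
 qed
 have c_at: "?c x = sm K (%q. nf.act p' q (b p q) x) (opp E w p)" for x using row_at[OF p'(1), of "b p" x] bp by (simp add: p'(2))
 show "?c : nf.NF n"
 proof (rule nf.NF_I)
 show "?c x <: K" for x using nf.NM_values(1)[OF cM] .
 show "?c (u, v) = 0[K]" if "~ nf.nrm u v" for u v using nf.NM_values(2)[OF cM that] .
 show "?c (u, v) = 0[K]" if u: "nf.nrm u v" "n < nf.deg u" for u v unfolding c_at
 proof (rule nf.NF_good[OF b' _ pP p(2) u])
 fix u v assume u: "nf.nrm u v" "Suc n < nf.deg u"
 have "(a +[?M] M.step (Suc (Suc n)) b) (u, v) = 0[K]" using nf.NF_D(3)[OF s] u(2) by simp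
 moreover have "a (u, v) = 0[K]" using nf.NF_D(3)[OF a u(2)] .
 moreover have "M.step (Suc (Suc n)) b <: nf.NM" using M.step_closed[of "Suc (Suc n)" b] into[OF b] by (simp add: Ms)
 ultimately have "M.step (Suc (Suc n)) b (u, v) = 0[K]" using nf.NM_values(1) by (simp add: Ms nf.NM_simps(3))
 thus "sm K (%p. sm K (%q. nf.act p q (b p q) (u, v)) (opp E w p)) {p : ix E w. side p = odd (Suc (Suc n))} = 0[K]"
 unfolding step_at[OF into[OF b]] .
 qed
 qed
 qed
 \<comment> \<open>The sum of the empty words at all vertices, the element that corresponds to
   \<open>1[L]\<close>.\<close>
 define dlt :: "('v, 'e) cell => 'k"
 where "dlt = (%(u, v). if u = [] & v : vs E then 1[K] else 0[K])"
 have d1: "dlt : nf.NF 1" by (rule nf.NF_I) (auto simp: dlt_def)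
 note dM = nf.carrier_NM_I[OF d1]
 define tht where "tht l = l *:[?M] dlt" for l
 note reg = lv.lv_module_regular
 interpret R: lv_module K L "vs E" "ix E w" "opp E w" "peer E w" "ob E" side nu g "rmod L" by (rule reg)
 have tht_hom: "leavitt_hom K L (vs E) (ix E w) (opp E w) (peer E w) (ob E) side nu g ?M (rmod L) tht"
 by (intro leavitt_hom.intro leavitt_hom_axioms.intro H reg)
 (use dM M.M.smult_closed M.M.smult_l_distr M.M.smult_assoc in "auto simp: rmod_simps tht_def Ms")
 have tht_vsum: "tht (lv.vsum c) = (%(u, v). if u = [] & v : vs E then c v else 0[K])"
 if c: "c : vs E ->: K" for c
 proof
 fix x :: "('v, 'e) cell"
 obtain u v where x: "x = (u, v)" by force
 have t: "(c v *:[L] nu v) *:[?M] dlt = (%x. c v *[K] nf.nact v dlt x)" if v: "v : vs E" for v proof -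
 have cv: "c v <: K" using c v by blast
 have "(c v *:[L] nu v) *:[?M] dlt = lv.ka (c v) *:[?M] (nu v *:[?M] dlt)"
 using cv v dM by (subst M.M.smult_assoc[symmetric]) (auto simp: lv.ka_mult Ms)
 also have "... = (%x. c v *[K] nf.nact v dlt x)" using cv v dM nf.nact_NM by (simp add: Ms Hn Hk nf.NM_simps(4))
 finally show ?thesis .
 qed
 have "tht (lv.vsum c) x = sm K (%v. ((c v *:[L] nu v) *:[?M] dlt) x) (vs E)"
 unfolding tht_def lv.vsum_def by (rule add_finsum[OF fam.B.ag K.ag, of "%l. (l *:[?M] dlt) x"])
 (use c dM nu_L M.M.smult_closed M.M.smult_l_distr nf.NM_values(1) in "auto simp: Ms nf.NM_simps(3)")
 also have "... = sm K (%v. c v *[K] nf.nact v dlt x) (vs E)"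
 using c nf.nact_closed[OF nf.NM_values(1)[OF dM]] by (intro K.finsum_cong') (auto simp: t Pi_def)
 also have "... = (if u = [] & v : vs E then c v else 0[K])"
 proof (cases "u = [] & v : vs E")
 case True
 have "sm K (%v. c v *[K] nf.nact v dlt x) (vs E) = c v *[K] nf.nact v dlt x"
 using True c nf.NM_values(1)[OF dM] by (intro K.finsum_delta finite_verts) (auto simp: x nf.nact_def Pi_def)
 also have "... = c v" using True c by (simp add: x nf.nact_def dlt_def Pi_def)
 finally show ?thesis using True by simp
 next
 case False
 hence "nf.nact v' dlt x = 0[K]" for v' by (auto simp: x nf.nact_def dlt_def)
 hence "sm K (%v. c v *[K] nf.nact v dlt x) (vs E) = 0[K]" using c by (intro K.add.finprod_one_eqI) (auto simp: Pi_def)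
 thus ?thesis unfolding if_not_P[OF False] .
 qed
 finally show "tht (lv.vsum c) x = (%(u, v). if u = [] & v : vs E then c v else 0[K]) x" by (simp add: x)
 qed
 \<comment> \<open>New generators appear at level one only. They are the combinations of vertices,
   which correspond to empty words, the words of degree one.\<close>
 define Y where "Y n = (if n = Suc 0 then {lv.vsum c | c. c : vs E ->: K} else {0[L]})" for n
 have "R.subspace {lv.vsum c | c. c : vs E ->: K}" unfolding R.subspace_def rmod_simps
 proof (intro conjI ballI)
 have z: "(%_. 0[K]) : vs E ->: K" by auto
 show "0[L] : {lv.vsum c | c. c : vs E ->: K}" unfolding lv.vsum_zero[symmetric] by blast
 next
 fix x y assume xy: "x : {lv.vsum c | c. c : vs E ->: K}" "y : {lv.vsum c | c. c : vs E ->: K}"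
 then obtain c d where cd: "c : vs E ->: K" "d : vs E ->: K" "x = lv.vsum c" "y = lv.vsum d" by blast
 have "(%v. c v +[K] d v) : vs E ->: K" using cd by auto
 thus "x +[L] y : {lv.vsum c | c. c : vs E ->: K}" unfolding cd lv.vsum_add[OF cd(1,2)] by blast
 next
 fix k x assume k: "k <: K" "x : {lv.vsum c | c. c : vs E ->: K}"
 then obtain c where c: "c : vs E ->: K" "x = lv.vsum c" by blast
 have "(%v. k *[K] c v) : vs E ->: K" using c k by auto
 thus "lv.ka k *[L] x : {lv.vsum c | c. c : vs E ->: K}" unfolding c(2) lv.ka_vsum[OF c(1) k(1)] by blast
 next
 fix u x assume u: "u : vs E" "x : {lv.vsum c | c. c : vs E ->: K}"
 then obtain c where c: "c : vs E ->: K" "x = lv.vsum c" by blast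
 have "(%v. if v = u then c v else 0[K]) : vs E ->: K" using c by auto
 thus "nu u *[L] x : {lv.vsum c | c. c : vs E ->: K}" unfolding c(2) lv.nu_vsum[OF c(1) u(1)] by blast
 qed (use lv.vsum_closed in auto)
 hence Ysub: "R.subspace (Y n)" for n using R.subspace_zero by (simp add: Y_def rmod_simps)
 interpret th: leavitt_hom K L "vs E" "ix E w" "opp E w" "peer E w" "ob E" side nu g ?M "rmod L" tht by (rule tht_hom)
 have tht0: "tht 0[L] = (%_. 0[K])" using th.pr_zero by (simp add: rmod_simps Ms nf.NM_simps(2))
 have vs1: "tht (lv.vsum c) : nf.NF (Suc 0)" if c: "c : vs E ->: K" for c
 unfolding tht_vsum[OF c] by (rule nf.NF_I) (use c in "auto simp: nf.deg_Nil_iff split: prod.splits")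
 have zeroK: "M.step (Suc 0) b = 0[?M]" if "M.into (Suc 0) (nf.NF 0) b" for b proof -
 have "g p q *:[?M] b p q = 0[?M]" if "p : lv.level (Suc 0)" "q : opp E w p" for p q
 using NF0[of "b p q"] `M.into _ _ b` that lv.levelD(1)[OF that(1)]
 M.M.smult_r_zero[OF g_L[of p q]] by (auto simp: M.into_def Ms nf.NM_simps(2))
 hence "M.step (Suc 0) b : {0[?M]}" by (intro M.step_mem[OF M.subspace_zero]) auto
 thus ?thesis by simp
 qed
 have lift: "lifting K L (vs E) (ix E w) (opp E w) (peer E w) (ob E) side nu g ?M nf.NF (rmod L) tht Y"
 proof (intro lifting.intro lifting_axioms.intro good tht_hom Ysub)
 show "tht y : nf.NF n" if "y : Y n" for y n using that vs1 tht0 nf.NF_subspace(3) by (auto simp: Y_def split: if_splits)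
 next
 fix f n assume f: "f : nf.NF (Suc n)"
 show "EX a b y. a : nf.NF n & M.into (Suc n) (nf.NF n) b & y : Y (Suc n) &
 f = a +[?M] M.step (Suc n) b +[?M] tht y"
 proof (cases n)
 case 0
 have c: "(%v. f ([], v)) : vs E ->: K" using nf.NF_D(1)[OF f] by auto
 have "f = tht (lv.vsum (%v. f ([], v)))" unfolding tht_vsum[OF c]
 proof
 fix x :: "('v, 'e) cell"
 obtain u v where x: "x = (u, v)" by force
 show "f x = (%(u, v). if u = [] & v : vs E then f ([], v) else 0[K]) x"
 using nf.NF_D(2)[OF f, of u v] nf.NF_D(3)[OF f, of u v] nf.deg_Nil_iff[of u] 0 by (auto simp: x)
 qed
 hence "f = 0[?M] +[?M] M.step (Suc n) (%p q. 0[?M]) +[?M] tht (lv.vsum (%v. f ([], v)))"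
 using th.pr_closed[of "lv.vsum (%v. f ([], v))"] lv.vsum_closed[OF c] by (simp add: M.step_zero rmod_simps)
 moreover have "lv.vsum (%v. f ([], v)) : Y (Suc n)" using c 0 by (auto simp: Y_def)
 moreover have "M.into (Suc n) (nf.NF n) (%p q. 0[?M])" "0[?M] : nf.NF n" using M.subspaceD(2)[OF NFs] by (auto simp: M.into_def)
 ultimately show ?thesis by blast
 next
 case (Suc m)
 obtain b where b: "!!p q. p : ix E w ==> side p = odd (Suc n) ==> q : opp E w p ==> b p q : nf.NF n"
 and bf: "!!u v. nf.nrm u v ==> nf.deg u > n ==>
 f (u, v) = sm K (%p. sm K (%q. nf.act p q (b p q) (u, v)) (opp E w p)) {p : ix E w. side p = odd (Suc n)}"
 using nf.NF_span[OF f] Suc by blast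
 have bi: "M.into (Suc n) (nf.NF n) b" using b by (auto simp: M.into_def lev)
 have sM: "M.step (Suc n) b : nf.NF (Suc n)" using nf.act_NF[OF b] Hg nf.carrier_NM_I[OF b] by (intro M.step_mem[OF NFs]) (auto simp: lev Ms)
 \<comment> \<open>The remainder after subtracting what \<open>f\<close> shows above degree
   \<open>n\<close>; its own coefficients there cancel by \<open>bf\<close>.\<close>
 let ?a = "f -[?M] M.step (Suc n) b"
 have fM: "f <: ?M" "M.step (Suc n) b <: ?M" using nf.carrier_NM_I[OF f] nf.carrier_NM_I[OF sM] by (auto simp: Ms)
 have aS: "?a : nf.NF (Suc n)" unfolding a_minus_def by (rule M.subspaceD(3)[OF NFs f M.subspaceD(7)[OF NFs sM]])
 have fa: "f = ?a +[?M] M.step (Suc n) b" using fM by (simp add: a_minus_def M.M.a_assoc M.M.l_neg)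
 have "?a : nf.NF n"
 proof (rule nf.NF_I)
 show "?a x <: K" for x using nf.NF_D(1)[OF aS] .
 show "?a (u, v) = 0[K]" if "~ nf.nrm u v" for u v using nf.NF_D(2)[OF aS that] .
 show "?a (u, v) = 0[K]" if u: "nf.nrm u v" "n < nf.deg u" for u v proof -
 have "f (u, v) = ?a (u, v) +[K] M.step (Suc n) b (u, v)" using arg_cong[OF fa, of "%f. f (u, v)"] by (simp add: Ms nf.NM_simps(3))
 moreover have "f (u, v) = M.step (Suc n) b (u, v)" using bf[OF u] step_at[OF into[OF bi]] by simp
 ultimately have "?a (u, v) +[K] M.step (Suc n) b (u, v) = M.step (Suc n) b (u, v)" by (rule trans[OF sym])
 thus ?thesis using K.add.r_cancel_one[OF nf.NF_D(1)[OF sM, of "(u, v)"] nf.NF_D(1)[OF aS, of "(u, v)"]] by simp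
 qed
 qed
 moreover have "f = ?a +[?M] M.step (Suc n) b +[?M] tht 0[L]" using fa fM th.pr_zero by (simp add: rmod_simps)
 ultimately show ?thesis using bi Suc by (intro exI[of _ ?a] exI[of _ b] exI[of _ "0[L]"]) (simp add: Y_def)
 qed
 next
 fix a n b y assume a: "a : nf.NF n" and b: "M.into (Suc n) (nf.NF n) b" and y: "y : Y (Suc n)"
 and z: "a +[?M] M.step (Suc n) b +[?M] tht y = 0[?M]"
 show "y = 0[rmod L]"
 proof (cases n)
 case 0
 obtain c where c: "c : vs E ->: K" "y = lv.vsum c" using y 0 by (auto simp: Y_def)
 have a0: "a = 0[?M]" using NF0[of a] a 0 by (simp add: Ms nf.NM_simps(2))
 have "tht y <: ?M" using th.pr_closed[of y] c lv.vsum_closed by (simp add: rmod_simps)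
 hence "tht y = 0[?M]" using z a0 zeroK[of b] b 0 by simp
 hence ty: "tht y = (%_. 0[K])" by (simp add: Ms(2) nf.NM_simps(2))
 have "c v = 0[K]" if "v : vs E" for v using fun_cong[OF ty, of "([], v)"] that by (simp add: c(2) tht_vsum[OF c(1)])
 hence "y = lv.vsum (%_. 0[K])" unfolding c(2) lv.vsum_def by (intro fam.B.finsum_cong') auto
 thus ?thesis by (simp add: lv.vsum_zero rmod_simps)
 next
 case (Suc m)
 thus ?thesis using y by (simp add: Y_def rmod_simps)
 qed
 qed
 interpret li: lifting K L "vs E" "ix E w" "opp E w" "peer E w" "ob E" side nu g ?M nf.NF "rmod L" tht Y by (rule lift)
 \<comment> \<open>The union of the \<open>Gam n\<close> is closed under the action, so containing
   \<open>1[L]\<close> means being all of \<open>L\<close>.\<close>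
 have one: "1[L] : (UN n. li.Gam n)" proof -
 have "(%_. 1[K]) : vs E ->: K" by auto
 hence "1[L] : Y (Suc 0)" unfolding lv.vsum_one[symmetric] Y_def by auto
 thus ?thesis using li.Gam_Y by blast
 qed
 have "l : (UN n. li.Gam n)" if "l <: L" for l using li.act_Gam[OF that one] that by (simp add: rmod_simps)
 hence inj: "l = 0[L]" if "l <: L" "tht l = 0[?M]" for l using li.pr_inj_Union[of l] that by (simp add: rmod_simps)
 have "good_mod (rmod L) (%n. {x : car (rmod L). ALL i:{()}. tht x : nf.NF n})"
 by (rule good_pullback[OF good reg, of "{()}" "%_. tht"]) (use th.pr_closed th.pr_add th.pr_smult inj in "auto simp: rmod_simps")
 thus ?thesis by (rule that)
qed

end

section \<open>Products of modules, linear combinations and spans\<close>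

definition dmod :: "('l, 'm) module => ('l, 'n) module => ('l, 'm \<times> 'n) module" where
 "dmod M N = \<lparr>carrier = car M \<times> car N, monoid.mult = undefined, one = undefined,
 ring.zero = (0[M], 0[N]), add = (%x y. (fst x +[M] fst y, snd x +[N] snd y)),
 smult = (%l x. (l *:[M] fst x, l *:[N] snd x))\<rparr>"

lemma prod_simps: "car (dmod M N) = car M \<times> car N" "0[dmod M N] = (0[M], 0[N])"
 "x +[dmod M N] y = (fst x +[M] fst y, snd x +[N] snd y)"
 "l *:[dmod M N] x = (l *:[M] fst x, l *:[N] snd x)" by (simp_all add: dmod_def)

lemma left_module_prod: assumes "lmod L M" "lmod L N" shows "lmod L (dmod M N)"
proof -
 interpret M: left_module L M by fact
 interpret N: left_module L N by fact
 have "abelian_group (dmod M N)"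
 proof (rule abelian_groupI)
 fix x assume "x <: (dmod M N)"
 hence "(-[M] fst x, -[N] snd x) <: (dmod M N)" "(-[M] fst x, -[N] snd x) +[dmod M N] x = 0[dmod M N]"
 by (auto simp: prod_simps M.M.l_neg N.M.l_neg)
 thus "EX y:car (dmod M N). y +[dmod M N] x = 0[dmod M N]" by blast
 qed (auto simp: prod_simps M.M.a_ac N.M.a_ac)
 thus ?thesis unfolding left_module_def left_module_axioms_def by (auto simp: prod_simps M.R.ring_axioms M.smult_l_distr N.smult_l_distr
 M.smult_r_distr N.smult_r_distr M.smult_assoc N.smult_assoc)
qed

context left_module
begin

definition lcomb :: "('i => 'a) => ('i => 'm) => 'i set => 'm" where "lcomb l t S = sm M (%i. l i *:[M] t i) S"

lemma lcomb_closed: "[|l : S ->: R; t : S ->: M|] ==> lcomb l t S <: M"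
 unfolding lcomb_def by (intro M.finsum_closed) (auto intro: smult_closed)

lemma lcomb_superset:
 assumes "finite T" "S <= T" "l : S ->: R" "t : T ->: M"
 shows "lcomb l t S = lcomb (%i. if i : S then l i else 0[R]) t T" unfolding lcomb_def using assms
 by (intro M.add.finprod_mono_neutral_cong_left) (auto simp: Pi_def)

lemma lcomb_add:
 assumes "l : S ->: R" "l' : S ->: R" "t : S ->: M" shows "lcomb l t S +[M] lcomb l' t S = lcomb (%i. l i +[R] l' i) t S"
proof -
 have "lcomb (%i. l i +[R] l' i) t S = sm M (%i. l i *:[M] t i +[M] l' i *:[M] t i) S"
 unfolding lcomb_def using assms by (intro M.finsum_cong') (auto simp: Pi_def smult_l_distr)
 also have "... = lcomb l t S +[M] lcomb l' t S" unfolding lcomb_def using assms by (intro M.finsum_addf) (auto simp: Pi_def)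
 finally show ?thesis ..
qed

lemma lcomb_smult:
 assumes "l : S ->: R" "a <: R" "t : S ->: M" shows "a *:[M] lcomb l t S = lcomb (%i. a *[R] l i) t S"
proof -
 have "a *:[M] lcomb l t S = sm M (%i. a *:[M] (l i *:[M] t i)) S"
 unfolding lcomb_def using assms by (intro smult_r_finsum) (auto simp: Pi_def)
 also have "... = lcomb (%i. a *[R] l i) t S" unfolding lcomb_def using assms by (intro M.finsum_cong') (auto simp: Pi_def smult_assoc)
 finally show ?thesis .
qed

lemma lcomb_cong: "[|!!i. i : S ==> l i = l' i; l' : S ->: R; t : S ->: M|] ==> lcomb l t S = lcomb l' t S"
 unfolding lcomb_def by (intro M.finsum_cong') (auto simp: Pi_def)

lemma lcomb_zero: "[|!!i. i : S ==> l i = 0[R]; t : S ->: M|] ==> lcomb l t S = 0[M]"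
 unfolding lcomb_def by (intro M.add.finprod_one_eqI) (auto simp: Pi_def)

lemma lcomb_single:
 assumes "finite S" "i : S" "l i <: R" "t : S ->: M" "!!j. [|j : S; j ~= i|] ==> l j = 0[R]" shows "lcomb l t S = l i *:[M] t i"
 unfolding lcomb_def using assms by (intro M.finsum_delta) (auto simp: Pi_def)

definition lspan :: "'m set => 'm set" where "lspan B = {lcomb l (%i. i) S | l S. finite S & S <= B & l : S ->: R}"

lemma lspanI: "[|finite S; S <= B; l : S ->: R|] ==> lcomb l (%i. i) S : lspan B" unfolding lspan_def by blast

lemma lspan_sub: "B <= car M ==> lspan B <= car M" by (auto simp: lspan_def intro!: lcomb_closed)

lemma lspan_mono: assumes "S <= T" shows "lspan S <= lspan T"
proof
 fix x assume "x : lspan S"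
 then obtain l S' where "finite S'" "S' <= S" "l : S' ->: R" "x = lcomb l (%i. i) S'" unfolding lspan_def by auto
 thus "x : lspan T" using lspanI[of S' T l] assms by auto
qed

lemma lspan_zero: "0[M] : lspan B" using lspanI[of "{}" B "%_. 0[R]"] by (simp add: lcomb_def)

lemma lspan_add: assumes B: "B <= car M" and x: "x : lspan B" "y : lspan B" shows "x +[M] y : lspan B"
proof -
 obtain l S l' S' where 1: "finite S" "S <= B" "l : S ->: R" "x = lcomb l (%i. i) S"
 and 2: "finite S'" "S' <= B" "l' : S' ->: R" "y = lcomb l' (%i. i) S'" using x by (auto simp: lspan_def)
 let ?l = "%i. if i : S then l i else 0[R]" and ?l' = "%i. if i : S' then l' i else 0[R]"
 have t: "(%i. i) : S \<union> S' ->: M" using 1(2) 2(2) B by auto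
 have "x = lcomb ?l (%i. i) (S \<union> S')" "y = lcomb ?l' (%i. i) (S \<union> S')"
 unfolding 1(4) 2(4) using 1 2 t by (intro lcomb_superset; auto)+
 hence "x +[M] y = lcomb (%i. ?l i +[R] ?l' i) (%i. i) (S \<union> S')" using 1(3) 2(3) t by (simp add: lcomb_add Pi_def)
 also have "... : lspan B" using 1 2 by (intro lspanI) (auto simp: Pi_def)
 finally show ?thesis .
qed

lemma lspan_smult: assumes B: "B <= car M" and "a <: R" "x : lspan B" shows "a *:[M] x : lspan B"
proof -
 obtain l S where 1: "finite S" "S <= B" "l : S ->: R" "x = lcomb l (%i. i) S" using assms by (auto simp: lspan_def)
 have "a *:[M] x = lcomb (%i. a *[R] l i) (%i. i) S" unfolding 1(4) using 1 assms by (intro lcomb_smult) auto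
 also have "... : lspan B" using 1 assms by (intro lspanI) auto
 finally show ?thesis .
qed

lemma lspan_mem: "[|B <= car M; x : B|] ==> x : lspan B" using lspanI[of "{x}" B "%_. 1[R]"] by (auto simp: lcomb_def)

lemma lspan_finsum: "[|B <= car M; !!i. i : A ==> f i : lspan B|] ==> sm M f A : lspan B"
 by (rule M.finsum_mem) (auto simp: lspan_zero lspan_add subsetD[OF lspan_sub])

lemma lspan_finite: assumes "finite B" "B <= car M" "x : lspan B"
 obtains l where "l : B ->: R" "x = lcomb l (%i. i) B"
proof -
 obtain l S where 1: "finite S" "S <= B" "l : S ->: R" "x = lcomb l (%i. i) S" using assms by (auto simp: lspan_def)
 have "x = lcomb (%i. if i : S then l i else 0[R]) (%i. i) B" unfolding 1(4) using 1 assms by (intro lcomb_superset) auto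
 thus ?thesis using that[of "%i. if i : S then l i else 0[R]"] 1 by (auto simp: Pi_def)
qed

lemma lspan_mono_finite: assumes "finite X" "X <= lspan B"
 obtains S where "finite S" "S <= B" "X <= lspan S"
proof -
 have "ALL x:X. EX S. finite S & S <= B & x : lspan S"
 proof
 fix x assume "x : X"
 hence "x : lspan B" using assms(2) by blast
 then obtain l S where "finite S" "S <= B" "l : S ->: R" "x = lcomb l (%i. i) S" unfolding lspan_def by auto
 thus "EX S. finite S & S <= B & x : lspan S" using lspanI[of S S l] by auto
 qed
 from bchoice[OF this] obtain F where F: "ALL x:X. finite (F x) & F x <= B & x : lspan (F x)" ..
 have "lspan (F x) <= lspan (\<Union>(F ` X))" if "x : X" for x proof -
 have "F x <= \<Union>(F ` X)" using that by blast
 thus ?thesis by (rule lspan_mono)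
 qed
 hence "X <= lspan (\<Union>(F ` X))" using F by (meson subsetD subsetI)
 moreover have "finite (\<Union>(F ` X))" using F assms(1) by simp
 moreover have "\<Union>(F ` X) <= B" using F by (simp add: UN_subset_iff)
 ultimately show ?thesis using that by simp
qed

lemma lspan_lspan: assumes "B <= car M" "X <= lspan B" shows "lspan X <= lspan B"
proof
 fix x assume "x : lspan X"
 then obtain l S where 1: "S <= X" "l : S ->: R" "x = lcomb l (%i. i) S" by (auto simp: lspan_def)
 show "x : lspan B" unfolding 1(3) lcomb_def using 1 assms lspan_smult[OF assms(1)] by (intro lspan_finsum) blast+
qed

end

context lv_module
begin

definition kspan :: "('i => 'm) => 'i set => 'm set" where "kspan t B = {M.lcomb (%i. ka (c i)) t S | c S. finite S & S <= B & c : S ->: K}"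

lemma kspanI: "[|finite S; S <= B; c : S ->: K|] ==> M.lcomb (%i. ka (c i)) t S : kspan t B" unfolding kspan_def by blast

lemma kspan_mem: assumes "i : B" "t i <: M" shows "t i : kspan t B"
proof -
 have "t i = M.lcomb (%i. ka 1[K]) t {i}" using assms by (simp add: M.lcomb_def ka_one)
 thus ?thesis using kspanI[of "{i}" B "%_. 1[K]" t] assms by simp
qed

text \<open>Each \<open>t i\<close> belongs to a single vertex, so multiplication by a vertex merely
  deletes some of the coefficients.\<close>

lemma kspan_subspace:
 assumes t: "!!i. i : B ==> t i <: M" and u: "!!i. i : B ==> u i : V & nu (u i) *:[M] t i = t i" shows "subspace (kspan t B)" unfolding subspace_def
proof (intro conjI ballI)
 have kc: "(%i. ka (c i)) : S ->: L" if "c : S ->: K" for c S using that by (simp add: Pi_def)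
 have tS: "t : S ->: M" if "S <= B" for S using t that by auto
 show "kspan t B <= car M" using M.lcomb_closed[OF kc tS] by (auto simp: kspan_def)
 show "0[M] : kspan t B" using kspanI[of "{}" B "%_. 0[K]" t] by (simp add: M.lcomb_def)
 fix x assume "x : kspan t B"
 then obtain c S where 1: "finite S" "S <= B" "c : S ->: K" "x = M.lcomb (%i. ka (c i)) t S" by (auto simp: kspan_def)
 {
 fix y assume "y : kspan t B"
 then obtain d T where 2: "finite T" "T <= B" "d : T ->: K" "y = M.lcomb (%i. ka (d i)) t T" by (auto simp: kspan_def)
 let ?c = "%i. if i : S then c i else 0[K]" and ?d = "%i. if i : T then d i else 0[K]"
 have cd: "?c : S \<union> T ->: K" "?d : S \<union> T ->: K" using 1(3) 2(3) by auto
 have e: "(%i. if i : S then ka (c i) else 0[L]) = (%i. ka (?c i))" "(%i. if i : T then ka (d i) else 0[L]) = (%i. ka (?d i))"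
 by (auto simp: ka_zero)
 have "x = M.lcomb (%i. ka (?c i)) t (S \<union> T)" "y = M.lcomb (%i. ka (?d i)) t (S \<union> T)"
 unfolding 1(4) 2(4) e[symmetric] using 1 2 kc tS[of "S \<union> T"] by (intro M.lcomb_superset; auto)+
 hence "x +[M] y = M.lcomb (%i. ka (?c i) +[L] ka (?d i)) t (S \<union> T)"
 using kc[OF cd(1)] kc[OF cd(2)] tS[of "S \<union> T"] 1(2) 2(2) by (simp add: M.lcomb_add)
 also have "... = M.lcomb (%i. ka (?c i +[K] ?d i)) t (S \<union> T)"
 using cd tS[of "S \<union> T"] 1(2) 2(2) by (intro M.lcomb_cong) (auto simp: ka_add Pi_def)
 also have "... : kspan t B" using 1 2 cd by (intro kspanI) (auto simp: Pi_def)
 finally show "x +[M] y : kspan t B" .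
 next
 fix k assume k: "k <: K"
 have "ka k *:[M] x = M.lcomb (%i. ka k *[L] ka (c i)) t S" unfolding 1(4) using kc[OF 1(3)] tS[OF 1(2)] k by (intro M.lcomb_smult) auto
 also have "... = M.lcomb (%i. ka (k *[K] c i)) t S" using 1(3) k tS[OF 1(2)] by (intro M.lcomb_cong) (auto simp: ka_kap Pi_def)
 also have "... : kspan t B" using 1 k by (intro kspanI) auto
 finally show "ka k *:[M] x : kspan t B" .
 next
 fix v assume v: "v : V"
 let ?d = "%i. if u i = v then c i else 0[K]"
 have "nu v *:[M] x = M.lcomb (%i. nu v *[L] ka (c i)) t S" unfolding 1(4) using kc[OF 1(3)] tS[OF 1(2)] v by (intro M.lcomb_smult) auto
 also have "... = M.lcomb (%i. ka (?d i)) t S" unfolding M.lcomb_def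
 proof (rule M.finsum_cong'[OF refl])
 fix i assume i: "i : S"
 have ci: "c i <: K" "t i <: M" "u i : V" "nu (u i) *:[M] t i = t i" using i 1 t u by auto
 have "(nu v *[L] ka (c i)) *:[M] t i = (ka (c i) *[L] nu v) *:[M] (nu (u i) *:[M] t i)" using ci v by (simp add: mult_kap ka_mult)
 also have "... = (ka (c i) *[L] (nu v *[L] nu (u i))) *:[M] t i" using ci(1-3) v by (simp add: U.mult_assoc flip: M.smult_assoc)
 also have "... = ka (?d i) *:[M] t i" using ci v by (auto simp: nu_mult M.smult_assoc ka_zero)
 finally show "(nu v *[L] ka (c i)) *:[M] t i = ka (?d i) *:[M] t i" .
 qed (use 1 t in "auto intro!: ka_act simp: Pi_def")
 also have "... : kspan t B" using 1 by (intro kspanI) auto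
 finally show "nu v *:[M] x : kspan t B" .
 }
qed

end

section \<open>Bases of good modules\<close>

context good_module
begin

text \<open>The part of \<open>Fil (Suc n)\<close> that \<open>Fil n\<close> generates; new basis
  elements are chosen modulo it.\<close>

definition stp :: "nat => 'm set" where "stp n = {a +[M] step (Suc n) b | a b. a : Fil n & into (Suc n) (Fil n) b}"

lemma stpE: assumes "x : stp n"
 obtains a b where "a : Fil n" "into (Suc n) (Fil n) b" "x = a +[M] step (Suc n) b" using assms unfolding stp_def by blast

lemma stpI: "[|a : Fil n; into (Suc n) (Fil n) b|] ==> a +[M] step (Suc n) b : stp n" unfolding stp_def by blast

lemma into_Fil_carrier: "into n (Fil m) b ==> into n (car M) b" by (erule into_mono) (rule FilD(1))

lemma Fil_stp: assumes "a : Fil n" shows "a : stp n" using stpI[OF assms, of "%p q. 0[M]"] FilD(2) FilD(6)[OF assms] by (simp add: into_def step_zero)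

lemma stp_Fil: "stp n <= Fil (Suc n)"
proof
 fix x assume "x : stp n"
 then obtain a b where ab: "a : Fil n" "into (Suc n) (Fil n) b" "x = a +[M] step (Suc n) b" by (rule stpE)
 have "step (Suc n) b : Fil (Suc n)" using ab(2) Fil_step by (intro step_mem[OF Fil_subspace]) (auto simp: into_def)
 moreover have "a : Fil (Suc n)" using ab(1) Fil_mono by blast
 ultimately show "x : Fil (Suc n)" unfolding ab(3) using FilD(3) by blast
qed

lemma stp_add: assumes "x : stp n" "y : stp n" shows "x +[M] y : stp n"
proof -
 obtain a b where 1: "a : Fil n" "into (Suc n) (Fil n) b" "x = a +[M] step (Suc n) b" using assms(1) by (rule stpE)
 obtain a' b' where 2: "a' : Fil n" "into (Suc n) (Fil n) b'" "y = a' +[M] step (Suc n) b'" using assms(2) by (rule stpE)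
 note c = into_Fil_carrier[OF 1(2)] into_Fil_carrier[OF 2(2)] FilD(6)[OF 1(1)] FilD(6)[OF 2(1)]
 have "x +[M] y = (a +[M] a') +[M] (step (Suc n) b +[M] step (Suc n) b')" unfolding 1(3) 2(3) using c step_closed by (simp add: M.a_ac)
 also have "step (Suc n) b +[M] step (Suc n) b' = step (Suc n) (%p q. b p q +[M] b' p q)" using c by (simp add: step_add)
 finally show ?thesis using stpI[OF FilD(3)[OF 1(1) 2(1)], of "%p q. b p q +[M] b' p q"] 1(2) 2(2) FilD(3) by (simp add: into_def)
qed

lemma stp_kap: assumes "x : stp n" "c <: K" shows "ka c *:[M] x : stp n"
proof -
 obtain a b where 1: "a : Fil n" "into (Suc n) (Fil n) b" "x = a +[M] step (Suc n) b" using assms(1) by (rule stpE)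
 note c = into_Fil_carrier[OF 1(2)] FilD(6)[OF 1(1)]
 have "ka c *:[M] x = ka c *:[M] a +[M] step (Suc n) (%p q. ka c *:[M] b p q)"
 unfolding 1(3) using c assms(2) by (simp add: M.smult_r_distr ka_step step_closed)
 thus ?thesis using stpI[OF FilD(4)[OF assms(2) 1(1)], of "%p q. ka c *:[M] b p q"] 1(2) FilD(4)[OF assms(2)] by (simp add: into_def)
qed

text \<open>A basis element has to belong to a single vertex \<open>u\<close>, since it is meant to
  generate a summand isomorphic to \<open>L nu u\<close>.\<close>

definition homog :: "nat => 'm set" where "homog n = {y : Fil (Suc n). EX u:V. nu u *:[M] y = y}"

definition indep_mod :: "nat => 'm set => bool" where "indep_mod n B <-> B <= homog n & (ALL S c. finite S --> S <= B --> c : S ->: K -->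
 M.lcomb (%i. ka (c i)) (%i. i) S : stp n --> (ALL y:S. c y = 0[K]))"

text \<open>Zorn's lemma, as a level may have infinite dimension. A linear dependence involves
  finitely many elements, so the union of a chain is again independent.\<close>

lemma max_indep: "EX B. indep_mod n B & (ALL B'. indep_mod n B' --> B <= B' --> B' = B)"
proof -
 have "EX B:{B. indep_mod n B}. ALL X:{B. indep_mod n B}. B <= X --> X = B"
 proof (rule subset_Zorn_nonempty)
 have "indep_mod n {}" by (simp add: indep_mod_def)
 thus "{B. indep_mod n B} ~= {}" by blast
 next
 fix C assume C: "C ~= {}" "subset.chain {B. indep_mod n B} C"
 have Ci: "indep_mod n X" if "X : C" for X using C(2) that unfolding subset.chain_def by blast
 have "\<Union>C <= homog n" using Ci unfolding indep_mod_def by blast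
 moreover have "ALL y:S. c y = 0[K]" if S: "finite S" "S <= \<Union>C" "c : S ->: K" "M.lcomb (%i. ka (c i)) (%i. i) S : stp n" for S c proof -
 obtain X where "X : C" "S <= X" by (rule finite_subset_Union_chain[OF S(1,2) C])
 thus ?thesis using Ci S unfolding indep_mod_def by blast
 qed
 ultimately show "\<Union>C : {B. indep_mod n B}" unfolding indep_mod_def by blast
 qed
 thus ?thesis by blast
qed

definition Bas :: "nat => 'm set" where "Bas n = (SOME B. indep_mod n B & (ALL B'. indep_mod n B' --> B <= B' --> B' = B))"

lemma Bas_indep: "indep_mod n (Bas n)" and Bas_max: "[|indep_mod n B'; Bas n <= B'|] ==> B' = Bas n"
 using someI_ex[OF max_indep[of n]] unfolding Bas_def by blast+

lemma Bas_homog: "y : Bas n ==> y : homog n" using Bas_indep unfolding indep_mod_def by blast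

definition vtx :: "'m => 'v" where "vtx y = (SOME u. u : V & nu u *:[M] y = y)"

lemma vtx: assumes "y : homog n" shows "vtx y : V" "nu (vtx y) *:[M] y = y"
proof -
 have "EX u. u : V & nu u *:[M] y = y" using assms by (auto simp: homog_def)
 from someI_ex[OF this] show "vtx y : V" "nu (vtx y) *:[M] y = y" unfolding vtx_def by auto
qed

lemma homog_carrier: "y : homog n ==> y <: M" using FilD(6) by (auto simp: homog_def)

lemma kspan_Bas_subspace: "subspace (kspan (%i. i) (Bas n))"
 using vtx[OF Bas_homog] homog_carrier[OF Bas_homog] by (intro kspan_subspace[where u = vtx]) auto

text \<open>Otherwise \<open>x\<close> could be added to the maximal set \<open>Bas n\<close>. In
  the relation that prevents this, the coefficient of \<open>x\<close> is nonzero, and dividing by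
  it solves for \<open>x\<close>.\<close>

lemma homog_span:
 assumes x: "x : homog n" shows "EX s t. s : stp n & t : kspan (%i. i) (Bas n) & x = s +[M] t"
proof (cases "x : Bas n")
 case True
 have "0[M] : stp n" by (rule Fil_stp[OF FilD(2)])
 moreover have "x : kspan (%i. i) (Bas n)" using kspan_mem[of x "Bas n" "%i. i"] True homog_carrier[OF x] by simp
 ultimately show ?thesis using homog_carrier[OF x] by (metis M.l_zero)
next
 case False
 hence "~ indep_mod n (insert x (Bas n))" using Bas_max[of n "insert x (Bas n)"] by blast
 moreover have "insert x (Bas n) <= homog n" using x Bas_homog by blast
 ultimately obtain S c where S: "finite S" "S <= insert x (Bas n)" "c : S ->: K"
 "M.lcomb (%i. ka (c i)) (%i. i) S : stp n" and nz: "~ (ALL y:S. c y = 0[K])" unfolding indep_mod_def by blast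
 have Sc: "i <: M" if "i : S" for i using that S(2) homog_carrier[OF Bas_homog] homog_carrier[OF x] by blast
 have cS: "ka (c i) <: L" if "i : S" for i using that S(3) ka_closed by blast
 let ?S = "S - {x}"
 let ?t = "M.lcomb (%i. ka (c i)) (%i. i) ?S"
 have sub: "?S <= Bas n" using S(2) by blast
 have tk: "?t : kspan (%i. i) (Bas n)" using S by (intro kspanI) auto
 have xS: "x : S"
 proof (rule ccontr)
 assume "x \<notin> S"
 hence "S <= Bas n" using S(2) by blast
 thus False using Bas_indep[of n] S nz unfolding indep_mod_def by blast
 qed
 have sum: "M.lcomb (%i. ka (c i)) (%i. i) S = ka (c x) *:[M] x +[M] ?t" proof -
 have "M.lcomb (%i. ka (c i)) (%i. i) (insert x ?S) = ka (c x) *:[M] x +[M] ?t"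
 unfolding M.lcomb_def using S(1) Sc cS xS by (intro M.finsum_insert) auto
 thus ?thesis using xS by (simp add: insert_absorb)
 qed
 have cx: "c x <: K" using S(3) xS by blast
 have tc: "?t <: M" by (rule subspaceD(6)[OF kspan_Bas_subspace tk])
 have cxn: "c x ~= 0[K]"
 proof
 assume 0: "c x = 0[K]"
 hence "?t : stp n" using S(4) tc homog_carrier[OF x] unfolding sum by (simp add: ka_zero)
 hence "ALL y:?S. c y = 0[K]" using Bas_indep[of n] S unfolding indep_mod_def by blast
 thus False using nz 0 by blast
 qed
 let ?d = "inv\<^bsub>K\<^esub> (c x)"
 have d: "?d <: K" "?d *[K] c x = 1[K]" using cx cxn U.K.field_Units by auto
 let ?s = "M.lcomb (%i. ka (c i)) (%i. i) S"
 have sc: "?s <: M" using S(4) stp_Fil FilD(6) by blast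
 have "ka (c x) *:[M] x = ?s +[M] -[M] ?t" unfolding sum using tc ka_act[OF cx homog_carrier[OF x]] by (simp add: M.a_assoc M.r_neg)
 hence "ka ?d *:[M] (ka (c x) *:[M] x) = ka ?d *:[M] ?s +[M] ka ?d *:[M] (-[M] ?t)" using sc tc d by (simp add: M.smult_r_distr)
 moreover have "ka ?d *:[M] (ka (c x) *:[M] x) = x" using d cx homog_carrier[OF x] by (simp add: ka_one flip: M.smult_assoc ka_kap)
 moreover have "ka ?d *:[M] ?s : stp n" by (rule stp_kap[OF S(4) d(1)])
 moreover have "ka ?d *:[M] (-[M] ?t) : kspan (%i. i) (Bas n)"
 by (rule subspaceD(4)[OF kspan_Bas_subspace d(1) subspaceD(7)[OF kspan_Bas_subspace tk]])
 ultimately show ?thesis by metis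
qed

text \<open>The vertices decompose the identity, so it is enough to treat the homogeneous pieces
  \<open>nu v *:[M] x\<close>.\<close>

lemma Fil_span:
 assumes x: "x : Fil (Suc n)" shows "EX s t. s : stp n & t : kspan (%i. i) (Bas n) & x = s +[M] t"
proof -
 let ?T = "{s +[M] t | s t. s : stp n & t : kspan (%i. i) (Bas n)}"
 have sc: "s <: M" if "s : stp n" for s using that stp_Fil FilD(6) by blast
 note kD = subspaceD[OF kspan_Bas_subspace[of n]]
 have "(sm M (%v. nu v *:[M] x) V) : ?T"
 proof (rule M.finsum_mem)
 have "0[M] +[M] 0[M] : ?T" using Fil_stp[OF FilD(2)] kD(2) by blast
 thus "0[M] : ?T" by simp
 show "?T <= car M" using sc kD(6) by auto
 fix y z assume "y : ?T" "z : ?T"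
 then obtain s t s' t' where 1: "s : stp n" "t : kspan (%i. i) (Bas n)" "y = s +[M] t"
 "s' : stp n" "t' : kspan (%i. i) (Bas n)" "z = s' +[M] t'" by blast
 have "y +[M] z = (s +[M] s') +[M] (t +[M] t')" unfolding 1(3,6) using sc[OF 1(1)] sc[OF 1(4)] kD(6)[OF 1(2)] kD(6)[OF 1(5)] by (simp add: M.a_ac)
 thus "y +[M] z : ?T" using stp_add[OF 1(1,4)] kD(3)[OF 1(2,5)] by blast
 next
 fix v assume v: "v : V"
 have "nu v *:[M] (nu v *:[M] x) = nu v *:[M] x" using v FilD(6)[OF x] by (simp add: nu_mult flip: M.smult_assoc)
 hence "nu v *:[M] x : homog n" using v FilD(5)[OF v x] by (auto simp: homog_def)
 from homog_span[OF this] show "nu v *:[M] x : ?T" by blast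
 qed
 thus ?thesis using sum_nu_act[OF FilD(6)[OF x]] by auto
qed

text \<open>One coefficient is tested at a time. In \<open>M \<times> L\<close> each
  \<open>y\<close> is lifted to \<open>(y, 0)\<close>, except for \<open>y0\<close>, whose second
  component is \<open>nu (vtx y0)\<close>. By the lifting theorem the first projection is injective
  on the submodule generated by these lifts, so a relation in \<open>M\<close> also holds in the
  second component, where only the term of \<open>y0\<close> is left.\<close>

lemma indep_L:
 assumes S: "finite S" "S <= (UN n. Bas n)" and l: "l : S ->: L" and z: "M.lcomb l (%i. i) S = 0[M]" and y0: "y0 : S"
 shows "l y0 *[L] nu (vtx y0) = 0[L]" proof -
 let ?R = "rmod L"
 let ?W = "dmod M ?R"
 have lmW: "lv_module K L V P opp peer ob side nu g ?W"
 by (intro lv_module.intro leavitt_axioms left_module_prod M.left_module_axioms left_module_regular U.A.ring_axioms)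
 interpret W: lv_module K L V P opp peer ob side nu g ?W by (rule lmW)
 define t where "t y = (y, if y = y0 then nu (vtx y0) else 0[L])" for y
 \<comment> \<open>The shift by one comes from \<open>Bas n\<close>, whose elements lie in
   \<open>Fil (Suc n)\<close>.\<close>
 define Y where "Y n = W.kspan t (case n of 0 => {} | Suc m => Bas m)" for n
 have hg: "y <: M" "vtx y : V" "nu (vtx y) *:[M] y = y" if "y : Bas n" for y n
 using vtx[OF Bas_homog[OF that]] homog_carrier[OF Bas_homog[OF that]] by auto
 obtain n0 where n0: "y0 : Bas n0" using y0 S(2) by blast
 have tc: "t y <: ?W" "nu (vtx y) *:[?W] t y = t y" if "y : Bas n" for y n using hg[OF that] by (auto simp: t_def prod_simps rmod_simps nu_mult)
 have hom: "leavitt_hom K L V P opp peer ob side nu g M ?W fst"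
 by (intro leavitt_hom.intro leavitt_hom_axioms.intro lv_module_axioms lmW) (auto simp: prod_simps)
 interpret fst: leavitt_hom K L V P opp peer ob side nu g M ?W fst by (rule hom)
 have fst_lin: "fst (W.M.lcomb l t T) = M.lcomb l (%i. i) T"
 if "l : T ->: L" "!!i. i : T ==> t i <: ?W" for l T
 proof -
 have "fst (W.M.lcomb l t T) = sm M (%i. fst (l i *:[?W] t i)) T"
 unfolding W.M.lcomb_def using that by (intro fst.pr_finsum) (auto intro!: W.M.smult_closed)
 also have "... = M.lcomb l (%i. i) T" by (simp add: M.lcomb_def prod_simps t_def)
 finally show ?thesis .
 qed
 have kaT: "(%i. ka (c i)) : T ->: L" if "c : T ->: K" for c T using that by (simp add: Pi_def)
 have lift: "lifting K L V P opp peer ob side nu g M Fil ?W fst Y"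
 proof (intro lifting.intro lifting_axioms.intro good_module_axioms hom)
 show "W.subspace (Y n)" for n unfolding Y_def using tc hg by (intro W.kspan_subspace[where u = vtx]) (auto split: nat.splits)
 next
 fix y n assume "y : Y n"
 then obtain c T where T: "finite T" "T <= (case n of 0 => {} | Suc m => Bas m)" "c : T ->: K"
 "y = W.M.lcomb (%i. ka (c i)) t T" unfolding Y_def W.kspan_def by blast
 have "fst y = M.lcomb (%i. ka (c i)) (%i. i) T" unfolding T(4) using T(2) tc(1) by (intro fst_lin[OF kaT[OF T(3)]]) (auto split: nat.splits)
 also have "... : Fil n" unfolding M.lcomb_def
 proof (rule subspace_finsum[OF Fil_subspace])
 fix i assume i: "i : T"
 hence "i : Fil n" using T(2) Bas_homog by (auto simp: homog_def split: nat.splits)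
 thus "ka (c i) *:[M] i : Fil n" using FilD(4) T(3) i by blast
 qed
 finally show "fst y : Fil n" .
 next
 fix x n assume "x : Fil (Suc n)"
 then obtain s k where sk: "s : stp n" "k : kspan (%i. i) (Bas n)" "x = s +[M] k" using Fil_span by blast
 obtain a b where ab: "a : Fil n" "into (Suc n) (Fil n) b" "s = a +[M] step (Suc n) b" by (rule stpE[OF sk(1)])
 obtain c T where T: "finite T" "T <= Bas n" "c : T ->: K" "k = M.lcomb (%i. ka (c i)) (%i. i) T" using sk(2) unfolding kspan_def by blast
 have "W.M.lcomb (%i. ka (c i)) t T : Y (Suc n)" unfolding Y_def using T by (auto intro: W.kspanI)
 moreover have "fst (W.M.lcomb (%i. ka (c i)) t T) = k" unfolding T(4) using T(2) tc(1) by (intro fst_lin[OF kaT[OF T(3)]]) auto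
 ultimately show "EX a b y. a : Fil n & into (Suc n) (Fil n) b & y : Y (Suc n) &
 x = a +[M] step (Suc n) b +[M] fst y" using ab sk(3) by metis
 next
 fix a n b y assume a: "a : Fil n" "into (Suc n) (Fil n) b" and y: "y : Y (Suc n)"
 and e: "a +[M] step (Suc n) b +[M] fst y = 0[M]"
 obtain c T where T: "finite T" "T <= Bas n" "c : T ->: K" "y = W.M.lcomb (%i. ka (c i)) t T" using y unfolding Y_def W.kspan_def by auto
 have f: "fst y = M.lcomb (%i. ka (c i)) (%i. i) T" unfolding T(4) using T(2) tc(1) by (intro fst_lin[OF kaT[OF T(3)]]) auto
 have sc: "a +[M] step (Suc n) b <: M" using FilD(6)[OF a(1)] step_closed[OF into_Fil_carrier[OF a(2)]] by simp
 have fc: "fst y <: M" unfolding f using kaT[OF T(3)] T(2) hg(1) by (intro M.lcomb_closed) auto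
 \<comment> \<open>As the negative of an element of \<open>stp n\<close>, the combination
   \<open>fst y\<close> lies in \<open>stp n\<close>, and independence modulo \<open>stp n\<close>
   forces its coefficients to vanish.\<close>
 have "fst y = -[M] (a +[M] step (Suc n) b)" using e sc fc by (metis M.a_comm M.minus_equality)
 also have "... = ka (-[K] 1[K]) *:[M] (a +[M] step (Suc n) b)" by (rule minus_kap[OF sc])
 also have "... : stp n" by (rule stp_kap[OF stpI[OF a]]) simp
 finally have "M.lcomb (%i. ka (c i)) (%i. i) T : stp n" unfolding f .
 hence c0: "ALL i:T. c i = 0[K]" using Bas_indep[of n] T(1-3) unfolding indep_mod_def by blast
 show "y = 0[?W]" unfolding T(4) using c0 T(2) tc(1) by (intro W.M.lcomb_zero) (auto simp: ka_zero)
 qed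
 interpret li: lifting K L V P opp peer ob side nu g M Fil ?W fst Y by (rule lift)
 have tS: "t i <: ?W" "t i : (UN n. li.Gam n)" if i: "i : S" for i proof -
 obtain n where n: "i : Bas n" using i S(2) by blast
 thus "t i <: ?W" by (rule tc)
 have "t i : Y (Suc n)" unfolding Y_def using n tc(1)[OF n] by (auto intro: W.kspan_mem)
 thus "t i : (UN n. li.Gam n)" using li.Gam_Y by blast
 qed
 have zero: "0[?W] : (UN n. li.Gam n)" using li.GamD(2) by blast
 have mem: "W.M.lcomb l t S : (UN n. li.Gam n)" unfolding W.M.lcomb_def
 proof (rule W.M.finsum_mem[OF zero])
 show "x +[?W] y : (UN n. li.Gam n)" if xy: "x : (UN n. li.Gam n)" "y : (UN n. li.Gam n)" for x y proof -
 obtain m n where "x : li.Gam m" "y : li.Gam n" using xy by blast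
 hence "x : li.Gam (max m n)" "y : li.Gam (max m n)" using li.Gam_mono_le[of m "max m n"] li.Gam_mono_le[of n "max m n"] by auto
 thus ?thesis using li.GamD(3) by blast
 qed
 show "(UN n. li.Gam n) <= car ?W" using li.GamD(1) by blast
 show "l i *:[?W] t i : (UN n. li.Gam n)" if "i : S" for i using li.act_Gam tS(2)[OF that] l that by blast
 qed
 have "fst (W.M.lcomb l t S) = 0[M]" using fst_lin[OF l tS(1)] z by simp
 hence W0: "W.M.lcomb l t S = 0[?W]" by (rule li.pr_inj_Union[OF mem])
 have lt: "l i *:[?W] t i <: ?W" if "i : S" for i using W.M.smult_closed[OF _ tS(1)[OF that]] l that by blast
 have "snd (W.M.lcomb l t S) = sm L (%i. snd (l i *:[?W] t i)) S" unfolding W.M.lcomb_def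
 by (rule add_finsum[OF W.M.M.ag U.M.ag, of snd]) (use lt in "auto simp: prod_simps(1,3) rmod_simps(1,3)")
 also have "... = snd (l y0 *:[?W] t y0)" using S(1) y0 l hg(2)[OF n0] by (intro U.M.finsum_delta) (auto simp: prod_simps rmod_simps t_def Pi_def)
 also have "... = l y0 *[L] nu (vtx y0)" by (simp add: prod_simps rmod_simps t_def)
 finally show ?thesis using W0 by (simp add: prod_simps rmod_simps)
qed

lemma Bas_generates: "car M <= M.lspan (UN n. Bas n)"
proof -
 let ?B = "UN n. Bas n"
 have B: "?B <= car M" using homog_carrier[OF Bas_homog] by blast
 have "Fil n <= M.lspan ?B" for n
 proof (induction n)
 case 0
 thus ?case using M.lspan_zero by (simp add: Fil_0)
 next
 case (Suc n)
 show ?case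
 proof
 fix x assume "x : Fil (Suc n)"
 then obtain s k where sk: "s : stp n" "k : kspan (%i. i) (Bas n)" "x = s +[M] k" using Fil_span by blast
 obtain a b where ab: "a : Fil n" "into (Suc n) (Fil n) b" "s = a +[M] step (Suc n) b" by (rule stpE[OF sk(1)])
 obtain c T where T: "finite T" "T <= Bas n" "c : T ->: K" "k = M.lcomb (%i. ka (c i)) (%i. i) T" using sk(2) unfolding kspan_def by blast
 have "k : M.lspan ?B" unfolding T(4) using T by (intro M.lspanI) (auto simp: Pi_def)
 moreover have "step (Suc n) b : M.lspan ?B" unfolding step_def
 proof (intro M.lspan_finsum[OF B])
 fix p q assume "p : level (Suc n)" "q : opp p"
 thus "g p q *:[M] b p q : M.lspan ?B" using ab(2) Suc by (intro M.lspan_smult[OF B] g_closed) (auto simp: into_def dest: levelD)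
 qed
 moreover have "a : M.lspan ?B" using ab(1) Suc by blast
 ultimately show "x : M.lspan ?B" unfolding sk(3) ab(3) by (intro M.lspan_add[OF B])
 qed
 qed
 thus ?thesis using Fil_ex by blast
qed

text \<open>Finitely many generators involve finitely many elements of the basis. These already
  generate everything, and a subset of an independent set is independent.\<close>

theorem finite_basis:
 assumes X: "finite X" "X <= car M" "car M <= M.lspan X"
 obtains S u where "finite S" "S <= car M" "car M <= M.lspan S" "!!y. y : S ==> u y : V & nu (u y) *:[M] y = y"
 "!!l y. [|l : S ->: L; M.lcomb l (%i. i) S = 0[M]; y : S|] ==> l y *[L] nu (u y) = 0[L]"
proof -
 have B: "(UN n. Bas n) <= car M" using homog_carrier[OF Bas_homog] by blast
 have "X <= M.lspan (UN n. Bas n)" using X(2) Bas_generates by blast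
 then obtain S where S: "finite S" "S <= (UN n. Bas n)" "X <= M.lspan S" by (rule M.lspan_mono_finite[OF X(1)])
 have Sc: "S <= car M" using S(2) B by blast
 have "car M <= M.lspan S" using X(3) M.lspan_lspan[OF Sc S(3)] by blast
 moreover have "vtx y : V & nu (vtx y) *:[M] y = y" if "y : S" for y using that S(2) vtx[OF Bas_homog] by blast
 ultimately show ?thesis using indep_L[OF S(1,2)] S(1) Sc by (intro that[of S vtx]) auto
qed

end

section \<open>Hair extensions\<close>

lemma algebra_isomorphicI:
 assumes A: "ualg K A" and B: "ualg K B" and h: "alg_map K A B h"
 and bij: "bij_betw h (car A) (car B)" and one: "h 1[A] = 1[B]" shows "algebra_isomorphic K A B" "algebra_isomorphic K B A"
proof -
 interpret A: unital_algebra K A by fact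
 interpret B: unital_algebra K B by fact
 have "h : ring_iso A B" using bij one alg_mapD[OF h] by (auto simp: ring_iso_def Ring.ring_hom_def)
 thus "algebra_isomorphic K A B" unfolding algebra_isomorphic_def using alg_mapD(4)[OF h] by blast
 let ?k = "inv_into (car A) h"
 have k: "?k y <: A" "h (?k y) = y" if "y <: B" for y using bij that by (auto simp: bij_betw_def inv_into_into f_inv_into_f)
 have kI: "?k y = x" if "x <: A" "h x = y" for x y using bij that by (auto simp: bij_betw_def)
 have "?k : ring_iso B A" proof -
 have "?k (x *[B] y) = ?k x *[A] ?k y" "?k (x +[B] y) = ?k x +[A] ?k y"
 if "x <: B" "y <: B" for x y using k that alg_mapD[OF h] by (auto intro!: kI)
 moreover have "?k 1[B] = 1[A]" using one by (intro kI) auto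
 ultimately show ?thesis using bij_betw_inv_into[OF bij] k by (auto simp: ring_iso_def Ring.ring_hom_def)
 qed
 moreover have "?k (c *:[B] x) = c *:[A] ?k x" if "c <: K" "x <: B" for c x using k that alg_mapD[OF h] by (auto intro!: kI)
 ultimately show "algebra_isomorphic K B A" unfolding algebra_isomorphic_def by blast
qed

lemma alg_map_inj:
 assumes h: "alg_map K A B h" and A: "abelian_group A" and B: "abelian_group B" and ker: "!!x. [|x <: A; h x = 0[B]|] ==> x = 0[A]"
 shows "inj_on h (car A)"
proof
 interpret A: abelian_group A by fact
 interpret B: abelian_group B by fact
 fix x y assume xy: "x <: A" "y <: A" "h x = h y"
 have "h (x -[A] y) = h x -[B] h y" using additive_minus[OF A B, of h y] alg_mapD[OF h] xy by (simp add: a_minus_def)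
 hence "x -[A] y = 0[A]" using ker[of "x -[A] y"] xy alg_mapD(1)[OF h] B.minus_eq_zero_iff by simp
 thus "x = y" using A.minus_eq_zero_iff xy by simp
qed

locale hair = lpa_setup K E w for K :: "'k ring" and E :: "('v, 'e) pre_digraph" and w +
 fixes m :: "'v => nat"
begin

abbreviation "E' \<equiv> hair_extension E m"
abbreviation "w' \<equiv> hair_weight w :: 'e + 'v \<times> nat => nat"

lemma hair_verts: "s : vs E' <-> fst s : vs E & (snd s = 0 | snd s : {1..m (fst s) - 1})" by (cases s) (auto simp: hair_extension_def)

lemma hair_arcs: "arcs E' = Inl ` arcs E \<union> Inr ` {(v, j) | v j. v : vs E & j : {1..m v - 1}}" by (simp add: hair_extension_def)

lemma hair_ends: "tail E' (Inl e) = (tail E e, 0)" "head E' (Inl e) = (head E e, 0)"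
 "tail E' (Inr (v, j)) = (v, j)" "head E' (Inr (v, j)) = (v, j - 1)" by (simp_all add: hair_extension_def)

lemma hair_out: "out_arcs E' (v, 0) = Inl ` out_arcs E v" "j ~= 0 ==> (v, j) : vs E' ==> out_arcs E' (v, j) = {Inr (v, j)}"
 by (auto simp: hair_arcs hair_ends hair_verts)

lemma fin_hair: "fin_digraph E'"
proof
 fix e assume e: "e : arcs E'"
 show "tail E' e : vs E'" "head E' e : vs E'" using e by (auto simp: hair_arcs hair_ends hair_verts)
next
 have "vs E' <= Sigma (vs E) (%v. {0..m v})" by (auto simp: hair_verts)
 thus "finite (vs E')" by (rule finite_subset) simp
 have "{(v, j) | v j. v : vs E & j : {1..m v - 1}} = Sigma (vs E) (%v. {1..m v - 1})" by auto
 thus "finite (arcs E')" by (simp add: hair_arcs)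
qed

lemma regular_hair: "(v, j) : regular_verts E' <-> (j = 0 & v : regular_verts E) | (j ~= 0 & (v, j) : vs E')"
proof (cases "j = 0")
 case True
 have "finite (out_arcs E v)" by auto
 thus ?thesis using True hair_out(1)[of v] by (simp add: regular_verts_def hair_verts)
next
 case False
 thus ?thesis by (auto simp: regular_verts_def hair_out)
qed

lemma vwg_hair: "vertex_weighted_graph E' w'"
proof -
 interpret F: fin_digraph E' by (rule fin_hair)
 show ?thesis
 proof
 fix e assume "e : arcs E'"
 thus "0 < w' e" by (auto simp: hair_arcs hair_weight_def weight_pos)
 next
 show "row_finite E'" by (auto simp: row_finite_def)
 next
 fix s e e' assume s: "s : regular_verts E'" and e: "e : out_arcs E' s" "e' : out_arcs E' s"
 obtain v j where sv: "s = (v, j)" by (cases s)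
 show "w' e = w' e'"
 proof (cases "j = 0")
 case True
 then obtain d d' where d: "e = Inl d" "e' = Inl d'" "d : out_arcs E v" "d' : out_arcs E v" "v : regular_verts E"
 using s e hair_out(1)[of v] regular_hair[of v 0] unfolding sv by auto
 thus ?thesis using weight_eq[OF d(5,3,4)] by (simp add: hair_weight_def)
 next
 case False
 hence "e = Inr (v, j)" "e' = Inr (v, j)" using s e regular_hair[of v j] hair_out(2)[of j v] unfolding sv by simp_all
 thus ?thesis by simp
 qed
 qed
qed

sublocale H: lpa_setup K E' w' by (intro lpa_setup.intro fin_hair vwg_hair K.field_axioms)

lemma vertex_weight_hair: "vertex_weight E' w' (v, 0) = vertex_weight E w v" "j ~= 0 ==> (v, j) : vs E' ==> vertex_weight E' w' (v, j) = 1"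
 by (auto simp: vertex_weight_def hair_out hair_weight_def image_image)

fun up :: "('v, 'e) idx => ('v \<times> nat, 'e + 'v \<times> nat) idx" where "up (Src v i) = Src (v, 0) i"
| "up (Out e) = Out (Inl e)"

text \<open>A new vertex \<open>s\<close> on a hair emits one edge, of weight one, so its two
  matrices have size one; \<open>hs s\<close> and \<open>ho s\<close> are their only
  indices.\<close>

definition hs :: "'v \<times> nat => ('v \<times> nat, 'e + 'v \<times> nat) idx" where "hs s = Src s 1"
definition ho :: "'v \<times> nat => ('v \<times> nat, 'e + 'v \<times> nat) idx" where "ho s = Out (Inr s)"

definition hairs :: "('v \<times> nat) set" where "hairs = {s : vs E'. snd s ~= 0}"

definition below :: "'v \<times> nat => 'v \<times> nat" where "below s = (fst s, snd s - 1)"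

lemma up_inj: "up p = up q <-> p = q" by (cases p; cases q) auto

lemma ix_hair: "ix E' w' = up ` ix E w \<union> hs ` hairs \<union> ho ` hairs"
proof (intro equalityI subsetI)
 fix p assume p: "p : ix E' w'"
 show "p : up ` ix E w \<union> hs ` hairs \<union> ho ` hairs"
 proof (cases p)
 case (Src s i)
 obtain v j where s: "s = (v, j)" by (cases s)
 have r: "(v, j) : regular_verts E'" "i : {1..vertex_weight E' w' (v, j)}" using p unfolding Src s ix_def by auto
 show ?thesis
 proof (cases "j = 0")
 case True
 hence "Src v i : ix E w" using r Src_idxs by (simp add: regular_hair vertex_weight_hair)
 hence "up (Src v i) : up ` ix E w" by (rule imageI)
 thus ?thesis using True Src s by simp
 next
 case False
 hence "i = 1" "(v, j) : hairs" using r by (auto simp: regular_hair vertex_weight_hair hairs_def)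
 hence "p = hs (v, j)" using Src s by (simp add: hs_def)
 thus ?thesis using `(v, j) : hairs` by blast
 qed
 next
 case (Out e)
 hence e: "e : arcs E'" using p unfolding ix_def by auto
 show ?thesis
 proof (cases e)
 case (Inl d)
 hence "up (Out d) : up ` ix E w" using e by (intro imageI) (auto simp: ix_def hair_arcs)
 thus ?thesis using Inl Out by simp
 next
 case (Inr s)
 hence "s : hairs" using e by (auto simp: hairs_def hair_arcs hair_verts)
 hence "ho s : ho ` hairs" by (rule imageI)
 thus ?thesis using Inr Out by (simp add: ho_def)
 qed
 qed
next
 fix p assume "p : up ` ix E w \<union> hs ` hairs \<union> ho ` hairs"
 then consider p0 where "p0 : ix E w" "p = up p0" | s where "s : hairs" "p = hs s" | s where "s : hairs" "p = ho s" by blast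
 thus "p : ix E' w'"
 proof cases
 case 1
 show ?thesis
 proof (cases p0)
 case (Src v i)
 hence "v : regular_verts E" "i : {1..vertex_weight E w v}" using 1 unfolding ix_def by auto
 thus ?thesis using H.Src_idxs[of "(v, 0)" i] 1 Src by (simp add: regular_hair vertex_weight_hair)
 next
 case (Out e)
 thus ?thesis using 1 by (auto simp: ix_def hair_arcs)
 qed
 next
 case 2
 obtain v j where s: "s = (v, j)" by (cases s)
 thus ?thesis using H.Src_idxs[of "(v, j)" 1] 2 by (auto simp: hs_def regular_hair vertex_weight_hair hairs_def)
 next
 case 3
 thus ?thesis by (cases s) (auto simp: ix_def ho_def hair_arcs hairs_def hair_verts)
 qed
qed

lemma hair_out_hairs: "s : hairs ==> out_arcs E' s = {Inr s} & vertex_weight E' w' s = 1"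
 by (cases s) (use hair_out(2) vertex_weight_hair(2) in "simp add: hairs_def")

lemma hair_ends_Inr: "tail E' (Inr s) = s" "head E' (Inr s) = below s" by (cases s; simp add: hair_ends below_def)+

lemma opp_hair: "opp E' w' (up p) = up ` opp E w p" "s : hairs ==> opp E' w' (hs s) = {ho s}" "s : hairs ==> opp E' w' (ho s) = {hs s}"
 by (cases p; simp add: hair_out vertex_weight_hair hair_ends image_image) (simp_all add: hs_def ho_def hair_out_hairs hair_ends_Inr)

lemma peer_hair: "peer E' w' (up p) = up ` peer E w p" "s : hairs ==> peer E' w' (hs s) = {hs s}" "s : hairs ==> peer E' w' (ho s) = {ho s}"
 by (cases p; simp add: hair_out vertex_weight_hair hair_ends image_image) (simp_all add: hs_def ho_def hair_out_hairs hair_ends_Inr)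

lemma ob_hair: "ob E' (up p) = (ob E p, 0)" "ob E' (hs s) = s" "ob E' (ho s) = below s"
 by (cases p; simp add: hair_ends) (simp_all add: hs_def ho_def hair_ends_Inr)

lemma below_verts: "s : hairs ==> below s : vs E' & fst (below s) = fst s" by (auto simp: hairs_def hair_verts below_def)

lemma base_verts: "v : vs E ==> (v, 0) : vs E'" by (simp add: hair_verts)

lemma hairs_verts: "s : hairs ==> s : vs E'" by (simp add: hairs_def)

end

text \<open>Both maps take the same value at \<open>1[L]\<close>, since it is the sum of the
  vertices; \<open>L_generated\<close> does the rest.\<close>

lemma alg_map_ext:
 fixes E :: "('v, 'e) pre_digraph" and w
 assumes "lpa_setup K E w" and B: "ualg K B"
 defines "L \<equiv> leavitt_path_algebra K E w"
 assumes h: "alg_map K L B h" and h': "alg_map K L B h'" and nu: "!!v. v : vs E ==> h (lpa_setup.nu K E w v) = h' (lpa_setup.nu K E w v)"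
 and g: "!!p q. [|p : ix E w; q : opp E w p|] ==> h (lpa_setup.g K E w p q) = h' (lpa_setup.g K E w p q)" and x: "x <: L" shows "h x = h' x"
proof -
 interpret lpa_setup K E w by fact
 interpret B: unital_algebra K B by fact
 note hD = alg_mapD[OF h, unfolded L_def] and hD' = alg_mapD[OF h', unfolded L_def]
 have z: "h 0[L] = h' 0[L]" using alg_map_zero[OF h] alg_map_zero[OF h'] fam.B.ag B.M.ag unfolding L_def by simp
 have fm: "k (sm L nu (vs E)) = sm B (%v. k (nu v)) (vs E)" if "alg_map K L B k" for k
 by (rule alg_map_finsum[OF that[unfolded L_def] fam.B.ag B.M.ag, folded L_def]) (simp add: L_def)
 have one: "h 1[L] = h' 1[L]" using fm[OF h] fm[OF h'] hD(1)[OF nu_L] unfolding lv.one_sum L_def by (simp add: nu cong: B.M.finsum_cong)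
 have "car L = {y : car L. h y = h' y}" unfolding L_def by (rule L_generated)
 (use z one nu g hD hD' in "auto simp: L_def lv.U.mult_closed nu_L g_L fam.B.add.m_closed")
 thus ?thesis using x by blast
qed

section \<open>Homomorphisms out of the algebra of a hair extension\<close>

context hair
begin

fun down :: "('v \<times> nat, 'e + 'v \<times> nat) idx => ('v, 'e) idx" where "down (Src s i) = Src (fst s) i"
| "down (Out (Inl e)) = Out e"
| "down (Out (Inr s)) = undefined"

text \<open>Between old indices this is \<open>G\<close>. The edge at a hair vertex \<open>s\<close>
  and its ghost become the two matrix units between \<open>s\<close> and
  \<open>below s\<close>.\<close>

definition glue :: "(('v, 'e) idx => ('v, 'e) idx => 'b) => ('v \<times> nat => 'v \<times> nat => 'b) =>
 ('v \<times> nat, 'e + 'v \<times> nat) idx => ('v \<times> nat, 'e + 'v \<times> nat) idx => 'b" where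
 "glue G Eb p q = (case p of Out (Inr s) => Eb (below s) s |
 _ => (case q of Out (Inr s) => Eb s (below s) | _ => G (down p) (down q)))"

lemma glue_up: "glue G Eb (up p) (up q) = G p q" by (cases p; cases q) (auto simp: glue_def)

lemma glue_hair: "glue G Eb (hs s) (ho s) = Eb s (below s)" "glue G Eb (ho s) (hs s) = Eb (below s) s" by (auto simp: glue_def hs_def ho_def)

text \<open>A case rule for the matrix entries: old ones, an edge of a hair, or its ghost.\<close>

lemma hair_all_opp:
 assumes "!!p q. [|p : ix E w; q : opp E w p|] ==> Q (up p) (up q)" and "!!s. s : hairs ==> Q (hs s) (ho s)" "!!s. s : hairs ==> Q (ho s) (hs s)"
 and "p : ix E' w'" "q : opp E' w' p" shows "Q p q"
proof -
 consider p0 where "p0 : ix E w" "p = up p0" | s where "s : hairs" "p = hs s" | s where "s : hairs" "p = ho s"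
 using assms(4) unfolding ix_hair by blast
 thus ?thesis by cases (use assms opp_hair in auto)
qed

lemma hair_all_peer:
 assumes "!!p p'. [|p : ix E w; p' : peer E w p|] ==> Q (up p) (up p')"
 and "!!s. s : hairs ==> Q (hs s) (hs s)" "!!s. s : hairs ==> Q (ho s) (ho s)" and "p : ix E' w'" "p' : peer E' w' p" shows "Q p p'"
proof -
 consider p0 where "p0 : ix E w" "p = up p0" | s where "s : hairs" "p = hs s" | s where "s : hairs" "p = ho s"
 using assms(4) unfolding ix_hair by blast
 thus ?thesis by cases (use assms peer_hair in auto)
qed

lemma below_hairs: assumes "s : hairs" shows "s : vs E'" "below s : vs E'" "fst (below s) = fst s" "below s ~= s"
 by (rule hairs_verts[OF assms], use below_verts[OF assms] in simp_all) (use assms in "cases s; clarsimp simp: below_def hairs_def; arith")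

end

text \<open>What an algebra \<open>B\<close> has to contain in order to receive a map from
  \<open>H.L\<close>: an image of \<open>L\<close>, and matrix units linking the vertices of each
  hair, compatible with it at the old vertices. The image of \<open>1[L]\<close> is in general only
  an idempotent of \<open>B\<close>.\<close>

locale hair_units = hair K E w m + B: unital_algebra K B
 for K :: "'k ring" and E :: "('v, 'e) pre_digraph" and w m and B :: "('k, 'b) module" +
 fixes psi and eps :: "'v \<times> nat => 'v \<times> nat => 'b"
 assumes psi: "alg_map K L B psi" and eps_closed: "[|s : vs E'; t : vs E'; fst s = fst t|] ==> eps s t <: B"
 and eps_mult: "[|s : vs E'; t : vs E'; fst s = fst t; t' : vs E'; r : vs E'; fst t' = fst r|] ==>
 eps s t *[B] eps t' r = (if t = t' then eps s r else 0[B])"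
 and eps_base: "v : vs E ==> eps (v, 0) (v, 0) = psi (nu v)"
begin

declare eps_closed [simp]

lemma glue_closed:
 assumes "p : ix E' w'" "q : opp E' w' p" shows "glue (%p q. psi (g p q)) eps p q <: B" by (rule hair_all_opp[OF _ _ _ assms])
 (use eps_closed below_hairs in "auto simp: glue_up glue_hair alg_mapD(1)[OF psi] g_L")

lemma relations_glue: "lpa_relations E' w' B (%s. eps s s) (glue (%p q. psi (g p q)) eps)" unfolding lpa_relations_def
proof (intro conjI ballI)
 let ?g = "glue (%p q. psi (g p q)) eps"
 note psiD = alg_mapD[OF psi]
 fix u v assume "u : vs E'" "v : vs E'"
 thus "eps u u *[B] eps v v = (if u = v then eps u u else 0[B])" using eps_mult by simp
next
 let ?g = "glue (%p q. psi (g p q)) eps"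
 note psiD = alg_mapD[OF psi]
 fix p q assume pq: "p : ix E' w'" "q : opp E' w' p"
 have b: "eps (v, 0) (v, 0) = psi (nu v)" if "v : vs E" for v using eps_base that by simp
 have 1: "psi (nu (ob E p)) *[B] psi (g p q) = psi (g p q)" "psi (g p q) *[B] psi (nu (ob E q)) = psi (g p q)"
 if "p : ix E w" "q : opp E w p" for p q
 using fam.nu_g[OF that] fam.g_nu[OF that] nu_L[OF ob_closed[OF that(1)]] nu_L[OF ob_closed[OF opp_P[OF that]]] g_L[OF that]
 by (simp_all flip: psiD(3))
 have c: "ob E p : vs E" "ob E q : vs E" if "p : ix E w" "q : opp E w p" for p q using ob_closed that opp_P[OF that] by auto
 show "eps (ob E' p) (ob E' p) *[B] ?g p q = ?g p q" by (rule hair_all_opp[OF _ _ _ pq])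
 (use below_hairs eps_mult in "auto simp: ob_hair glue_up glue_hair b c 1")
 show "?g p q *[B] eps (ob E' q) (ob E' q) = ?g p q" by (rule hair_all_opp[OF _ _ _ pq])
 (use below_hairs eps_mult in "auto simp: ob_hair glue_up glue_hair b c 1")
next
 let ?g = "glue (%p q. psi (g p q)) eps"
 note psiD = alg_mapD[OF psi]
 fix p p' assume pp: "p : ix E' w'" "p' : peer E' w' p"
 show "sm B (%q. ?g p q *[B] ?g q p') (opp E' w' p) = (if p = p' then eps (ob E' p) (ob E' p) else 0[B])"
 proof (rule hair_all_peer[OF _ _ _ pp])
 fix p p' assume p: "p : ix E w" "p' : peer E w p"
 have gc: "g p q <: L" "g q p' <: L" if "q : opp E w p" for q using g_L[OF p(1) that] g_L[OF opp_P[OF p(1) that] opp_mem[OF p(1) that p(2)]] by auto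
 have "sm B (%q. ?g (up p) q *[B] ?g q (up p')) (opp E' w' (up p)) = sm B (%q. ?g (up p) (up q) *[B] ?g (up q) (up p')) (opp E w p)"
 unfolding opp_hair using gc by (intro B.M.finsum_reindex) (auto simp: inj_on_def up_inj glue_up psiD)
 also have "... = sm B (%q. psi (g p q *[L] g q p')) (opp E w p)" unfolding glue_up using gc by (intro B.M.finsum_cong') (auto simp: psiD)
 also have "... = psi (sm L (%q. g p q *[L] g q p') (opp E w p))" using gc by (intro alg_map_finsum[OF psi fam.B.ag B.M.ag, symmetric]) auto
 also have "... = (if up p = up p' then eps (ob E' (up p)) (ob E' (up p)) else 0[B])"
 unfolding fam.g_g[OF p] using eps_base[OF ob_closed[OF p(1)], symmetric]
 alg_map_zero[OF psi fam.B.ag B.M.ag] by (auto simp: up_inj ob_hair)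
 finally show "sm B (%q. ?g (up p) q *[B] ?g q (up p')) (opp E' w' (up p)) = (if up p = up p' then eps (ob E' (up p)) (ob E' (up p)) else 0[B])" .
 qed (use below_hairs eps_mult eps_closed in "auto simp: opp_hair glue_hair ob_hair")
qed

lemma hair_universal:
 obtains phi where "alg_map K H.L B phi" "!!s. s : vs E' ==> phi (H.nu s) = eps s s"
 "!!p q. [|p : ix E w; q : opp E w p|] ==> phi (H.g (up p) (up q)) = psi (g p q)" "!!s. s : hairs ==> phi (H.g (hs s) (ho s)) = eps s (below s)"
 "!!s. s : hairs ==> phi (H.g (ho s) (hs s)) = eps (below s) s"
proof -
 obtain phi where phi: "alg_map K H.L B phi" "!!s. s : vs E' ==> phi (H.nu s) = eps s s"
 "!!p q. [|p : ix E' w'; q : opp E' w' p|] ==> phi (H.g p q) = glue (%p q. psi (g p q)) eps p q"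
 by (rule H.L_universal[OF B.unital_algebra_axioms relations_glue _ glue_closed]) (use eps_closed in auto)
 show ?thesis
 proof (rule that[OF phi(1,2)])
 show "phi (H.g (up p) (up q)) = psi (g p q)" if pq: "p : ix E w" "q : opp E w p" for p q
 using phi(3)[of "up p" "up q"] pq by (simp add: ix_hair opp_hair glue_up)
 qed (use phi(3) in "auto simp: ix_hair opp_hair glue_hair")
qed

end

section \<open>The copy of \<open>L\<close> inside the algebra of a hair extension\<close>

context hair
begin

text \<open>The map given by the universal property; it sends \<open>1[L]\<close> to the sum of the
  old vertices \<open>(v, 0)\<close>.\<close>

definition emb where "emb = (SOME h. alg_map K L H.L h & (ALL v:vs E. h (nu v) = H.nu (v, 0)) &
 (ALL p:ix E w. ALL q:opp E w p. h (g p q) = H.g (up p) (up q)))"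

lemma up_closed: "[|p : ix E w; q : opp E w p|] ==> up p : ix E' w' & up q : opp E' w' (up p)" by (simp add: ix_hair opp_hair)

lemma emb: "alg_map K L H.L emb" "v : vs E ==> emb (nu v) = H.nu (v, 0)" "[|p : ix E w; q : opp E w p|] ==> emb (g p q) = H.g (up p) (up q)"
proof -
 let ?g = "%p q. H.g (up p) (up q)"
 have gg: "sm H.L (%q. ?g p q *[H.L] ?g q p') (opp E w p) = (if p = p' then H.nu (ob E p, 0) else 0[H.L])"
 if p: "p : ix E w" "p' : peer E w p" for p p'
 proof -
 have pp: "up p : ix E' w'" "up p' : peer E' w' (up p)" using p by (auto simp: ix_hair peer_hair)
 have c: "H.g (up p) q *[H.L] H.g q (up p') <: H.L" if "q : opp E' w' (up p)" for q
 using H.g_L[OF pp(1) that] H.g_L[OF H.opp_P[OF pp(1) that] H.opp_mem[OF pp(1) that pp(2)]] by (rule H.lv.U.mult_closed)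
 have "sm H.L (%q. H.g (up p) q *[H.L] H.g q (up p')) (opp E' w' (up p)) = sm H.L (%q. ?g p q *[H.L] ?g q p') (opp E w p)"
 unfolding opp_hair using c by (intro H.fam.B.finsum_reindex) (auto simp: inj_on_def up_inj opp_hair)
 thus ?thesis using H.fam.g_g[OF pp] by (auto simp: up_inj ob_hair)
 qed
 obtain h where "alg_map K L H.L h" "!!v. v : vs E ==> h (nu v) = H.nu (v, 0)"
 "!!p q. [|p : ix E w; q : opp E w p|] ==> h (g p q) = H.g (up p) (up q)"
 proof (rule L_universal[OF H.unital_L, of "%v. H.nu (v, 0)" "%p q. H.g (up p) (up q)"])
 show "lpa_relations E w H.L (%v. H.nu (v, 0)) ?g" unfolding lpa_relations_def
 proof (intro conjI ballI)
 fix p q assume pq: "p : ix E w" "q : opp E w p"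
 show "H.nu (ob E p, 0) *[H.L] ?g p q = ?g p q" "?g p q *[H.L] H.nu (ob E q, 0) = ?g p q"
 using H.fam.nu_g H.fam.g_nu up_closed[OF pq] ob_hair by metis+
 next
 fix u v assume "u : vs E" "v : vs E"
 thus "H.nu (u, 0) *[H.L] H.nu (v, 0) = (if u = v then H.nu (u, 0) else 0[H.L])"
 using H.fam.nu_mult[of "(u, 0)" "(v, 0)"] by (auto simp: base_verts)
 qed (rule gg)
 show "H.nu (v, 0) <: H.L" if "v : vs E" for v by (rule H.nu_L[OF base_verts[OF that]])
 show "H.g (up p) (up q) <: H.L" if "p : ix E w" "q : opp E w p" for p q using H.g_L up_closed[OF that] by blast
 qed blast
 hence "EX h. alg_map K L H.L h & (ALL v:vs E. h (nu v) = H.nu (v, 0)) & (ALL p:ix E w. ALL q:opp E w p. h (g p q) = H.g (up p) (up q))" by blast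
 from someI_ex[OF this] show "alg_map K L H.L emb" "v : vs E ==> emb (nu v) = H.nu (v, 0)"
 "[|p : ix E w; q : opp E w p|] ==> emb (g p q) = H.g (up p) (up q)" unfolding emb_def by blast+
qed

abbreviation hmult (infixl "**" 70) where "x ** y \<equiv> x *[H.L] y"

text \<open>The path along the hair from \<open>(v, j)\<close> down to \<open>(v, 0)\<close>, and in
  \<open>rs\<close> its ghost. They are inverse to each other between these two vertices, since all
  matrices along a hair have size one.\<close>

fun dn :: "'v => nat => (('v \<times> nat, 'e + 'v \<times> nat) lpa_gen list => 'k) set" where "dn v 0 = H.nu (v, 0)"
| "dn v (Suc j) = H.g (hs (v, Suc j)) (ho (v, Suc j)) ** dn v j"

fun rs :: "'v => nat => (('v \<times> nat, 'e + 'v \<times> nat) lpa_gen list => 'k) set" where "rs v 0 = H.nu (v, 0)"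
| "rs v (Suc j) = rs v j ** H.g (ho (v, Suc j)) (hs (v, Suc j))"

lemma hair_g:
 assumes "s : hairs" shows "H.g (hs s) (ho s) <: H.L" "H.g (ho s) (hs s) <: H.L"
 "H.nu s ** H.g (hs s) (ho s) = H.g (hs s) (ho s)" "H.g (hs s) (ho s) ** H.nu (below s) = H.g (hs s) (ho s)"
 "H.nu (below s) ** H.g (ho s) (hs s) = H.g (ho s) (hs s)" "H.g (ho s) (hs s) ** H.nu s = H.g (ho s) (hs s)"
 "H.g (hs s) (ho s) ** H.g (ho s) (hs s) = H.nu s" "H.g (ho s) (hs s) ** H.g (hs s) (ho s) = H.nu (below s)"
proof -
 have p: "hs s : ix E' w'" "ho s : ix E' w'" and q: "ho s : opp E' w' (hs s)" "hs s : opp E' w' (ho s)"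
 using assms by (auto simp: ix_hair opp_hair)
 show c: "H.g (hs s) (ho s) <: H.L" "H.g (ho s) (hs s) <: H.L" using p q by auto
 show "H.nu s ** H.g (hs s) (ho s) = H.g (hs s) (ho s)" "H.g (hs s) (ho s) ** H.nu (below s) = H.g (hs s) (ho s)"
 "H.nu (below s) ** H.g (ho s) (hs s) = H.g (ho s) (hs s)" "H.g (ho s) (hs s) ** H.nu s = H.g (ho s) (hs s)"
 using H.fam.nu_g[OF p(1) q(1)] H.fam.g_nu[OF p(1) q(1)] H.fam.nu_g[OF p(2) q(2)] H.fam.g_nu[OF p(2) q(2)] by (simp_all add: ob_hair)
 show "H.g (hs s) (ho s) ** H.g (ho s) (hs s) = H.nu s" "H.g (ho s) (hs s) ** H.g (hs s) (ho s) = H.nu (below s)"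
 using H.fam.g_g[OF p(1), of "hs s"] H.fam.g_g[OF p(2), of "ho s"] assms c by (simp_all add: opp_hair peer_hair ob_hair)
qed

lemma Suc_hair: "(v, Suc j) : vs E' ==> (v, Suc j) : hairs & below (v, Suc j) = (v, j) & (v, j) : vs E'"
 by (auto simp: hairs_def below_def hair_verts)

lemmas Hmc = H.lv.U.mult_closed
lemmas Hma = H.lv.U.mult_assoc

lemma path_closed: "(v, j) : vs E' ==> dn v j <: H.L" "(v, j) : vs E' ==> rs v j <: H.L"
 by (induction j) (use Suc_hair hair_g H.nu_L in "auto intro!: Hmc")

lemma path_ends:
 assumes "(v, j) : vs E'" shows "H.nu (v, j) ** dn v j = dn v j" "rs v j ** H.nu (v, j) = rs v j"
 "dn v j ** H.nu (v, 0) = dn v j" "H.nu (v, 0) ** rs v j = rs v j"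
proof -
 have "H.nu (v, j) ** dn v j = dn v j & rs v j ** H.nu (v, j) = rs v j &
 dn v j ** H.nu (v, 0) = dn v j & H.nu (v, 0) ** rs v j = rs v j" using assms
 proof (induction j)
 case 0
 thus ?case using H.fam.nu_mult by simp
 next
 case (Suc j)
 note h = Suc_hair[OF Suc.prems]
 have b: "(v, 0) : vs E'" using Suc.prems by (auto simp: hair_verts)
 note c = hair_g[OF conjunct1[OF h]] path_closed[of v j] H.nu_L[OF Suc.prems] H.nu_L[OF b]
 show ?case using c h Suc.IH by (simp flip: Hma) (simp add: Hma)
 qed
 thus "H.nu (v, j) ** dn v j = dn v j" "rs v j ** H.nu (v, j) = rs v j" "dn v j ** H.nu (v, 0) = dn v j" "H.nu (v, 0) ** rs v j = rs v j" by auto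
qed

lemma path_paths:
 assumes "(v, j) : vs E'" shows "rs v j ** dn v j = H.nu (v, 0)" "dn v j ** rs v j = H.nu (v, j)"
proof -
 have "rs v j ** dn v j = H.nu (v, 0) & dn v j ** rs v j = H.nu (v, j)" using assms
 proof (induction j)
 case 0
 thus ?case using H.fam.nu_mult by simp
 next
 case (Suc j)
 note h = Suc_hair[OF Suc.prems]
 note c = hair_g[OF conjunct1[OF h]]
 let ?a = "H.g (hs (v, Suc j)) (ho (v, Suc j))" and ?b = "H.g (ho (v, Suc j)) (hs (v, Suc j))"
 have d: "dn v j <: H.L" "rs v j <: H.L" using path_closed h by auto
 have "rs v (Suc j) ** dn v (Suc j) = rs v j ** (?b ** ?a) ** dn v j" using c(1,2) d by (simp add: Hma)
 also have "... = H.nu (v, 0)" using c(8) h path_ends[of v j] Suc.IH by simp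
 finally have 1: "rs v (Suc j) ** dn v (Suc j) = H.nu (v, 0)" .
 have "dn v (Suc j) ** rs v (Suc j) = ?a ** (dn v j ** rs v j) ** ?b" using c(1,2) d by (simp add: Hma)
 also have "... = H.nu (v, Suc j)" using c(4,7) h Suc.IH by simp
 finally show ?case using 1 by blast
 qed
 thus "rs v j ** dn v j = H.nu (v, 0)" "dn v j ** rs v j = H.nu (v, j)" by auto
qed

definition dnp where "dnp s = dn (fst s) (snd s)"
definition rsp where "rsp s = rs (fst s) (snd s)"

lemma pathp:
 assumes "s : vs E'" shows "dnp s <: H.L" "rsp s <: H.L" "H.nu s ** dnp s = dnp s" "rsp s ** H.nu s = rsp s"
 "dnp s ** H.nu (fst s, 0) = dnp s" "H.nu (fst s, 0) ** rsp s = rsp s" "rsp s ** dnp s = H.nu (fst s, 0)" "dnp s ** rsp s = H.nu s" "fst s : vs E"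
proof -
 obtain v j where s: "s = (v, j)" by (cases s)
 have "(v, j) : vs E'" using assms s by simp
 note c = path_closed[OF this] path_ends[OF this] path_paths[OF this] hair_verts[THEN iffD1, OF this]
 show "dnp s <: H.L" "rsp s <: H.L" "H.nu s ** dnp s = dnp s" "rsp s ** H.nu s = rsp s"
 "dnp s ** H.nu (fst s, 0) = dnp s" "H.nu (fst s, 0) ** rsp s = rsp s" "rsp s ** dnp s = H.nu (fst s, 0)" "dnp s ** rsp s = H.nu s" "fst s : vs E"
 using c by (simp_all add: s dnp_def rsp_def)
qed

text \<open>Paths from different vertices meet in orthogonal idempotents.\<close>

lemma rsp_dnp:
 assumes s: "s : vs E'" and t: "t : vs E'" shows "rsp s ** dnp t = (if s = t then H.nu (fst s, 0) else 0[H.L])"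
proof (cases "s = t")
 case False
 note c = pathp[OF s] pathp[OF t] H.nu_L[OF s] H.nu_L[OF t]
 have "rsp s ** dnp t = (rsp s ** H.nu s) ** (H.nu t ** dnp t)" using c by simp
 also have "... = rsp s ** (H.nu s ** H.nu t) ** dnp t" using c(1,2,10,11,19,20) by (simp only: Hma Hmc)
 also have "... = 0[H.L]" using H.fam.nu_mult[OF s t] False c by simp
 finally show ?thesis using False by simp
qed (use pathp[OF s] in simp)

lemma emb_closed: "x <: L ==> emb x <: H.L" by (rule alg_mapD(1)[OF emb(1)])

lemma emb_image: "0[H.L] : emb ` car L" "v : vs E ==> H.nu (v, 0) : emb ` car L"
 "[|x : emb ` car L; y : emb ` car L|] ==> x +[H.L] y : emb ` car L"
 "[|x : emb ` car L; y : emb ` car L|] ==> x ** y : emb ` car L" "[|c <: K; x : emb ` car L|] ==> c *:[H.L] x : emb ` car L"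
proof -
 show "0[H.L] : emb ` car L" using alg_map_zero[OF emb(1) fam.B.ag H.fam.B.ag] fam.B.zero_closed by (metis imageI)
 show "H.nu (v, 0) : emb ` car L" if "v : vs E" using emb(2)[OF that] nu_L[OF that] by (metis imageI)
 show "x +[H.L] y : emb ` car L" "x ** y : emb ` car L" if xy: "x : emb ` car L" "y : emb ` car L" proof -
 obtain a b where "a <: L" "b <: L" "x = emb a" "y = emb b" using xy by blast
 thus "x +[H.L] y : emb ` car L" "x ** y : emb ` car L" by (auto simp flip: alg_mapD(2,3)[OF emb(1)])
 qed
 show "c *:[H.L] x : emb ` car L" if "c <: K" "x : emb ` car L" using that by (auto simp flip: alg_mapD(4)[OF emb(1)])
qed

text \<open>By \<open>L_generated\<close> it is enough to multiply by a generator from the left.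
  Moving a generator past \<open>rsp s\<close> gives zero or \<open>a ** rsp r\<close> with
  \<open>a\<close> in the copy of \<open>L\<close>.\<close>

lemma corner_emb:
 assumes "z <: H.L" "s : vs E'" "t : vs E'" shows "rsp s ** z ** dnp t : emb ` car L"
proof -
 \<comment> \<open>Both ends are quantified inside \<open>S\<close>, because moving a generator past
   the ghost path changes its end.\<close>
 define S where "S = {z : car H.L. ALL s:vs E'. ALL t:vs E'. rsp s ** z ** dnp t : emb ` car L}"
 have SI: "z : S" if "z <: H.L" "!!s t. [|s : vs E'; t : vs E'|] ==> rsp s ** z ** dnp t : emb ` car L" for z
 using that by (simp add: S_def)
 have SD: "z <: H.L" "[|s : vs E'; t : vs E'|] ==> rsp s ** z ** dnp t : emb ` car L" if "z : S" for z s t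
 using that by (simp_all add: S_def)
 have left: "y ** x : S" if x: "x : S" and y: "y <: H.L"
 and st: "!!s. s : vs E' ==> rsp s ** y = 0[H.L] | (EX r:vs E'. EX a. a : emb ` car L & rsp s ** y = a ** rsp r)" for x y
 proof (rule SI)
 show "y ** x <: H.L" by (rule Hmc[OF y SD(1)[OF x]])
 fix s t assume s: "s : vs E'" and t: "t : vs E'"
 note c = pathp(1)[OF t] pathp(2)[OF s] y SD(1)[OF x]
 have e: "rsp s ** (y ** x) ** dnp t = (rsp s ** y) ** (x ** dnp t)" using c by (simp add: Hma)
 show "rsp s ** (y ** x) ** dnp t : emb ` car L"
 proof (cases "rsp s ** y = 0[H.L]")
 case True
 thus ?thesis using e c emb_image(1) by simp
 next
 case False
 then obtain r a where r: "r : vs E'" "a : emb ` car L" "rsp s ** y = a ** rsp r" using st[OF s] by blast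
 have "a <: H.L" using r(2) emb_closed by blast
 hence "rsp s ** (y ** x) ** dnp t = a ** (rsp r ** x ** dnp t)" using e r(3) c pathp(2)[OF r(1)] by (simp add: Hma)
 thus ?thesis using emb_image(4)[OF r(2) SD(2)[OF x r(1) t]] by simp
 qed
 qed
 have "car H.L = S"
 proof (rule H.L_generated)
 show "S <= car H.L" by (auto simp: S_def)
 show "0[H.L] : S" using pathp emb_image(1) by (intro SI) simp_all
 show "1[H.L] : S" using pathp rsp_dnp emb_image(1,2) by (intro SI) simp_all
 show "x +[H.L] y : S" if xy: "x : S" "y : S" for x y
 proof (rule SI)
 fix s t assume st: "s : vs E'" "t : vs E'"
 show "rsp s ** (x +[H.L] y) ** dnp t : emb ` car L"
 using emb_image(3)[OF SD(2)[OF xy(1) st] SD(2)[OF xy(2) st]] SD(1)[OF xy(1)] SD(1)[OF xy(2)] pathp st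
 by (simp add: H.lv.U.mult_l_distr H.lv.U.mult_r_distr)
 qed (use xy SD(1) in simp)
 show "c *:[H.L] x : S" if cx: "c <: K" "x : S" for c x
 proof (rule SI)
 fix s t assume st: "s : vs E'" "t : vs E'"
 show "rsp s ** (c *:[H.L] x) ** dnp t : emb ` car L" using emb_image(5)[OF cx(1) SD(2)[OF cx(2) st]] SD(1)[OF cx(2)] pathp st cx(1)
 by (simp add: H.lv.U.mult_smult_l H.lv.U.mult_smult_r)
 qed (use cx SD(1) in simp)
 show "H.nu r ** x : S" if r: "r : vs E'" and x: "x : S" for r x
 proof (rule left[OF x H.nu_L[OF r]])
 fix s assume s: "s : vs E'"
 have "rsp s ** H.nu r = rsp s ** (H.nu s ** H.nu r)" using pathp[OF s] H.nu_L[OF s] H.nu_L[OF r] by (simp flip: Hma)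
 also have "... = (if s = r then H.nu (fst s, 0) ** rsp s else 0[H.L])" using H.fam.nu_mult[OF s r] pathp[OF s] by auto
 finally show "rsp s ** H.nu r = 0[H.L] | (EX r':vs E'. EX a. a : emb ` car L & rsp s ** H.nu r = a ** rsp r')"
 using s emb_image(2)[OF pathp(9)[OF s]] by (metis (full_types))
 qed
 show "H.g p q ** x : S" if p: "p : ix E' w'" and q: "q : opp E' w' p" and x: "x : S" for p q x
 proof (rule left[OF x H.g_L[OF p q]])
 fix s assume s: "s : vs E'"
 let ?P = "%p q. rsp s ** H.g p q = 0[H.L] | (EX r':vs E'. EX a. a : emb ` car L & rsp s ** H.g p q = a ** rsp r')"
 have z: "rsp s ** H.g p q = 0[H.L]" if "ob E' p ~= s" "p : ix E' w'" "q : opp E' w' p" for p q proof -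
 note c = H.nu_L[OF s] H.nu_L[OF H.ob_closed[OF that(2)]] H.g_L[OF that(2,3)] pathp(2)[OF s]
 have "rsp s ** H.g p q = (rsp s ** H.nu s) ** (H.nu (ob E' p) ** H.g p q)" using pathp(4)[OF s] H.fam.nu_g[OF that(2,3)] by simp
 also have "... = rsp s ** (H.nu s ** H.nu (ob E' p)) ** H.g p q" using c by (simp only: Hma Hmc)
 also have "... = 0[H.L]" using H.fam.nu_mult[OF s H.ob_closed[OF that(2)]] that(1) c by simp
 finally show ?thesis .
 qed
 show "?P p q"
 proof (rule hair_all_opp[OF _ _ _ p q])
 fix p q assume pq: "p : ix E w" "q : opp E w p"
 note u = up_closed[OF pq]
 show "?P (up p) (up q)"
 proof (cases "ob E' (up p) = s")
 case True
 hence "rsp s = H.nu (ob E' (up p))" by (auto simp: ob_hair rsp_def)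
 moreover have "rsp (ob E q, 0) = H.nu (ob E' (up q))" by (auto simp: ob_hair rsp_def)
 ultimately have "rsp s ** H.g (up p) (up q) = emb (g p q) ** rsp (ob E q, 0)"
 using H.fam.nu_g[of "up p" "up q"] H.fam.g_nu[of "up p" "up q"] u emb(3)[OF pq] by simp
 moreover have "(ob E q, 0) : vs E'" by (rule base_verts[OF ob_closed[OF opp_P[OF pq]]])
 moreover have "emb (g p q) : emb ` car L" using g_L[OF pq] by blast
 ultimately show ?thesis by blast
 qed (use z u in blast)
 next
 fix r assume r: "r : hairs"
 note hg = hair_g[OF r]
 obtain v j where vj: "r = (v, Suc j)" using r by (cases r; cases "snd r") (auto simp: hairs_def)
 have b: "below r = (v, j)" by (simp add: below_def vj)
 have br: "below r : vs E'" "r : vs E'" using below_hairs[OF r] by auto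
 have rr: "rsp r = rsp (below r) ** H.g (ho r) (hs r)" by (simp add: rsp_def b flip: vj) (simp add: vj)
 have E: "rsp t = H.nu (fst t, 0) ** rsp t & H.nu (fst t, 0) : emb ` car L" if "t : vs E'" for t using pathp[OF that] emb_image(2) by simp
 have io: "hs r : ix E' w'" "ho r : opp E' w' (hs r)" "ho r : ix E' w'" "hs r : opp E' w' (ho r)" using r by (auto simp: ix_hair opp_hair)
 show "?P (hs r) (ho r)"
 proof (cases "r = s")
 case True
 \<comment> \<open>The edge of the hair cancels the last letter of the ghost path.\<close>
 have "rsp s ** H.g (hs r) (ho r) = rsp (below r) ** (H.g (ho r) (hs r) ** H.g (hs r) (ho r))"
 using rr True hg pathp(2)[OF br(1)] by (simp add: Hma)
 also have "... = rsp (below r)" using hg(8) pathp(4)[OF br(1)] by simp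
 finally show ?thesis using E[OF br(1)] br by metis
 qed (use z[OF _ io(1,2)] ob_hair in simp)
 show "?P (ho r) (hs r)"
 proof (cases "below r = s")
 case True
 hence "rsp s ** H.g (ho r) (hs r) = rsp r" using rr by simp
 thus ?thesis using E[OF br(2)] br by metis
 qed (use z[OF _ io(3,4)] ob_hair in simp)
 qed
 qed
 qed
 thus ?thesis using assms SD(2) by blast
qed

end

context hair_units
begin

lemma extend:
 obtains phi where "alg_map K H.L B phi" "!!x. x <: L ==> phi (emb x) = psi x"
 "!!s. s : vs E' ==> phi (dnp s) = eps s (fst s, 0)" "!!s. s : vs E' ==> phi (rsp s) = eps (fst s, 0) s"
 "!!s. s : vs E' ==> phi (H.nu s) = eps s s"
proof -
 obtain phi where phi: "alg_map K H.L B phi" "!!s. s : vs E' ==> phi (H.nu s) = eps s s"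
 "!!p q. [|p : ix E w; q : opp E w p|] ==> phi (H.g (up p) (up q)) = psi (g p q)" "!!s. s : hairs ==> phi (H.g (hs s) (ho s)) = eps s (below s)"
 "!!s. s : hairs ==> phi (H.g (ho s) (hs s)) = eps (below s) s" by (rule hair_universal) blast
 have path: "phi (dn v j) = eps (v, j) (v, 0) & phi (rs v j) = eps (v, 0) (v, j)" if "(v, j) : vs E'" for v j using that
 proof (induction j)
 case 0
 thus ?case using phi(2) by simp
 next
 case (Suc j)
 note h = Suc_hair[OF Suc.prems] and hg = hair_g[OF conjunct1[OF Suc_hair[OF Suc.prems]]]
 have b: "(v, 0) : vs E'" "(v, j) : vs E'" using Suc.prems by (auto simp: hair_verts)
 have "phi (dn v (Suc j)) = eps (v, Suc j) (v, j) *[B] eps (v, j) (v, 0)"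
 using alg_mapD(3)[OF phi(1) hg(1) path_closed(1)[OF b(2)]] phi(4)[OF conjunct1[OF h]] h Suc.IH by simp
 moreover have "phi (rs v (Suc j)) = eps (v, 0) (v, j) *[B] eps (v, j) (v, Suc j)"
 using alg_mapD(3)[OF phi(1) path_closed(2)[OF b(2)] hg(2)] phi(5)[OF conjunct1[OF h]] h Suc.IH by simp
 ultimately show ?case using eps_mult Suc.prems b by simp
 qed
 have "alg_map K L B (%x. phi (emb x))" using alg_mapD[OF phi(1)] alg_mapD[OF emb(1)] by (auto simp: alg_map_def)
 hence e: "phi (emb x) = psi x" if "x <: L" for x by (rule alg_map_ext[OF lpa_setup_axioms B.unital_algebra_axioms _ psi _ _ that])
 (use emb(2,3) phi(2,3) base_verts eps_base in simp_all)
 have "phi (dnp s) = eps s (fst s, 0)" "phi (rsp s) = eps (fst s, 0) s" if "s : vs E'" for s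
 using path[of "fst s" "snd s"] that by (simp_all add: dnp_def rsp_def)
 from that[OF phi(1) e this phi(2)] show ?thesis .
qed

text \<open>The Peirce decomposition with respect to the diagonal matrix units.\<close>

lemma B_decomp:
 assumes one: "sm B (%s. eps s s) (vs E') = 1[B]" and b: "b <: B"
 shows "b = sm B (%s. sm B (%t. eps s s *[B] b *[B] eps t t) (vs E')) (vs E')" proof -
 have c: "eps s s <: B" if "s : vs E'" for s using that by simp
 have r: "x *[B] sm B (%s. eps s s) (vs E') = sm B (%s. x *[B] eps s s) (vs E')" if "x <: B" for x by (rule B.mult_finsum)
 (use that c in "auto simp: B.mult_closed B.mult_r_distr")
 have l: "sm B (%s. eps s s) (vs E') *[B] x = sm B (%s. eps s s *[B] x) (vs E')" if "x <: B" for x by (rule B.finsum_mult)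
 (use that c in "auto simp: B.mult_closed B.mult_l_distr")
 have "b = sm B (%s. eps s s *[B] b) (vs E')" using l[OF b] one b by simp
 also have "... = sm B (%s. sm B (%t. eps s s *[B] b *[B] eps t t) (vs E')) (vs E')"
 proof (rule B.M.finsum_cong'[OF refl])
 show "(%s. sm B (%t. eps s s *[B] b *[B] eps t t) (vs E')) : vs E' ->: B" using b by (intro Pi_I B.M.finsum_closed) auto
 fix s assume "s : vs E'"
 hence "eps s s *[B] b <: B" using b by simp
 from r[OF this] show "eps s s *[B] b = sm B (%t. eps s s *[B] b *[B] eps t t) (vs E')" using `eps s s *[B] b <: B` one by simp
 qed
 finally show ?thesis .
qed

text \<open>The paths in \<open>H.L\<close> and the matrix units in \<open>B\<close> move every
  Peirce component into the corner at the old vertices, where \<open>phi\<close> is given by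
  \<open>psi\<close>. There, injectivity and surjectivity are the hypotheses \<open>inj\<close> and
  \<open>corner\<close>.\<close>

theorem isomorphic_hair_algebra:
 assumes inj: "inj_on psi (car L)" and one: "sm B (%s. eps s s) (vs E') = 1[B]"
 and corner: "!!b. b <: B ==> psi 1[L] *[B] b *[B] psi 1[L] : psi ` car L" shows "algebra_isomorphic K B H.L"
proof -
 obtain phi where phi: "alg_map K H.L B phi" "!!x. x <: L ==> phi (emb x) = psi x"
 "!!s. s : vs E' ==> phi (dnp s) = eps s (fst s, 0)" "!!s. s : vs E' ==> phi (rsp s) = eps (fst s, 0) s"
 "!!s. s : vs E' ==> phi (H.nu s) = eps s s" by (rule extend) blast
 note phiD = alg_mapD[OF phi(1)]
 have phi0: "phi 0[H.L] = 0[B]" "psi 0[L] = 0[B]" using alg_map_zero[OF phi(1)] alg_map_zero[OF psi] H.fam.B.ag fam.B.ag B.M.ag by auto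
 have phi1: "phi 1[H.L] = 1[B]" unfolding H.lv.one_sum one[symmetric] by (subst alg_map_finsum[OF phi(1) H.fam.B.ag B.M.ag])
 (auto simp: phi(5) intro!: B.M.finsum_cong')
 have bv: "(fst s, 0) : vs E'" "fst s : vs E" if "s : vs E'" for s using that by (auto simp: hair_verts)
 \<comment> \<open>The paths make \<open>H.L\<close> itself an instance of the locale, with
   \<open>emb\<close> in the role of \<open>psi\<close>; this provides its Peirce
   decomposition.\<close>
 interpret HU: hair_units K E w m H.L emb "%s t. dnp s ** rsp t"
 proof unfold_locales
 show "dnp s ** rsp t ** (dnp t' ** rsp r) = (if t = t' then dnp s ** rsp r else 0[H.L])"
 if "s : vs E'" "t : vs E'" "fst s = fst t" "t' : vs E'" "r : vs E'" "fst t' = fst r" for s t t' r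
 proof -
 note c = pathp[OF that(1)] pathp[OF that(2)] pathp[OF that(4)] pathp[OF that(5)]
 have "dnp s ** rsp t ** (dnp t' ** rsp r) = dnp s ** (rsp t ** dnp t') ** rsp r" using c(1,11,19,29) by (simp add: Hma)
 also have "... = (if t = t' then dnp s ** rsp r else 0[H.L])" using rsp_dnp[OF that(2,4)] c(1,5,29) that(3) by auto
 finally show ?thesis .
 qed
 show "dnp (v, 0) ** rsp (v, 0) = emb (nu v)" if "v : vs E" for v using pathp(8)[OF base_verts[OF that]] emb(2)[OF that] by simp
 qed (use emb(1) pathp Hmc in auto)
 have hone: "sm H.L (%s. dnp s ** rsp s) (vs E') = 1[H.L]" unfolding H.lv.one_sum by (intro H.fam.B.finsum_cong') (auto simp: pathp)
 have "inj_on phi (car H.L)"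
 proof (rule alg_map_inj[OF phi(1) H.fam.B.ag B.M.ag])
 fix z assume z: "z <: H.L" "phi z = 0[B]"
 have 0: "rsp s ** z ** dnp t = 0[H.L]" if st: "s : vs E'" "t : vs E'" for s t proof -
 obtain l where l: "l <: L" "rsp s ** z ** dnp t = emb l" using corner_emb[OF z(1) st] by blast
 have "psi l = phi (rsp s ** z ** dnp t)" using l phi(2) by simp
 also have "... = 0[B]" using z st pathp(1,2) phiD(1) by (simp add: phiD(3))
 finally have "l = 0[L]" using inj l(1) phi0(2) fam.B.zero_closed by (metis inj_onD)
 thus ?thesis using l(2) alg_map_zero[OF emb(1) fam.B.ag H.fam.B.ag] by simp
 qed
 have "z = sm H.L (%s. sm H.L (%t. dnp s ** rsp s ** z ** (dnp t ** rsp t)) (vs E')) (vs E')" by (rule HU.B_decomp[OF hone z(1)])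
 also have "... = sm H.L (%s. sm H.L (%t. 0[H.L]) (vs E')) (vs E')"
 proof (intro H.fam.B.finsum_cong' refl)
 fix s t assume st: "s : vs E'" "t : vs E'"
 have "dnp s ** rsp s ** z ** (dnp t ** rsp t) = dnp s ** (rsp s ** z ** dnp t) ** rsp t"
 using pathp(1,2)[OF st(1)] pathp(1,2)[OF st(2)] z by (simp add: Hma)
 thus "dnp s ** rsp s ** z ** (dnp t ** rsp t) = 0[H.L]" using 0[OF st] pathp st by simp
 qed auto
 finally show "z = 0[H.L]" by simp
 qed
 moreover have "phi ` car H.L = car B"
 proof
 show "phi ` car H.L <= car B" using phiD(1) by blast
 show "car B <= phi ` car H.L"
 proof
 fix b assume b: "b <: B"
 have im: "sm B f (vs E') : phi ` car H.L" if "!!s. s : vs E' ==> f s : phi ` car H.L" for f :: "'v \<times> nat => 'b"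
 proof (rule B.M.finsum_mem)
 show "0[B] : phi ` car H.L" using phi0 H.fam.B.zero_closed by (metis imageI)
 fix x y assume "x : phi ` car H.L" "y : phi ` car H.L"
 thus "x +[B] y : phi ` car H.L" by (auto simp flip: phiD(2))
 qed (use phiD(1) that in auto)
 have st: "eps s s *[B] b *[B] eps t t : phi ` car H.L" if s: "s : vs E'" and t: "t : vs E'" for s t proof -
 let ?s = "(fst s, 0)" and ?t = "(fst t, 0)"
 note c = eps_closed[OF s bv(1)[OF s]] eps_closed[OF bv(1)[OF s] s] eps_closed[OF bv(1)[OF t] t] eps_closed[OF t bv(1)[OF t]]
 let ?e = "psi 1[L]"
 have onenu: "?e *[B] eps (v, 0) (v, 0) = eps (v, 0) (v, 0)" "eps (v, 0) (v, 0) *[B] ?e = eps (v, 0) (v, 0)"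
 if "v : vs E" for v using eps_base[OF that] nu_L[OF that] by (simp_all flip: alg_mapD(3)[OF psi])
 have ec: "?e <: B" using alg_mapD(1)[OF psi] by simp
 \<comment> \<open>The old vertex at one end of a matrix unit absorbs the image of
   \<open>1[L]\<close>, which brings the component into the form required by
   \<open>corner\<close>.\<close>
 have e1: "eps ?s s = ?e *[B] eps ?s s" proof -
 have "?e *[B] eps ?s s = ?e *[B] (eps ?s ?s *[B] eps ?s s)" using eps_mult s bv(1)[OF s] by simp
 also have "... = eps ?s ?s *[B] eps ?s s" using onenu(1)[OF bv(2)[OF s]] c ec bv(1)[OF s] by (simp flip: B.mult_assoc)
 also have "... = eps ?s s" using eps_mult s bv(1)[OF s] by simp
 finally show ?thesis by simp
 qed
 have e2: "eps t ?t = eps t ?t *[B] ?e" proof -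
 have "eps t ?t *[B] ?e = (eps t ?t *[B] eps ?t ?t) *[B] ?e" using eps_mult t bv(1)[OF t] by simp
 also have "... = eps t ?t *[B] eps ?t ?t" using onenu(2)[OF bv(2)[OF t]] c ec bv(1)[OF t] by (simp add: B.mult_assoc)
 also have "... = eps t ?t" using eps_mult t bv(1)[OF t] by simp
 finally show ?thesis by simp
 qed
 have "?e *[B] (eps ?s s *[B] b *[B] eps t ?t) *[B] ?e : psi ` car L" using c b by (intro corner) simp
 also have "?e *[B] (eps ?s s *[B] b *[B] eps t ?t) *[B] ?e = (?e *[B] eps ?s s) *[B] b *[B] (eps t ?t *[B] ?e)"
 using c b ec by (simp add: B.mult_assoc)
 finally have "eps ?s s *[B] b *[B] eps t ?t : psi ` car L" unfolding e1[symmetric] e2[symmetric] .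
 then obtain l where l: "l <: L" "eps ?s s *[B] b *[B] eps t ?t = psi l" by blast
 have "eps s s *[B] b *[B] eps t t = (eps s ?s *[B] eps ?s s) *[B] b *[B] (eps t ?t *[B] eps ?t t)"
 using eps_mult s t bv(1)[OF s] bv(1)[OF t] by simp
 also have "... = eps s ?s *[B] (eps ?s s *[B] b *[B] eps t ?t) *[B] eps ?t t" using c b by (simp add: B.mult_assoc)
 also have "... = phi (dnp s ** emb l ** rsp t)"
 using l phi(2)[OF l(1)] phi(3)[OF s] phi(4)[OF t] pathp(1)[OF s] pathp(2)[OF t] emb_closed[OF l(1)] by (simp add: phiD(3))
 finally show ?thesis using pathp(1)[OF s] pathp(2)[OF t] emb_closed[OF l(1)] by simp
 qed
 show "b : phi ` car H.L" by (subst B_decomp[OF one b]) (intro im st)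
 qed
 qed
 ultimately have "bij_betw phi (car H.L) (car B)" by (simp add: bij_betw_def)
 from algebra_isomorphicI(2)[OF H.unital_L B.unital_algebra_axioms phi(1) this phi1] show ?thesis .
qed

end

section \<open>A representation that detects the copy of \<open>L\<close>\<close>

definition fmod :: "('k, 'm) module => ('k, 's => 'm) module" where
 "fmod M = \<lparr>carrier = {x. ALL s. x s : car M}, monoid.mult = undefined, one = undefined,
 ring.zero = (%_. 0[M]), add = (%x y s. x s +[M] y s), smult = (%c x s. c *:[M] x s)\<rparr>"

lemma fun_simps: "x <: (fmod M) <-> (ALL s. x s <: M)" "0[fmod M] = (%_. 0[M])"
 "x +[fmod M] y = (%s. x s +[M] y s)" "c *:[fmod M] x = (%s. c *:[M] x s)" by (simp_all add: fmod_def)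

lemma fun_val: "x <: (fmod M) ==> x s <: M" by (simp add: fmod_def)

lemma module_fun: assumes "module K M" shows "module K (fmod M)"
proof -
 interpret M: module K M by fact
 have "abelian_group (fmod M)"
 proof (rule abelian_groupI)
 fix x assume "x <: (fmod M)"
 hence "(%s. -[M] x s) <: (fmod M)" "(%s. -[M] x s) +[fmod M] x = 0[fmod M]" by (auto simp: fun_simps M.l_neg)
 thus "EX y:car (fmod M). y +[fmod M] x = 0[fmod M]" by blast
 qed (auto simp: fun_simps M.a_ac)
 thus ?thesis by (intro moduleI) (auto simp: fun_simps M.smult_l_distr M.smult_r_distr M.smult_assoc1 M.R.is_cring)
qed

context hair
begin

text \<open>
 \<open>L(E\<^sup>+)\<close> acts on functions \<open>x\<close> from the vertices to \<open>L\<close>: a hair moves the value at one of its ends to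
 the other end, and \<open>L\<close> acts on the values at the old vertices.
\<close>

definition shift where "shift s t = (\<lambda>x\<in>car (fmod L). %r. if r = (s :: 'v \<times> nat) then nu (fst s) *[L] x t else 0[L])"

text \<open>Reassembles an element of \<open>L\<close> from its pieces at the old vertices;
  \<open>old l\<close> multiplies it by \<open>l\<close> and takes it apart again.\<close>

definition total where "total x = sm L (%v. nu v *[L] x (v, 0::nat)) (vs E)"

definition old where
 "old l = (\<lambda>x\<in>car (fmod L). %r. if r : vs E \<times> {0::nat} then nu (fst r) *[L] (l *[L] total x) else 0[L])"

lemma total_closed: "x <: (fmod L) ==> total x <: L" unfolding total_def by (intro fam.B.finsum_closed) (auto simp: fun_simps)

lemma total_add:
 assumes "x <: (fmod L)" "y <: (fmod L)" shows "total (x +[fmod L] y) = total x +[L] total y"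
proof -
 have c: "x r <: L" "y r <: L" for r by (rule fun_val[OF assms(1)], rule fun_val[OF assms(2)])
 have "total (x +[fmod L] y) = sm L (%v. nu v *[L] x (v, 0) +[L] nu v *[L] y (v, 0)) (vs E)" unfolding total_def fun_simps using c
 by (intro fam.B.finsum_cong') (simp_all add: lv.U.mult_r_distr)
 also have "... = total x +[L] total y" unfolding total_def using c by (intro fam.B.finsum_addf) simp_all
 finally show ?thesis .
qed

lemma total_smult:
 assumes "c <: K" "x <: (fmod L)" shows "total (c *:[fmod L] x) = c *:[L] total x"
proof -
 have x: "x r <: L" for r by (rule fun_val[OF assms(2)])
 have "total (c *:[fmod L] x) = sm L (%v. c *:[L] (nu v *[L] x (v, 0))) (vs E)" unfolding total_def fun_simps using x assms(1)
 by (intro fam.B.finsum_cong') (simp_all add: lv.U.mult_smult_r)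
 also have "... = c *:[L] total x" unfolding total_def by (rule add_finsum[OF fam.B.ag fam.B.ag, of "%y. c *:[L] y", symmetric])
 (use x nu_L assms(1) in "simp_all add: lv.U.mult_closed lv.U.smult_r_distr")
 finally show ?thesis .
qed

lemma nu_total: assumes "u : vs E" "x <: (fmod L)" shows "nu u *[L] total x = nu u *[L] x (u, 0)"
proof -
 have c: "nu v *[L] x (v, 0) <: L" if "v : vs E" for v using that assms by (simp add: fun_simps)
 have "nu u *[L] total x = sm L (%v. nu u *[L] (nu v *[L] x (v, 0))) (vs E)" unfolding total_def by (rule lv.U.mult_finsum)
 (use assms c nu_L in "auto simp: lv.U.mult_closed lv.U.mult_r_distr")
 also have "... = nu u *[L] (nu u *[L] x (u, 0))"
 proof (rule fam.B.finsum_delta[OF finite_verts assms(1)])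
 fix v assume "v : vs E" "v ~= u"
 hence "nu u *[L] nu v *[L] x (v, 0) = 0[L]" using fam.nu_mult[OF assms(1)] assms(2) by (simp add: fun_simps)
 thus "nu u *[L] (nu v *[L] x (v, 0)) = 0[L]" using assms `v : vs E` by (simp add: lv.U.mult_assoc fun_simps)
 qed (use c[OF assms(1)] nu_L[OF assms(1)] in "simp add: lv.U.mult_closed")
 also have "... = nu u *[L] x (u, 0)" using fam.nu_mult[OF assms(1,1)] nu_L[OF assms(1)] assms(2) by (simp add: fun_simps flip: lv.U.mult_assoc)
 finally show ?thesis .
qed

lemma total_single: assumes l: "l <: L" shows "total (%r. if r : vs E \<times> {0} then nu (fst r) *[L] l else 0[L]) = l"
proof -
 have "total (%r. if r : vs E \<times> {0} then nu (fst r) *[L] l else 0[L]) = sm L (%v. nu v *[L] l) (vs E)" unfolding total_def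
 proof (rule fam.B.finsum_cong'[OF refl])
 fix v assume v: "v : vs E"
 hence "nu v *[L] (nu v *[L] l) = nu v *[L] l" using fam.nu_mult[OF v v] l by (simp flip: lv.U.mult_assoc)
 thus "nu v *[L] (if (v, 0::nat) : vs E \<times> {0} then nu (fst (v, 0::nat)) *[L] l else 0[L]) = nu v *[L] l" using v by simp
 qed (use nu_L l lv.U.mult_closed in auto)
 also have "... = sm L (%v. nu v) (vs E) *[L] l" by (rule lv.U.finsum_mult[symmetric])
 (use l nu_L in "auto simp: lv.U.mult_closed lv.U.mult_l_distr")
 also have "... = l" using l by (simp flip: lv.one_sum)
 finally show ?thesis .
qed

lemma module_FM: "module K (fmod L)" by (rule module_fun[OF lv.U.module_axioms])

lemma units_End: "hair_units K E w m (end_algebra K (fmod L)) old shift"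
proof -
 let ?M = "fmod L :: ('k, 'v \<times> nat => (('v, 'e) lpa_gen list => 'k) set) module"
 let ?E = "end_algebra K ?M"
 interpret FM: module K ?M by (rule module_FM)
 interpret E: unital_algebra K ?E by (rule end_unital[OF K.field_axioms module_FM])
 note Lmc = lv.U.mult_closed and Lma = lv.U.mult_assoc
 have val: "x s <: L" if "x <: ?M" for x s using that by (rule fun_val)
 have ov: "old l x <: ?M" if "l <: L" "x <: ?M" for l x using that total_closed by (auto simp: old_def fun_simps(1))
 have oc: "old l <: ?E" if l: "l <: L" for l unfolding end_simps(1)
 proof (intro conjI ballI)
 show "old l : car ?M \<rightarrow>\<^sub>E car ?M" using ov[OF l] by (simp add: old_def)
 fix x y assume x: "x <: ?M" and y: "y <: ?M"
 thus "old l (x +[?M] y) = old l x +[?M] old l y" using l total_closed FM.M.add.m_closed[OF x y]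
 by (auto simp: old_def total_add[unfolded fun_simps(3)] fun_simps(3) fun_eq_iff lv.U.mult_r_distr)
 next
 fix c x assume c: "c <: K" and x: "x <: ?M"
 thus "old l (c *:[?M] x) = c *:[?M] old l x" using l total_closed FM.smult_closed[OF c x]
 by (auto simp: old_def total_smult[unfolded fun_simps(4)] fun_simps(4) fun_eq_iff lv.U.mult_smult_r)
 qed
 have sv: "shift s t x <: ?M" if "fst s : vs E" "x <: ?M" for s t x using nu_L[OF that(1)] val[OF that(2)] by (simp add: shift_def fun_simps(1))
 have sc: "shift s t <: ?E" if s: "fst s : vs E" for s t unfolding end_simps(1)
 proof (intro conjI ballI)
 show "shift s t : car ?M \<rightarrow>\<^sub>E car ?M" using sv[OF s] by (simp add: shift_def)
 fix x y assume x: "x <: ?M" and y: "y <: ?M"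
 thus "shift s t (x +[?M] y) = shift s t x +[?M] shift s t y" using nu_L[OF s] val[OF x] val[OF y] FM.M.add.m_closed[OF x y]
 by (simp add: shift_def fun_simps(3) fun_eq_iff lv.U.mult_r_distr)
 next
 fix c x assume c: "c <: K" and x: "x <: ?M"
 thus "shift s t (c *:[?M] x) = c *:[?M] shift s t x" using nu_L[OF s] val[OF x] FM.smult_closed[OF c x]
 by (simp add: shift_def fun_simps(4) fun_eq_iff lv.U.mult_smult_r)
 qed
 have ext: "h = h'" if "h <: ?E" "h' <: ?E" "!!x. x <: ?M ==> h x = h' x" for h h'
 using that by (intro extensionalityI[of h "car ?M" h']) (auto simp: end_simps(1) PiE_def)
 have fv: "fst s : vs E" if "s : vs E'" for s using that by (simp add: hair_verts)
 show ?thesis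
 proof (unfold_locales, goal_cases)
 case 1
 show ?case unfolding alg_map_def
 proof (intro conjI ballI)
 show "old : car L ->: ?E" using oc by blast
 fix l l' assume l: "l <: L" "l' <: L"
 show "old (l +[L] l') = old l +[?E] old l'"
 proof (rule ext)
 fix x assume x: "x <: ?M"
 show "old (l +[L] l') x = (old l +[?E] old l') x" using l total_closed[OF x]
 by (auto simp: old_def end_simps(5) fun_simps(3) fun_eq_iff lv.U.mult_r_distr lv.U.mult_l_distr)
 qed (use l oc in auto)
 show "old (l *[L] l') = old l *[?E] old l'"
 proof (rule ext)
 fix x assume x: "x <: ?M"
 have "old l' x = (%r. if r : vs E \<times> {0} then nu (fst r) *[L] (l' *[L] total x) else 0[L])" using x by (simp add: old_def)
 hence "total (old l' x) = l' *[L] total x" using total_single[of "l' *[L] total x"] l total_closed[OF x] by simp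
 thus "old (l *[L] l') x = (old l *[?E] old l') x"
 using l total_closed[OF x] ov[OF l(2) x] by (simp add: old_def[of l] old_def[of "l *[L] l'"] end_simps(2) Lma cong: if_cong)
 qed (simp_all add: l oc Lmc E.mult_closed)
 next
 fix c l assume l: "c <: K" "l <: L"
 show "old (c *:[L] l) = c *:[?E] old l"
 proof (rule ext)
 fix x assume x: "x <: ?M"
 show "old (c *:[L] l) x = (c *:[?E] old l) x" using l total_closed[OF x]
 by (auto simp: old_def end_simps(6) fun_simps(4) fun_eq_iff lv.U.mult_smult_l lv.U.mult_smult_r)
 qed (use l oc in auto)
 qed
 next
 case (2 s t) thus ?case using sc fv by blast
 next
 case (3 s t t' r)
 show ?case
 proof (rule ext)
 show "shift s t *[?E] shift t' r <: ?E" using 3 sc fv by (intro E.mult_closed) auto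
 show "(if t = t' then shift s r else 0[?E]) <: ?E" using 3 sc fv by auto
 fix x assume x: "x <: ?M"
 have "nu (fst t) *[L] (nu (fst t) *[L] x r) = nu (fst t) *[L] x r"
 using fam.nu_mult[OF fv[OF 3(2)] fv[OF 3(2)]] nu_L[OF fv[OF 3(2)]] val[OF x] by (simp flip: Lma)
 thus "(shift s t *[?E] shift t' r) x = (if t = t' then shift s r else 0[?E]) x" using x 3 sv[OF fv[OF 3(4)] x, of r] nu_L[OF fv[OF 3(1)]]
 by (auto simp: end_simps(2,4) shift_def fun_simps(2) fun_eq_iff)
 qed
 next
 case (4 v)
 show ?case
 proof (rule ext)
 show "shift (v, 0) (v, 0) <: ?E" using 4 sc by simp
 show "old (nu v) <: ?E" using 4 oc nu_L by simp
 fix x assume x: "x <: ?M"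
 have "nu (fst r) *[L] (nu v *[L] total x) = (if fst r = v then nu v *[L] x (v, 0) else 0[L])"
 if "r : vs E \<times> {0}" for r
 proof -
 have r: "fst r : vs E" using that by auto
 have "nu (fst r) *[L] (nu v *[L] total x) = (nu (fst r) *[L] nu v) *[L] total x" using nu_L[OF r] nu_L[OF 4] total_closed[OF x] by (simp add: Lma)
 thus ?thesis using fam.nu_mult[OF r 4] nu_total[OF 4 x] total_closed[OF x] by auto
 qed
 thus "shift (v, 0) (v, 0) x = old (nu v) x" using x 4 by (auto simp: shift_def old_def fun_eq_iff)
 qed
 qed
qed

text \<open>In the representation, \<open>emb l\<close> becomes \<open>old l\<close>, and applied to
  the pieces of \<open>1[L]\<close> this returns the pieces of \<open>l\<close>. So adding hairs
  imposes no new relation on \<open>L\<close>.\<close>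

lemma inj_emb: "inj_on emb (car L)"
proof (rule alg_map_inj[OF emb(1) fam.B.ag H.fam.B.ag])
 interpret HU: hair_units K E w m "end_algebra K (fmod L)" old shift by (rule units_End)
 fix l assume l: "l <: L" "emb l = 0[H.L]"
 obtain phi where phi: "alg_map K H.L (end_algebra K (fmod L)) phi" "!!x. x <: L ==> phi (emb x) = old x" by (rule HU.extend) blast
 have "old l = 0[end_algebra K (fmod L)]" using phi(2)[OF l(1)] l(2) alg_map_zero[OF phi(1) H.fam.B.ag HU.B.M.ag] by simp
 define x where "x = (%r. if r : vs E \<times> {0::nat} then nu (fst r) *[L] 1[L] else 0[L])"
 have x: "x <: (fmod L)" by (auto simp: x_def fun_simps)
 have "total x = 1[L]" unfolding x_def by (rule total_single) simp
 hence "(%r. if r : vs E \<times> {0} then nu (fst r) *[L] l else 0[L]) = old l x" using x l(1) by (simp add: old_def cong: if_cong)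
 also have "... = (%_. 0[L])" using `old l = _` x by (simp add: end_simps(4) fun_simps(2))
 finally have 0: "(%r. if r : vs E \<times> {0::nat} then nu (fst r) *[L] l else 0[L]) = (%_. 0[L])" .
 have "l = total (%r. 0[L])" using total_single[OF l(1)] unfolding 0 by simp
 also have "... = 0[L]" unfolding total_def  by (simp add: cong: fam.B.finsum_cong)
 finally show "l = 0[L]" .
qed

end

section \<open>Modules in a universe\<close>

text \<open>Transport of structure along an injection, by which a module is placed into the
  universe.\<close>

definition imod :: "('m => 'u) => ('a, 'm) module => ('a, 'u) module" where "imod h M = (let d = inv_into (car M) h in
 \<lparr>carrier = h ` car M, monoid.mult = undefined, one = undefined, ring.zero = h 0[M],
 add = (%x y. h (d x +[M] d y)), smult = (%a x. h (a *:[M] d x))\<rparr>)"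

definition image_map :: "('m => 'u) => ('a, 'm) module => ('m => 'u') => 'u => 'u'" where
 "image_map h M f = (\<lambda>y\<in>h ` car M. f (inv_into (car M) h y))"

lemma image_simps: "car (imod h M) = h ` car M" "0[imod h M] = h 0[M]" by (simp_all add: imod_def Let_def)

lemma image_ops:
 assumes "inj_on h (car M)" "x <: M" shows "y <: M ==> h x +[imod h M] h y = h (x +[M] y)"
 "a *:[imod h M] h x = h (a *:[M] x)" "image_map h M f (h x) = f x" using assms by (simp_all add: imod_def image_map_def Let_def)

lemma left_module_image:
 assumes M: "lmod A M" and h: "inj_on h (car M)" shows "lmod A (imod h M)"
proof -
 interpret M: left_module A M by fact
 note ops = image_ops[OF h]
 have "abelian_group (imod h M)"
 proof (rule abelian_groupI)
 fix x assume "x <: (imod h M)"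
 then obtain m where m: "m <: M" "x = h m" unfolding image_simps by blast
 hence "h (-[M] m) +[imod h M] x = 0[imod h M]" by (simp add: ops image_simps M.l_neg)
 thus "EX y:car (imod h M). y +[imod h M] x = 0[imod h M]" using m unfolding image_simps(1) by blast
 qed (auto simp: image_simps ops M.M.a_ac)
 thus ?thesis unfolding left_module_def left_module_axioms_def
 by (auto simp: image_simps ops M.smult_l_distr M.smult_r_distr M.smult_assoc M.R.ring_axioms)
qed

definition lmap :: "('k, 'a) module => ('a, 'm) module => ('a, 'n) module => ('m => 'n) => bool" where
 "lmap A M N f <-> f : car M ->: N & (ALL x:car M. ALL y:car M. f (x +[M] y) = f x +[N] f y) &
 (ALL a:car A. ALL x:car M. f (a *:[M] x) = a *:[N] f x)"

lemma lmapD: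
 assumes "lmap A M N f" shows "x <: M ==> f x <: N" "[|x <: M; y <: M|] ==> f (x +[M] y) = f x +[N] f y"
 "[|a <: A; x <: M|] ==> f (a *:[M] x) = a *:[N] f x" using assms by (auto simp: lmap_def)

lemma lmap_finsum:
 assumes "lmap A M N f" "lmod A M" "lmod A N" "t : S ->: M" shows "f (sm M t S) = sm N (%i. f (t i)) S"
 using assms by (intro add_finsum) (auto simp: lmap_def left_module_def)

lemma lmap_zero:
 assumes "lmap A M N f" "lmod A M" "lmod A N"
 shows "f 0[M] = 0[N]" using assms by (intro additive_zero) (auto simp: lmap_def left_module_def)

lemma mod_hom_iff: "f : mod_hom A M N <-> lmap A M N f & f : extensional (car M)" by (auto simp: mod_hom_def lmap_def PiE_def)

lemma mod_hom_restrict: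
 assumes "lmod A M" "lmap A M N f" shows "(\<lambda>x\<in>car M. f x) : mod_hom A M N"
proof -
 interpret left_module A M by fact
 show ?thesis using assms(2) by (auto simp: mod_hom_iff lmap_def)
qed

lemma mod_isoI:
 assumes f: "f : mod_hom A M N" and M: "lmod A M" and N: "lmod A N" and bij: "bij_betw f (car M) (car N)"
 shows "f : mod_iso A M N" proof -
 interpret M: left_module A M by fact
 interpret N: left_module A N by fact
 let ?g = "\<lambda>y\<in>car N. inv_into (car M) f y"
 have d: "inv_into (car M) f y <: M" "f (inv_into (car M) f y) = y" if "y <: N" for y
 using bij that by (auto simp: bij_betw_def inv_into_into f_inv_into_f)
 have i: "inv_into (car M) f (f x) = x" if "x <: M" for x using bij that by (simp add: bij_betw_def)
 note fD = lmapD[OF f[unfolded mod_hom_iff, THEN conjunct1]]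
 have dI: "inv_into (car M) f y = x" if "x <: M" "f x = y" for x y using that i by blast
 have "lmap A N M ?g" unfolding lmap_def
 proof (intro conjI ballI)
 fix x y assume xy: "x <: N" "y <: N"
 thus "?g (x +[N] y) = ?g x +[M] ?g y" using d fD by (simp add: dI)
 next
 fix a x assume "a <: A" "x <: N"
 thus "?g (a *:[N] x) = a *:[M] ?g x" using d fD by (simp add: dI)
 qed (use d in auto)
 hence "?g : mod_hom A N M" by (simp add: mod_hom_iff)
 moreover have "compose (car M) ?g f = mod_id M" "compose (car N) f ?g = mod_id N" using d i fD(1) by (auto simp: compose_def mod_id_def)
 ultimately show ?thesis using f by (auto simp: mod_iso_def)
qed

text \<open>Pairs, and in \<open>tuple\<close> finite sequences, are coded by single elements; this
  keeps finite powers inside an infinite universe.\<close>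

definition pairing :: "'u \<times> 'u => 'u" where "pairing = (SOME p. inj p)"

lemma inj_pairing: assumes "infinite (UNIV :: 'u set)" shows "inj (pairing :: 'u \<times> 'u => 'u)"
proof -
 obtain p :: "'u \<times> 'u => 'u" where "bij_betw p (UNIV \<times> UNIV) UNIV"
 using card_of_Times_same_infinite[OF assms] unfolding card_of_ordIso[symmetric] by blast
 hence "inj p" by (simp add: bij_betw_def)
 thus ?thesis unfolding pairing_def by (rule someI[of inj])
qed

primrec tuple :: "nat => (nat => 'u) => 'u" where "tuple 0 f = undefined"
| "tuple (Suc n) f = pairing (f n, tuple n f)"

lemma tuple_cong: "(!!i. i < n ==> f i = g i) ==> tuple n f = tuple n g" by (induction n) auto

lemma tuple_inject:
 assumes "infinite (UNIV :: 'u set)" "tuple n f = tuple n (g :: nat => 'u)" "i < n" shows "f i = g i" using assms(2,3)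
proof (induction n)
 case (Suc n)
 have "(f n, tuple n f) = (g n, tuple n g)" by (rule injD[OF inj_pairing[OF assms(1)]]) (use Suc.prems(1) in simp)
 thus ?case using Suc.IH Suc.prems(2) by (cases "i = n") simp_all
qed simp

lemma inj_tuple:
 assumes "infinite (UNIV :: 'u set)" "S <= extensional {..<n}" shows "inj_on (tuple n) (S :: (nat => 'u) set)"
proof
 fix f g :: "nat => 'u" assume "f : S" "g : S" "tuple n f = tuple n g"
 thus "f = g" using tuple_inject[OF assms(1), of n f g] assms(2) by (intro extensionalityI[of f "{..<n}" g]) auto
qed

section \<open>Full corners\<close>

text \<open>
 \<open>A\<close> is identified by \<open>j\<close> with \<open>eCe\<close>, where \<open>e = j \<one>\<close>, and the \<open>a i\<close>, \<open>b i\<close> witness that \<open>CeC = C\<close>.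
\<close>

locale corner = A: unital_algebra K A + C: unital_algebra K C
 for K :: "'k ring" and A :: "('k, 'a) module" and C :: "('k, 'c) module" +
 fixes j :: "'a => 'c" and n :: nat and a b :: "nat => 'c"
 assumes j: "alg_map K A C j" and inj_j: "inj_on j (car A)" and corner: "z <: C ==> j 1[A] *[C] z *[C] j 1[A] : j ` car A"
 and ab_closed: "i < n ==> a i <: C" "i < n ==> b i <: C" and ab_e: "i < n ==> a i *[C] j 1[A] = a i" "i < n ==> j 1[A] *[C] b i = b i"
 and full: "sm C (%i. a i *[C] b i) {..<n} = 1[C]"
begin

declare ab_closed [simp]

abbreviation e where "e \<equiv> j 1[A]"

lemmas jD = alg_mapD[OF j]

lemma e_closed [simp]: "e <: C" by (simp add: jD)

lemma e_j: "x <: A ==> e *[C] j x = j x" "x <: A ==> j x *[C] e = j x" by (simp_all flip: jD(3))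

text \<open>The compression of \<open>z\<close> to the corner, read in \<open>A\<close>. It is
  additive, but multiplicative only in the form \<open>ka_mult\<close>, with \<open>e\<close>
  inserted between the factors.\<close>

definition ka where "ka z = inv_into (car A) j (e *[C] z *[C] e)"

lemma ka_closed [simp]: "z <: C ==> ka z <: A" unfolding ka_def by (rule inv_into_into[OF corner])

lemma j_kap: "z <: C ==> j (ka z) = e *[C] z *[C] e" unfolding ka_def by (rule f_inv_into_f[OF corner])

lemma kaI: "[|x <: A; j x = e *[C] z *[C] e|] ==> ka z = x" unfolding ka_def using inv_into_f_f[OF inj_j] by metis

lemma ka_j: "x <: A ==> ka (j x) = x" by (rule kaI) (simp_all add: e_j)

lemma ka_one: "ka 1[C] = 1[A]" by (rule kaI) (simp_all add: e_j)

lemma ka_add: "[|x <: C; y <: C|] ==> ka (x +[C] y) = ka x +[A] ka y" by (rule kaI) (simp_all add: jD j_kap C.mult_l_distr C.mult_r_distr)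

lemma ee: "e *[C] e = e" "y <: C ==> e *[C] (e *[C] y) = e *[C] y"
proof -
 show "e *[C] e = e" by (rule e_j(1)) simp
 thus "e *[C] (e *[C] y) = e *[C] y" if "y <: C" using C.mult_assoc[OF e_closed e_closed that] by simp
qed

lemma ka_mult: "[|x <: C; y <: C|] ==> ka x *[A] ka y = ka (x *[C] e *[C] y)" by (rule kaI[symmetric])
 (simp_all add: jD(3) j_kap C.mult_assoc ee)

lemma ka_finsum: "f : S ->: C ==> ka (sm C f S) = sm A (%i. ka (f i)) S" by (rule add_finsum[OF C.M.ag A.M.ag]) (auto simp: ka_add)

text \<open>\<open>1[C]\<close>, as the sum of the \<open>a i *[C] b i\<close>, is inserted between
  \<open>x\<close> and \<open>y\<close>; the idempotent that \<open>ka_mult\<close> places in the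
  middle is absorbed by \<open>a i\<close>.\<close>

lemma resolve: assumes "x <: C" "y <: C" shows "sm A (%i. ka (x *[C] a i) *[A] ka (b i *[C] y)) {..<n} = ka (x *[C] y)"
proof -
 have "sm A (%i. ka (x *[C] a i) *[A] ka (b i *[C] y)) {..<n} = sm A (%i. ka (x *[C] (a i *[C] b i) *[C] y)) {..<n}"
 proof (rule A.M.finsum_cong'[OF refl])
 fix i assume "i : {..<n}"
 hence i: "a i <: C" "b i <: C" "a i *[C] e = a i" using ab_e by auto
 have "x *[C] a i *[C] e *[C] (b i *[C] y) = x *[C] (a i *[C] e) *[C] (b i *[C] y)" using assms i(1,2) by (simp add: C.mult_assoc)
 also have "... = x *[C] (a i *[C] b i) *[C] y" using assms i by (simp add: C.mult_assoc)
 finally show "ka (x *[C] a i) *[A] ka (b i *[C] y) = ka (x *[C] (a i *[C] b i) *[C] y)" using assms i by (simp add: ka_mult)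
 qed (use assms ab_closed in "auto simp: ka_closed C.mult_closed")
 also have "... = ka (sm C (%i. x *[C] (a i *[C] b i) *[C] y) {..<n})" using assms by (intro ka_finsum[symmetric]) auto
 also have "sm C (%i. x *[C] (a i *[C] b i) *[C] y) {..<n} = x *[C] sm C (%i. a i *[C] b i) {..<n} *[C] y"
 by (rule add_finsum[OF C.M.ag C.M.ag, of "%z. x *[C] z *[C] y", symmetric])
 (use assms ab_closed in "auto simp: C.mult_closed C.mult_l_distr C.mult_r_distr")
 also have "... = x *[C] y" using assms by (simp add: full)
 finally show ?thesis .
qed

end

text \<open>
 The \<open>C\<close>-module \<open>Ce \<otimes> M\<close> is represented by the tuples \<open>z\<close> with \<open>act \<one> z = z\<close>: the tensor \<open>c \<otimes> m\<close>
 becomes \<open>vec c m\<close>, and \<open>pair c\<close> is the map \<open>c' \<otimes> m \<mapsto> ecc'e *[C] m\<close>.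
\<close>

locale corner_mod = corner K A C j n a b + M: left_module A M
 for K :: "'k ring" and A :: "('k, 'a) module" and C :: "('k, 'c) module" and j n a b
 and M :: "('a, 'm) module"
begin

definition pair :: "'c => (nat => 'm) => 'm" where "pair c z = sm M (%l. ka (c *[C] a l) *:[M] z l) {..<n}"

definition act :: "'c => (nat => 'm) => nat => 'm" where "act c z = (\<lambda>i\<in>{..<n}. pair (b i *[C] c) z)"

definition vec :: "'c => 'm => nat => 'm" where "vec c x = (\<lambda>i\<in>{..<n}. ka (b i *[C] c) *:[M] x)"

abbreviation T where "T \<equiv> {..<n} \<rightarrow>\<^sub>E car M"

lemma term_closed: "[|c <: C; z : T; l < n|] ==> ka (c *[C] a l) *:[M] z l <: M" by (auto simp: PiE_def Pi_def)

lemma pair_closed: "[|c <: C; z : T|] ==> pair c z <: M" unfolding pair_def by (intro M.finsum_closed) (simp add: term_closed)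

lemma act_closed: "[|c <: C; z : T|] ==> act c z : T" by (simp add: act_def pair_closed)

lemma vec_closed: "[|c <: C; x <: M|] ==> vec c x : T" by (simp add: vec_def)

lemma pair_add_l: assumes "c <: C" "c' <: C" "z : T" shows "pair (c +[C] c') z = pair c z +[M] pair c' z"
proof -
 have z: "z l <: M" if "l < n" for l using assms(3) that by auto
 have "pair (c +[C] c') z = sm M (%l. ka (c *[C] a l) *:[M] z l +[M] ka (c' *[C] a l) *:[M] z l) {..<n}" unfolding pair_def using assms z
 by (intro M.finsum_cong') (simp_all add: C.mult_l_distr ka_add M.smult_l_distr)
 also have "... = pair c z +[M] pair c' z" unfolding pair_def using assms by (intro M.finsum_addf) (simp_all add: term_closed)
 finally show ?thesis .
qed

lemma pair_add_r: assumes "c <: C" "z : T" "z' : T" shows "pair c (\<lambda>i\<in>{..<n}. z i +[M] z' i) = pair c z +[M] pair c z'"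
proof -
 have z: "z l <: M" "z' l <: M" if "l < n" for l using assms that by auto
 have "pair c (\<lambda>i\<in>{..<n}. z i +[M] z' i) = sm M (%l. ka (c *[C] a l) *:[M] z l +[M] ka (c *[C] a l) *:[M] z' l) {..<n}"
 unfolding pair_def using assms z by (intro M.finsum_cong') (simp_all add: M.smult_r_distr)
 also have "... = pair c z +[M] pair c z'" unfolding pair_def using assms by (intro M.finsum_addf) (simp_all add: term_closed)
 finally show ?thesis .
qed

lemma smult_pair: assumes "c <: C" "c' <: C" "z : T" shows "ka c *:[M] pair c' z = pair (c *[C] e *[C] c') z"
proof -
 have z: "z l <: M" if "l < n" for l using assms that by auto
 have "ka c *:[M] pair c' z = sm M (%l. ka c *:[M] (ka (c' *[C] a l) *:[M] z l)) {..<n}"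
 unfolding pair_def using assms by (intro M.smult_r_finsum) (simp_all add: term_closed)
 also have "... = pair (c *[C] e *[C] c') z" unfolding pair_def using assms z e_closed by (intro M.finsum_cong')
 (simp_all add: term_closed C.mult_closed ab_closed C.mult_assoc ka_closed ka_mult flip: M.smult_assoc)
 finally show ?thesis .
qed

text \<open>After the two sums are interchanged, the inner one is evaluated by
  \<open>resolve\<close>.\<close>

lemma pair_act: assumes c: "c <: C" "c' <: C" and z: "z : T" shows "pair c (act c' z) = pair (c *[C] c') z"
proof -
 have zl: "z l <: M" if "l < n" for l using assms that by auto
 have k: "ka (c *[C] a i) <: A" "ka (b i *[C] c' *[C] a l) <: A" if "i < n" "l < n" for i l using that c by simp_all
 have "pair c (act c' z) = sm M (%i. sm M (%l. (ka (c *[C] a i) *[A] ka (b i *[C] c' *[C] a l)) *:[M] z l) {..<n}) {..<n}"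
 unfolding pair_def[of c]
 proof (rule M.finsum_cong'[OF refl])
 fix i assume "i : {..<n}"
 hence i: "i < n" by simp
 have bc: "b i *[C] c' <: C" using c i by simp
 have "ka (c *[C] a i) *:[M] pair (b i *[C] c') z = sm M (%l. ka (c *[C] a i) *:[M] (ka (b i *[C] c' *[C] a l) *:[M] z l)) {..<n}"
 unfolding pair_def using k i term_closed[OF bc z] by (intro M.smult_r_finsum) auto
 also have "... = sm M (%l. (ka (c *[C] a i) *[A] ka (b i *[C] c' *[C] a l)) *:[M] z l) {..<n}"
 using k i zl by (intro M.finsum_cong') (simp_all add: M.smult_assoc)
 finally show "ka (c *[C] a i) *:[M] act c' z i = sm M (%l. (ka (c *[C] a i) *[A] ka (b i *[C] c' *[C] a l)) *:[M] z l) {..<n}"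
 using i by (simp add: act_def)
 qed (use k zl in "simp add: M.smult_closed A.mult_closed")
 also have "... = sm M (%l. sm M (%i. (ka (c *[C] a i) *[A] ka (b i *[C] c' *[C] a l)) *:[M] z l) {..<n}) {..<n}"
 using k zl by (intro M.finsum_swap) simp_all
 also have "... = pair (c *[C] c') z" unfolding pair_def
 proof (rule M.finsum_cong'[OF refl])
 fix l assume "l : {..<n}"
 hence l: "l < n" by simp
 have "sm M (%i. (ka (c *[C] a i) *[A] ka (b i *[C] c' *[C] a l)) *:[M] z l) {..<n}
 = sm A (%i. ka (c *[C] a i) *[A] ka (b i *[C] c' *[C] a l)) {..<n} *:[M] z l" using k l zl by (intro M.smult_l_finsum[symmetric]) simp_all
 also have "sm A (%i. ka (c *[C] a i) *[A] ka (b i *[C] c' *[C] a l)) {..<n} = sm A (%i. ka (c *[C] a i) *[A] ka (b i *[C] (c' *[C] a l))) {..<n}"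
 using c l by (intro A.M.finsum_cong') (simp_all add: C.mult_assoc)
 also have "... = ka (c *[C] c' *[C] a l)" using resolve[of c "c' *[C] a l"] c l by (simp add: C.mult_assoc)
 finally show "sm M (%i. (ka (c *[C] a i) *[A] ka (b i *[C] c' *[C] a l)) *:[M] z l) {..<n} = ka (c *[C] c' *[C] a l) *:[M] z l" .
 qed (use c z term_closed C.mult_closed in simp)
 finally show ?thesis .
qed

lemma pair_vec: assumes "c <: C" "c' <: C" "x <: M" shows "pair c (vec c' x) = ka (c *[C] c') *:[M] x"
proof -
 have k: "ka (c *[C] a i) <: A" "ka (b i *[C] c') <: A" if "i < n" for i using that assms by simp_all
 have "pair c (vec c' x) = sm M (%i. (ka (c *[C] a i) *[A] ka (b i *[C] c')) *:[M] x) {..<n}" unfolding pair_def using k assms(3)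
 by (intro M.finsum_cong') (simp_all add: vec_def M.smult_assoc)
 also have "... = sm A (%i. ka (c *[C] a i) *[A] ka (b i *[C] c')) {..<n} *:[M] x" using assms by (intro M.smult_l_finsum[symmetric]) simp_all
 finally show ?thesis using resolve assms by simp
qed

lemma act_act: assumes "c <: C" "c' <: C" "z : T"
 shows "act c (act c' z) = act (c *[C] c') z" unfolding act_def[of c] act_def[of "c *[C] c'"] using assms
 by (intro restrict_ext) (simp add: pair_act C.mult_assoc)

lemma act_vec: assumes "c <: C" "c' <: C" "x <: M" shows "act c (vec c' x) = vec (c *[C] c') x" unfolding act_def vec_def[of "c *[C] c'"] using assms
 by (intro restrict_ext) (simp add: pair_vec C.mult_assoc)

lemma vec_pair: assumes "c <: C" "c' <: C" "z : T" shows "vec c (pair c' z) = act (c *[C] e *[C] c') z" unfolding act_def vec_def using assms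
 by (intro restrict_ext) (simp add: smult_pair C.mult_assoc)

definition plus :: "(nat => 'm) => (nat => 'm) => nat => 'm" where "plus z z' = (\<lambda>i\<in>{..<n}. z i +[M] z' i)"

lemma plus_closed: "[|z : T; z' : T|] ==> plus z z' : T" by (auto simp: plus_def)

lemma act_plus: "[|c <: C; z : T; z' : T|] ==> act c (plus z z') = plus (act c z) (act c z')"
 unfolding act_def plus_def by (intro restrict_ext) (simp add: pair_add_r)

lemma act_add: "[|c <: C; c' <: C; z : T|] ==> act (c +[C] c') z = plus (act c z) (act c' z)" unfolding act_def plus_def
 by (intro restrict_ext) (simp add: C.mult_r_distr pair_add_l)

lemma vec_add: "[|c <: C; x <: M; y <: M|] ==> vec c (x +[M] y) = plus (vec c x) (vec c y)" unfolding vec_def plus_def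
 by (intro restrict_ext) (simp add: M.smult_r_distr)

lemma vec_smult: assumes "c <: C" "r <: A" "x <: M" shows "vec c (r *:[M] x) = vec (c *[C] j r) x" unfolding vec_def
proof (rule restrict_ext)
 fix i assume "i : {..<n}"
 hence bc: "b i *[C] c <: C" using assms by simp
 have "ka (b i *[C] c) *:[M] (r *:[M] x) = (ka (b i *[C] c) *[A] ka (j r)) *:[M] x" using assms bc by (simp add: M.smult_assoc ka_j)
 also have "ka (b i *[C] c) *[A] ka (j r) = ka (b i *[C] (c *[C] j r))" using assms `i : {..<n}` by (simp add: ka_mult jD(1) C.mult_assoc e_j)
 finally show "ka (b i *[C] c) *:[M] (r *:[M] x) = ka (b i *[C] (c *[C] j r)) *:[M] x" .
qed

lemma vec_e: "[|c <: C; x <: M|] ==> vec (c *[C] e) x = vec c x" using vec_smult[of c "1[A]" x] by simp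

lemma vec_add_l: assumes "c <: C" "c' <: C" "x <: M" shows "vec (c +[C] c') x = plus (vec c x) (vec c' x)" unfolding vec_def plus_def using assms
 by (intro restrict_ext) (simp add: C.mult_r_distr ka_add M.smult_l_distr)

lemma pair_smult: assumes "k <: K" "c <: C" "z : T" shows "pair (k *:[C] c) z = (k *:[A] 1[A]) *:[M] pair c z"
proof -
 have z: "z l <: M" if "l < n" for l using assms that by auto
 have kapk: "ka (k *:[C] x) = (k *:[A] 1[A]) *[A] ka x" if "x <: C" for x by (rule kaI)
 (use that assms(1) in "simp_all add: A.mult_smult_l ka_closed jD(4) j_kap C.mult_smult_l C.mult_smult_r e_closed C.mult_closed")
 have "(k *:[A] 1[A]) *:[M] pair c z = sm M (%l. (k *:[A] 1[A]) *:[M] (ka (c *[C] a l) *:[M] z l)) {..<n}"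
 unfolding pair_def using assms by (intro M.smult_r_finsum) (simp_all add: term_closed)
 also have "... = pair (k *:[C] c) z" unfolding pair_def using assms z by (intro M.finsum_cong') (simp_all add: C.mult_smult_l kapk M.smult_assoc)
 finally show ?thesis ..
qed

lemma plus_assoc: "[|z : T; z' : T; z'' : T|] ==> plus (plus z z') z'' = plus z (plus z' z'')"
 unfolding plus_def by (intro restrict_ext) (auto simp: M.M.a_assoc PiE_def Pi_def)

lemma plus_comm: "[|z : T; z' : T|] ==> plus z z' = plus z' z" unfolding plus_def by (intro restrict_ext) (auto simp: M.M.a_comm PiE_def Pi_def)

definition none :: "nat => 'm" where "none = (\<lambda>i\<in>{..<n}. 0[M])"

lemma none_closed: "none : T" by (simp add: none_def)

lemma plus_none: "z : T ==> plus none z = z" by (rule extensionalityI[of _ "{..<n}"]) (auto simp: plus_def none_def PiE_def Pi_def)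

lemma act_zero: assumes "z : T" shows "act 0[C] z = none" unfolding act_def none_def
proof (rule restrict_ext)
 fix i assume "i : {..<n}"
 have "pair 0[C] z = 0[M]" using pair_add_l[of "0[C]" "0[C]" z] pair_closed[of "0[C]" z] assms by simp
 thus "pair (b i *[C] 0[C]) z = 0[M]" using `i : {..<n}` by simp
qed

end

text \<open>Two algebras are compared through a common algebra \<open>C\<close> of which both are
  full corners. The functors come from the bimodules between the two idempotents, and the situation
  is symmetric.\<close>

locale two_corners = X: corner K A C jA n a b + Y: corner K B C jB m c d
 for K :: "'k ring" and A :: "('k, 'a) module" and B :: "('k, 'b) module" and C :: "('k, 'c) module"
 and jA n a b jB m c d
begin

text \<open>\<open>B\<close> acts on \<open>eCe' \<otimes> M\<close>, where \<open>e\<close> and \<open>e'\<close> are the identities of \<open>B\<close> and \<open>A\<close> in \<open>C\<close>.\<close>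

definition tensor :: "('a, 'u) module => ('b, nat => 'u) module" where
 "tensor M = \<lparr>carrier = {z : {..<n} \<rightarrow>\<^sub>E car M. corner_mod.act A C jA n a b M (jB 1[B]) z = z},
 monoid.mult = undefined, one = undefined, ring.zero = corner_mod.none n M,
 add = corner_mod.plus n M, smult = (%r. corner_mod.act A C jA n a b M (jB r))\<rparr>"

text \<open>The tensor product consists of tuples; they are coded so that the functor stays within
  one universe.\<close>

definition fobj :: "('a, 'u) module => ('b, 'u) module" where "fobj M = imod (tuple n) (tensor M)"

definition farr :: "('a, 'u) module => ('a, 'u) module => ('u => 'u) => 'u => 'u" where
 "farr M N f = image_map (tuple n) (tensor M) (%z. tuple n (%i. f (z i)))"

lemma corner_modI: "lmod A M ==> corner_mod K A C jA n a b M" by (intro corner_mod.intro X.corner_axioms)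

text \<open>Restricting to the tuples fixed by the idempotent \<open>jB 1[B]\<close> is what makes
  the action of \<open>B\<close> unital.\<close>

lemma left_module_tensor:
 assumes "lmod A M" shows "lmod B (tensor M)"
proof -
 interpret M: corner_mod K A C jA n a b M by (rule corner_modI[OF assms])
 have s: "z <: (tensor M) <-> z : M.T & M.act Y.e z = z" "0[tensor M] = M.none"
 "z +[tensor M] z' = M.plus z z'" "r *:[tensor M] z = M.act (jB r) z" for z z' r by (simp_all add: tensor_def)
 have ag: "abelian_group (tensor M)"
 proof (rule abelian_groupI)
 show "0[tensor M] <: (tensor M)" using M.act_act[OF Y.e_closed, of "0[C]"] M.act_zero M.none_closed by (simp add: s)
 fix z assume z: "z <: (tensor M)"
 have e: "-[C] Y.e +[C] Y.e = 0[C]" using Y.e_closed by (rule X.C.M.l_neg)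
 have "M.act (-[C] Y.e) z <: (tensor M)" using z by (simp add: s M.act_closed M.act_act X.C.mult_minus_r Y.ee)
 moreover have "M.act (-[C] Y.e) z +[tensor M] z = 0[tensor M]" using M.act_add[of "-[C] Y.e" Y.e z] z by (simp add: s e M.act_zero)
 ultimately show "EX y:car (tensor M). y +[tensor M] z = 0[tensor M]" by blast
 qed (simp_all add: s M.plus_closed M.act_plus Y.e_closed M.plus_none, simp add: M.plus_assoc, simp add: M.plus_comm)
 show ?thesis unfolding left_module_def left_module_axioms_def
 proof (intro conjI ag Y.A.A.ring_axioms allI impI)
 fix r z assume "r <: B" "z <: (tensor M)"
 thus "r *:[tensor M] z <: (tensor M)" by (simp add: s M.act_closed Y.jD(1) M.act_act Y.e_j)
 qed (simp_all add: s Y.jD M.act_plus M.act_add M.act_act)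
qed

lemma tensorD: "z <: (tensor M) ==> z : {..<n} \<rightarrow>\<^sub>E car M" by (simp add: tensor_def)

lemma inj_tensor:
 fixes M :: "('a, 'u) module"
 assumes "infinite (UNIV :: 'u set)" shows "inj_on (tuple n) (car (tensor M))" by (rule inj_tuple[OF assms]) (use tensorD in "auto simp: PiE_def")

lemma fobj_closed: "z <: (tensor M) ==> tuple n z <: (fobj M)" by (simp add: fobj_def image_simps)

lemma fobjE: assumes "y <: (fobj M)" obtains z where "z <: (tensor M)" "y = tuple n z" using assms by (auto simp: fobj_def image_simps)

lemma left_module_fobj:
 fixes M :: "('a, 'u) module"
 assumes "infinite (UNIV :: 'u set)" "lmod A M" shows "lmod B (fobj M)"
 unfolding fobj_def by (rule left_module_image[OF left_module_tensor[OF assms(2)] inj_tensor[OF assms(1)]])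

lemma tensor_map:
 assumes M: "lmod A M" and N: "lmod A N" and f: "lmap A M N f" and z: "z <: (tensor M)"
 shows "(\<lambda>i\<in>{..<n}. f (z i)) <: (tensor N)"
 and "r <: C ==> (\<lambda>i\<in>{..<n}. f (corner_mod.act A C jA n a b M r z i)) =
 corner_mod.act A C jA n a b N r (\<lambda>i\<in>{..<n}. f (z i))"
proof -
 interpret M: corner_mod K A C jA n a b M by (rule corner_modI[OF M])
 interpret N: corner_mod K A C jA n a b N by (rule corner_modI[OF N])
 have z': "z : M.T" "M.act Y.e z = z" using z by (simp_all add: tensor_def)
 have fz: "(\<lambda>i\<in>{..<n}. f (z i)) : N.T" using z' lmapD(1)[OF f] by auto
 have zl: "z l <: M" if "l < n" for l using z' that by auto
 have p: "f (M.pair r z) = N.pair r (\<lambda>i\<in>{..<n}. f (z i))" if r: "r <: C" for r proof -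
 have "f (M.pair r z) = sm N (%l. f (X.ka (r *[C] a l) *:[M] z l)) {..<n}"
 unfolding M.pair_def using M.term_closed[OF r z'(1)] by (intro lmap_finsum[OF f M N]) simp
 also have "... = N.pair r (\<lambda>i\<in>{..<n}. f (z i))" unfolding N.pair_def using N.term_closed[OF r fz] zl r
 by (intro N.M.finsum_cong') (simp_all add: lmapD(3)[OF f])
 finally show ?thesis .
 qed
 show act: "(\<lambda>i\<in>{..<n}. f (M.act r z i)) = N.act r (\<lambda>i\<in>{..<n}. f (z i))" if "r <: C" for r
 unfolding N.act_def using that by (intro restrict_ext) (simp add: M.act_def p)
 show "(\<lambda>i\<in>{..<n}. f (z i)) <: (tensor N)" using act[OF Y.e_closed] z' fz by (simp add: tensor_def)
qed

lemma farr_tuple: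
 fixes M N :: "('a, 'u) module"
 assumes "infinite (UNIV :: 'u set)" "z <: (tensor M)" shows "farr M N f (tuple n z) = tuple n (\<lambda>i\<in>{..<n}. f (z i))"
proof -
 have "farr M N f (tuple n z) = tuple n (%i. f (z i))" unfolding farr_def by (rule image_ops(3)[OF inj_tensor[OF assms(1)] assms(2)])
 also have "... = tuple n (\<lambda>i\<in>{..<n}. f (z i))" by (rule tuple_cong) simp
 finally show ?thesis .
qed

lemma fobj_ops:
 fixes M :: "('a, 'u) module"
 assumes "infinite (UNIV :: 'u set)" "z <: (tensor M)"
 shows "z' <: (tensor M) ==> tuple n z +[fobj M] tuple n z' = tuple n (corner_mod.plus n M z z')"
 "r *:[fobj M] tuple n z = tuple n (corner_mod.act A C jA n a b M (jB r) z)"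
 using image_ops[OF inj_tensor[OF assms(1)] assms(2)] by (simp_all add: fobj_def tensor_def)

lemma linear_functor_tensor:
 assumes inf: "infinite (UNIV :: 'u set)" shows "linear_functor K A B (fobj :: ('a, 'u) module => ('b, 'u) module) farr"
proof (rule linear_functor.intro)
 note fo = fobj_ops[OF inf] and ft = farr_tuple[OF inf]
 fix M N :: "('a, 'u) module" and f
 assume M: "lmod A M"
 show "lmod B (fobj M)" by (rule left_module_fobj[OF inf M])
 have ext: "farr M N f : extensional (car (fobj M))" for N f by (simp add: farr_def image_map_def fobj_def image_simps)
 show "farr M M (mod_id M) = mod_id (fobj M)"
 proof (rule extensionalityI[OF ext])
 show "mod_id (fobj M) : extensional (car (fobj M))" by (simp add: mod_id_def)
 fix y assume y: "y <: (fobj M)"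
 then obtain z where z: "z <: (tensor M)" "y = tuple n z" by (rule fobjE)
 have "tuple n (\<lambda>i\<in>{..<n}. mod_id M (z i)) = tuple n z" by (rule tuple_cong) (use tensorD[OF z(1)] in "auto simp: mod_id_def")
 thus "farr M M (mod_id M) y = mod_id (fobj M) y" using y z ft by (simp add: mod_id_def)
 qed
 assume N: "lmod A N" and f: "f : mod_hom A M N"
 interpret M: corner_mod K A C jA n a b M by (rule corner_modI[OF M])
 interpret N: corner_mod K A C jA n a b N by (rule corner_modI[OF N])
 have f': "lmap A M N f" using f by (simp add: mod_hom_iff)
 note tm = tensor_map[OF M N f']
 have fz: "z i <: M" if "z <: (tensor M)" "i < n" for z i using tensorD[OF that(1)] that(2) by auto
 have "lmap A M N f ==> lmap B (fobj M) (fobj N) (farr M N f)" unfolding lmap_def[of B]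
 proof (intro conjI ballI)
 show "farr M N f : car (fobj M) ->: (fobj N)"
 proof
 fix y assume "y <: (fobj M)"
 then obtain z where z: "z <: (tensor M)" "y = tuple n z" by (rule fobjE)
 show "farr M N f y <: (fobj N)" unfolding z(2) ft[OF z(1)] by (rule fobj_closed[OF tm(1)[OF z(1)]])
 qed
 fix x y assume "x <: (fobj M)" "y <: (fobj M)"
 then obtain z z' where z: "z <: (tensor M)" "x = tuple n z" "z' <: (tensor M)" "y = tuple n z'" by (metis fobjE)
 interpret tM: left_module B "tensor M" by (rule left_module_tensor[OF M])
 have p: "M.plus z z' <: (tensor M)" using tM.M.add.m_closed[OF z(1,3)] by (simp add: tensor_def)
 have "farr M N f (x +[fobj M] y) = tuple n (\<lambda>i\<in>{..<n}. f (M.plus z z' i))" using z fo ft[OF p] by simp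
 also have "(\<lambda>i\<in>{..<n}. f (M.plus z z' i)) = N.plus (\<lambda>i\<in>{..<n}. f (z i)) (\<lambda>i\<in>{..<n}. f (z' i))"
 unfolding N.plus_def using fz[OF z(1)] fz[OF z(3)] by (intro restrict_ext) (simp add: M.plus_def lmapD(2)[OF f'])
 also have "tuple n ... = farr M N f x +[fobj N] farr M N f y" using z fo(1)[OF tm(1)[OF z(1)] tm(1)[OF z(3)]] ft by simp
 finally show "farr M N f (x +[fobj M] y) = farr M N f x +[fobj N] farr M N f y" .
 next
 fix r x assume r: "r <: B" and "x <: (fobj M)"
 then obtain z where z: "z <: (tensor M)" "x = tuple n z" by (metis fobjE)
 interpret tM: left_module B "tensor M" by (rule left_module_tensor[OF M])
 have p: "M.act (jB r) z <: (tensor M)" using tM.smult_closed[OF r z(1)] by (simp add: tensor_def)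
 show "farr M N f (r *:[fobj M] x) = r *:[fobj N] farr M N f x"
 using z fo(2)[OF z(1)] ft[OF p] tm(2)[OF z(1) Y.jD(1)[OF r]] fo(2)[OF tm(1)[OF z(1)]] ft[OF z(1)] by simp
 qed
 thus "farr M N f : mod_hom B (fobj M) (fobj N)" using f' ext by (simp add: mod_hom_iff)
 {
 fix h assume h: "h : mod_hom A M N"
 show "farr M N (hom_add M N f h) = hom_add (fobj M) (fobj N) (farr M N f) (farr M N h)"
 proof (rule extensionalityI[OF ext])
 show "hom_add (fobj M) (fobj N) (farr M N f) (farr M N h) : extensional (car (fobj M))" by (simp add: hom_add_def)
 fix x assume x: "x <: (fobj M)"
 then obtain z where z: "z <: (tensor M)" "x = tuple n z" by (rule fobjE)
 have h': "lmap A M N h" using h by (simp add: mod_hom_iff)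
 have "(\<lambda>i\<in>{..<n}. hom_add M N f h (z i)) = N.plus (\<lambda>i\<in>{..<n}. f (z i)) (\<lambda>i\<in>{..<n}. h (z i))"
 unfolding N.plus_def hom_add_def using fz[OF z(1)] by (intro restrict_ext) simp
 thus "farr M N (hom_add M N f h) x = hom_add (fobj M) (fobj N) (farr M N f) (farr M N h) x"
 using x z ft[OF z(1)] fo(1)[OF tm(1)[OF z(1)] tensor_map(1)[OF M N h' z(1)]] by (simp add: hom_add_def)
 qed
 next
 fix k assume k: "k <: K"
 show "farr M N (hom_smult A M N k f) = hom_smult B (fobj M) (fobj N) k (farr M N f)"
 proof (rule extensionalityI[OF ext])
 show "hom_smult B (fobj M) (fobj N) k (farr M N f) : extensional (car (fobj M))" by (simp add: hom_smult_def)
 fix x assume x: "x <: (fobj M)"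
 then obtain z where z: "z <: (tensor M)" "x = tuple n z" by (rule fobjE)
 let ?w = "\<lambda>i\<in>{..<n}. f (z i)"
 have w: "?w : N.T" "N.act Y.e ?w = ?w" using tm(1)[OF z(1)] by (simp_all add: tensor_def)
 have "(\<lambda>i\<in>{..<n}. hom_smult A M N k f (z i)) = N.act (jB (k *:[B] 1[B])) ?w" unfolding N.act_def
 proof (rule restrict_ext)
 fix i assume i: "i : {..<n}"
 have "?w i = N.pair (b i *[C] Y.e) ?w" using fun_cong[OF w(2), of i] i by (simp add: N.act_def)
 hence "(k *:[A] 1[A]) *:[N] f (z i) = N.pair (k *:[C] (b i *[C] Y.e)) ?w" using N.pair_smult[OF k _ w(1), of "b i *[C] Y.e"] i by simp
 thus "hom_smult A M N k f (z i) = N.pair (b i *[C] jB (k *:[B] 1[B])) ?w"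
 using i k fz[OF z(1)] by (simp add: hom_smult_def Y.jD(4) X.C.mult_smult_r)
 qed
 thus "farr M N (hom_smult A M N k f) x = hom_smult B (fobj M) (fobj N) k (farr M N f) x"
 using x z ft[OF z(1)] fo(2)[OF tm(1)[OF z(1)]] by (simp add: hom_smult_def)
 qed
 next
 fix P :: "('a, 'u) module" and h
 assume P: "lmod A P" and h: "h : mod_hom A N P"
 show "farr M P (compose (car M) h f) = compose (car (fobj M)) (farr N P h) (farr M N f)"
 proof (rule extensionalityI[OF ext])
 fix x assume x: "x <: (fobj M)"
 then obtain z where z: "z <: (tensor M)" "x = tuple n z" by (rule fobjE)
 have "(\<lambda>i\<in>{..<n}. compose (car M) h f (z i)) = (\<lambda>i\<in>{..<n}. h ((\<lambda>i\<in>{..<n}. f (z i)) i))"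
 using fz[OF z(1)] by (intro restrict_ext) (simp add: compose_def)
 thus "farr M P (compose (car M) h f) x = compose (car (fobj M)) (farr N P h) (farr M N f) x"
 using x z ft[OF z(1)] ft[OF tm(1)[OF z(1)]] by (simp add: compose_def)
 qed simp
 }
qed

end

sublocale two_corners \<subseteq> swap: two_corners K B A C jB m c d jA n a b by (intro two_corners.intro X.corner_axioms Y.corner_axioms)

context two_corners
begin

text \<open>The isomorphism sends \<open>y\<close> to \<open>1 \<otimes> y\<close>, written as the
  tuple of all \<open>d k \<otimes> y\<close>; here \<open>V M x y\<close> is the code of
  \<open>x \<otimes> y\<close>. The inverse multiplies by the \<open>c k\<close> and adds up, as the
  \<open>c k *[C] d k\<close> sum to \<open>1[C]\<close>.\<close>

lemma nat_iso_tensor: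
 assumes inf: "infinite (UNIV :: 'u set)" shows "nat_iso_id A (fobj :: ('a, 'u) module => ('b, 'u) module) farr swap.fobj swap.farr"
proof -
 define V where "V M x y = tuple n (corner_mod.vec A C jA n b M x y)" for M :: "('a, 'u) module" and x y
 define eta where "eta M = (\<lambda>y\<in>car M. tuple m (\<lambda>k\<in>{..<m}. V M (d k) y))" for M :: "('a, 'u) module"
 note fo = fobj_ops[OF inf] and ft = farr_tuple[OF inf]
 have tM: "corner_mod.vec A C jA n b M x y <: (tensor M)" "V M x y <: (fobj M)"
 if "lmod A M" "x <: C" "Y.e *[C] x = x" "y <: M" for M x y
 proof -
 interpret M: corner_mod K A C jA n a b M by (rule corner_modI[OF that(1)])
 show "M.vec x y <: (tensor M)" using that by (simp add: tensor_def M.vec_closed M.act_vec)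
 thus "V M x y <: (fobj M)" unfolding V_def by (rule fobj_closed)
 qed
 have main: "eta M : mod_iso A M (swap.fobj (fobj M)) &
 (ALL y:car M. (\<lambda>k\<in>{..<m}. V M (d k) y) : car (swap.tensor (fobj M)))" if M: "lmod A M" for M
 proof -
 interpret M: corner_mod K A C jA n a b M by (rule corner_modI[OF M])
 have F: "lmod B (fobj M)" by (rule left_module_fobj[OF inf M])
 interpret F: corner_mod K B C jB m c d "fobj M" by (rule swap.corner_modI[OF F])
 note dd = Y.ab_closed(2) Y.ab_e(2) and cc = Y.ab_closed(1) Y.ab_e(1)
 note T = tM[OF M]
 have Vd: "V M (d k) y <: (fobj M)" if "k < m" "y <: M" for k y using T(2)[OF dd(1)[OF that(1)] dd(2)[OF that(1)] that(2)] .
 have Vs: "r *:[fobj M] V M x y = V M (jB r *[C] x) y"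
 if "r <: B" "x <: C" "Y.e *[C] x = x" "y <: M" for r x y unfolding V_def using fo(2)[OF T(1)[OF that(2-4)]] that by (simp add: M.act_vec Y.jD(1))
 have Va: "V M x (y +[M] y') = V M x y +[fobj M] V M x y'"
 if "x <: C" "Y.e *[C] x = x" "y <: M" "y' <: M" for x y y'
 unfolding V_def using fo(1)[OF T(1)[OF that(1,2,3)] T(1)[OF that(1,2,4)]] that by (simp add: M.vec_add)
 \<comment> \<open>Additivity in the factor from \<open>C\<close> is stated after multiplication by
   \<open>Y.e\<close>, since only such tensors lie in the module.\<close>
 have Va': "V M (Y.e *[C] (x +[C] x')) y = V M (Y.e *[C] x) y +[fobj M] V M (Y.e *[C] x') y"
 if "x <: C" "x' <: C" "y <: M" for x x' y
 proof -
 have ec: "Y.e *[C] z <: C & Y.e *[C] (Y.e *[C] z) = Y.e *[C] z" if "z <: C" for z using that by (simp add: Y.ee)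
 show ?thesis unfolding V_def using fo(1)[OF T(1)[of "Y.e *[C] x" y] T(1)[of "Y.e *[C] x'" y]] that ec by (simp add: M.vec_add_l X.C.mult_r_distr)
 qed
 \<comment> \<open>All coefficients are moved into the left tensor factor, where the sum of the
   \<open>c k *[C] d k\<close> disappears.\<close>
 have pairV: "F.pair x (\<lambda>k\<in>{..<m}. V M (d k) y) = V M (Y.e *[C] x) y"
 if x: "x <: C" and y: "y <: M" for x y
 proof -
 have "F.pair x (\<lambda>k\<in>{..<m}. V M (d k) y) = sm (fobj M) (%k. V M (Y.e *[C] (x *[C] (c k *[C] d k))) y) {..<m}" unfolding F.pair_def
 proof (rule F.M.finsum_cong'[OF refl])
 fix k assume "k : {..<m}"
 hence k: "k < m" by simp
 note kk = dd[OF k] cc[OF k]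
 have "jB (Y.ka (x *[C] c k)) *[C] d k = Y.e *[C] (x *[C] (c k *[C] d k))" using kk x by (simp add: Y.j_kap X.C.mult_assoc)
 thus "Y.ka (x *[C] c k) *:[fobj M] (\<lambda>k\<in>{..<m}. V M (d k) y) k = V M (Y.e *[C] (x *[C] (c k *[C] d k))) y"
 using k kk x y by (simp add: Vs)
 next
 show "(%k. V M (Y.e *[C] (x *[C] (c k *[C] d k))) y) : {..<m} ->: (fobj M)" using x y by (auto intro!: T(2) simp: Y.ee)
 qed
 also have "... = V M (Y.e *[C] sm C (%k. x *[C] (c k *[C] d k)) {..<m}) y"
 by (rule add_finsum[OF X.C.M.ag F.M.ag, of "%z. V M (Y.e *[C] z) y", symmetric])
 (use x y dd(1) cc(1) Va' in "auto intro!: T(2) simp: X.C.mult_closed Y.e_closed Y.ee")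
 also have "sm C (%k. x *[C] (c k *[C] d k)) {..<m} = x *[C] sm C (%k. c k *[C] d k) {..<m}" by (rule X.C.mult_finsum[symmetric])
 (use x dd(1) cc(1) in "auto simp: X.C.mult_closed X.C.mult_r_distr")
 finally show ?thesis unfolding Y.full X.C.A.r_one[OF x] .
 qed
 have actV: "F.act x (\<lambda>k\<in>{..<m}. V M (d k) y) = (\<lambda>k\<in>{..<m}. V M (d k *[C] x) y)"
 if x: "x <: C" and y: "y <: M" for x y unfolding F.act_def using that dd by (intro restrict_ext) (simp add: pairV flip: X.C.mult_assoc)
 let ?G = "swap.fobj (fobj M)" and ?v = "%y. \<lambda>k\<in>{..<m}. V M (d k) y"
 have v: "?v y : car (swap.tensor (fobj M))" if y: "y <: M" for y proof -
 have "F.act X.e (?v y) = ?v y" unfolding actV[OF X.e_closed y] using y by (intro restrict_ext) (simp add: V_def M.vec_e)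
 moreover have "?v y : {..<m} \<rightarrow>\<^sub>E car (fobj M)" using Vd y by simp
 ultimately show ?thesis by (simp add: swap.tensor_def)
 qed
 note so = swap.fobj_ops[OF inf]
 have hom: "eta M : mod_hom A M ?G" unfolding mod_hom_iff lmap_def
 proof (intro conjI ballI)
 show "eta M : car M ->: ?G" using swap.fobj_closed[OF v] by (simp add: eta_def)
 show "eta M : extensional (car M)" by (simp add: eta_def)
 fix x y assume xy: "x <: M" "y <: M"
 have "?v (x +[M] y) = F.plus (?v x) (?v y)" unfolding F.plus_def using xy dd by (intro restrict_ext) (simp add: Va)
 thus "eta M (x +[M] y) = eta M x +[?G] eta M y" using xy so(1)[OF v v] by (simp add: eta_def)
 next
 fix r y assume r: "r <: A" and y: "y <: M"
 have "?v (r *:[M] y) = F.act (jA r) (?v y)" unfolding actV[OF X.jD(1)[OF r] y] using r y by (intro restrict_ext) (simp add: V_def M.vec_smult)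
 thus "eta M (r *:[M] y) = r *:[?G] eta M y" using r y so(2)[OF v] by (simp add: eta_def)
 qed
 have "inj_on (eta M) (car M)"
 proof
 fix y y' assume y: "y <: M" "y' <: M" "eta M y = eta M y'"
 have eq: "M.vec (d k) y = M.vec (d k) y'" if k: "k < m" for k proof -
 have "tuple m (?v y) = tuple m (?v y')" using y by (simp only: eta_def restrict_apply')
 from tuple_inject[OF inf this k] have "?v y k = ?v y' k" .
 hence "tuple n (M.vec (d k) y) = tuple n (M.vec (d k) y')" using k by (simp add: V_def)
 thus ?thesis using inj_onD[OF inj_tensor[OF inf] _ T(1)[OF dd[OF k] y(1)] T(1)[OF dd[OF k] y(2)]] by simp
 qed
 \<comment> \<open>Contracting the tuple with the \<open>c k\<close> recovers
   \<open>y\<close>.\<close>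
 have r: "y = sm M (%k. M.pair (c k) (M.vec (d k) y)) {..<m}" if y: "y <: M" for y proof -
 have k: "X.ka (c k *[C] d k) <: A" if "k < m" for k using that by simp
 have "sm M (%k. M.pair (c k) (M.vec (d k) y)) {..<m} = sm M (%k. X.ka (c k *[C] d k) *:[M] y) {..<m}"
 using y by (intro M.M.finsum_cong') (simp_all add: M.pair_vec)
 also have "... = sm A (%k. X.ka (c k *[C] d k)) {..<m} *:[M] y" using y by (intro M.M.smult_l_finsum[symmetric]) simp_all
 also have "sm A (%k. X.ka (c k *[C] d k)) {..<m} = X.ka 1[C]" unfolding Y.full[symmetric]  by (intro X.ka_finsum[symmetric]) simp
 finally show ?thesis using y by (simp add: X.ka_one)
 qed
 have "sm M (%k. M.pair (c k) (M.vec (d k) y)) {..<m} = sm M (%k. M.pair (c k) (M.vec (d k) y')) {..<m}"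
 using eq y(2) by (intro M.M.finsum_cong') (simp_all add: M.pair_closed M.vec_closed)
 thus "y = y'" by (simp only: r[OF y(1), symmetric] r[OF y(2), symmetric])
 qed
 moreover have "eta M ` car M = car ?G"
 proof
 show "eta M ` car M <= car ?G" by (rule image_subsetI) (rule lmapD(1)[OF hom[unfolded mod_hom_iff, THEN conjunct1]])
 show "car ?G <= eta M ` car M"
 proof
 fix q assume "q <: ?G"
 then obtain y where y: "y : car (swap.tensor (fobj M))" "q = tuple m y" by (rule swap.fobjE)
 have y': "y : F.T" "F.act X.e y = y" using y(1) by (simp_all add: swap.tensor_def)
 have "ALL k:{..<m}. EX z. z <: (tensor M) & y k = tuple n z"
 proof
 fix k assume "k : {..<m}"
 hence "y k <: (fobj M)" using y'(1) by auto
 thus "EX z. z <: (tensor M) & y k = tuple n z" by (metis fobjE)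
 qed
 from bchoice[OF this] obtain z where z: "z k <: (tensor M)" "y k = tuple n (z k)" if "k < m" for k by blast
 have zT: "z k : M.T" if "k < m" for k using tensorD[OF z(1)[OF that]] .
 \<comment> \<open>The same contraction, applied to an arbitrary tuple, gives its preimage.\<close>
 define x where "x = sm M (%l. M.pair (c l) (z l)) {..<m}"
 have pc: "M.pair (c l) (z l) <: M" if "l < m" for l using zT[OF that] cc(1)[OF that] by (rule M.pair_closed[rotated])
 have x: "x <: M" unfolding x_def using pc by (intro M.M.finsum_closed) simp
 have "V M (d k) x = y k" if k: "k < m" for k proof -
 have "V M (d k) x = sm (fobj M) (%l. V M (d k) (M.pair (c l) (z l))) {..<m}" unfolding x_def
 by (rule add_finsum[OF M.M.ag F.M.ag]) (use pc T(2)[OF dd[OF k]] Va[OF dd[OF k]] in auto)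
 also have "... = sm (fobj M) (%l. Y.ka (d k *[C] X.e *[C] c l) *:[fobj M] y l) {..<m}"
 proof (rule F.M.finsum_cong'[OF refl])
 fix l assume "l : {..<m}"
 hence l: "l < m" by simp
 have dec: "d k *[C] X.e *[C] c l <: C" using dd(1)[OF k] cc(1)[OF l] by simp
 have "Y.e *[C] (d k *[C] X.e *[C] c l) *[C] Y.e = (Y.e *[C] d k) *[C] X.e *[C] (c l *[C] Y.e)"
 using dd(1)[OF k] cc(1)[OF l] by (simp add: X.C.mult_assoc)
 hence jk: "jB (Y.ka (d k *[C] X.e *[C] c l)) = d k *[C] X.e *[C] c l" using dd(2)[OF k] cc(2)[OF l] by (simp add: Y.j_kap[OF dec])
 show "V M (d k) (M.pair (c l) (z l)) = Y.ka (d k *[C] X.e *[C] c l) *:[fobj M] y l" unfolding V_def z(2)[OF l] fo(2)[OF z(1)[OF l]] jk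
 by (simp add: M.vec_pair[OF dd(1)[OF k] cc(1)[OF l] zT[OF l]])
 next
 show "(%l. Y.ka (d k *[C] X.e *[C] c l) *:[fobj M] y l) : {..<m} ->: (fobj M)" using F.term_closed[OF _ y'(1)] dd(1)[OF k] by simp
 qed
 also have "... = F.act X.e y k" using k by (simp add: F.act_def F.pair_def)
 finally show ?thesis using y'(2) by simp
 qed
 hence "eta M x = tuple m y" using x by (simp add: eta_def) (rule tuple_cong, simp)
 thus "q : eta M ` car M" using x y(2) by (metis imageI)
 qed
 qed
 ultimately have "eta M : mod_iso A M ?G" by (intro mod_isoI[OF hom M swap.left_module_fobj[OF inf F]]) (simp add: bij_betw_def)
 thus ?thesis using v by blast
 qed
 have nat: "compose (car M) (eta N) f = compose (car M) (swap.farr (fobj M) (fobj N) (farr M N f)) (eta M)"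
 if M: "lmod A M" and N: "lmod A N" and f: "f : mod_hom A M N" for M N f unfolding compose_def
 proof (rule restrict_ext)
 interpret M: corner_mod K A C jA n a b M by (rule corner_modI[OF M])
 interpret N: corner_mod K A C jA n a b N by (rule corner_modI[OF N])
 fix x assume x: "x <: M"
 have fM: "lmap A M N f" using f by (simp add: mod_hom_iff)
 have fx: "f x <: N" by (rule lmapD(1)[OF fM x])
 let ?v = "\<lambda>k\<in>{..<m}. V M (d k) x"
 have vt: "?v : car (swap.tensor (fobj M))" using main[OF M] x by blast
 have "swap.farr (fobj M) (fobj N) (farr M N f) (eta M x) = tuple m (\<lambda>k\<in>{..<m}. farr M N f (?v k))"
 using swap.farr_tuple[OF inf vt] x by (simp add: eta_def)
 also have "... = tuple m (\<lambda>k\<in>{..<m}. V N (d k) (f x))"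
 proof (rule tuple_cong)
 fix k assume k: "k < m"
 have kk: "X.ka (b i *[C] d k) <: A" if "i < n" for i using that k by simp
 have "farr M N f (V M (d k) x) = tuple n (\<lambda>i\<in>{..<n}. f (M.vec (d k) x i))"
 unfolding V_def by (rule ft[OF tM(1)[OF M Y.ab_closed(2)[OF k] Y.ab_e(2)[OF k] x]])
 also have "... = V N (d k) (f x)" unfolding V_def by (rule tuple_cong) (simp add: M.vec_def N.vec_def lmapD(3)[OF fM kk x])
 finally show "(\<lambda>k\<in>{..<m}. farr M N f (?v k)) k = (\<lambda>k\<in>{..<m}. V N (d k) (f x)) k" by simp
 qed
 also have "... = eta N (f x)" using fx by (simp add: eta_def)
 finally show "eta N (f x) = swap.farr (fobj M) (fobj N) (farr M N f) (eta M x)" ..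
 qed
 show ?thesis unfolding nat_iso_id_def using main nat by (intro exI[of _ eta]) simp
qed

end

context two_corners
begin

theorem morita_equivalent_corners:
 assumes "infinite (UNIV :: 'u set)" shows "morita_equivalent TYPE('u) K A B" unfolding morita_equivalent_def
 using linear_functor_tensor[OF assms] swap.linear_functor_tensor[OF assms]
 nat_iso_tensor[OF assms] swap.nat_iso_tensor[OF assms] by blast

end

section \<open>Matrices\<close>

lemma matrix_carrier: "M <: (matrix_algebra n A) <-> M : carrier_mat n n & (ALL i<n. ALL k<n. M $$ (i, k) <: A)"
 by (fastforce simp: matrix_algebra_def elements_mat_def)

lemma matrix_ops: "M *[matrix_algebra n A] N = mat n n (%(i, k). sm A (%l. M $$ (i, l) *[A] N $$ (l, k)) {..<n})"
 "1[matrix_algebra n A] = mat n n (%(i, k). if i = k then 1[A] else 0[A])" "0[matrix_algebra n A] = mat n n (%_. 0[A])"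
 "M +[matrix_algebra n A] N = mat n n (%(i, k). M $$ (i, k) +[A] N $$ (i, k))"
 "c *:[matrix_algebra n A] M = map_mat (%x. c *:[A] x) M" by (simp_all add: matrix_algebra_def)

lemma matrix_eqI:
 assumes "M <: (matrix_algebra n A)" "N <: (matrix_algebra n A)" and "!!i k. [|i < n; k < n|] ==> M $$ (i, k) = N $$ (i, k)"
 shows "M = N" using assms by (intro eq_matI) (auto simp: matrix_carrier)

lemma (in unital_algebra) unital_matrix_algebra: "ualg K (matrix_algebra n A)"
proof -
 let ?R = "matrix_algebra n A"
 note mc = matrix_carrier[of _ n A]
 have c: "M $$ (i, k) <: A" if "M <: ?R" "i < n" "k < n" for M i k using that by (simp add: mc)
 have e: "(M *[?R] N) $$ (i, k) = sm A (%l. M $$ (i, l) *[A] N $$ (l, k)) {..<n}"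
 "1[?R] $$ (i, k) = (if i = k then 1[A] else 0[A])" "0[?R] $$ (i, k) = 0[A]"
 "(M +[?R] N) $$ (i, k) = M $$ (i, k) +[A] N $$ (i, k)" if "i < n" "k < n" for M N i k using that by (simp_all add: matrix_ops)
 have es: "(x *:[?R] M) $$ (i, k) = x *:[A] M $$ (i, k)" if "M <: ?R" "i < n" "k < n" for x M i k using that by (auto simp: mc matrix_ops)
 have tc: "M $$ (i, l) *[A] N $$ (l, k) <: A" if "M <: ?R" "N <: ?R" "i < n" "l < n" "k < n" for M N i l k using that c by simp
 have cl: "M *[?R] N <: ?R" "1[?R] <: ?R" "0[?R] <: ?R" "M +[?R] N <: ?R"
 if "M <: ?R" "N <: ?R" for M N using that by (simp_all add: mc matrix_ops)
 have oz: "1[?R] <: ?R" "0[?R] <: ?R" by (simp_all add: mc matrix_ops)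
 have scl: "x *:[?R] M <: ?R" if "x <: K" "M <: ?R" for x M using that by (auto simp: mc matrix_ops)
 have ag: "abelian_group ?R"
 proof (rule abelian_groupI)
 fix M assume M: "M <: ?R"
 have m: "mat n n (%(i, k). -[A] M $$ (i, k)) <: ?R" using c[OF M] by (simp add: mc)
 have "mat n n (%(i, k). -[A] M $$ (i, k)) +[?R] M = 0[?R]" by (rule matrix_eqI[of _ n A]) (use M m cl oz c in "simp_all add: e M.l_neg")
 thus "EX N:car ?R. N +[?R] M = 0[?R]" using m by blast
 show "0[?R] +[?R] M = M" by (rule matrix_eqI[of _ n A]) (use M cl oz c in "simp_all add: e")
 fix N assume N: "N <: ?R"
 show "M +[?R] N = N +[?R] M" by (rule matrix_eqI[of _ n A]) (use M N cl c in "simp_all add: e M.a_comm")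
 fix P assume P: "P <: ?R"
 show "M +[?R] N +[?R] P = M +[?R] (N +[?R] P)" by (rule matrix_eqI[of _ n A]) (use M N P cl c in "simp_all add: e M.a_assoc")
 qed (use cl oz in auto)
 have mod: "module K ?R"
 proof (rule moduleI[OF K.is_cring ag])
 fix M assume M: "M <: ?R"
 show "1[K] *:[?R] M = M" by (rule matrix_eqI[of _ n A]) (use M scl c in "simp_all add: es")
 fix x assume x: "x <: K"
 show "x *:[?R] M <: ?R" by (rule scl[OF x M])
 fix y assume y: "y <: K"
 show "(x +[K] y) *:[?R] M = x *:[?R] M +[?R] y *:[?R] M" by (rule matrix_eqI[of _ n A]) (use M x y scl cl c in "simp_all add: e es smult_l_distr")
 show "(x *[K] y) *:[?R] M = x *:[?R] (y *:[?R] M)" by (rule matrix_eqI[of _ n A]) (use M x y scl cl c in "simp_all add: es smult_assoc1")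
 next
 fix x M N assume x: "x <: K" and M: "M <: ?R" and N: "N <: ?R"
 show "x *:[?R] (M +[?R] N) = x *:[?R] M +[?R] x *:[?R] N" by (rule matrix_eqI[of _ n A]) (use M N x scl cl c in "simp_all add: e es smult_r_distr")
 qed
 have "pre_algebra K ?R"
 proof (intro pre_algebra.intro pre_algebra_axioms.intro K.field_axioms mod)
 fix M N P assume M: "M <: ?R" and N: "N <: ?R" and P: "P <: ?R"
 show "(M *[?R] N) *[?R] P = M *[?R] (N *[?R] P)"
 proof (rule matrix_eqI[of _ n A])
 fix i k assume ik: "i < n" "k < n"
 have t: "M $$ (i, r) *[A] N $$ (r, l) *[A] P $$ (l, k) <: A" if "r < n" "l < n" for r l using that ik c M N P by simp
 have "((M *[?R] N) *[?R] P) $$ (i, k) = sm A (%l. sm A (%r. M $$ (i, r) *[A] N $$ (r, l) *[A] P $$ (l, k)) {..<n}) {..<n}"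
 unfolding e(1)[OF ik]
 proof (rule M.finsum_cong'[OF refl])
 fix l assume "l : {..<n}"
 hence l: "l < n" by simp
 show "(M *[?R] N) $$ (i, l) *[A] P $$ (l, k) = sm A (%r. M $$ (i, r) *[A] N $$ (r, l) *[A] P $$ (l, k)) {..<n}"
 unfolding e(1)[OF ik(1) l] by (rule finsum_mult) (use tc[OF M N ik(1) _ l] c[OF P l ik(2)] in "auto simp: mult_closed mult_l_distr")
 qed (use t in "simp add: M.finsum_closed Pi_def")
 also have "... = sm A (%r. sm A (%l. M $$ (i, r) *[A] N $$ (r, l) *[A] P $$ (l, k)) {..<n}) {..<n}" using t by (intro M.finsum_swap) auto
 also have "... = (M *[?R] (N *[?R] P)) $$ (i, k)" unfolding e(1)[OF ik]
 proof (rule M.finsum_cong'[OF refl])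
 fix r assume "r : {..<n}"
 hence r: "r < n" by simp
 have "sm A (%l. M $$ (i, r) *[A] N $$ (r, l) *[A] P $$ (l, k)) {..<n} = sm A (%l. M $$ (i, r) *[A] (N $$ (r, l) *[A] P $$ (l, k))) {..<n}"
 using ik r c M N P by (intro M.finsum_cong') (simp_all add: mult_assoc)
 also have "... = M $$ (i, r) *[A] sm A (%l. N $$ (r, l) *[A] P $$ (l, k)) {..<n}" by (rule mult_finsum[symmetric])
 (use tc[OF N P r _ ik(2)] c[OF M ik(1) r] in "auto simp: mult_closed mult_r_distr")
 finally show "sm A (%l. M $$ (i, r) *[A] N $$ (r, l) *[A] P $$ (l, k)) {..<n} = M $$ (i, r) *[A] (N *[?R] P) $$ (r, k)"
 unfolding e(1)[OF r ik(2)] .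
 qed (use tc[OF M cl(1)[OF N P] ik(1) _ ik(2)] in simp)
 finally show "((M *[?R] N) *[?R] P) $$ (i, k) = (M *[?R] (N *[?R] P)) $$ (i, k)" .
 qed (use M N P cl in simp_all)
 have add: "sm A (%l. f l +[A] h l) {..<n} = sm A f {..<n} +[A] sm A h {..<n}"
 if "!!l. l < n ==> f l <: A" "!!l. l < n ==> h l <: A" for f h by (rule M.finsum_addf) (use that in auto)
 show "(M +[?R] N) *[?R] P = M *[?R] P +[?R] N *[?R] P"
 proof (rule matrix_eqI[of _ n A])
 fix i k assume ik: "i < n" "k < n"
 have "((M +[?R] N) *[?R] P) $$ (i, k) = sm A (%l. M $$ (i, l) *[A] P $$ (l, k) +[A] N $$ (i, l) *[A] P $$ (l, k)) {..<n}"
 unfolding e(1)[OF ik] using ik c[OF M] c[OF N] c[OF P] by (intro M.finsum_cong') (simp_all add: e mult_l_distr)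
 also have "... = (M *[?R] P +[?R] N *[?R] P) $$ (i, k)" unfolding e(4)[OF ik] e(1)[OF ik] using ik c[OF M] c[OF N] c[OF P] by (intro add) simp_all
 finally show "((M +[?R] N) *[?R] P) $$ (i, k) = (M *[?R] P +[?R] N *[?R] P) $$ (i, k)" .
 qed (use M N P cl in simp_all)
 show "P *[?R] (M +[?R] N) = P *[?R] M +[?R] P *[?R] N"
 proof (rule matrix_eqI[of _ n A])
 fix i k assume ik: "i < n" "k < n"
 have "(P *[?R] (M +[?R] N)) $$ (i, k) = sm A (%l. P $$ (i, l) *[A] M $$ (l, k) +[A] P $$ (i, l) *[A] N $$ (l, k)) {..<n}"
 unfolding e(1)[OF ik] using ik c[OF M] c[OF N] c[OF P] by (intro M.finsum_cong') (simp_all add: e mult_r_distr)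
 also have "... = (P *[?R] M +[?R] P *[?R] N) $$ (i, k)" unfolding e(4)[OF ik] e(1)[OF ik] using ik c[OF M] c[OF N] c[OF P] by (intro add) simp_all
 finally show "(P *[?R] (M +[?R] N)) $$ (i, k) = (P *[?R] M +[?R] P *[?R] N) $$ (i, k)" .
 qed (use M N P cl in simp_all)
 next
 fix x M N assume x: "x <: K" and M: "M <: ?R" and N: "N <: ?R"
 have s: "x *:[A] sm A f {..<n} = sm A (%l. x *:[A] f l) {..<n}" if "!!l. l < n ==> f l <: A" for f
 by (rule add_finsum[OF M.ag M.ag]) (use that x in "auto simp: smult_r_distr")
 show "(x *:[?R] M) *[?R] N = x *:[?R] (M *[?R] N)"
 proof (rule matrix_eqI[of _ n A])
 fix i k assume ik: "i < n" "k < n"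
 have "((x *:[?R] M) *[?R] N) $$ (i, k) = sm A (%l. x *:[A] (M $$ (i, l) *[A] N $$ (l, k))) {..<n}"
 unfolding e(1)[OF ik] using ik c[OF M] c[OF N] x by (intro M.finsum_cong') (simp_all add: es[OF M] mult_smult_l)
 also have "... = (x *:[?R] (M *[?R] N)) $$ (i, k)"
 unfolding es[OF cl(1)[OF M N] ik] e(1)[OF ik] using tc[OF M N ik(1) _ ik(2)] by (intro s[symmetric]) simp
 finally show "((x *:[?R] M) *[?R] N) $$ (i, k) = (x *:[?R] (M *[?R] N)) $$ (i, k)" .
 qed (use x M N cl scl in simp_all)
 show "M *[?R] (x *:[?R] N) = x *:[?R] (M *[?R] N)"
 proof (rule matrix_eqI[of _ n A])
 fix i k assume ik: "i < n" "k < n"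
 have "(M *[?R] (x *:[?R] N)) $$ (i, k) = sm A (%l. x *:[A] (M $$ (i, l) *[A] N $$ (l, k))) {..<n}"
 unfolding e(1)[OF ik] using ik c[OF M] c[OF N] x by (intro M.finsum_cong') (simp_all add: es[OF N] mult_smult_r)
 also have "... = (x *:[?R] (M *[?R] N)) $$ (i, k)"
 unfolding es[OF cl(1)[OF M N] ik] e(1)[OF ik] using tc[OF M N ik(1) _ ik(2)] by (intro s[symmetric]) simp
 finally show "(M *[?R] (x *:[?R] N)) $$ (i, k) = (x *:[?R] (M *[?R] N)) $$ (i, k)" .
 qed (use x M N cl scl in simp_all)
 qed (use cl in simp)
 then interpret R: pre_algebra K ?R .
 show ?thesis
 proof (rule R.unital_algebraI[OF oz(1)])
 fix M assume M: "M <: ?R"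
 show "1[?R] *[?R] M = M"
 proof (rule matrix_eqI[of _ n A])
 fix i k assume ik: "i < n" "k < n"
 have "sm A (%l. 1[?R] $$ (i, l) *[A] M $$ (l, k)) {..<n} = 1[?R] $$ (i, i) *[A] M $$ (i, k)"
 using ik c[OF M] by (intro M.finsum_delta) (simp_all add: e)
 thus "(1[?R] *[?R] M) $$ (i, k) = M $$ (i, k)" using ik c[OF M] by (simp add: e)
 qed (use M cl oz in simp_all)
 show "M *[?R] 1[?R] = M"
 proof (rule matrix_eqI[of _ n A])
 fix i k assume ik: "i < n" "k < n"
 have "sm A (%l. M $$ (i, l) *[A] 1[?R] $$ (l, k)) {..<n} = M $$ (i, k) *[A] 1[?R] $$ (k, k)"
 using ik c[OF M] by (intro M.finsum_delta) (simp_all add: e)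
 thus "(M *[?R] 1[?R]) $$ (i, k) = M $$ (i, k)" using ik c[OF M] by (simp add: e)
 qed (use M cl oz in simp_all)
 qed
qed

definition munit :: "('k, 'a) module => nat => nat => nat => 'a => 'a mat" where
 "munit A n i k x = mat n n (%(r, s). if r = i & s = k then x else 0[A])"

context unital_algebra
begin

lemma munit_closed: "x <: A ==> munit A n i k x <: (matrix_algebra n A)" by (simp add: munit_def matrix_carrier)

lemma munit_mult_l:
 assumes "M <: (matrix_algebra n A)" "i < n" "k < n" "x <: A"
 shows "munit A n i k x *[matrix_algebra n A] M = mat n n (%(r, s). if r = i then x *[A] M $$ (k, s) else 0[A])"
proof (rule eq_matI)
 fix r s assume "r < dim_row (mat n n (%(r, s). if r = i then x *[A] M $$ (k, s) else 0[A]))"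
 "s < dim_col (mat n n (%(r, s). if r = i then x *[A] M $$ (k, s) else 0[A]))"
 hence rs: "r < n" "s < n" by auto
 have c: "M $$ (l, s) <: A" if "l < n" for l using assms(1) that rs by (simp add: matrix_carrier)
 have "sm A (%l. munit A n i k x $$ (r, l) *[A] M $$ (l, s)) {..<n} = munit A n i k x $$ (r, k) *[A] M $$ (k, s)"
 using assms rs c by (intro M.finsum_delta) (auto simp: munit_def)
 thus "(munit A n i k x *[matrix_algebra n A] M) $$ (r, s) = mat n n (%(r, s). if r = i then x *[A] M $$ (k, s) else 0[A]) $$ (r, s)"
 using assms rs c by (simp add: matrix_ops) (simp add: munit_def)
qed (simp_all add: matrix_ops)

lemma munit_mult_r:
 assumes "M <: (matrix_algebra n A)" "i < n" "k < n" "x <: A"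
 shows "M *[matrix_algebra n A] munit A n i k x = mat n n (%(r, s). if s = k then M $$ (r, i) *[A] x else 0[A])"
proof (rule eq_matI)
 fix r s assume "r < dim_row (mat n n (%(r, s). if s = k then M $$ (r, i) *[A] x else 0[A]))"
 "s < dim_col (mat n n (%(r, s). if s = k then M $$ (r, i) *[A] x else 0[A]))"
 hence rs: "r < n" "s < n" by auto
 have c: "M $$ (r, l) <: A" if "l < n" for l using assms(1) that rs by (simp add: matrix_carrier)
 have "sm A (%l. M $$ (r, l) *[A] munit A n i k x $$ (l, s)) {..<n} = M $$ (r, i) *[A] munit A n i k x $$ (i, s)"
 using assms rs c by (intro M.finsum_delta) (auto simp: munit_def)
 thus "(M *[matrix_algebra n A] munit A n i k x) $$ (r, s) = mat n n (%(r, s). if s = k then M $$ (r, i) *[A] x else 0[A]) $$ (r, s)"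
 using assms rs c by (simp add: matrix_ops) (simp add: munit_def)
qed (simp_all add: matrix_ops)

lemma munit_mult:
 assumes "i < n" "k < n" "l < n" "x <: A" "y <: A" shows "munit A n i k x *[matrix_algebra n A] munit A n k l y = munit A n i l (x *[A] y)"
 unfolding munit_mult_l[OF munit_closed[OF assms(5)] assms(1,2,4)] using assms by (intro eq_matI) (auto simp: munit_def)

text \<open>\<open>A\<close> is the corner at position \<open>(0, 0)\<close>, which exists as
  \<open>n\<close> is positive. The matrix units of column zero and of row zero witness that the
  corner is full.\<close>

lemma corner_matrix:
 assumes n: "0 < n" shows "corner K A (matrix_algebra n A) (munit A n 0 0) n (%i. munit A n i 0 1[A]) (%i. munit A n 0 i 1[A])"
proof -
 let ?R = "matrix_algebra n A"
 interpret R: unital_algebra K ?R by (rule unital_matrix_algebra)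
 show ?thesis
 proof (intro corner.intro corner_axioms.intro unital_algebra_axioms R.unital_algebra_axioms)
 show "alg_map K A ?R (munit A n 0 0)" unfolding alg_map_def
 proof (intro conjI ballI)
 fix x y assume xy: "x <: A" "y <: A"
 show "munit A n 0 0 (x +[A] y) = munit A n 0 0 x +[?R] munit A n 0 0 y" by (intro eq_matI) (auto simp: munit_def matrix_ops)
 show "munit A n 0 0 (x *[A] y) = munit A n 0 0 x *[?R] munit A n 0 0 y" using munit_mult[OF n n n xy] by simp
 next
 fix c x assume "c <: K" "x <: A"
 thus "munit A n 0 0 (c *:[A] x) = c *:[?R] munit A n 0 0 x" by (intro eq_matI) (auto simp: munit_def matrix_ops)
 qed (use munit_closed in auto)
 show "inj_on (munit A n 0 0) (car A)"
 proof
 fix x y assume "munit A n 0 0 x = munit A n 0 0 y"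
 hence "munit A n 0 0 x $$ (0, 0) = munit A n 0 0 y $$ (0, 0)" by simp
 thus "x = y" using n by (simp add: munit_def)
 qed
 show "munit A n 0 0 1[A] *[?R] M *[?R] munit A n 0 0 1[A] : munit A n 0 0 ` car A"
 if M: "M <: ?R" for M
 proof
 have c: "M $$ (i, k) <: A" if "i < n" "k < n" for i k using M that by (simp add: matrix_carrier)
 have eM: "munit A n 0 0 1[A] *[?R] M <: ?R" using M munit_closed by simp
 show "munit A n 0 0 1[A] *[?R] M *[?R] munit A n 0 0 1[A] = munit A n 0 0 (M $$ (0, 0))"
 unfolding munit_mult_r[OF eM n n A.one_closed] unfolding munit_mult_l[OF M n n A.one_closed] using c
 by (intro eq_matI) (auto simp: munit_def)
 show "M $$ (0, 0) <: A" using c n by simp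
 qed
 show "sm ?R (%i. munit A n i 0 1[A] *[?R] munit A n 0 i 1[A]) {..<n} = 1[?R]"
 proof (rule matrix_eqI[of _ n A])
 let ?f = "%i. munit A n i 0 1[A] *[?R] munit A n 0 i 1[A]"
 have fi: "?f i = munit A n i i 1[A]" if "i < n" for i using munit_mult[OF that n that] by simp
 show "sm ?R ?f {..<n} <: ?R" using munit_closed by (intro R.M.finsum_closed) auto
 fix r s assume rs: "r < n" "s < n"
 have "sm ?R ?f {..<n} $$ (r, s) = sm A (%i. ?f i $$ (r, s)) {..<n}" by (rule add_finsum[OF R.M.ag M.ag, of "%M. M $$ (r, s)"])
 (use rs fi munit_closed in "auto simp: matrix_carrier matrix_ops")
 also have "... = ?f r $$ (r, s)" using rs by (intro M.finsum_delta) (simp_all add: fi, simp_all add: munit_def)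
 finally show "sm ?R ?f {..<n} $$ (r, s) = 1[?R] $$ (r, s)" using rs by (simp add: fi) (auto simp: munit_def matrix_ops)
 qed simp
 qed (use munit_closed munit_mult n in auto)
qed

end

lemma algebra_isomorphicE:
 assumes "algebra_isomorphic K A B"
 obtains h where "alg_map K A B h" "bij_betw h (car A) (car B)" "h 1[A] = 1[B]"
proof -
 obtain h where h: "h : ring_iso A B" "ALL c:car K. ALL x:car A. h (c *:[A] x) = c *:[B] h x"
 using assms unfolding algebra_isomorphic_def by blast
 show ?thesis by (rule that[of h]) (use h in "auto simp: ring_iso_def Ring.ring_hom_def alg_map_def")
qed

text \<open>This turns \<open>A\<close> from a corner of its matrix algebra into a corner of the
  algebra of the hair extension.\<close>

lemma corner_iso:
 assumes "corner K A C j n a b" and D: "ualg K D" and h: "alg_map K C D h" "bij_betw h (car C) (car D)" "h 1[C] = 1[D]"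
 shows "corner K A D (%x. h (j x)) n (%i. h (a i)) (%i. h (b i))" proof -
 interpret corner K A C j n a b by fact
 interpret D: unital_algebra K D by fact
 note hD = alg_mapD[OF h(1)]
 show ?thesis
 proof (intro corner.intro corner_axioms.intro A.unital_algebra_axioms D)
 show "alg_map K A D (%x. h (j x))" using hD jD by (auto simp: alg_map_def)
 show "inj_on (%x. h (j x)) (car A)" using inj_j h(2) jD(1) by (auto simp: inj_on_def bij_betw_def)
 show "h (j 1[A]) *[D] z *[D] h (j 1[A]) : (%x. h (j x)) ` car A" if z: "z <: D" for z proof -
 obtain y where y: "y <: C" "z = h y" using h(2) z unfolding bij_betw_def by blast
 have "h (j 1[A]) *[D] z *[D] h (j 1[A]) = h (j (ka y))" using y by (simp add: j_kap hD(3))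
 thus ?thesis using ka_closed[OF y(1)] by blast
 qed
 show "sm D (%i. h (a i) *[D] h (b i)) {..<n} = 1[D]" proof -
 have "sm D (%i. h (a i) *[D] h (b i)) {..<n} = sm D (%i. h (a i *[C] b i)) {..<n}" using hD by (intro D.M.finsum_cong') auto
 also have "... = h (sm C (%i. a i *[C] b i) {..<n})" by (intro alg_map_finsum[OF h(1) C.M.ag D.M.ag, symmetric]) auto
 finally show ?thesis by (simp add: full h(3))
 qed
 qed (use ab_closed ab_e hD e_closed in "auto simp flip: hD(3)")
qed

context hair
begin

text \<open>The paths witness fullness: \<open>dnp s ** rsp s\<close> is the vertex
  \<open>s\<close>, and the vertices sum to the unit.\<close>

lemma corner_hair: obtains N a b where "corner K L H.L emb N a b"
proof -
 let ?I = "emb ` car L"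
 obtain f where f: "bij_betw f {0..<card (vs E')} (vs E')" using ex_bij_betw_nat_finite[OF H.finite_verts] by blast
 define N where "N = card (vs E')"
 have fi: "f i : vs E'" if "i < N" for i using f that by (auto simp: N_def bij_betw_def)
 have fb: "inj_on f {..<N}" "f ` {..<N} = vs E'" using f by (auto simp: N_def bij_betw_def atLeast0LessThan)
 let ?e = "emb 1[L]"
 have ec: "?e <: H.L" by (rule emb_closed) simp
 have nue: "H.nu (v, 0) ** ?e = H.nu (v, 0)" "?e ** H.nu (v, 0) = H.nu (v, 0)" if "v : vs E" for v
 using nu_L[OF that] by (simp_all add: emb(2)[OF that, symmetric] flip: alg_mapD(3)[OF emb(1)])
 have es: "?e = sm H.L (%v. H.nu (v, 0)) (vs E)" proof -
 have "?e = sm H.L (%v. emb (nu v)) (vs E)" unfolding lv.one_sum by (intro alg_map_finsum[OF emb(1) fam.B.ag H.fam.B.ag]) auto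
 also have "... = sm H.L (%v. H.nu (v, 0)) (vs E)" using H.nu_L[OF base_verts] by (intro H.fam.B.finsum_cong') (auto simp: emb(2))
 finally show ?thesis .
 qed
 have mem: "sm H.L h (vs E) : ?I" if "!!v. v : vs E ==> h v : ?I" for h by (rule H.fam.B.finsum_mem) (use emb_image emb_closed that in auto)
 have nuc: "H.nu (v, 0) <: H.L" if "v : vs E" for v by (rule H.nu_L[OF base_verts[OF that]])
 have corner: "?e ** z ** ?e : ?I" if z: "z <: H.L" for z proof -
 have 1: "H.nu (u, 0) ** z ** ?e : ?I" if u: "u : vs E" for u proof -
 have "H.nu (u, 0) ** z ** ?e = sm H.L (%v. H.nu (u, 0) ** z ** H.nu (v, 0)) (vs E)" unfolding es by (rule H.lv.U.mult_finsum)
 (use nuc[OF u] nuc z in "auto simp: Hmc H.lv.U.mult_r_distr")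
 also have "... : ?I"
 proof (rule mem)
 fix v assume v: "v : vs E"
 show "H.nu (u, 0) ** z ** H.nu (v, 0) : ?I" using corner_emb[OF z base_verts[OF u] base_verts[OF v]] by (simp add: rsp_def dnp_def)
 qed
 finally show ?thesis .
 qed
 have "?e ** z ** ?e = sm H.L (%u. H.nu (u, 0) ** z ** ?e) (vs E)" by (subst (1) es,
 rule add_finsum[OF H.fam.B.ag H.fam.B.ag, of "%y. y ** z ** ?e"]) (use ec nuc z in "auto simp: Hmc H.lv.U.mult_l_distr")
 also have "... : ?I" using 1 by (rule mem)
 finally show ?thesis .
 qed
 have "corner K L H.L emb N (%i. dnp (f i)) (%i. rsp (f i))"
 proof (intro corner.intro corner_axioms.intro unital_L H.unital_L emb(1) inj_emb corner)
 fix i assume i: "i < N"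
 note p = pathp[OF fi[OF i]]
 show "dnp (f i) <: H.L" "rsp (f i) <: H.L" using p by auto
 have "dnp (f i) ** ?e = dnp (f i) ** H.nu (fst (f i), 0) ** ?e" using p by simp
 also have "... = dnp (f i)" unfolding Hma[OF p(1) nuc[OF p(9)] ec] nue(1)[OF p(9)] by (rule p(5))
 finally show "dnp (f i) ** ?e = dnp (f i)" .
 have "?e ** rsp (f i) = ?e ** (H.nu (fst (f i), 0) ** rsp (f i))" using p by simp
 also have "... = rsp (f i)" unfolding Hma[OF ec nuc[OF p(9)] p(2), symmetric] nue(2)[OF p(9)] by (rule p(6))
 finally show "?e ** rsp (f i) = rsp (f i)" .
 next
 have "sm H.L (%i. dnp (f i) ** rsp (f i)) {..<N} = sm H.L (%i. H.nu (f i)) {..<N}"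
 using fi by (intro H.fam.B.finsum_cong') (auto simp: pathp)
 also have "... = sm H.L (%s. H.nu s) (vs E')" unfolding fb(2)[symmetric] using fb by (intro H.fam.B.finsum_reindex[symmetric]) auto
 finally show "sm H.L (%i. dnp (f i) ** rsp (f i)) {..<N} = 1[H.L]" by (simp add: H.lv.one_sum)
 qed
 thus ?thesis by (rule that)
qed

text \<open>Both \<open>A\<close> and \<open>L\<close> are full corners of \<open>H.L\<close>: the
  former through the matrix algebra, the latter through \<open>emb\<close>.\<close>

theorem morita_equivalent_hair:
 assumes A: "ualg K A" and n: "0 < n" and inf: "infinite (UNIV :: 'u set)" and iso: "algebra_isomorphic K (matrix_algebra n A) H.L"
 shows "morita_equivalent TYPE('u) K A L" proof -
 interpret A: unital_algebra K A by fact
 obtain h where h: "alg_map K (matrix_algebra n A) H.L h" "bij_betw h (car (matrix_algebra n A)) (car H.L)" "h 1[matrix_algebra n A] = 1[H.L]"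
 using iso by (rule algebra_isomorphicE)
 obtain N a b where N: "corner K L H.L emb N a b" by (rule corner_hair)
 have "two_corners K A L H.L (%x. h (munit A n 0 0 x)) n (%i. h (munit A n i 0 1[A])) (%i. h (munit A n 0 i 1[A])) emb N a b"
 by (intro two_corners.intro corner_iso[OF A.corner_matrix[OF n] H.unital_L h] N)
 thus ?thesis by (rule two_corners.morita_equivalent_corners[OF _ inf])
qed

end

section \<open>Equivalences of module categories\<close>

text \<open>Cosets are replaced by chosen representatives, so that the quotient has its carrier in
  the same type and remains in the universe.\<close>

lemma (in left_module) quotient:
 fixes S
 assumes S: "S <= car M" "0[M] : S" "!!x y. [|x : S; y : S|] ==> x +[M] y : S" "!!a x. [|a <: R; x : S|] ==> a *:[M] x : S"
 obtains Q :: "('a, 'm) module" and q where "lmod R Q" "q ` car M = car Q" "!!x y. [|x <: M; y <: M|] ==> q (x +[M] y) = q x +[Q] q y"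
 "!!a x. [|a <: R; x <: M|] ==> q (a *:[M] x) = a *:[Q] q x" "!!x. x <: M ==> q x = 0[Q] <-> x : S"
proof -
 have Sc: "x <: M" if "x : S" for x using that S(1) by blast
 have neg: "-[M] x : S" if "x : S" for x proof -
 have "-[M] x = (-[R] 1[R]) *:[M] x" using Sc[OF that] by (simp add: smult_l_minus)
 thus ?thesis using S(4)[OF _ that] by simp
 qed
 have mz: "x +[M] -[M] 0[M] = x" if "x <: M" for x proof -
 have "-[M] 0[M] = 0[M]" by simp
 thus ?thesis using that by (simp only: M.r_zero)
 qed
 define eq where "eq x y <-> y <: M & x +[M] -[M] y : S" for x y
 have sym: "eq y x" if "x <: M" "eq x y" for x y proof -
 have y: "y <: M" "x +[M] -[M] y : S" using that by (auto simp: eq_def)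
 have "y +[M] -[M] x = -[M] (x +[M] -[M] y)" using y that by (simp add: M.minus_add M.a_comm)
 thus ?thesis using neg[OF y(2)] that(1) by (simp add: eq_def)
 qed
 have trans: "eq x z" if "x <: M" "eq x y" "eq y z" for x y z proof -
 have yz: "y <: M" "z <: M" using that by (auto simp: eq_def)
 have "x +[M] -[M] z = (x +[M] -[M] y) +[M] (y +[M] -[M] z)" using that(1) yz by (simp add: M.a_assoc M.r_neg1)
 thus ?thesis using S(3) that by (simp add: eq_def)
 qed
 \<comment> \<open>For equivalent elements the predicates \<open>eq x\<close> and
   \<open>eq y\<close> coincide, so the choice picks the same representative for both.\<close>
 define q where "q x = (SOME y. eq x y)" for x
 have q: "eq x (q x)" if "x <: M" for x unfolding q_def by (rule someI[of "eq x" x]) (use that S(2) in "simp add: eq_def M.r_neg")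
 have qc: "q x <: M" if "x <: M" for x using q[OF that] by (simp add: eq_def)
 have qeq: "q x = q y" if "x <: M" "y <: M" "eq x y" for x y proof -
 have "eq x = eq y" using that sym trans by (intro ext iffI) blast+
 thus ?thesis by (simp add: q_def)
 qed
 have q2: "q (q x +[M] q y) = q (x +[M] y)" if "x <: M" "y <: M" for x y
 proof (rule qeq[symmetric])
 have "x +[M] y +[M] -[M] (q x +[M] q y) = (x +[M] -[M] q x) +[M] (y +[M] -[M] q y)" using that qc by (simp add: M.minus_add M.a_ac)
 thus "eq (x +[M] y) (q x +[M] q y)" using S(3) q[OF that(1)] q[OF that(2)] by (simp add: eq_def)
 qed (use that qc in auto)
 have q3: "q (a *:[M] q x) = q (a *:[M] x)" if "a <: R" "x <: M" for a x
 proof (rule qeq[symmetric])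
 have "a *:[M] x +[M] -[M] (a *:[M] q x) = a *:[M] (x +[M] -[M] q x)" using that qc by (simp add: smult_r_distr smult_r_minus)
 thus "eq (a *:[M] x) (a *:[M] q x)" using S(4)[OF that(1)] q[OF that(2)] that(1) by (simp add: eq_def)
 qed (use that qc smult_closed in auto)
 define Q :: "('a, 'm) module" where "Q = \<lparr>carrier = q ` car M, monoid.mult = undefined, one = undefined,
 ring.zero = q 0[M], add = (%x y. q (x +[M] y)), smult = (%a x. q (a *:[M] x))\<rparr>"
 have Qs: "car Q = q ` car M" "0[Q] = q 0[M]" "!!x y. [|x <: M; y <: M|] ==> q x +[Q] q y = q (x +[M] y)"
 "!!a x. [|a <: R; x <: M|] ==> a *:[Q] q x = q (a *:[M] x)" using q2 q3 by (simp_all add: Q_def)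
 have "abelian_group Q"
 proof (rule abelian_groupI)
 fix x assume "x <: Q"
 then obtain y where y: "y <: M" "x = q y" by (auto simp: Qs)
 hence "q (-[M] y) +[Q] x = 0[Q]" by (simp add: Qs M.l_neg)
 thus "EX y:car Q. y +[Q] x = 0[Q]" using y unfolding Qs(1) by blast
 qed (auto simp: Qs M.a_ac)
 hence "lmod R Q" unfolding left_module_def left_module_axioms_def by (auto simp: Qs smult_l_distr smult_r_distr smult_assoc R.ring_axioms)
 moreover have "q x = 0[Q] <-> x : S" if x: "x <: M" for x
 proof
 assume "q x = 0[Q]"
 hence "eq x (q 0[M])" using q[OF x] by (simp add: Qs)
 hence "eq x 0[M]" using trans[OF x _ sym[OF _ q]] by simp
 thus "x : S" using mz[OF x] by (simp add: eq_def)
 next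
 assume "x : S"
 hence "eq x 0[M]" using mz[OF x] by (simp add: eq_def)
 thus "q x = 0[Q]" using qeq[OF x] by (simp add: Qs)
 qed
 ultimately show ?thesis using that[of Q q] Qs by simp
qed

definition zmap :: "('a, 'u) module => ('a, 'u) module => 'u => 'u" where "zmap M N = (\<lambda>x\<in>car M. 0[N])"

lemma zmap_hom: assumes "lmod A M" "lmod A N" shows "zmap M N : mod_hom A M N"
proof -
 interpret M: left_module A M by fact
 interpret N: left_module A N by fact
 show ?thesis by (auto simp: mod_hom_iff lmap_def zmap_def)
qed

lemma mod_hom_eqI: "[|f : mod_hom A M N; g : mod_hom A M N'; !!x. x <: M ==> f x = g x|] ==> f = g"
 by (rule extensionalityI[of f "car M"]) (auto simp: mod_hom_iff)

lemma mod_hom_closed: "[|f : mod_hom A M N; x <: M|] ==> f x <: N" by (auto simp: mod_hom_iff lmap_def)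

lemma mod_hom_compose:
 assumes "f : mod_hom A L M" "g : mod_hom A M N" "lmod A L" shows "compose (car L) g f : mod_hom A L N"
proof -
 interpret left_module A L by fact
 have f: "lmap A L M f" and g: "lmap A M N g" using assms by (auto simp: mod_hom_iff)
 have "lmap A L N (compose (car L) g f)" unfolding lmap_def
 proof (intro conjI ballI)
 show "compose (car L) g f : car L ->: N" using lmapD(1)[OF f] lmapD(1)[OF g] by (simp add: compose_def)
 qed (use lmapD(1)[OF f] in "simp_all add: compose_def smult_closed lmapD(2,3)[OF f] lmapD(2,3)[OF g]")
 thus ?thesis by (simp add: mod_hom_iff)
qed

lemma mod_isoE:
 assumes "f : mod_iso A M N"
 obtains g where "f : mod_hom A M N" "g : mod_hom A N M" "!!x. x <: M ==> g (f x) = x" "!!y. y <: N ==> f (g y) = y"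
proof -
 obtain g where g: "f : mod_hom A M N" "g : mod_hom A N M" "compose (car M) g f = mod_id M"
 "compose (car N) f g = mod_id N" using assms by (auto simp: mod_iso_def)
 have "g (f x) = x" if "x <: M" for x using fun_cong[OF g(3), of x] that by (simp add: compose_def mod_id_def)
 moreover have "f (g y) = y" if "y <: N" for y using fun_cong[OF g(4), of y] that by (simp add: compose_def mod_id_def)
 ultimately show ?thesis by (rule that[OF g(1,2)])
qed

text \<open>A Morita equivalence with its natural isomorphisms named and naturality evaluated at
  elements. The locale is symmetric, so each fact about \<open>F\<close> is available for
  \<open>G\<close>.\<close>

locale equivalence = A: unital_algebra K A + B: unital_algebra K B +
 F: linear_functor K A B F Phi + G: linear_functor K B A G Gam
 for K :: "'k ring" and A :: "('k, 'a) module" and B :: "('k, 'b) module"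
 and F :: "('a, 'u) module => ('b, 'u) module" and Phi and G :: "('b, 'u) module => ('a, 'u) module" and Gam +
 fixes eta :: "('a, 'u) module => 'u => 'u" and zet :: "('b, 'u) module => 'u => 'u"
 assumes eta_iso: "lmod A M ==> eta M : mod_iso A M (G (F M))"
 and eta_nat: "[|lmod A M; lmod A N; f : mod_hom A M N; x <: M|] ==>
 eta N (f x) = Gam (F M) (F N) (Phi M N f) (eta M x)"
 and zet_iso: "lmod B X ==> zet X : mod_iso B X (F (G X))" and zet_nat: "[|lmod B X; lmod B Y; h : mod_hom B X Y; y <: X|] ==>
 zet Y (h y) = Phi (G X) (G Y) (Gam X Y h) (zet X y)"

sublocale equivalence \<subseteq> swap: equivalence K B A G Gam F Phi zet eta by unfold_locales (use eta_iso eta_nat zet_iso zet_nat in blast)+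

context equivalence
begin

lemma eta_inv:
 assumes "lmod A M"
 obtains eta' where "eta M : mod_hom A M (G (F M))" "eta' : mod_hom A (G (F M)) M"
 "!!x. x <: M ==> eta' (eta M x) = x" "!!y. y : car (G (F M)) ==> eta M (eta' y) = y" using mod_isoE[OF eta_iso[OF assms]] by blast

lemma eta_inj: "[|lmod A M; x <: M; y <: M; eta M x = eta M y|] ==> x = y" by (metis eta_inv)

lemma faithful:
 assumes M: "lmod A M" and N: "lmod A N" and fg: "f : mod_hom A M N" "g : mod_hom A M N" and eq: "Phi M N f = Phi M N g" shows "f = g"
proof (rule mod_hom_eqI[OF fg])
 fix x assume x: "x <: M"
 have "eta N (f x) = eta N (g x)" using eta_nat[OF M N fg(1) x] eta_nat[OF M N fg(2) x] eq by simp
 thus "f x = g x" using eta_inj[OF N] mod_hom_closed fg x by metis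
qed

text \<open>The zero map is the only solution of \<open>z + z = z\<close>, and the functor preserves
  sums.\<close>

lemma F_zero: assumes M: "lmod A M" and N: "lmod A N" shows "Phi M N (zmap M N) = zmap (F M) (F N)"
proof -
 interpret FN: left_module B "F N" by (rule F.obj[OF N])
 interpret N: left_module A N by fact
 have z: "zmap M N : mod_hom A M N" by (rule zmap_hom[OF M N])
 have "hom_add M N (zmap M N) (zmap M N) = zmap M N" unfolding hom_add_def zmap_def by (rule restrict_ext) simp
 hence h: "Phi M N (zmap M N) = hom_add (F M) (F N) (Phi M N (zmap M N)) (Phi M N (zmap M N))" using F.map_add[OF M N z z] by simp
 show ?thesis
 proof (rule mod_hom_eqI[OF F.arr[OF M N z] zmap_hom[OF F.obj[OF M] F.obj[OF N]]])
 fix x assume x: "x <: (F M)"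
 have "Phi M N (zmap M N) x = Phi M N (zmap M N) x +[F N] Phi M N (zmap M N) x" using fun_cong[OF h, of x] x by (simp add: hom_add_def)
 hence "Phi M N (zmap M N) x = 0[F N]" using mod_hom_closed[OF F.arr[OF M N z] x] by (metis FN.M.add.l_cancel_one')
 thus "Phi M N (zmap M N) x = zmap (F M) (F N) x" using x by (simp add: zmap_def)
 qed
qed

end

context equivalence
begin

text \<open>The candidate is \<open>Gam h\<close> conjugated with \<open>eta\<close>; faithfulness
  of the functor \<open>G\<close> identifies its image under \<open>F\<close>.\<close>

lemma full:
 assumes M: "lmod A M" and N: "lmod A N" and h: "h : mod_hom B (F M) (F N)"
 obtains f where "f : mod_hom A M N" "Phi M N f = h"
proof -
 note FM = F.obj[OF M] and FN = F.obj[OF N]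
 note Gh = G.arr[OF FM FN h]
 obtain eta' where e: "eta' : mod_hom A (G (F N)) N" "!!y. y : car (G (F N)) ==> eta N (eta' y) = y" using eta_inv[OF N] by metis
 obtain eta'' where e': "eta M : mod_hom A M (G (F M))" "eta'' : mod_hom A (G (F M)) M" "!!y. y : car (G (F M)) ==> eta M (eta'' y) = y"
 using eta_inv[OF M] by metis
 define f where "f = compose (car M) eta' (compose (car M) (Gam (F M) (F N) h) (eta M))"
 have f: "f : mod_hom A M N" unfolding f_def by (intro mod_hom_compose[OF mod_hom_compose[OF e'(1) Gh M] e(1) M])
 have "Gam (F M) (F N) (Phi M N f) = Gam (F M) (F N) h"
 proof (rule mod_hom_eqI[OF G.arr[OF FM FN F.arr[OF M N f]] Gh])
 fix y assume y: "y : car (G (F M))"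
 have y': "eta'' y <: M" by (rule mod_hom_closed[OF e'(2) y])
 have "Gam (F M) (F N) (Phi M N f) y = eta N (f (eta'' y))" using eta_nat[OF M N f y'] e'(3)[OF y] by simp
 also have "... = Gam (F M) (F N) h y" using y' e'(3)[OF y] e(2)[OF mod_hom_closed[OF Gh y]] by (simp add: f_def compose_def)
 finally show "Gam (F M) (F N) (Phi M N f) y = Gam (F M) (F N) h y" .
 qed
 hence "Phi M N f = h" by (rule swap.faithful[OF FM FN F.arr[OF M N f] h])
 thus ?thesis using f that by blast
qed

text \<open>If the image were proper, let \<open>q\<close> be the map onto the nonzero quotient by
  it. Then \<open>Gam q\<close> kills the image of \<open>Gam (Phi f)\<close>, which is everything,
  because naturality identifies this map with the surjection \<open>f\<close>. So \<open>q\<close>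
  would be zero.\<close>

lemma preserves_surj:
 assumes M: "lmod A M" and N: "lmod A N" and f: "f : mod_hom A M N" and surj: "f ` car M = car N"
 shows "Phi M N f ` car (F M) = car (F N)"
proof (rule ccontr)
 note FM = F.obj[OF M] and FN = F.obj[OF N] and Ff = F.arr[OF M N f]
 interpret FM: left_module B "F M" by (rule FM)
 interpret FN: left_module B "F N" by (rule FN)
 let ?S = "Phi M N f ` car (F M)"
 have fm: "lmap B (F M) (F N) (Phi M N f)" using Ff by (simp add: mod_hom_iff)
 note fD = lmapD[OF fm]
 have im: "?S <= car (F N)" using fD(1) by (rule image_subsetI)
 assume "?S ~= car (F N)"
 then obtain y where y: "y <: (F N)" "y \<notin> ?S" using im by blast
 obtain Q :: "('b, 'u) module" and q where Q: "lmod B Q" "q ` car (F N) = car Q"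
 "!!x y. [|x <: (F N); y <: (F N)|] ==> q (x +[F N] y) = q x +[Q] q y" "!!a x. [|a <: B; x <: (F N)|] ==> q (a *:[F N] x) = a *:[Q] q x"
 "!!x. x <: (F N) ==> q x = 0[Q] <-> x : ?S"
 proof (rule FN.quotient[of ?S])
 show "0[F N] : ?S" using lmap_zero[OF fm FM FN] FM.M.zero_closed by (metis imageI)
 fix x y assume "x : ?S" "y : ?S"
 then obtain x' y' where "x' <: (F M)" "y' <: (F M)" "x = Phi M N f x'" "y = Phi M N f y'" by blast
 thus "x +[F N] y : ?S" by (simp flip: fD(2))
 next
 fix a x assume "a <: B" "x : ?S"
 then obtain x' where "a <: B" "x' <: (F M)" "x = Phi M N f x'" by blast
 thus "a *:[F N] x : ?S" by (simp flip: fD(3))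
 qed (use im in blast)+
 let ?q = "\<lambda>x\<in>car (F N). q x"
 have qm: "?q : mod_hom B (F N) Q"
 proof (rule mod_hom_restrict[OF FN])
 have "q : car (F N) ->: Q" using Q(2) by blast
 thus "lmap B (F N) Q q" using Q(3,4) by (simp add: lmap_def)
 qed
 note Gq = G.arr[OF FN Q(1) qm]
 note GQ = G.obj[OF Q(1)]
 have "compose (car (F M)) ?q (Phi M N f) = zmap (F M) Q" unfolding compose_def zmap_def using fD(1) Q(5) by (intro restrict_ext) simp
 hence z: "compose (car (G (F M))) (Gam (F N) Q ?q) (Gam (F M) (F N) (Phi M N f)) = zmap (G (F M)) (G Q)"
 using G.map_comp[OF FM FN Q(1) Ff qm] swap.F_zero[OF FM Q(1)] by simp
 obtain eta' where e: "eta' : mod_hom A (G (F N)) N" "!!y. y : car (G (F N)) ==> eta N (eta' y) = y" using eta_inv[OF N] by metis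
 obtain e0 where e0: "eta M : mod_hom A M (G (F M))" using eta_inv[OF M] by metis
 have "Gam (F N) Q ?q = zmap (G (F N)) (G Q)"
 proof (rule mod_hom_eqI[OF Gq zmap_hom[OF G.obj[OF FN] GQ]])
 fix t assume t: "t : car (G (F N))"
 have "eta' t : f ` car M" using mod_hom_closed[OF e(1) t] surj by simp
 then obtain x where x: "x <: M" "eta' t = f x" by blast
 have ex: "eta M x : car (G (F M))" by (rule mod_hom_closed[OF e0 x(1)])
 have "t = Gam (F M) (F N) (Phi M N f) (eta M x)" using e(2)[OF t] x eta_nat[OF M N f x(1)] by simp
 thus "Gam (F N) Q ?q t = zmap (G (F N)) (G Q) t" using fun_cong[OF z, of "eta M x"] ex t by (simp add: compose_def zmap_def)
 qed
 hence "?q = zmap (F N) Q" using swap.faithful[OF FN Q(1) qm zmap_hom[OF FN Q(1)]] swap.F_zero[OF FN Q(1)] by simp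
 hence "?q y = zmap (F N) Q y" by simp
 hence "q y = 0[Q]" using y by (simp add: zmap_def)
 thus False using Q(5) y by blast
qed

end

section \<open>The images of the regular modules under an equivalence\<close>

locale equiv_reg = equivalence K A B F Phi G Gam eta zet
 for K :: "'k ring" and A :: "('k, 'a) module" and B :: "('k, 'b) module"
 and F :: "('a, 'u) module => ('b, 'u) module" and Phi and G :: "('b, 'u) module => ('a, 'u) module" and Gam and eta zet +
 fixes iA :: "'a => 'u" and iB :: "'b => 'u"
 assumes inj_iA: "inj_on iA (car A)" and inj_iB: "inj_on iB (car B)"

sublocale equiv_reg \<subseteq> swap: equiv_reg K B A G Gam F Phi zet eta iB iA by unfold_locales (rule inj_iB inj_iA)+

context equiv_reg
begin

definition reg :: "('a, 'u) module" where "reg = imod iA (rmod A)"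

definition orbit :: "('a, 'm) module => 'm => 'u => 'm" where "orbit M x = image_map iA (rmod A) (%a. a *:[M] x)"

lemma inj_iA': "inj_on iA (car (rmod A))" using inj_iA by (simp add: rmod_simps)

lemma left_module_reg: "lmod A reg" unfolding reg_def by (rule left_module_image[OF left_module_regular[OF A.A.ring_axioms] inj_iA'])

lemma reg_carrier: "car reg = iA ` car A" "0[reg] = iA 0[A]" by (simp_all add: reg_def image_simps rmod_simps)

lemma reg_ops:
 assumes "a <: A" shows "b <: A ==> iA a +[reg] iA b = iA (a +[A] b)" "c *:[reg] iA a = iA (c *[A] a)" "orbit M x (iA a) = a *:[M] x" "iA a <: reg"
 using image_ops[OF inj_iA', of a] assms by (simp_all add: reg_def rmod_simps orbit_def image_simps)

lemma orbit_hom: assumes M: "lmod A M" and x: "x <: M" shows "orbit M x : mod_hom A reg M"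
proof -
 interpret M: left_module A M by fact
 have "lmap A reg M (orbit M x)" unfolding lmap_def reg_carrier using x M.smult_l_distr M.smult_assoc by (auto simp: reg_ops)
 moreover have "orbit M x : extensional (car reg)" unfolding orbit_def image_map_def reg_carrier by (simp add: rmod_simps)
 ultimately show ?thesis by (simp add: mod_hom_iff)
qed

end

context equiv_reg
begin

text \<open>
 If the images of the maps \<open>G B \<rightarrow> A\<close> spanned a proper left ideal \<open>J\<close>, then \<open>A \<rightarrow> A/J\<close> would induce a
 nonzero map \<open>F A \<rightarrow> F (A/J)\<close>, which composed with a suitable \<open>B \<rightarrow> F A\<close> is still nonzero.
\<close>

lemma generator:
 obtains T p t where "finite T" "!!s. s : T ==> p s : mod_hom A (G swap.reg) reg"
 "!!s. s : T ==> t s <: (G swap.reg)" "iA 1[A] = sm reg (%s. p s (t s)) (T :: 'u set)"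
proof -
 note RA = left_module_reg and RB = swap.left_module_reg
 note GR = G.obj[OF RB] and FR = F.obj[OF RA]
 interpret R: left_module A reg by (rule RA)
 interpret GR: left_module A "G swap.reg" by (rule GR)
 define S where "S = {p t | p t. p : mod_hom A (G swap.reg) reg & t : car (G swap.reg)}"
 have Sc: "S <= car reg" by (auto simp: S_def intro: mod_hom_closed)
 have one: "iA 1[A] <: reg" by (simp add: reg_ops)
 show ?thesis
 proof (cases "iA 1[A] : R.lspan S")
 case True
 then obtain l T where T: "finite T" "T <= S" "l : T ->: A" "iA 1[A] = R.lcomb l (%i. i) T" by (auto simp: R.lspan_def)
 have "ALL s:T. EX pt. fst pt : mod_hom A (G swap.reg) reg & snd pt <: (G swap.reg) & s = fst pt (snd pt)"
 proof
 fix s assume "s : T"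
 then obtain p t where "p : mod_hom A (G swap.reg) reg" "t <: (G swap.reg)" "s = p t" using T(2) unfolding S_def by blast
 thus "EX pt. fst pt : mod_hom A (G swap.reg) reg & snd pt <: (G swap.reg) & s = fst pt (snd pt)" by (intro exI[of _ "(p, t)"]) simp
 qed
 from bchoice[OF this] obtain pt where pt: "!!s. s : T ==> fst (pt s) : mod_hom A (G swap.reg) reg"
 "!!s. s : T ==> snd (pt s) <: (G swap.reg)" "!!s. s : T ==> s = fst (pt s) (snd (pt s))" by metis
 have lc: "l s <: A" if "s : T" for s using T(3) that by auto
 have "R.lcomb l (%i. i) T = sm reg (%s. fst (pt s) (l s *:[G swap.reg] snd (pt s))) T" unfolding R.lcomb_def
 proof (rule R.M.finsum_cong'[OF refl])
 fix s assume s: "s : T"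
 have m: "lmap A (G swap.reg) reg (fst (pt s))" using pt(1)[OF s] by (simp add: mod_hom_iff)
 show "l s *:[reg] s = fst (pt s) (l s *:[G swap.reg] snd (pt s))" unfolding lmapD(3)[OF m lc[OF s] pt(2)[OF s]] pt(3)[OF s, symmetric] ..
 next
 show "(%s. fst (pt s) (l s *:[G swap.reg] snd (pt s))) : T ->: reg" using mod_hom_closed[OF pt(1)] GR.smult_closed[OF lc pt(2)] by blast
 qed
 thus ?thesis using that[of T "%s. fst (pt s)" "%s. l s *:[G swap.reg] snd (pt s)"] T(1,4) pt(1) GR.smult_closed[OF lc pt(2)] by simp
 next
 case False
 obtain Q :: "('a, 'u) module" and q where Q: "lmod A Q" "q ` car reg = car Q"
 "!!x y. [|x <: reg; y <: reg|] ==> q (x +[reg] y) = q x +[Q] q y" "!!a x. [|a <: A; x <: reg|] ==> q (a *:[reg] x) = a *:[Q] q x"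
 "!!x. x <: reg ==> q x = 0[Q] <-> x : R.lspan S"
 by (rule R.quotient[of "R.lspan S", OF R.lspan_sub[OF Sc] R.lspan_zero R.lspan_add[OF Sc] R.lspan_smult[OF Sc]]) blast+
 let ?q = "\<lambda>x\<in>car reg. q x"
 have qc: "q : car reg ->: Q" using Q(2) by blast
 have qm: "?q : mod_hom A reg Q" by (rule mod_hom_restrict[OF RA]) (use qc Q(3,4) in "simp add: lmap_def")
 have "?q ` car reg = car Q" using Q(2) by simp
 note surj = preserves_surj[OF RA Q(1) qm this] and FQ = F.obj[OF Q(1)] and Fq = F.arr[OF RA Q(1) qm]
 interpret Q: left_module A Q by (rule Q(1))
 interpret FQ: left_module B "F Q" by (rule FQ)
 interpret FR: left_module B "F reg" by (rule FR)
 \<comment> \<open>If \<open>F Q\<close> were zero, faithfulness would make \<open>Q\<close> zero,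
   although the class of \<open>1[A]\<close> in \<open>Q\<close> is nonzero.\<close>
 have "EX y:car (F Q). y ~= 0[F Q]"
 proof (rule ccontr)
 assume "~ (EX y:car (F Q). y ~= 0[F Q])"
 hence "mod_id (F Q) = zmap (F Q) (F Q)" unfolding mod_id_def zmap_def by (intro restrict_ext) blast
 hence e: "Phi Q Q (mod_id Q) = Phi Q Q (zmap Q Q)" using F.map_id[OF Q(1)] F_zero[OF Q(1) Q(1)] by simp
 have "mod_id Q : mod_hom A Q Q" unfolding mod_id_def by (rule mod_hom_restrict[OF Q(1)]) (simp add: lmap_def)
 hence "mod_id Q = zmap Q Q" by (rule faithful[OF Q(1) Q(1) _ zmap_hom[OF Q(1) Q(1)] e])
 hence "mod_id Q (q (iA 1[A])) = zmap Q Q (q (iA 1[A]))" by simp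
 moreover have "q (iA 1[A]) <: Q" using qc one by blast
 ultimately have "q (iA 1[A]) = 0[Q]" by (simp add: mod_id_def zmap_def)
 thus False using Q(5)[OF one] False by blast
 qed
 then obtain y where y: "y <: (F Q)" "y ~= 0[F Q]" by blast
 have "y : Phi reg Q ?q ` car (F reg)" unfolding surj by (rule y(1))
 then obtain x where x: "y = Phi reg Q ?q x" "x <: (F reg)" by (rule imageE)
 let ?r = "swap.orbit (F reg) x"
 have r: "?r : mod_hom B swap.reg (F reg)" by (rule swap.orbit_hom[OF FR x(2)])
 note Gr = G.arr[OF RB FR r]
 obtain eta' where e: "eta' : mod_hom A (G (F reg)) reg" "!!z. z : car (G (F reg)) ==> eta reg (eta' z) = z" using eta_inv[OF RA] by metis
 have etaQ: "lmap A Q (G (F Q)) (eta Q)" using eta_inv[OF Q(1)] by (metis mod_hom_iff)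
 \<comment> \<open>Up to the isomorphisms \<open>eta\<close>, this is a composite of a map from
   \<open>G swap.reg\<close> to \<open>reg\<close> with the projection to \<open>Q\<close>, which
   kills all of \<open>S\<close>.\<close>
 have zero: "compose (car (G swap.reg)) (Gam (F reg) (F Q) (Phi reg Q ?q)) (Gam swap.reg (F reg) ?r) = zmap (G swap.reg) (G (F Q))"
 unfolding compose_def zmap_def
 proof (rule restrict_ext)
 fix t assume t: "t <: (G swap.reg)"
 let ?s = "Gam swap.reg (F reg) ?r t"
 have s: "?s : car (G (F reg))" by (rule mod_hom_closed[OF Gr t])
 have es: "eta' ?s <: reg" by (rule mod_hom_closed[OF e(1) s])
 have "compose (car (G swap.reg)) eta' (Gam swap.reg (F reg) ?r) t : S" unfolding S_def using mod_hom_compose[OF Gr e(1) GR] t by blast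
 hence "eta' ?s : R.lspan S" using R.lspan_mem[OF Sc] t by (simp add: compose_def)
 hence "?q (eta' ?s) = 0[Q]" using Q(5)[OF es] es by simp
 moreover have "Gam (F reg) (F Q) (Phi reg Q ?q) ?s = eta Q (?q (eta' ?s))" using eta_nat[OF RA Q(1) qm es] e(2)[OF s] by simp
 ultimately show "Gam (F reg) (F Q) (Phi reg Q ?q) ?s = 0[G (F Q)]" using lmap_zero[OF etaQ Q(1) G.obj[OF FQ]] by simp
 qed
 have c: "compose (car swap.reg) (Phi reg Q ?q) ?r : mod_hom B swap.reg (F Q)" by (rule mod_hom_compose[OF r Fq RB])
 have "Gam swap.reg (F Q) (compose (car swap.reg) (Phi reg Q ?q) ?r) = Gam swap.reg (F Q) (zmap swap.reg (F Q))"
 unfolding G.map_comp[OF RB FR FQ r Fq] swap.F_zero[OF RB FQ] by (rule zero)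
 hence "compose (car swap.reg) (Phi reg Q ?q) ?r = zmap swap.reg (F Q)" by (rule swap.faithful[OF RB FQ c zmap_hom[OF RB FQ]])
 hence "compose (car swap.reg) (Phi reg Q ?q) ?r (iB 1[B]) = zmap swap.reg (F Q) (iB 1[B])" by simp
 hence "y = 0[F Q]" using x by (simp add: compose_def zmap_def swap.reg_ops)
 thus ?thesis using y by blast
 qed
qed

end

text \<open>\<open>B\<close> acts on \<open>P\<close> from the right, as the opposite of the algebra of all endomorphisms of \<open>P\<close>.\<close>

locale endo_bimodule = L: unital_algebra K L + B: unital_algebra K B + P: left_module L P
 for K :: "'k ring" and L :: "('k, 'l) module" and B :: "('k, 'b) module" and P :: "('l, 'p) module" +
 fixes rc :: "'p => 'b => 'p"
 assumes rc_map: "b <: B ==> lmap L P P (%x. rc x b)" and rc_add: "[|x <: P; b <: B; c <: B|] ==> rc x (b +[B] c) = rc x b +[P] rc x c"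
 and rc_mult: "[|x <: P; b <: B; c <: B|] ==> rc x (b *[B] c) = rc (rc x b) c" and rc_smult: "[|x <: P; k <: K; b <: B|] ==>
 rc x (k *:[B] b) = (k *:[L] 1[L]) *:[P] rc x b"
 and rc_full: "lmap L P P h ==> EX b:car B. ALL x:car P. rc x b = h x"
 and rc_faithful: "[|b <: B; !!x. x <: P ==> rc x b = 0[P]|] ==> b = 0[B]"

context equiv_reg
begin

definition rmul :: "'a => 'u => 'u" where "rmul a = image_map iA (rmod A) (%x. iA (x *[A] a))"

lemma rmul_iA: "x <: A ==> rmul a (iA x) = iA (x *[A] a)" unfolding rmul_def by (rule image_ops(3)[OF inj_iA']) (simp add: rmod_simps)

lemma rmul_hom: assumes "a <: A" shows "rmul a : mod_hom A reg reg"
proof -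
 have "lmap A reg reg (rmul a)" unfolding lmap_def reg_carrier using assms by (auto simp: reg_ops rmul_iA A.mult_l_distr A.mult_assoc)
 moreover have "rmul a : extensional (car reg)" unfolding rmul_def image_map_def reg_carrier by (simp add: rmod_simps)
 ultimately show ?thesis by (simp add: mod_hom_iff)
qed

text \<open>The endomorphisms of \<open>reg\<close> are the right multiplications, and
  \<open>F\<close> is \<open>K\<close>-linear, full and faithful.\<close>

lemma endo_bimodule_reg: "endo_bimodule K B A (F reg) (%x a. Phi reg reg (rmul a) x)"
proof -
 note RA = left_module_reg
 note FR = F.obj[OF RA]
 interpret FR: left_module B "F reg" by (rule FR)
 interpret R: left_module A reg by (rule RA)
 have regE: "EX x:car A. y = iA x" if "y <: reg" for y using that by (auto simp: reg_carrier)
 have ext: "f = h" if "f : mod_hom A reg reg" "h : mod_hom A reg reg" "!!x. x <: A ==> f (iA x) = h (iA x)" for f h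
 by (rule mod_hom_eqI[OF that(1,2)]) (use regE that(3) in blast)
 show ?thesis
 proof (intro endo_bimodule.intro endo_bimodule_axioms.intro B.unital_algebra_axioms A.unital_algebra_axioms FR)
 show "lmap B (F reg) (F reg) (Phi reg reg (rmul a))" if "a <: A" for a using F.arr[OF RA RA rmul_hom[OF that]] by (simp add: mod_hom_iff)
 fix x a c assume x: "x <: (F reg)" and a: "a <: A" and c: "c <: A"
 note ra = rmul_hom[OF a] and rc = rmul_hom[OF c]
 have "rmul (a +[A] c) = hom_add reg reg (rmul a) (rmul c)"
 proof (rule extensionalityI[of _ "car reg"])
 show "rmul (a +[A] c) : extensional (car reg)" using rmul_hom[of "a +[A] c"] a c by (simp add: mod_hom_iff)
 show "hom_add reg reg (rmul a) (rmul c) : extensional (car reg)" by (simp add: hom_add_def)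
 fix y assume y: "y <: reg"
 then obtain z where z: "z <: A" "y = iA z" using regE by blast
 have "iA (z *[A] (a +[A] c)) = iA (z *[A] a) +[reg] iA (z *[A] c)" using z a c by (simp add: A.mult_r_distr reg_ops(1))
 thus "rmul (a +[A] c) y = hom_add reg reg (rmul a) (rmul c) y" unfolding hom_add_def using y z by (simp add: rmul_iA)
 qed
 thus "Phi reg reg (rmul (a +[A] c)) x = Phi reg reg (rmul a) x +[F reg] Phi reg reg (rmul c) x"
 using F.map_add[OF RA RA ra rc] x by (simp add: hom_add_def)
 have "rmul (a *[A] c) = compose (car reg) (rmul c) (rmul a)" by (rule ext[OF rmul_hom mod_hom_compose[OF ra rc RA]])
 (use a c in "simp_all add: A.mult_closed compose_def rmul_iA reg_ops A.mult_assoc")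
 thus "Phi reg reg (rmul (a *[A] c)) x = Phi reg reg (rmul c) (Phi reg reg (rmul a) x)"
 using F.map_comp[OF RA RA RA ra rc] x by (simp add: compose_def)
 next
 fix x k a assume x: "x <: (F reg)" and k: "k <: K" and a: "a <: A"
 note ra = rmul_hom[OF a]
 have "rmul (k *:[A] a) = hom_smult A reg reg k (rmul a)"
 proof (rule extensionalityI[of _ "car reg"])
 show "rmul (k *:[A] a) : extensional (car reg)" using rmul_hom[of "k *:[A] a"] a k by (simp add: mod_hom_iff)
 show "hom_smult A reg reg k (rmul a) : extensional (car reg)" by (simp add: hom_smult_def)
 fix y assume y: "y <: reg"
 then obtain z where z: "z <: A" "y = iA z" using regE by blast
 have "iA (z *[A] (k *:[A] a)) = (k *:[A] 1[A]) *:[reg] iA (z *[A] a)" using z a k by (simp add: A.mult_smult_r A.mult_smult_l reg_ops(2))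
 thus "rmul (k *:[A] a) y = hom_smult A reg reg k (rmul a) y" unfolding hom_smult_def using y z by (simp add: rmul_iA)
 qed
 thus "Phi reg reg (rmul (k *:[A] a)) x = (k *:[B] 1[B]) *:[F reg] Phi reg reg (rmul a) x"
 using F.map_smult[OF RA RA ra k] x by (simp add: hom_smult_def)
 next
 fix h assume h: "lmap B (F reg) (F reg) h"
 have "(\<lambda>x\<in>car (F reg). h x) : mod_hom B (F reg) (F reg)" by (rule mod_hom_restrict[OF FR h])
 then obtain f where f: "f : mod_hom A reg reg" "Phi reg reg f = (\<lambda>x\<in>car (F reg). h x)" by (rule full[OF RA RA])
 obtain a where a: "a <: A" "f (iA 1[A]) = iA a" using regE[OF mod_hom_closed[OF f(1) reg_ops(4)[OF A.A.one_closed]]] by blast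
 have "f = rmul a"
 proof (rule ext[OF f(1) rmul_hom[OF a(1)]])
 fix x assume x: "x <: A"
 have fm: "lmap A reg reg f" using f(1) by (simp add: mod_hom_iff)
 have "iA x = x *:[reg] iA 1[A]" using x by (simp add: reg_ops(2))
 hence "f (iA x) = x *:[reg] iA a" using lmapD(3)[OF fm x reg_ops(4)[OF A.A.one_closed]] a(2) by simp
 thus "f (iA x) = rmul a (iA x)" using x a(1) by (simp add: reg_ops(2) rmul_iA)
 qed
 thus "EX a:car A. ALL x:car (F reg). Phi reg reg (rmul a) x = h x" using a(1) f(2) by (intro bexI[of _ a]) auto
 next
 fix a assume a: "a <: A" and z: "!!x. x <: (F reg) ==> Phi reg reg (rmul a) x = 0[F reg]"
 have "Phi reg reg (rmul a) = Phi reg reg (zmap reg reg)" unfolding F_zero[OF RA RA]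
 by (rule mod_hom_eqI[OF F.arr[OF RA RA rmul_hom[OF a]] zmap_hom[OF FR FR]]) (simp add: z zmap_def)
 hence "rmul a = zmap reg reg" by (rule faithful[OF RA RA rmul_hom[OF a] zmap_hom[OF RA RA]])
 hence "rmul a (iA 1[A]) = zmap reg reg (iA 1[A])" by simp
 hence "iA a = iA 0[A]" using a by (simp add: rmul_iA zmap_def reg_ops(4) reg_carrier(2))
 thus "a = 0[A]" using inj_onD[OF inj_iA _ a A.M.zero_closed] by simp
 qed
qed

end

lemma lmap_compose:
 assumes "lmap R M N f" "lmap R N P h" shows "lmap R M P (%x. h (f x))" unfolding lmap_def
proof (intro conjI ballI)
 show "(%x. h (f x)) : car M ->: P" by (rule Pi_I) (rule lmapD(1)[OF assms(2) lmapD(1)[OF assms(1)]])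
qed (simp_all add: lmapD[OF assms(1)] lmapD(2,3)[OF assms(2)])

context equiv_reg
begin

text \<open>Additivity gives the sum of two maps, and \<open>F_zero\<close> the empty sum.\<close>

lemma F_sum:
 assumes M: "lmod A M" and N: "lmod A N" and T: "finite T" and f: "!!s. s : T ==> f s : mod_hom A M N"
 shows "(\<lambda>x\<in>car M. sm N (%s. f s x) T) : mod_hom A M N &
 (ALL x:car (F M). Phi M N (\<lambda>x\<in>car M. sm N (%s. f s x) T) x = sm (F N) (%s. Phi M N (f s) x) T)"
proof -
 interpret N: left_module A N by (rule N)
 interpret FN: left_module B "F N" by (rule F.obj[OF N])
 show ?thesis using T f
proof (induction T)
 case empty
 have e: "(\<lambda>x\<in>car M. sm N (%s. f s x) {}) = zmap M N" unfolding zmap_def by (rule restrict_ext) simp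
 have "ALL x:car (F M). zmap (F M) (F N) x = sm (F N) (%s. Phi M N (f s) x) {}" by (simp add: zmap_def)
 thus ?case unfolding e F_zero[OF M N] using zmap_hom[OF M N] by blast
next
 case (insert s T)
 let ?h = "\<lambda>x\<in>car M. sm N (%s. f s x) T"
 have fs: "f s : mod_hom A M N" by (rule insert.prems) simp
 have fT: "f r : mod_hom A M N" if "r : T" for r by (rule insert.prems) (use that in simp)
 have IH: "?h : mod_hom A M N" "!!x. x <: (F M) ==> Phi M N ?h x = sm (F N) (%s. Phi M N (f s) x) T" using insert.IH[OF fT] by blast+
 have e: "(\<lambda>x\<in>car M. sm N (%s. f s x) (insert s T)) = hom_add M N (f s) ?h" unfolding hom_add_def
 by (rule restrict_ext) (use insert.hyps mod_hom_closed[OF fs] mod_hom_closed[OF fT] in "simp add: Pi_def")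
 have c: "hom_add M N (f s) ?h : mod_hom A M N" proof -
 have f1: "lmap A M N (f s)" and f2: "lmap A M N ?h" using fs IH(1) by (auto simp: mod_hom_iff)
 interpret M: left_module A M by (rule M)
 have "lmap A M N (%x. f s x +[N] ?h x)" unfolding lmap_def
 using lmapD[OF f1] lmapD[OF f2] by (simp add: N.M.a_ac N.smult_r_distr del: restrict_apply)
 from mod_hom_restrict[OF M this] show ?thesis unfolding hom_add_def .
 qed
 show ?case unfolding e F.map_add[OF M N fs IH(1)]
 proof (intro conjI ballI c)
 fix x assume x: "x <: (F M)"
 have m: "Phi M N (f r) x <: (F N)" if "r : insert s T" for r by (rule mod_hom_closed[OF F.arr[OF M N insert.prems[OF that]] x])
 show "hom_add (F M) (F N) (Phi M N (f s)) (Phi M N ?h) x = sm (F N) (%s. Phi M N (f s) x) (insert s T)"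
 unfolding hom_add_def using x IH(2)[OF x] m insert.hyps by simp
 qed
qed
qed

definition unreg :: "'u => 'a" where "unreg = inv_into (car A) iA"

lemma unreg_map: "lmap A reg (rmod A) unreg" "a <: A ==> unreg (iA a) = a" "x <: reg ==> iA (unreg x) = x"
proof -
 show 1: "unreg (iA a) = a" if "a <: A" for a using that inj_iA by (simp add: unreg_def)
 thus "lmap A reg (rmod A) unreg" unfolding lmap_def reg_carrier(1) by (auto simp: rmod_simps reg_ops)
 show "x <: reg ==> iA (unreg x) = x" unfolding reg_carrier(1) using 1 by auto
qed

text \<open>\<open>generator\<close> with the coding of \<open>A\<close> removed. With the two
  algebras exchanged, it says that \<open>F reg\<close> is a generator.\<close>

lemma trace_one:
 obtains T p t where "finite T" "!!s. s : T ==> lmap A (G swap.reg) (rmod A) (p s)"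
 "!!s. s : T ==> t s <: (G swap.reg)" "1[A] = sm A (%s. p s (t s)) (T :: 'u set)"
proof -
 obtain T p t where T: "finite T" "!!s. s : T ==> p s : mod_hom A (G swap.reg) reg"
 "!!s. s : T ==> t s <: (G swap.reg)" "iA 1[A] = sm reg (%s. p s (t s)) (T :: 'u set)" by (rule generator) blast
 interpret R: left_module A reg by (rule left_module_reg)
 have pm: "lmap A (G swap.reg) reg (p s)" if "s : T" for s using T(2)[OF that] by (simp add: mod_hom_iff)
 have "1[A] = unreg (sm reg (%s. p s (t s)) T)" unfolding T(4)[symmetric] by (simp add: unreg_map(2))
 also have "... = sm A (%s. unreg (p s (t s))) T" by (rule add_finsum[OF R.M.ag A.M.ag])
 (use lmapD[OF unreg_map(1)] mod_hom_closed[OF T(2) T(3)] in "auto simp: rmod_simps")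
 finally show ?thesis using that[of T "%s x. unreg (p s x)" t] T(1,3) lmap_compose[OF pm unreg_map(1)] by blast
qed

end

context equiv_reg
begin

text \<open>\<open>generator\<close> writes the identity of \<open>reg\<close> as a sum of maps that
  factor through \<open>G swap.reg\<close>. Under \<open>F\<close> this factors the identity of
  \<open>F reg\<close> through copies of \<open>F (G swap.reg)\<close>, which is \<open>B\<close> up
  to \<open>zet\<close>. The first halves are the coordinate functions \<open>q s\<close>; the
  second halves, evaluated at the unit, are the elements \<open>y s\<close>.\<close>

lemma dual_basis:
 obtains T q y where "finite T" "!!s. s : T ==> lmap B (F reg) (rmod B) (q s)" "!!s. s : T ==> y s <: (F reg)"
 "!!x. x <: (F reg) ==> x = sm (F reg) (%s. q s x *:[F reg] y s) (T :: 'u set)"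
proof -
 note RA = left_module_reg and RB = swap.left_module_reg
 note GR = G.obj[OF RB] and FR = F.obj[OF RA] and FGR = F.obj[OF G.obj[OF RB]]
 interpret R: left_module A reg by (rule RA)
 interpret GR: left_module A "G swap.reg" by (rule GR)
 interpret FR: left_module B "F reg" by (rule FR)
 obtain T p t where T: "finite T" "!!s. s : T ==> p s : mod_hom A (G swap.reg) reg"
 "!!s. s : T ==> t s <: (G swap.reg)" "iA 1[A] = sm reg (%s. p s (t s)) (T :: 'u set)" by (rule generator) blast
 define f where "f s = compose (car reg) (p s) (orbit (G swap.reg) (t s))" for s
 have o: "orbit (G swap.reg) (t s) : mod_hom A reg (G swap.reg)" if "s : T" for s by (rule orbit_hom[OF GR T(3)[OF that]])
 have f: "f s : mod_hom A reg reg" if "s : T" for s unfolding f_def by (rule mod_hom_compose[OF o[OF that] T(2)[OF that] RA])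
 have id: "(\<lambda>x\<in>car reg. sm reg (%s. f s x) T) = mod_id reg" unfolding mod_id_def
 proof (rule restrict_ext)
 fix x assume "x <: reg"
 then obtain a where a: "a <: A" "x = iA a" by (auto simp: reg_carrier)
 have "sm reg (%s. f s x) T = sm reg (%s. a *:[reg] p s (t s)) T"
 proof (rule R.M.finsum_cong'[OF refl])
 fix s assume s: "s : T"
 have m: "lmap A (G swap.reg) reg (p s)" using T(2)[OF s] by (simp add: mod_hom_iff)
 show "f s x = a *:[reg] p s (t s)"
 unfolding f_def compose_def using a reg_ops(4)[OF a(1)] lmapD(3)[OF m a(1) T(3)[OF s]] by (simp add: reg_ops(3))
 qed (use a mod_hom_closed[OF T(2) T(3)] R.smult_closed in blast)
 also have "... = a *:[reg] sm reg (%s. p s (t s)) T" using a mod_hom_closed[OF T(2) T(3)] by (intro R.smult_r_finsum[symmetric]) auto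
 also have "... = x" unfolding T(4)[symmetric] using a by (simp add: reg_ops(2))
 finally show "sm reg (%s. f s x) T = x" .
 qed
 obtain zet' where z: "zet swap.reg : mod_hom B swap.reg (F (G swap.reg))" "zet' : mod_hom B (F (G swap.reg)) swap.reg"
 "!!x. x : car (F (G swap.reg)) ==> zet swap.reg (zet' x) = x" using swap.eta_inv[OF RB] by metis
 define q where "q s x = swap.unreg (zet' (Phi reg (G swap.reg) (orbit (G swap.reg) (t s)) x))" for s x
 define y where "y s = Phi (G swap.reg) reg (p s) (zet swap.reg (iB 1[B]))" for s
 have om: "lmap B (F reg) (F (G swap.reg)) (Phi reg (G swap.reg) (orbit (G swap.reg) (t s)))" if "s : T" for s
 using F.arr[OF RA GR o[OF that]] by (simp add: mod_hom_iff)
 have zm: "lmap B (F (G swap.reg)) swap.reg zet'" "lmap B swap.reg (F (G swap.reg)) (zet swap.reg)" using z by (simp_all add: mod_hom_iff)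
 have pm: "lmap B (F (G swap.reg)) (F reg) (Phi (G swap.reg) reg (p s))" if "s : T" for s
 using F.arr[OF GR RA T(2)[OF that]] by (simp add: mod_hom_iff)
 have qm: "lmap B (F reg) (rmod B) (q s)" if "s : T" for s
 unfolding q_def by (rule lmap_compose[OF lmap_compose[OF om[OF that] zm(1)] swap.unreg_map(1)])
 have one: "iB 1[B] <: swap.reg" by (rule swap.reg_ops(4)) simp
 have yc: "y s <: (F reg)" if "s : T" for s unfolding y_def by (intro lmapD(1)[OF pm[OF that]] lmapD(1)[OF zm(2)] one)
 have "x = sm (F reg) (%s. q s x *:[F reg] y s) T" if x: "x <: (F reg)" for x proof -
 have "x = Phi reg reg (mod_id reg) x" unfolding F.map_id[OF RA] using x by (simp add: mod_id_def)
 also have "... = sm (F reg) (%s. Phi reg reg (f s) x) T" using F_sum[of reg reg T f, OF RA RA T(1) f] x unfolding id by blast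
 also have "... = sm (F reg) (%s. q s x *:[F reg] y s) T"
 proof (rule FR.M.finsum_cong'[OF refl])
 fix s assume s: "s : T"
 let ?z = "Phi reg (G swap.reg) (orbit (G swap.reg) (t s)) x"
 have zc: "?z : car (F (G swap.reg))" by (rule lmapD(1)[OF om[OF s] x])
 have qc: "q s x <: B" using lmapD(1)[OF qm[OF s] x] by (simp add: rmod_simps)
 have "zet' ?z = iB (q s x)" unfolding q_def by (rule swap.unreg_map(3)[OF lmapD(1)[OF zm(1) zc], symmetric])
 also have "... = q s x *:[swap.reg] iB 1[B]" using qc by (simp add: swap.reg_ops(2))
 finally have "?z = zet swap.reg (q s x *:[swap.reg] iB 1[B])" using z(3)[OF zc] by simp
 also have "... = q s x *:[F (G swap.reg)] zet swap.reg (iB 1[B])" by (rule lmapD(3)[OF zm(2) qc one])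
 finally have "Phi (G swap.reg) reg (p s) ?z = q s x *:[F reg] y s"
 unfolding y_def by (simp only: lmapD(3)[OF pm[OF s] qc lmapD(1)[OF zm(2) one]])
 thus "Phi reg reg (f s) x = q s x *:[F reg] y s" unfolding f_def F.map_comp[OF RA GR RA o[OF s] T(2)[OF s]] using x by (simp add: compose_def)
 next
 show "(%s. q s x *:[F reg] y s) : T ->: (F reg)" using lmapD(1)[OF qm x] yc by (simp add: rmod_simps)
 qed
 finally show ?thesis .
 qed
 with T(1) qm yc show ?thesis by (rule that)
qed

end

section \<open>Finite powers and their endomorphisms\<close>

definition pmod :: "nat => ('l, 'm) module => ('l, nat => 'm) module" where
 "pmod n M = \<lparr>carrier = {..<n} \<rightarrow>\<^sub>E car M, monoid.mult = undefined, one = undefined,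
 ring.zero = (\<lambda>i\<in>{..<n}. 0[M]), add = (%x y. \<lambda>i\<in>{..<n}. x i +[M] y i), smult = (%l x. \<lambda>i\<in>{..<n}. l *:[M] x i)\<rparr>"

lemma pow_simps: "car (pmod n M) = {..<n} \<rightarrow>\<^sub>E car M" "0[pmod n M] = (\<lambda>i\<in>{..<n}. 0[M])"
 "x +[pmod n M] y = (\<lambda>i\<in>{..<n}. x i +[M] y i)" "l *:[pmod n M] x = (\<lambda>i\<in>{..<n}. l *:[M] x i)"
 by (simp_all add: pmod_def)

lemma pow_val: "[|x <: (pmod n M); i < n|] ==> x i <: M" by (auto simp: pow_simps)

lemma pow_eqI: "[|x <: (pmod n M); y <: (pmod n M); !!i. i < n ==> x i = y i|] ==> x = y"
 by (rule extensionalityI[of _ "{..<n}"]) (auto simp: pow_simps PiE_def)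

lemma left_module_pow: assumes "lmod L M" shows "lmod L (pmod n M)"
proof -
 interpret M: left_module L M by fact
 note v = pow_val[where M = M]
 have cl: "x +[pmod n M] y <: (pmod n M)" if "x <: (pmod n M)" "y <: (pmod n M)" for x y
 using v[OF that(1)] v[OF that(2)] by (simp add: pow_simps(1,3))
 have scl: "l *:[pmod n M] y <: (pmod n M)" if "l <: L" "y <: (pmod n M)" for l y
 using v[OF that(2)] that(1) by (simp add: pow_simps(1,4))
 have z: "0[pmod n M] <: (pmod n M)" by (simp add: pow_simps(1,2))
 have ag: "abelian_group (pmod n M)"
 proof (rule abelian_groupI)
 fix x assume x: "x <: (pmod n M)"
 have nx: "(\<lambda>i\<in>{..<n}. -[M] x i) <: (pmod n M)" using v[OF x] by (simp add: pow_simps(1))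
 have "(\<lambda>i\<in>{..<n}. -[M] x i) +[pmod n M] x = 0[pmod n M]"
 by (rule pow_eqI[OF cl[OF nx x] z]) (simp add: pow_simps v[OF x] M.l_neg)
 thus "EX y:car (pmod n M). y +[pmod n M] x = 0[pmod n M]" using nx by blast
 show "0[pmod n M] +[pmod n M] x = x" by (rule pow_eqI[OF cl[OF z x] x]) (simp add: pow_simps v[OF x])
 fix y assume y: "y <: (pmod n M)"
 show "x +[pmod n M] y = y +[pmod n M] x" by (rule pow_eqI[OF cl[OF x y] cl[OF y x]]) (simp add: pow_simps v[OF x] v[OF y] M.a_comm)
 fix w assume w: "w <: (pmod n M)"
 show "x +[pmod n M] y +[pmod n M] w = x +[pmod n M] (y +[pmod n M] w)"
 by (rule pow_eqI[OF cl[OF cl[OF x y] w] cl[OF x cl[OF y w]]]) (simp add: pow_simps v[OF x] v[OF y] v[OF w] M.a_assoc)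
 qed (use cl z in auto)
 show ?thesis unfolding left_module_def left_module_axioms_def
 proof (intro conjI ag M.R.ring_axioms allI impI)
 fix x assume x: "x <: (pmod n M)"
 show "1[L] *:[pmod n M] x = x" by (rule pow_eqI[OF scl[OF M.R.one_closed x] x]) (simp add: pow_simps v[OF x])
 next
 fix a b x assume ab: "a <: L" "b <: L" and x: "x <: (pmod n M)"
 show "(a +[L] b) *:[pmod n M] x = a *:[pmod n M] x +[pmod n M] b *:[pmod n M] x"
 by (rule pow_eqI[OF scl[OF _ x] cl[OF scl[OF ab(1) x] scl[OF ab(2) x]]]) (simp_all add: pow_simps ab v[OF x] M.smult_l_distr)
 show "(a *[L] b) *:[pmod n M] x = a *:[pmod n M] (b *:[pmod n M] x)"
 by (rule pow_eqI[OF scl[OF _ x] scl[OF ab(1) scl[OF ab(2) x]]]) (simp_all add: pow_simps ab v[OF x] M.smult_assoc)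
 next
 fix a x y assume a: "a <: L" and x: "x <: (pmod n M)" and y: "y <: (pmod n M)"
 show "a *:[pmod n M] (x +[pmod n M] y) = a *:[pmod n M] x +[pmod n M] a *:[pmod n M] y"
 by (rule pow_eqI[OF scl[OF a cl[OF x y]] cl[OF scl[OF a x] scl[OF a y]]]) (simp add: pow_simps a v[OF x] v[OF y] M.smult_r_distr)
 qed (use scl in auto)
qed

definition uvec :: "nat => ('l, 'm) module => nat => 'm => nat => 'm" where
 "uvec n M i x = (\<lambda>k\<in>{..<n}. if k = i then x else 0[M])"

context left_module
begin

lemma pow_finsum: assumes "f : S ->: (pmod n M)" "k < n" shows "sm (pmod n M) f S k = sm M (%s. f s k) S"
proof -
 interpret P: left_module R "pmod n M" by (rule left_module_pow[OF left_module_axioms])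
 show ?thesis by (rule add_finsum[OF P.M.ag M.ag, of "%x. x k"]) (use assms in "simp_all add: pow_simps Pi_def PiE_def")
qed

lemma unit_vec_closed: "x <: M ==> uvec n M i x <: (pmod n M)" by (simp add: uvec_def pow_simps)

lemma pow_decomp: assumes z: "z <: (pmod n M)" shows "z = sm (pmod n M) (%i. uvec n M i (z i)) {..<n}"
proof -
 interpret P: left_module R "pmod n M" by (rule left_module_pow[OF left_module_axioms])
 have u: "(%i. uvec n M i (z i)) : {..<n} ->: (pmod n M)" by (rule Pi_I) (rule unit_vec_closed[OF pow_val[OF z]], simp)
 show ?thesis
 proof (rule pow_eqI[OF z P.M.finsum_closed[OF u]])
 fix k assume k: "k < n"
 have "sm M (%i. uvec n M i (z i) k) {..<n} = uvec n M k (z k) k"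
 using k pow_val[OF z] by (intro M.finsum_delta) (simp_all add: uvec_def)
 thus "z k = (sm (pmod n M) (%i. uvec n M i (z i)) {..<n}) k" unfolding pow_finsum[OF u k] using k by (simp add: uvec_def)
 qed
qed

end

lemma unit_vec_map:
 fixes A :: "('k, 'a) module"
 assumes "lmod A M" shows "lmap A M (pmod n M) (uvec n M i)" unfolding lmap_def
proof (intro conjI ballI)
 interpret left_module A M by fact
 show "uvec n M i : car M ->: (pmod n M)" using unit_vec_closed by blast
 fix x y assume "x <: M" "y <: M"
 thus "uvec n M i (x +[M] y) = uvec n M i x +[pmod n M] uvec n M i y"
 unfolding uvec_def pow_simps by (intro restrict_ext) simp
next
 interpret left_module A M by fact
 fix a x assume "a <: A" "x <: M"
 thus "uvec n M i (a *:[M] x) = a *:[pmod n M] uvec n M i x" unfolding uvec_def pow_simps by (intro restrict_ext) simp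
qed

context endo_bimodule
begin

lemma rc_closed: "[|x <: P; b <: B|] ==> rc x b <: P" by (rule lmapD(1)[OF rc_map])

lemma rc_plus: "[|x <: P; y <: P; b <: B|] ==> rc (x +[P] y) b = rc x b +[P] rc y b" by (rule lmapD(2)[OF rc_map])

lemma rc_lin: "[|l <: L; x <: P; b <: B|] ==> rc (l *:[P] x) b = l *:[P] rc x b" by (rule lmapD(3)[OF rc_map])

lemma rc_zero: "b <: B ==> rc 0[P] b = 0[P]" by (rule lmap_zero[OF rc_map P.left_module_axioms P.left_module_axioms])

lemma rc_zero_r: assumes "x <: P" shows "rc x 0[B] = 0[P]" by (rule additive_zero[OF B.M.ag P.M.ag, of "rc x"])
 (use assms in "simp_all add: rc_closed rc_add")

lemma rc_finsum_r: "[|x <: P; f : S ->: B|] ==> rc x (sm B f S) = sm P (%s. rc x (f s)) S"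
 by (rule add_finsum[OF B.M.ag P.M.ag, of "rc x"]) (simp_all add: rc_closed rc_add)

lemma rc_finsum_l: "[|b <: B; f : S ->: P|] ==> rc (sm P f S) b = sm P (%s. rc (f s) b) S"
 by (rule lmap_finsum[OF rc_map P.left_module_axioms P.left_module_axioms])

lemma rc_eqI:
 assumes "b <: B" "c <: B" "!!x. x <: P ==> rc x b = rc x c" shows "b = c"
proof -
 have "rc x (b -[B] c) = 0[P]" if x: "x <: P" for x proof -
 have "rc x (-[B] c) = -[P] rc x c" by (rule additive_minus[OF B.M.ag P.M.ag, of "rc x"]) (use x assms(2) in "simp_all add: rc_closed rc_add")
 thus ?thesis using rc_add[OF x assms(1), of "-[B] c"] assms x rc_closed[OF x assms(2)] by (simp add: a_minus_def P.M.r_neg)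
 qed
 hence "b -[B] c = 0[B]" using assms(1,2) by (intro rc_faithful) simp_all
 thus ?thesis using assms(1,2) B.M.minus_eq_zero_iff by simp
qed

lemma rc_one: assumes x: "x <: P" shows "rc x 1[B] = x"
proof -
 have "lmap L P P (%x. x)" by (simp add: lmap_def)
 then obtain b where b: "b <: B" "!!x. x <: P ==> rc x b = x" using rc_full by blast
 have "b = 1[B]"
 proof (rule rc_eqI[OF b(1) B.A.one_closed])
 fix x assume x: "x <: P"
 have "rc x (b *[B] 1[B]) = rc x 1[B]" using rc_mult[OF x b(1), of "1[B]"] b(2)[OF x] by simp
 thus "rc x b = rc x 1[B]" using b(1) by simp
 qed
 thus ?thesis using b(2)[OF x] by simp
qed

text \<open>Row vectors times matrices, in accordance with the action of \<open>B\<close> from the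
  right.\<close>

definition rc_pow :: "nat => (nat => 'p) => 'b mat => nat => 'p" where
 "rc_pow n z M = (\<lambda>k\<in>{..<n}. sm P (%i. rc (z i) (M $$ (i, k))) {..<n})"

text \<open>An endomorphism of a power is determined by its matrix of components, and each component
  is given by an element of \<open>B\<close> by \<open>rc_full\<close>.\<close>

lemma endo_bimodule_pow: "endo_bimodule K L (matrix_algebra n B) (pmod n P) (rc_pow n)"
proof -
 let ?R = "matrix_algebra n B" and ?Q = "pmod n P"
 interpret Q: left_module L ?Q by (rule left_module_pow[OF P.left_module_axioms])
 interpret R: unital_algebra K ?R by (rule B.unital_matrix_algebra)
 have mc: "M $$ (i, k) <: B" if "M <: ?R" "i < n" "k < n" for M i k using that by (simp add: matrix_carrier)
 have t: "rc (z i) (M $$ (i, k)) <: P" if "z <: ?Q" "M <: ?R" "i < n" "k < n" for z M i k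
 by (rule rc_closed[OF pow_val[OF that(1,3)] mc[OF that(2-4)]])
 have s: "sm P (%i. rc (z i) (M $$ (i, k))) {..<n} <: P" if "z <: ?Q" "M <: ?R" "k < n" for z M k
 using t[OF that(1,2) _ that(3)] by (intro P.M.finsum_closed) simp
 have c: "rc_pow n z M <: ?Q" if "z <: ?Q" "M <: ?R" for z M unfolding rc_pow_def pow_simps(1) using s[OF that] by simp
 have v: "rc_pow n z M k = sm P (%i. rc (z i) (M $$ (i, k))) {..<n}" if "k < n" for z M k using that by (simp add: rc_pow_def)
 have e: "(M *[?R] N) $$ (i, k) = sm B (%l. M $$ (i, l) *[B] N $$ (l, k)) {..<n}"
 "(M +[?R] N) $$ (i, k) = M $$ (i, k) +[B] N $$ (i, k)" if "i < n" "k < n" for M N i k using that by (simp_all add: matrix_ops)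
 have es: "(x *:[?R] M) $$ (i, k) = x *:[B] M $$ (i, k)" if "M <: ?R" "i < n" "k < n" for x M i k using that by (auto simp: matrix_carrier matrix_ops)
 have pa: "(z +[?Q] w) i = z i +[P] w i" "(l *:[?Q] z) i = l *:[P] z i" if "i < n" for z w l i using that by (simp_all add: pow_simps)
 have uv: "rc_pow n (uvec n P i x) M k = rc x (M $$ (i, k))"
 if "x <: P" "M <: ?R" "i < n" "k < n" for x M i k
 proof -
 have "rc_pow n (uvec n P i x) M k = rc (uvec n P i x i) (M $$ (i, k))" unfolding v[OF that(4)] using that mc
 by (intro P.M.finsum_delta) (simp_all add: uvec_def rc_zero rc_closed)
 thus ?thesis using that by (simp add: uvec_def)
 qed
 show ?thesis
 proof (intro endo_bimodule.intro endo_bimodule_axioms.intro L.unital_algebra_axioms R.unital_algebra_axioms Q.left_module_axioms)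
 fix M assume M: "M <: ?R"
 show "lmap L ?Q ?Q (%z. rc_pow n z M)" unfolding lmap_def
 proof (intro conjI ballI)
 show "(%z. rc_pow n z M) : car ?Q ->: ?Q" using c[OF _ M] by blast
 fix z w assume z: "z <: ?Q" and w: "w <: ?Q"
 show "rc_pow n (z +[?Q] w) M = rc_pow n z M +[?Q] rc_pow n w M"
 proof (rule pow_eqI[OF c[OF _ M]])
 fix k assume k: "k < n"
 have "sm P (%i. rc ((z +[?Q] w) i) (M $$ (i, k))) {..<n} = sm P (%i. rc (z i) (M $$ (i, k)) +[P] rc (w i) (M $$ (i, k))) {..<n}"
 using t[OF z M _ k] t[OF w M _ k] pow_val[OF z] pow_val[OF w] mc[OF M _ k] by (intro P.M.finsum_cong') (simp_all add: pa rc_plus)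
 also have "... = rc_pow n z M k +[P] rc_pow n w M k" unfolding v[OF k] using t[OF z M _ k] t[OF w M _ k] by (intro P.M.finsum_addf) simp_all
 finally show "rc_pow n (z +[?Q] w) M k = (rc_pow n z M +[?Q] rc_pow n w M) k" unfolding pa[OF k] v[OF k] .
 qed (use z w M c in auto)
 next
 fix l z assume l: "l <: L" and z: "z <: ?Q"
 show "rc_pow n (l *:[?Q] z) M = l *:[?Q] rc_pow n z M"
 proof (rule pow_eqI[OF c[OF _ M]])
 fix k assume k: "k < n"
 have "sm P (%i. rc ((l *:[?Q] z) i) (M $$ (i, k))) {..<n} = sm P (%i. l *:[P] rc (z i) (M $$ (i, k))) {..<n}"
 using t[OF z M _ k] pow_val[OF z] mc[OF M _ k] l by (intro P.M.finsum_cong') (simp_all add: pa rc_lin)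
 also have "... = l *:[P] rc_pow n z M k" unfolding v[OF k] using t[OF z M _ k] l by (intro P.smult_r_finsum[symmetric]) simp_all
 finally show "rc_pow n (l *:[?Q] z) M k = (l *:[?Q] rc_pow n z M) k" unfolding pa[OF k] v[OF k] .
 qed (use z l M c Q.smult_closed in auto)
 qed
 next
 fix z M N assume z: "z <: ?Q" and M: "M <: ?R" and N: "N <: ?R"
 show "rc_pow n z (M +[?R] N) = rc_pow n z M +[?Q] rc_pow n z N"
 proof (rule pow_eqI[OF c[OF z]])
 fix k assume k: "k < n"
 have "sm P (%i. rc (z i) ((M +[?R] N) $$ (i, k))) {..<n} = sm P (%i. rc (z i) (M $$ (i, k)) +[P] rc (z i) (N $$ (i, k))) {..<n}"
 using t[OF z M _ k] t[OF z N _ k] pow_val[OF z] mc[OF M _ k] mc[OF N _ k] k by (intro P.M.finsum_cong') (simp_all add: e rc_add)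
 also have "... = rc_pow n z M k +[P] rc_pow n z N k" unfolding v[OF k] using t[OF z M _ k] t[OF z N _ k] by (intro P.M.finsum_addf) simp_all
 finally show "rc_pow n z (M +[?R] N) k = (rc_pow n z M +[?Q] rc_pow n z N) k" unfolding pa[OF k] v[OF k] .
 qed (use z M N c in auto)
 show "rc_pow n z (M *[?R] N) = rc_pow n (rc_pow n z M) N"
 proof (rule pow_eqI[OF c[OF z R.mult_closed[OF M N]] c[OF c[OF z M] N]])
 fix k assume k: "k < n"
 have tt: "rc (rc (z l) (M $$ (l, i))) (N $$ (i, k)) <: P" if "i < n" "l < n" for i l using rc_closed[OF t[OF z M that(2,1)] mc[OF N that(1) k]] .
 have "rc_pow n z (M *[?R] N) k = sm P (%l. sm P (%i. rc (rc (z l) (M $$ (l, i))) (N $$ (i, k))) {..<n}) {..<n}" unfolding v[OF k]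
 proof (rule P.M.finsum_cong'[OF refl])
 fix l assume "l : {..<n}"
 hence l: "l < n" by simp
 have "rc (z l) ((M *[?R] N) $$ (l, k)) = sm P (%i. rc (z l) (M $$ (l, i) *[B] N $$ (i, k))) {..<n}"
 unfolding e(1)[OF l k] using mc[OF M l] mc[OF N _ k] pow_val[OF z l] by (intro rc_finsum_r) simp_all
 also have "... = sm P (%i. rc (rc (z l) (M $$ (l, i))) (N $$ (i, k))) {..<n}"
 using mc[OF M l] mc[OF N _ k] pow_val[OF z l] tt l by (intro P.M.finsum_cong') (simp_all add: rc_mult)
 finally show "rc (z l) ((M *[?R] N) $$ (l, k)) = sm P (%i. rc (rc (z l) (M $$ (l, i))) (N $$ (i, k))) {..<n}" .
 qed (use tt in "simp add: P.M.finsum_closed Pi_def")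
 also have "... = sm P (%i. sm P (%l. rc (rc (z l) (M $$ (l, i))) (N $$ (i, k))) {..<n}) {..<n}" using tt by (intro P.M.finsum_swap) auto
 also have "... = rc_pow n (rc_pow n z M) N k" unfolding v[OF k]
 proof (rule P.M.finsum_cong'[OF refl])
 fix i assume "i : {..<n}"
 hence i: "i < n" by simp
 show "sm P (%l. rc (rc (z l) (M $$ (l, i))) (N $$ (i, k))) {..<n} = rc (rc_pow n z M i) (N $$ (i, k))"
 unfolding v[OF i] using t[OF z M _ i] mc[OF N i k] by (intro rc_finsum_l[symmetric]) simp_all
 next
 show "(%i. rc (rc_pow n z M i) (N $$ (i, k))) : {..<n} ->: P" using t[OF c[OF z M] N _ k] by simp
 qed
 finally show "rc_pow n z (M *[?R] N) k = rc_pow n (rc_pow n z M) N k" .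
 qed
 next
 fix z x M assume z: "z <: ?Q" and x: "x <: K" and M: "M <: ?R"
 have xl: "x *:[L] 1[L] <: L" using x by simp
 show "rc_pow n z (x *:[?R] M) = (x *:[L] 1[L]) *:[?Q] rc_pow n z M"
 proof (rule pow_eqI[OF c[OF z]])
 fix k assume k: "k < n"
 have "sm P (%i. rc (z i) ((x *:[?R] M) $$ (i, k))) {..<n} = sm P (%i. (x *:[L] 1[L]) *:[P] rc (z i) (M $$ (i, k))) {..<n}"
 using t[OF z M _ k] pow_val[OF z] mc[OF M _ k] k x by (intro P.M.finsum_cong') (simp_all add: es[OF M] rc_smult)
 also have "... = (x *:[L] 1[L]) *:[P] rc_pow n z M k" unfolding v[OF k] using t[OF z M _ k] xl by (intro P.smult_r_finsum[symmetric]) simp_all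
 finally show "rc_pow n z (x *:[?R] M) k = ((x *:[L] 1[L]) *:[?Q] rc_pow n z M) k" unfolding pa[OF k] v[OF k] .
 qed (use z x M c xl Q.smult_closed in auto)
 next
 fix h assume h: "lmap L ?Q ?Q h"
 have hm: "lmap L P P (%x. h (uvec n P i x) k)" if k: "k < n" for i k proof -
 have "lmap L ?Q P (%z. z k)" using k pow_val[OF _ k, of _ P] by (simp add: lmap_def pa)
 from lmap_compose[OF lmap_compose[OF unit_vec_map[OF P.left_module_axioms] h] this] show ?thesis .
 qed
 have "ALL ik. fst ik < n & snd ik < n --> (EX b:car B. ALL x:car P. rc x b = h (uvec n P (fst ik) x) (snd ik))"
 using rc_full[OF hm] by blast
 then obtain m where m: "!!i k. [|i < n; k < n|] ==> m (i, k) <: B"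
 "!!i k x. [|i < n; k < n; x <: P|] ==> rc x (m (i, k)) = h (uvec n P i x) k" by (metis fst_conv snd_conv)
 have M: "mat n n m <: ?R" using m(1) by (simp add: matrix_carrier)
 have "rc_pow n z (mat n n m) = h z" if z: "z <: ?Q" for z
 proof (rule pow_eqI[OF c[OF z M] lmapD(1)[OF h z]])
 fix k assume k: "k < n"
 have u: "uvec n P i (z i) <: ?Q" if "i < n" for i by (rule P.unit_vec_closed[OF pow_val[OF z that]])
 have "h z = h (sm ?Q (%i. uvec n P i (z i)) {..<n})" using P.pow_decomp[OF z] by simp
 also have "... = sm ?Q (%i. h (uvec n P i (z i))) {..<n}"
 using u by (intro lmap_finsum[OF h Q.left_module_axioms Q.left_module_axioms]) simp
 finally have "h z k = sm P (%i. h (uvec n P i (z i)) k) {..<n}"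
 using P.pow_finsum[of "%i. h (uvec n P i (z i))" "{..<n}" n k] lmapD(1)[OF h u] k by simp
 also have "... = rc_pow n z (mat n n m) k" unfolding v[OF k] using k pow_val[OF z] m t[OF z M _ k] by (intro P.M.finsum_cong') simp_all
 finally show "rc_pow n z (mat n n m) k = h z k" ..
 qed
 thus "EX M:car ?R. ALL z:car ?Q. rc_pow n z M = h z" using M by blast
 next
 fix M assume M: "M <: ?R" and 0: "!!z. z <: ?Q ==> rc_pow n z M = 0[?Q]"
 show "M = 0[?R]"
 proof (rule matrix_eqI[OF M R.M.zero_closed])
 fix i k assume ik: "i < n" "k < n"
 have "M $$ (i, k) = 0[B]"
 proof (rule rc_faithful[OF mc[OF M ik]])
 fix x assume x: "x <: P"
 have "rc x (M $$ (i, k)) = 0[?Q] k" using uv[OF x M ik] 0[OF P.unit_vec_closed[OF x]] by simp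
 thus "rc x (M $$ (i, k)) = 0[P]" using ik by (simp add: pow_simps(2))
 qed
 thus "M $$ (i, k) = 0[?R] $$ (i, k)" using ik by (simp add: matrix_ops)
 qed
 qed
qed

end

section \<open>Modules with a basis of hairs\<close>

text \<open>\<open>P\<close> is a direct sum of modules \<open>L nu (fst s)\<close>, one for each
  vertex \<open>s\<close> of the hair extension. The coefficient at \<open>dlt s\<close> is unique
  only after multiplication by \<open>nu (fst s)\<close>, which is built into
  \<open>coef\<close>.\<close>

locale hair_basis = hair K E w m + EB: endo_bimodule K "leavitt_path_algebra K E w" B P rc
 for K :: "'k ring" and E :: "('v, 'e) pre_digraph" and w m and B :: "('k, 'b) module"
 and P :: "((('v, 'e) lpa_gen list => 'k) set, 'p) module" and rc +
 fixes dlt :: "'v \<times> nat => 'p"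
 assumes dlt_closed: "s : vs E' ==> dlt s <: P" and nu_dlt: "s : vs E' ==> nu (fst s) *:[P] dlt s = dlt s"
 and span: "z <: P ==> EX c : vs E' ->: L. z = EB.P.lcomb c dlt (vs E')"
 and indep: "[|c : vs E' ->: L; EB.P.lcomb c dlt (vs E') = 0[P]; s : vs E'|] ==>
 c s *[L] nu (fst s) = 0[L]"
begin

declare dlt_closed [simp]

abbreviation comb where "comb c \<equiv> EB.P.lcomb c dlt (vs E')"

lemma dlt_fun: "dlt : vs E' ->: P" using dlt_closed by blast

lemma fst_verts: "s : vs E' ==> fst s : vs E" by (simp add: hair_verts)

lemma nuf [simp]: "s : vs E' ==> nu (fst s) <: L" by (rule nu_L[OF fst_verts])

lemma comb_closed: "c : vs E' ->: L ==> comb c <: P" by (rule EB.P.lcomb_closed[OF _ dlt_fun])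

definition coef where "coef z s = (SOME c. c : vs E' ->: L & z = comb c) s *[L] nu (fst s)"

lemma indep_eq:
 assumes c: "c : vs E' ->: L" and d: "d : vs E' ->: L" and eq: "comb c = comb d" and s: "s : vs E'"
 shows "c s *[L] nu (fst s) = d s *[L] nu (fst s)" proof -
 have n: "(%s. -[L] 1[L] *[L] d s) : vs E' ->: L" using d by auto
 have "comb (%s. -[L] 1[L] *[L] d s) = -[L] 1[L] *:[P] comb d" using d by (intro EB.P.lcomb_smult[symmetric]) auto
 hence "comb (%s. c s +[L] (-[L] 1[L] *[L] d s)) = comb c +[P] -[P] comb d"
 using EB.P.lcomb_add[OF c n dlt_fun] comb_closed[OF d] by (simp add: EB.P.smult_l_minus)
 hence 0: "comb (%s. c s +[L] (-[L] 1[L] *[L] d s)) = 0[P]" using comb_closed[OF d] unfolding eq by (simp add: EB.P.M.r_neg)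
 have cs: "c s <: L" "d s <: L" using c d s by auto
 have "(c s +[L] (-[L] 1[L] *[L] d s)) *[L] nu (fst s) = 0[L]" by (rule indep[OF _ 0 s]) (use c n in "simp add: Pi_def")
 hence "c s *[L] nu (fst s) -[L] d s *[L] nu (fst s) = 0[L]" using cs nuf[OF s] by (simp add: lv.U.mult_l_distr lv.U.mult_minus_l a_minus_def)
 thus ?thesis using cs nuf[OF s] by (simp add: fam.B.minus_eq_zero_iff)
qed

lemma coef_comb:
 assumes c: "c : vs E' ->: L" and s: "s : vs E'" shows "coef (comb c) s = c s *[L] nu (fst s)"
proof -
 let ?d = "SOME d. d : vs E' ->: L & comb c = comb d"
 have d: "?d : vs E' ->: L & comb c = comb ?d" by (rule someI[of _ c]) (use c in blast)
 show ?thesis unfolding coef_def by (rule indep_eq[symmetric, OF c conjunct1[OF d] conjunct2[OF d] s])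
qed

lemma coef_closed: assumes z: "z <: P" and s: "s : vs E'" shows "coef z s <: L"
proof -
 obtain c where c: "c : vs E' ->: L" "z = comb c" using span[OF z] by blast
 have "c s <: L" using c(1) s by auto
 thus ?thesis unfolding c(2) coef_comb[OF c(1) s] using nuf[OF s] by simp
qed

lemma comb_coef: assumes z: "z <: P" shows "z = comb (coef z)"
proof -
 obtain c where c: "c : vs E' ->: L" "z = comb c" using span[OF z] by blast
 have "comb c = comb (coef z)" unfolding EB.P.lcomb_def
 proof (rule EB.P.M.finsum_cong'[OF refl])
 fix s assume s: "s : vs E'"
 have cs: "c s <: L" using c(1) s by auto
 show "c s *:[P] dlt s = coef z s *:[P] dlt s" unfolding c(2) coef_comb[OF c(1) s]
 using nu_dlt[OF s] cs nuf[OF s] dlt_closed[OF s] by (simp add: EB.P.smult_assoc)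
 qed (use coef_closed[OF z] dlt_closed EB.P.smult_closed in auto)
 thus ?thesis using c(2) by simp
qed

lemma coef_add: assumes "y <: P" "z <: P" "s : vs E'" shows "coef (y +[P] z) s = coef y s +[L] coef z s"
proof -
 obtain c where c: "c : vs E' ->: L" "y = comb c" using span[OF assms(1)] by blast
 obtain d where d: "d : vs E' ->: L" "z = comb d" using span[OF assms(2)] by blast
 have cs: "c s <: L" "d s <: L" using c d assms(3) by auto
 have "coef (y +[P] z) s = coef (comb (%s. c s +[L] d s)) s" using EB.P.lcomb_add[OF c(1) d(1) dlt_fun] c(2) d(2) by simp
 also have "... = (c s +[L] d s) *[L] nu (fst s)" by (rule coef_comb[OF _ assms(3)]) (use c(1) d(1) in "simp add: Pi_def")
 also have "... = coef y s +[L] coef z s" unfolding c(2) d(2) coef_comb[OF c(1) assms(3)] coef_comb[OF d(1) assms(3)]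
 using cs nuf[OF assms(3)] by (simp add: lv.U.mult_l_distr)
 finally show ?thesis .
qed

lemma coef_smult: assumes "l <: L" "z <: P" "s : vs E'" shows "coef (l *:[P] z) s = l *[L] coef z s"
proof -
 obtain d where d: "d : vs E' ->: L" "z = comb d" using span[OF assms(2)] by blast
 have cs: "d s <: L" using d assms(3) by auto
 have "coef (l *:[P] z) s = coef (comb (%s. l *[L] d s)) s" using EB.P.lcomb_smult[OF d(1) assms(1) dlt_fun] d(2) by simp
 also have "... = (l *[L] d s) *[L] nu (fst s)" by (rule coef_comb[OF _ assms(3)]) (use d(1) assms(1) in "simp add: Pi_def lv.U.mult_closed")
 also have "... = l *[L] coef z s" unfolding d(2) coef_comb[OF d(1) assms(3)] using cs nuf[OF assms(3)] assms(1) by (simp add: lv.U.mult_assoc)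
 finally show ?thesis .
qed

lemma coef_dlt: assumes s: "s : vs E'" and t: "t : vs E'" shows "coef (dlt t) s = (if s = t then nu (fst t) else 0[L])"
proof -
 let ?c = "%s. if s = t then 1[L] else 0[L]"
 have "comb ?c = ?c t *:[P] dlt t" by (rule EB.P.lcomb_single[OF H.finite_verts t]) (use dlt_fun in auto)
 hence "dlt t = comb ?c" using dlt_closed[OF t] by simp
 hence "coef (dlt t) s = ?c s *[L] nu (fst s)" using coef_comb[of ?c s] s by auto
 thus ?thesis using nuf[OF s] by auto
qed

lemma rc_eqI_dlt:
 assumes "b <: B" "c <: B" "!!s. s : vs E' ==> rc (dlt s) b = rc (dlt s) c" shows "b = c"
proof (rule EB.rc_eqI[OF assms(1,2)])
 fix z assume z: "z <: P"
 have r: "rc z b = sm P (%s. coef z s *:[P] rc (dlt s) b) (vs E')" if b: "b <: B" for b proof -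
 have "rc z b = rc (comb (coef z)) b" using comb_coef[OF z] by simp
 also have "... = sm P (%s. rc (coef z s *:[P] dlt s) b) (vs E')" unfolding EB.P.lcomb_def using coef_closed[OF z]
 by (intro EB.rc_finsum_l[OF b]) simp
 also have "... = sm P (%s. coef z s *:[P] rc (dlt s) b) (vs E')" using coef_closed[OF z] b
 by (intro EB.P.M.finsum_cong') (simp_all add: EB.rc_lin EB.rc_closed)
 finally show ?thesis .
 qed
 show "rc z b = rc z c" unfolding r[OF assms(1)] r[OF assms(2)] using assms(3) coef_closed[OF z] assms(2)
 by (intro EB.P.M.finsum_cong') (simp_all add: EB.rc_closed)
qed

text \<open>An endomorphism can be prescribed on the basis once each value is multiplied by the
  vertex of the basis element; \<open>rc_full\<close> realizes it in \<open>B\<close>.\<close>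

lemma elt_ex:
 assumes f: "!!s. s : vs E' ==> f s <: P" shows "EX b:car B. ALL s:vs E'. rc (dlt s) b = nu (fst s) *:[P] f s"
proof -
 let ?h = "%z. EB.P.lcomb (coef z) f (vs E')"
 have ff: "f : vs E' ->: P" using f by blast
 have cc: "coef z : vs E' ->: L" if "z <: P" for z using coef_closed[OF that] by blast
 have "lmap L P P ?h" unfolding lmap_def
 proof (intro conjI ballI)
 show "?h : car P ->: P" using EB.P.lcomb_closed[OF cc ff] by blast
 fix y z assume yz: "y <: P" "z <: P"
 have "?h (y +[P] z) = EB.P.lcomb (%s. coef y s +[L] coef z s) f (vs E')"
 by (rule EB.P.lcomb_cong[OF _ _ ff]) (use yz coef_add coef_closed in auto)
 thus "?h (y +[P] z) = ?h y +[P] ?h z" by (simp add: EB.P.lcomb_add[OF cc[OF yz(1)] cc[OF yz(2)] ff])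
 next
 fix l z assume lz: "l <: L" "z <: P"
 have "?h (l *:[P] z) = EB.P.lcomb (%s. l *[L] coef z s) f (vs E')"
 by (rule EB.P.lcomb_cong[OF _ _ ff]) (use lz coef_smult coef_closed lv.U.mult_closed in auto)
 thus "?h (l *:[P] z) = l *:[P] ?h z" by (simp add: EB.P.lcomb_smult[OF cc[OF lz(2)] lz(1) ff])
 qed
 then obtain b where b: "b <: B" "!!z. z <: P ==> rc z b = ?h z" using EB.rc_full by blast
 have "rc (dlt s) b = nu (fst s) *:[P] f s" if s: "s : vs E'" for s proof -
 have "?h (dlt s) = coef (dlt s) s *:[P] f s" by (rule EB.P.lcomb_single[OF H.finite_verts s _ ff]) (simp_all add: coef_dlt s)
 thus ?thesis using b(2)[OF dlt_closed[OF s]] coef_dlt[OF s s] by simp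
 qed
 thus ?thesis using b(1) by blast
qed

definition elt where "elt f = (SOME b. b <: B & (ALL s:vs E'. rc (dlt s) b = nu (fst s) *:[P] f s))"

lemma elt:
 assumes "!!s. s : vs E' ==> f s <: P" shows "elt f <: B" "s : vs E' ==> rc (dlt s) (elt f) = nu (fst s) *:[P] f s"
proof -
 have "EX b. b <: B & (ALL s:vs E'. rc (dlt s) b = nu (fst s) *:[P] f s)" using elt_ex[of f] assms by blast
 from someI_ex[OF this] show "elt f <: B" "s : vs E' ==> rc (dlt s) (elt f) = nu (fst s) *:[P] f s" unfolding elt_def by blast+
qed

text \<open>The embedding of \<open>L\<close> onto the summand generated by the basis elements at
  the old vertices.\<close>

definition iot where "iot l = EB.P.lcomb (%v. l *[L] nu v) (%v. dlt (v, 0)) (vs E)"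

text \<open>The endomorphism that takes \<open>dlt s\<close> to \<open>dlt t\<close> and kills the
  rest of the basis, for \<open>s\<close> and \<open>t\<close> on the same hair.\<close>

definition unit where "unit s t = elt (%r. if r = s then dlt t else 0[P])"

text \<open>Right multiplication by \<open>l\<close> on the summand \<open>L\<close>, and zero on
  the basis elements of the hairs.\<close>

definition lift where "lift l = elt (%r. if snd r = 0 then iot l else 0[P])"

lemma dlt0: "(%v. dlt (v, 0)) : vs E ->: P" using dlt_closed base_verts by blast

lemma lnu: "l <: L ==> (%v. l *[L] nu v) : vs E ->: L" using nu_L by blast

lemma iot_map: "lmap L (rmod L) P iot" unfolding lmap_def rmod_simps
proof (intro conjI ballI)
 show "iot : car L ->: P" unfolding iot_def using EB.P.lcomb_closed[OF lnu dlt0] by blast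
 fix x y assume xy: "x <: L" "y <: L"
 have "iot (x +[L] y) = EB.P.lcomb (%v. x *[L] nu v +[L] y *[L] nu v) (%v. dlt (v, 0)) (vs E)"
 unfolding iot_def by (rule EB.P.lcomb_cong[OF _ _ dlt0]) (use xy nu_L lv.U.mult_closed in "simp_all add: lv.U.mult_l_distr")
 thus "iot (x +[L] y) = iot x +[P] iot y" unfolding iot_def by (simp add: EB.P.lcomb_add[OF lnu[OF xy(1)] lnu[OF xy(2)] dlt0])
next
 fix x y assume xy: "x <: L" "y <: L"
 have "iot (x *[L] y) = EB.P.lcomb (%v. x *[L] (y *[L] nu v)) (%v. dlt (v, 0)) (vs E)" unfolding iot_def by (rule EB.P.lcomb_cong[OF _ _ dlt0])
 (use xy nu_L lv.U.mult_closed in "simp_all add: lv.U.mult_assoc")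
 thus "iot (x *[L] y) = x *:[P] iot y" unfolding iot_def by (simp add: EB.P.lcomb_smult[OF lnu[OF xy(2)] xy(1) dlt0])
qed

lemma iotD: "x <: L ==> iot x <: P" "[|x <: L; y <: L|] ==> iot (x +[L] y) = iot x +[P] iot y" "[|x <: L; y <: L|] ==> iot (x *[L] y) = x *:[P] iot y"
 using lmapD[OF iot_map] by (simp_all add: rmod_simps)

lemma iot_finsum: "f : S ->: L ==> iot (sm L f S) = sm P (%s. iot (f s)) S"
 by (rule add_finsum[OF fam.B.ag EB.P.M.ag]) (simp_all add: iotD)

lemma iot_zero: "iot 0[L] = 0[P]" by (rule additive_zero[OF fam.B.ag EB.P.M.ag]) (simp_all add: iotD)

lemma iot_nu: assumes v: "v : vs E" shows "iot (nu v) = dlt (v, 0)"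
proof -
 have "iot (nu v) = (nu v *[L] nu v) *:[P] dlt (v, 0)" unfolding iot_def by (rule EB.P.lcomb_single[OF finite_verts v _ dlt0])
 (use v nu_L lv.U.mult_closed fam.nu_mult in auto)
 thus ?thesis using fam.nu_mult[OF v v] nu_dlt[OF base_verts[OF v]] by simp
qed

lemma sum_nu: assumes "l <: L" shows "l = sm L (%v. l *[L] nu v) (vs E)"
proof -
 have "l *[L] 1[L] = sm L (%v. l *[L] nu v) (vs E)" unfolding lv.one_sum by (rule lv.U.mult_finsum)
 (use assms nu_L in "simp_all add: lv.U.mult_closed lv.U.mult_r_distr")
 thus ?thesis using assms by simp
qed

lemma iot_inj: assumes l: "l <: L" "iot l = 0[P]" shows "l = 0[L]"
proof -
 let ?c = "%s. if snd s = 0 then l *[L] nu (fst s) else 0[L]"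
 have cc: "?c : vs E' ->: L" using l(1) by auto
 have im: "(%v. (v, 0)) ` vs E <= vs E'" using base_verts by blast
 have tc: "(l *[L] nu v) *:[P] dlt (v, 0) <: P" if "v : vs E" for v using dlt_closed[OF base_verts[OF that]] nu_L[OF that] l(1) by simp
 have "iot l = sm P (%s. ?c s *:[P] dlt s) ((%v. (v, 0)) ` vs E)" unfolding iot_def EB.P.lcomb_def
 by (subst EB.P.M.finsum_reindex) (use tc in "auto simp: inj_on_def")
 also have "... = comb ?c" unfolding EB.P.lcomb_def
 proof (rule EB.P.M.add.finprod_mono_neutral_cong_left[OF H.finite_verts im])
 fix s assume s: "s : vs E' - (%v. (v, 0)) ` vs E"
 have "snd s ~= 0"
 proof
 assume "snd s = 0"
 hence "s = (fst s, 0)" by (simp add: prod_eq_iff)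
 thus False using s fst_verts by blast
 qed
 thus "?c s *:[P] dlt s = 0[P]" using s by simp
 qed (use EB.P.smult_closed[OF funcset_mem[OF cc] dlt_closed] in auto)
 finally have 0: "comb ?c = 0[P]" using l(2) by simp
 have "l *[L] nu v = 0[L]" if v: "v : vs E" for v
 using indep[OF cc 0 base_verts[OF v]] l(1) nu_L[OF v] fam.nu_mult[OF v v] by (simp add: lv.U.mult_assoc)
 thus ?thesis using sum_nu[OF l(1)] by (simp add: cong: fam.B.finsum_cong)
qed

lemma unit:
 assumes s: "s : vs E'" and t: "t : vs E'" and st: "fst s = fst t"
 shows "unit s t <: B" "r : vs E' ==> rc (dlt r) (unit s t) = (if r = s then dlt t else 0[P])" proof -
 have c: "(if r = s then dlt t else 0[P]) <: P" for r using dlt_closed[OF t] by simp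
 show "unit s t <: B" unfolding unit_def by (rule elt(1)[OF c])
 show "rc (dlt r) (unit s t) = (if r = s then dlt t else 0[P])" if r: "r : vs E'"
 unfolding unit_def elt(2)[OF c r] using nu_dlt[OF t] st nuf[OF r] by simp
qed

lemma lift:
 assumes l: "l <: L" shows "lift l <: B" "r : vs E' ==> rc (dlt r) (lift l) = (if snd r = 0 then iot (nu (fst r) *[L] l) else 0[P])"
proof -
 have c: "(if snd r = 0 then iot l else 0[P]) <: P" for r :: "'v \<times> nat" using iotD(1)[OF l] by simp
 show "lift l <: B" unfolding lift_def by (rule elt(1)[OF c])
 show "rc (dlt r) (lift l) = (if snd r = 0 then iot (nu (fst r) *[L] l) else 0[P])" if r: "r : vs E'"
 unfolding lift_def elt(2)[OF c r] using nuf[OF r] l by (simp add: iotD(3))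
qed

lemma rc_iot_lift: assumes x: "x <: L" and l: "l <: L" shows "rc (iot x) (lift l) = iot (x *[L] l)"
proof -
 note lc = lift(1)[OF l]
 have "rc (iot x) (lift l) = sm P (%v. rc ((x *[L] nu v) *:[P] dlt (v, 0)) (lift l)) (vs E)"
 unfolding iot_def EB.P.lcomb_def using dlt0 lnu[OF x] EB.P.smult_closed by (intro EB.rc_finsum_l[OF lc]) blast
 also have "... = sm P (%v. iot (x *[L] nu v *[L] l)) (vs E)"
 proof (rule EB.P.M.finsum_cong'[OF refl])
 fix v assume v: "v : vs E"
 note b = base_verts[OF v]
 have xv: "x *[L] nu v <: L" using x nu_L[OF v] by simp
 have "rc ((x *[L] nu v) *:[P] dlt (v, 0)) (lift l) = (x *[L] nu v) *:[P] iot (nu v *[L] l)"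
 using EB.rc_lin[OF xv dlt_closed[OF b] lc] lift(2)[OF l b] by simp
 also have "... = iot (x *[L] (nu v *[L] nu v) *[L] l)" using x l nu_L[OF v] by (simp add: lv.U.mult_assoc flip: iotD(3))
 finally show "rc ((x *[L] nu v) *:[P] dlt (v, 0)) (lift l) = iot (x *[L] nu v *[L] l)" using fam.nu_mult[OF v v] by simp
 qed (use x l nu_L in "simp add: iotD(1) lv.U.mult_closed")
 also have "... = iot (sm L (%v. x *[L] nu v *[L] l) (vs E))" using x l by (intro iot_finsum[symmetric]) simp
 also have "sm L (%v. x *[L] nu v *[L] l) (vs E) = sm L (%v. x *[L] nu v) (vs E) *[L] l" by (rule lv.U.finsum_mult[symmetric])
 (use lnu[OF x] l in "simp_all add: lv.U.mult_closed lv.U.mult_l_distr")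
 finally show ?thesis using sum_nu[OF x] by simp
qed

lemma alg_map_lift: "alg_map K L B lift"
proof -
 note cl = lift(1) and rv = lift(2)
 show ?thesis unfolding alg_map_def
 proof (intro conjI ballI)
 show "lift : car L ->: B" using cl by blast
 fix x y assume x: "x <: L" and y: "y <: L"
 show "lift (x +[L] y) = lift x +[B] lift y"
 proof (rule rc_eqI_dlt)
 fix r assume r: "r : vs E'"
 show "rc (dlt r) (lift (x +[L] y)) = rc (dlt r) (lift x +[B] lift y)" using x y EB.rc_add[OF dlt_closed[OF r] cl[OF x] cl[OF y]]
 by (simp add: rv r lv.U.mult_r_distr iotD)
 qed (use x y cl in simp_all)
 show "lift (x *[L] y) = lift x *[B] lift y"
 proof (rule rc_eqI_dlt)
 fix r assume r: "r : vs E'"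
 show "rc (dlt r) (lift (x *[L] y)) = rc (dlt r) (lift x *[B] lift y)" using x y EB.rc_mult[OF dlt_closed[OF r] cl[OF x] cl[OF y]]
 by (simp add: rv r rc_iot_lift EB.rc_zero cl lv.U.mult_assoc)
 qed (use x y cl in "simp_all add: lv.U.mult_closed EB.B.mult_closed")
 next
 fix k x assume k: "k <: K" and x: "x <: L"
 show "lift (k *:[L] x) = k *:[B] lift x"
 proof (rule rc_eqI_dlt)
 fix r assume r: "r : vs E'"
 have "nu (fst r) *[L] (k *:[L] x) = (k *:[L] 1[L]) *[L] (nu (fst r) *[L] x)" using k x nuf[OF r] by (simp add: lv.U.mult_smult_l lv.U.mult_smult_r)
 thus "rc (dlt r) (lift (k *:[L] x)) = rc (dlt r) (k *:[B] lift x)" using k x EB.rc_smult[OF dlt_closed[OF r] k cl[OF x]] by (simp add: rv r iotD)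
 qed (use k x cl in simp_all)
 qed
qed

text \<open>\<open>lift\<close> and \<open>unit\<close> are the data required by
  \<open>isomorphic_hair_algebra\<close>. The diagonal units sum to the identity since the
  \<open>dlt s\<close> generate \<open>P\<close>, and an endomorphism compressed to the summand
  \<open>L\<close> is right multiplication by an element of \<open>L\<close>.\<close>

lemma isomorphic_hair: "algebra_isomorphic K B H.L"
proof -
 have ag: "abelian_group L" "abelian_group B" by (rule fam.B.ag, rule EB.B.M.ag)
 interpret hair_units K E w m B lift unit
 proof unfold_locales
 show "unit s t <: B" if "s : vs E'" "t : vs E'" "fst s = fst t" for s t by (rule unit(1)[OF that])
 show "unit s t *[B] unit t' r = (if t = t' then unit s r else 0[B])"
 if st: "s : vs E'" "t : vs E'" "fst s = fst t" and tr: "t' : vs E'" "r : vs E'" "fst t' = fst r" for s t t' r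
 proof (rule rc_eqI_dlt)
 note u = unit(1)[OF st] unit(1)[OF tr]
 show "unit s t *[B] unit t' r <: B" using u by (rule EB.B.mult_closed)
 show "(if t = t' then unit s r else 0[B]) <: B" using unit(1) st tr by simp
 fix x assume x: "x : vs E'"
 show "rc (dlt x) (unit s t *[B] unit t' r) = rc (dlt x) (if t = t' then unit s r else 0[B])"
 unfolding EB.rc_mult[OF dlt_closed[OF x] u] unit(2)[OF st x] using st tr x u unit(2)[OF st(1) tr(2)] unit(2)[OF tr st(2)]
 by (auto simp: EB.rc_zero EB.rc_zero_r)
 qed
 show "unit (v, 0) (v, 0) = lift (nu v)" if v: "v : vs E" for v
 proof (rule rc_eqI_dlt)
 note b = base_verts[OF v]
 show "unit (v, 0) (v, 0) <: B" by (rule unit(1)[OF b b refl])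
 show "lift (nu v) <: B" by (rule lift(1)[OF nu_L[OF v]])
 fix r assume r: "r : vs E'"
 show "rc (dlt r) (unit (v, 0) (v, 0)) = rc (dlt r) (lift (nu v))" unfolding unit(2)[OF b b refl r] lift(2)[OF nu_L[OF v] r]
 using fam.nu_mult[OF fst_verts[OF r] v] by (cases r) (auto simp: iot_zero iot_nu v)
 qed
 qed (rule alg_map_lift)
 show ?thesis
 proof (rule isomorphic_hair_algebra)
 show "inj_on lift (car L)"
 proof (rule alg_map_inj[OF alg_map_lift ag])
 fix l assume l: "l <: L" "lift l = 0[B]"
 have "iot l = rc (iot 1[L]) (lift l)" using rc_iot_lift[OF _ l(1), of "1[L]"] l(1) by simp
 also have "... = 0[P]" unfolding l(2) by (rule EB.rc_zero_r) (simp add: iotD)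
 finally show "l = 0[L]" by (rule iot_inj[OF l(1)])
 qed
 have uc: "unit s s <: B" if "s : vs E'" for s by (rule unit(1)[OF that that refl])
 show "sm B (%s. unit s s) (vs E') = 1[B]"
 proof (rule rc_eqI_dlt)
 show "sm B (%s. unit s s) (vs E') <: B" by simp
 fix r assume r: "r : vs E'"
 have "rc (dlt r) (sm B (%s. unit s s) (vs E')) = sm P (%s. rc (dlt r) (unit s s)) (vs E')"
 using uc by (intro EB.rc_finsum_r[OF dlt_closed[OF r]]) blast
 also have "... = rc (dlt r) (unit r r)" using r by (intro EB.P.M.finsum_delta[OF H.finite_verts r]) (auto simp: unit(2))
 also have "... = dlt r" using unit(2)[OF r r refl r] by simp
 finally show "rc (dlt r) (sm B (%s. unit s s) (vs E')) = rc (dlt r) 1[B]" using EB.rc_one[OF dlt_closed[OF r]] by simp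
 qed simp
 fix b assume b: "b <: B"
 have i1: "iot 1[L] <: P" by (simp add: iotD)
 have l1: "lift 1[L] <: B" by (rule lift(1)) simp
 let ?z = "rc (iot 1[L]) b"
 have z: "?z <: P" by (rule EB.rc_closed[OF i1 b])
 have cz: "coef ?z s <: L" if "s : vs E'" for s by (rule coef_closed[OF z that])
 \<comment> \<open>The component in \<open>L\<close> of the image of \<open>1[L]\<close> under
   \<open>b\<close>; the compressed endomorphism is right multiplication by it.\<close>
 define l0 where "l0 = sm L (%s. if snd s = 0 then coef ?z s *[L] nu (fst s) else 0[L]) (vs E')"
 have l0c: "(%s. if snd s = 0 then coef ?z s *[L] nu (fst s) else 0[L]) : vs E' ->: L" using cz by auto
 have l0: "l0 <: L" unfolding l0_def by (rule fam.B.finsum_closed[OF l0c])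
 have "rc ?z (lift 1[L]) = sm P (%s. rc (coef ?z s *:[P] dlt s) (lift 1[L])) (vs E')" using cz dlt_closed EB.P.smult_closed
 by (subst comb_coef[OF z], unfold EB.P.lcomb_def, intro EB.rc_finsum_l[OF l1]) blast
 also have "... = sm P (%s. iot (if snd s = 0 then coef ?z s *[L] nu (fst s) else 0[L])) (vs E')"
 proof (rule EB.P.M.finsum_cong'[OF refl])
 fix s assume s: "s : vs E'"
 show "rc (coef ?z s *:[P] dlt s) (lift 1[L]) = iot (if snd s = 0 then coef ?z s *[L] nu (fst s) else 0[L])"
 unfolding EB.rc_lin[OF cz[OF s] dlt_closed[OF s] l1] lift(2)[OF fam.B.one_closed s] using cz[OF s] nuf[OF s] by (simp add: iotD(3) iot_zero)
 next
 show "(%s. iot (if snd s = 0 then coef ?z s *[L] nu (fst s) else 0[L])) : vs E' ->: P" using l0c iotD(1) by (simp add: Pi_def)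
 qed
 also have "... = iot l0" unfolding l0_def by (rule iot_finsum[OF l0c, symmetric])
 finally have zl: "rc ?z (lift 1[L]) = iot l0" .
 have lb: "lift 1[L] *[B] b <: B" by (rule EB.B.mult_closed[OF l1 b])
 have "lift 1[L] *[B] b *[B] lift 1[L] = lift l0"
 proof (rule rc_eqI_dlt[OF EB.B.mult_closed[OF lb l1] lift(1)[OF l0]])
 fix r assume r: "r : vs E'"
 have e: "rc (dlt r) (lift 1[L] *[B] b *[B] lift 1[L]) = rc (rc (rc (dlt r) (lift 1[L])) b) (lift 1[L])"
 using EB.rc_mult[OF dlt_closed[OF r] lb l1] EB.rc_mult[OF dlt_closed[OF r] l1 b] by simp
 have s0: "rc (dlt r) (lift 1[L]) = nu (fst r) *:[P] iot 1[L]" if "snd r = 0"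
 unfolding lift(2)[OF fam.B.one_closed r] using that iotD(3)[OF nuf[OF r] fam.B.one_closed] by simp
 show "rc (dlt r) (lift 1[L] *[B] b *[B] lift 1[L]) = rc (dlt r) (lift l0)"
 proof (cases "snd r = 0")
 case True
 thus ?thesis unfolding e s0[OF True] EB.rc_lin[OF nuf[OF r] i1 b] EB.rc_lin[OF nuf[OF r] z l1] zl lift(2)[OF l0 r]
 using nuf[OF r] l0 by (simp add: iotD(3))
 next
 case False
 hence "rc (dlt r) (lift 1[L]) = 0[P]" unfolding lift(2)[OF fam.B.one_closed r] by simp
 thus ?thesis unfolding e lift(2)[OF l0 r] using False b l1 by (simp add: EB.rc_zero)
 qed
 qed
 thus "lift 1[L] *[B] b *[B] lift 1[L] : lift ` car L" using l0 by blast
 qed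
qed

end

section \<open>Splitting off \<open>L\<close> and attaching the hairs\<close>

context lpa_setup
begin

text \<open>\<open>P\<close> is the direct sum of the image of \<open>i\<close> and the kernel
  \<open>Q\<close> of \<open>p\<close>. The maps \<open>h\<close> embed \<open>Q\<close> into a
  finite power of \<open>L\<close>, so \<open>Q\<close> is good and has a finite basis, whose
  elements at \<open>v\<close> are placed on the hair at \<open>v\<close>.\<close>

lemma bimodule_hair:
 assumes EB: "endo_bimodule K L B P rc" and i: "lmap L (rmod L) P i" and p: "lmap L P (rmod L) p"
 and pi: "!!l. l <: L ==> p (i l) = l" and X: "finite X" "X <= car P" "car P <= left_module.lspan L P X"
 and I: "finite I" and h: "!!k. k : I ==> lmap L P (rmod L) (h k)" "!!x. [|x <: P; !!k. k : I ==> h k x = 0[L]|] ==> x = 0[P]"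
 obtains m where "!!v. 0 < m v" "algebra_isomorphic K B (leavitt_path_algebra K (hair_extension E m) (hair_weight w))"
proof -
 interpret EB: endo_bimodule K L B P rc by fact
 note PM = EB.P.left_module_axioms
 have RM: "lmod L (rmod L)" by (rule left_module_regular[OF fam.B.ring_axioms])
 have ic: "i l <: P" if "l <: L" for l using lmapD(1)[OF i] that by (simp add: rmod_simps)
 have iadd: "i (l +[L] l') = i l +[P] i l'" if "l <: L" "l' <: L" for l l' using lmapD(2)[OF i] that by (simp add: rmod_simps)
 have ism: "i (l *[L] l') = l *:[P] i l'" if "l <: L" "l' <: L" for l l' using lmapD(3)[OF i] that by (simp add: rmod_simps)
 have pc: "p x <: L" if "x <: P" for x using lmapD(1)[OF p] that by (simp add: rmod_simps)
 have padd: "p (x +[P] y) = p x +[L] p y" if "x <: P" "y <: P" for x y using lmapD(2)[OF p] that by (simp add: rmod_simps)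
 have psm: "p (l *:[P] x) = l *[L] p x" if "l <: L" "x <: P" for l x using lmapD(3)[OF p] that by (simp add: rmod_simps)
 have i0: "i 0[L] = 0[P]" using lmap_zero[OF i RM PM] by (simp add: rmod_simps)
 have p0: "p 0[P] = 0[L]" using lmap_zero[OF p PM RM] by (simp add: rmod_simps)
 have neg: "-[P] x = (-[L] 1[L]) *:[P] x" if "x <: P" for x using that by (simp add: EB.P.smult_l_minus)
 define Q where "Q = P\<lparr>carrier := {x : car P. p x = 0[L]}\<rparr>"
 have Qs: "x <: Q <-> x <: P & p x = 0[L]" "0[Q] = 0[P]" "x +[Q] y = x +[P] y" "l *:[Q] x = l *:[P] x" for x y l by (simp_all add: Q_def)
 have QM: "lmod L Q" proof -
 have "abelian_group Q"
 proof (rule abelian_groupI)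
 fix x assume x: "x <: Q"
 have "p (-[P] x) = 0[L]" using x by (simp add: Qs neg psm)
 hence "-[P] x <: Q" "-[P] x +[Q] x = 0[Q]" using x by (simp_all add: Qs EB.P.M.l_neg)
 thus "EX y:car Q. y +[Q] x = 0[Q]" by blast
 qed (simp_all add: Qs padd p0 EB.P.M.a_ac)
 thus ?thesis unfolding left_module_def left_module_axioms_def by (simp add: Qs psm fam.B.ring_axioms EB.P.smult_l_distr EB.P.smult_r_distr
 EB.P.smult_assoc)
 qed
 interpret Q: left_module L Q by (rule QM)
 \<comment> \<open>The projection onto the complement; it carries the generators of \<open>P\<close>
   to generators of \<open>Q\<close>.\<close>
 define t where "t x = x +[P] -[P] i (p x)" for x
 have tc: "t x <: Q" if "x <: P" for x proof -
 have "p (t x) = p x +[L] (-[L] 1[L]) *[L] p (i (p x))" using that ic[OF pc[OF that]] by (simp add: t_def neg padd psm)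
 also have "... = 0[L]" using pc[OF that] by (simp add: pi lv.U.mult_minus_l fam.B.r_neg)
 finally show ?thesis using that ic[OF pc[OF that]] by (simp add: Qs t_def)
 qed
 have tm: "lmap L P Q t" unfolding lmap_def
 proof (intro conjI ballI)
 show "t : car P ->: Q" using tc by blast
 fix x y assume xy: "x <: P" "y <: P"
 show "t (x +[P] y) = t x +[Q] t y" using xy ic[OF pc[OF xy(1)]] ic[OF pc[OF xy(2)]]
 by (simp add: t_def Qs(3) padd iadd pc EB.P.M.minus_add EB.P.M.a_ac)
 next
 fix l x assume lx: "l <: L" "x <: P"
 show "t (l *:[P] x) = l *:[Q] t x" using lx ic[OF pc[OF lx(2)]] by (simp add: t_def Qs(4) psm ism pc EB.P.smult_r_distr EB.P.smult_r_minus)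
 qed
 have tQ: "t x = x" if "x <: Q" for x proof -
 have "-[P] 0[P] = 0[P]" by simp
 moreover have "i (p x) = 0[P]" "x <: P" using that by (simp_all add: Qs i0)
 ultimately show ?thesis unfolding t_def by (simp only: EB.P.M.r_zero)
 qed
 have decomp: "x = i (p x) +[P] t x" if "x <: P" for x proof -
 have c: "i (p x) <: P" by (rule ic[OF pc[OF that]])
 have "i (p x) +[P] (x +[P] -[P] i (p x)) = (i (p x) +[P] -[P] i (p x)) +[P] x" using c that by (simp add: EB.P.M.a_ac)
 thus ?thesis unfolding t_def using c that by (simp add: EB.P.M.r_neg)
 qed
 have incl: "lmap L Q P (%x. x)" by (simp add: lmap_def Qs)
 have linQ: "Q.lcomb l (%y. y) S = EB.P.lcomb l (%y. y) S" if "S <= car Q" "l : S ->: L" for l S proof -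
 have "(%y. l y *:[Q] y) : S ->: Q" using that Q.smult_closed by blast
 from lmap_finsum[OF incl QM PM this] show ?thesis unfolding Q.lcomb_def EB.P.lcomb_def by (simp add: Qs(4))
 qed
 have tX: "t ` X <= car Q" using tc X(2) by blast
 have Xgen: "car Q <= Q.lspan (t ` X)"
 proof
 fix x assume x: "x <: Q"
 hence "x : EB.P.lspan X" using X(3) by (auto simp: Qs)
 then obtain l where l: "l : X ->: L" "x = EB.P.lcomb l (%y. y) X" by (rule EB.P.lspan_finite[OF X(1,2)])
 have c: "(%y. l y *:[P] y) : X ->: P" using l(1) X(2) EB.P.smult_closed by blast
 have "x = t x" using tQ[OF x] by simp
 also have "... = sm Q (%y. t (l y *:[P] y)) X" unfolding l(2) EB.P.lcomb_def by (rule lmap_finsum[OF tm PM QM c])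
 also have "... : Q.lspan (t ` X)"
 proof (rule Q.lspan_finsum[OF tX])
 fix y assume y: "y : X"
 have ly: "l y <: L" "y <: P" using l(1) X(2) y by auto
 have "t y : Q.lspan (t ` X)" using Q.lspan_mem[OF tX] y by blast
 thus "t (l y *:[P] y) : Q.lspan (t ` X)" unfolding lmapD(3)[OF tm ly] by (rule Q.lspan_smult[OF tX ly(1)])
 qed
 finally show "x : Q.lspan (t ` X)" .
 qed
 obtain Fil where Fil: "good_mod (rmod L) Fil" by (rule regular_good)
 have Qlv: "leavitt_mod Q" by (rule lv_module.intro[OF lv.leavitt_axioms QM])
 have hQ: "h k x <: (rmod L)" "h k (x +[Q] y) = h k x +[rmod L] h k y" "l <: L ==> h k (l *:[Q] x) = l *:[rmod L] h k x"
 if "k : I" "x <: Q" "y <: Q" for k x y l using that lmapD[OF h(1)[OF that(1)]] by (simp_all add: Qs)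
 have "good_mod Q (%n. {x : car Q. ALL k:I. h k x : Fil n})"
 proof (rule good_pullback[OF Fil Qlv I])
 show "x = 0[Q]" if "x <: Q" "!!k. k : I ==> h k x = 0[rmod L]" for x using h(2)[of x] that by (simp add: Qs rmod_simps)
 qed (use hQ in auto)
 then interpret gQ: good_module K L "vs E" "ix E w" "opp E w" "peer E w" "ob E" side nu g Q "%n. {x : car Q. ALL k:I. h k x : Fil n}" .
 obtain S u where S: "finite S" "S <= car Q" "car Q <= Q.lspan S" "!!y. y : S ==> u y : vs E & nu (u y) *:[Q] y = y"
 "!!l y. [|l : S ->: L; Q.lcomb l (%i. i) S = 0[Q]; y : S|] ==> l y *[L] nu (u y) = 0[L]"
 by (rule gQ.finite_basis[of "t ` X"]) (use X(1) tX Xgen in auto)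
 have SP: "S <= car P" using S(2) by (auto simp: Qs)
 define Sv where "Sv v = {y : S. u y = v}" for v
 have "ALL v. EX f. bij_betw f {0..<card (Sv v)} (Sv v)" using S(1) by (intro allI ex_bij_betw_nat_finite) (simp add: Sv_def)
 then obtain en where en: "!!v. bij_betw (en v) {0..<card (Sv v)} (Sv v)" by metis
 \<comment> \<open>One vertex for each basis element of \<open>Q\<close> at \<open>v\<close>, and
   one for \<open>v\<close> itself, which belongs to the summand \<open>L\<close>.\<close>
 define m where "m v = Suc (card (Sv v))" for v
 interpret hr: hair K E w m by unfold_locales
 \<comment> \<open>New hair vertices are numbered from one, the enumeration \<open>en\<close> from
   zero.\<close>
 define dlt where "dlt s = (if snd s = 0 then i (nu (fst s)) else en (fst s) (snd s - 1))" for s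
 have hairsD: "s : hr.hairs <-> fst s : vs E & snd s ~= 0 & snd s - 1 < card (Sv (fst s))" for s by (auto simp: hr.hairs_def hr.hair_verts m_def)
 have dlth: "dlt s : Sv (fst s)" "dlt s = en (fst s) (snd s - 1)" if "s : hr.hairs" for s proof -
 show e: "dlt s = en (fst s) (snd s - 1)" using that by (simp add: dlt_def hairsD)
 show "dlt s : Sv (fst s)" unfolding e using en[of "fst s"] that by (auto simp: bij_betw_def hairsD)
 qed
 have bij: "bij_betw dlt hr.hairs S" unfolding bij_betw_def
 proof (intro conjI equalityI subsetI)
 show "inj_on dlt hr.hairs"
 proof
 fix s r assume sr: "s : hr.hairs" "r : hr.hairs" "dlt s = dlt r"
 have f: "fst s = fst r" using dlth(1)[OF sr(1)] dlth(1)[OF sr(2)] sr(3) by (simp add: Sv_def)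
 have "snd s - 1 = snd r - 1" using sr dlth(2)[OF sr(1)] dlth(2)[OF sr(2)] f en[of "fst r"] hairsD
 by (intro inj_onD[of "en (fst r)" "{0..<card (Sv (fst r))}"]) (auto simp: bij_betw_def)
 thus "s = r" using f sr(1,2) by (auto simp: hairsD prod_eq_iff)
 qed
 fix y assume "y : dlt ` hr.hairs"
 thus "y : S" using dlth(1) by (auto simp: Sv_def)
 next
 fix y assume y: "y : S"
 hence "y : en (u y) ` {0..<card (Sv (u y))}" using en[of "u y"] by (simp add: bij_betw_def Sv_def)
 then obtain j where j: "j < card (Sv (u y))" "y = en (u y) j" by auto
 have s: "(u y, Suc j) : hr.hairs" using j(1) S(4)[OF y] by (simp add: hairsD)
 have "dlt (u y, Suc j) = y" using j(2) by (simp add: dlt_def)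
 thus "y : dlt ` hr.hairs" using s by (metis imageI)
 qed
 have ufst: "u (dlt s) = fst s" "dlt s : S" if "s : hr.hairs" for s using dlth(1)[OF that] by (auto simp: Sv_def)
 have vE: "vs hr.E' = (%v. (v, 0)) ` vs E \<union> hr.hairs" by (auto simp: hr.hairs_def hr.hair_verts)
 have disj: "(%v. (v, 0)) ` vs E \<inter> hr.hairs = {}" by (auto simp: hairsD)
 have finh: "finite hr.hairs" by (simp add: hr.hairs_def)
 have dlt0: "dlt (v, 0) = i (nu v)" for v by (simp add: dlt_def)
 have dltc: "dlt s <: P" if s: "s : vs hr.E'" for s
 proof (cases "s : hr.hairs")
 case False
 then obtain v where "v : vs E" "s = (v, 0)" using s unfolding vE by blast
 thus ?thesis using dlt0 ic[OF nu_L] by simp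
 qed (use ufst SP in blast)
 define di where "di = inv_into hr.hairs dlt"
 have di: "di y : hr.hairs" "dlt (di y) = y" if "y : S" for y using bij that unfolding di_def bij_betw_def by auto
 have didlt: "di (dlt s) = s" if "s : hr.hairs" for s using bij that unfolding di_def bij_betw_def by simp
 \<comment> \<open>The terms at the old vertices add up to an element of the image of
   \<open>i\<close>, and the terms at the hairs to a combination of the basis \<open>S\<close> of
   \<open>Q\<close>.\<close>
 have split: "EB.P.lcomb c dlt (vs hr.E') = i (sm L (%v. c (v, 0) *[L] nu v) (vs E)) +[P] Q.lcomb (%y. c (di y)) (%y. y) S"
 if c: "c : vs hr.E' ->: L" for c
 proof -
 have cc: "c s *:[P] dlt s <: P" if "s : vs hr.E'" for s using c dltc[OF that] that EB.P.smult_closed by blast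
 have cb: "c (v, 0) <: L" if "v : vs E" for v using c hr.base_verts[OF that] by blast
 have "EB.P.lcomb c dlt (vs hr.E') = sm P (%s. c s *:[P] dlt s) ((%v. (v, 0)) ` vs E) +[P] sm P (%s. c s *:[P] dlt s) hr.hairs"
 unfolding EB.P.lcomb_def vE by (rule EB.P.M.finsum_Un_disjoint) (use finh finite_verts disj cc vE in auto)
 also have "sm P (%s. c s *:[P] dlt s) ((%v. (v, 0)) ` vs E) = sm P (%v. c (v, 0) *:[P] dlt (v, 0)) (vs E)"
 by (rule EB.P.M.finsum_reindex) (use cc vE in "auto simp: inj_on_def")
 also have "... = sm P (%v. i (c (v, 0) *[L] nu v)) (vs E)"
 by (rule EB.P.M.finsum_cong') (use cb nu_L ic in "simp_all add: dlt0 ism lv.U.mult_closed EB.P.smult_closed")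
 also have "... = i (sm L (%v. c (v, 0) *[L] nu v) (vs E))" by (rule add_finsum[OF fam.B.ag EB.P.M.ag, symmetric])
 (use cb nu_L ic iadd in "simp_all add: lv.U.mult_closed")
 also have "sm P (%s. c s *:[P] dlt s) hr.hairs = sm P (%s. c (di (dlt s)) *:[P] dlt s) hr.hairs"
 by (rule EB.P.M.finsum_cong') (use cc vE in "auto simp: didlt")
 also have "... = sm P (%y. c (di y) *:[P] y) (dlt ` hr.hairs)"
 by (rule EB.P.M.finsum_reindex[symmetric]) (use bij cc vE didlt in "auto simp: bij_betw_def")
 also have "... = Q.lcomb (%y. c (di y)) (%y. y) S" proof -
 have "(%y. c (di y)) : S ->: L" using c di(1) vE by blast
 from linQ[OF S(2) this] show ?thesis using bij by (simp add: EB.P.lcomb_def bij_betw_def)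
 qed
 finally show ?thesis .
 qed
 interpret hb: hair_basis K E w m B P rc dlt
 proof (intro hair_basis.intro hr.hair_axioms EB hair_basis_axioms.intro)
 fix s assume s: "s : vs hr.E'"
 show "dlt s <: P" by (rule dltc[OF s])
 show "nu (fst s) *:[P] dlt s = dlt s"
 proof (cases "s : hr.hairs")
 case True
 thus ?thesis using S(4)[OF ufst(2)[OF True]] ufst(1)[OF True] by (simp add: Qs)
 next
 case False
 then obtain v where v: "v : vs E" "s = (v, 0)" using s unfolding vE by blast
 thus ?thesis using fam.nu_mult[OF v(1) v(1)] by (simp add: dlt0 flip: ism)
 qed
 next
 fix z assume z: "z <: P"
 have "t z : Q.lspan S" using S(3) tc[OF z] by blast
 then obtain l where l: "l : S ->: L" "t z = Q.lcomb l (%y. y) S" by (rule Q.lspan_finite[OF S(1,2)])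
 \<comment> \<open>Every old vertex may carry the full coefficient \<open>p z\<close>, since
   \<open>dlt (v, 0)\<close> retains only \<open>p z *[L] nu v\<close>, and these parts sum to
   \<open>p z\<close>.\<close>
 define c where "c s = (if snd s = 0 then p z else l (dlt s))" for s
 have cc: "c : vs hr.E' ->: L"
 proof
 fix s assume s: "s : vs hr.E'"
 show "c s <: L"
 proof (cases "snd s = 0")
 case False
 hence "s : hr.hairs" using s by (simp add: hr.hairs_def)
 thus ?thesis using funcset_mem[OF l(1) ufst(2)] False by (simp add: c_def)
 qed (simp add: c_def pc[OF z])
 qed
 have "Q.lcomb (%y. c (di y)) (%y. y) S = Q.lcomb l (%y. y) S"
 proof (rule Q.lcomb_cong[OF _ l(1)])
 fix y assume y: "y : S"
 have "snd (di y) ~= 0" using di(1)[OF y] hairsD by blast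
 thus "c (di y) = l y" by (simp add: c_def di(2)[OF y])
 qed (use S(2) in blast)
 moreover have "sm L (%v. c (v, 0) *[L] nu v) (vs E) = p z" proof -
 have "sm L (%v. p z *[L] nu v) (vs E) = p z *[L] 1[L]" unfolding lv.one_sum by (rule lv.U.mult_finsum[symmetric])
 (use pc[OF z] nu_L in "simp_all add: lv.U.mult_closed lv.U.mult_r_distr")
 thus ?thesis using pc[OF z] by (simp add: c_def)
 qed
 ultimately have "z = EB.P.lcomb c dlt (vs hr.E')" using split[OF cc] decomp[OF z] l(2) by simp
 thus "EX c:vs hr.E' ->: L. z = EB.P.lcomb c dlt (vs hr.E')" using cc by blast
 next
 fix c s assume c: "c : vs hr.E' ->: L" and 0: "EB.P.lcomb c dlt (vs hr.E') = 0[P]" and s: "s : vs hr.E'"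
 let ?a = "sm L (%v. c (v, 0) *[L] nu v) (vs E)" and ?q = "Q.lcomb (%y. c (di y)) (%y. y) S"
 have cb: "c (v, 0) <: L" if "v : vs E" for v using c hr.base_verts[OF that] by blast
 have ac: "?a <: L" using cb by (intro fam.B.finsum_closed) simp
 have dl: "(%y. c (di y)) : S ->: L" using c di(1) vE by blast
 have qc: "?q <: Q" by (rule Q.lcomb_closed[OF dl]) (use S(2) in blast)
 hence qP: "?q <: P" "p ?q = 0[L]" by (simp_all add: Qs)
 have e: "i ?a +[P] ?q = 0[P]" using split[OF c] 0 by simp
 \<comment> \<open>Applying \<open>p\<close> separates the two summands of the relation.\<close>
 have "p (i ?a +[P] ?q) = ?a" using ac qP ic[OF ac] by (simp add: padd pi)
 hence a0: "?a = 0[L]" using e p0 by simp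
 hence q0: "?q = 0[Q]" using e qP(1) by (simp add: i0 Qs(2))
 show "c s *[L] nu (fst s) = 0[L]"
 proof (cases "s : hr.hairs")
 case True
 show ?thesis using S(5)[OF dl q0 ufst(2)[OF True]] by (simp add: didlt[OF True] ufst(1)[OF True])
 next
 case False
 then obtain v where v: "v : vs E" "s = (v, 0)" using s unfolding vE by blast
 have "?a *[L] nu v = sm L (%r. c (r, 0) *[L] nu r *[L] nu v) (vs E)" by (rule lv.U.finsum_mult)
 (use cb nu_L v in "simp_all add: lv.U.mult_closed lv.U.mult_l_distr")
 also have "... = c (v, 0) *[L] nu v *[L] nu v" by (rule fam.B.finsum_delta[OF finite_verts v(1)])
 (use cb nu_L v fam.nu_mult in "simp_all add: lv.U.mult_closed lv.U.mult_assoc")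
 also have "... = c (v, 0) *[L] nu v" using cb[OF v(1)] nu_L[OF v(1)] fam.nu_mult[OF v(1) v(1)] by (simp add: lv.U.mult_assoc)
 finally show ?thesis using a0 v by simp
 qed
 qed
 show ?thesis by (rule that[OF _ hb.isomorphic_hair]) (simp add: m_def)
qed

end

lemma morita_equivalentE:
 fixes A :: "('k, 'a) module" and B :: "('k, 'b) module"
 assumes "ualg K A" "ualg K B" "morita_equivalent TYPE('u) K A B"
 obtains F :: "('a, 'u) module => ('b, 'u) module" and Phi G Gam eta zet where "equivalence K A B F Phi G Gam eta zet"
proof -
 obtain F :: "('a, 'u) module => ('b, 'u) module" and Phi G Gam where
 FG: "linear_functor K A B F Phi" "linear_functor K B A G Gam" "nat_iso_id A F Phi G Gam" "nat_iso_id B G Gam F Phi"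
 using assms(3) unfolding morita_equivalent_def by blast
 obtain eta where eta: "!!M. lmod A M ==> eta M : mod_iso A M (G (F M))" "!!M N f. [|lmod A M; lmod A N; f : mod_hom A M N|] ==>
 compose (car M) (eta N) f = compose (car M) (Gam (F M) (F N) (Phi M N f)) (eta M)" using FG(3) unfolding nat_iso_id_def by blast
 obtain zet where zet: "!!M. lmod B M ==> zet M : mod_iso B M (F (G M))" "!!M N f. [|lmod B M; lmod B N; f : mod_hom B M N|] ==>
 compose (car M) (zet N) f = compose (car M) (Phi (G M) (G N) (Gam M N f)) (zet M)" using FG(4) unfolding nat_iso_id_def by blast
 have "equivalence K A B F Phi G Gam eta zet"
 proof (intro equivalence.intro equivalence_axioms.intro assms(1,2) FG(1,2))
 fix M N :: "('a, 'u) module" and f x assume "lmod A M" "lmod A N" "f : mod_hom A M N" "x <: M"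
 thus "eta N (f x) = Gam (F M) (F N) (Phi M N f) (eta M x)" using fun_cong[OF eta(2), of M N f x] by (simp add: compose_def)
 next
 fix M N :: "('b, 'u) module" and f x assume "lmod B M" "lmod B N" "f : mod_hom B M N" "x <: M"
 thus "zet N (f x) = Phi (G M) (G N) (Gam M N f) (zet M x)" using fun_cong[OF zet(2), of M N f x] by (simp add: compose_def)
 qed (use eta(1) zet(1) in auto)
 thus ?thesis by (rule that)
qed

context lpa_setup
begin

text \<open>Since \<open>F reg\<close> is a generator, \<open>L\<close> splits off a finite power of
  it; since it has a dual basis, this power has finitely many generators and a jointly injective
  finite family of maps to \<open>L\<close>.\<close>

lemma equivalence_hair:
 fixes A :: "('k, 'a) module" and F :: "('a, 'u) module => _" and iA :: "'a => 'u"
 assumes "equiv_reg K A L F Phi G Gam eta zet iA iL"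
 obtains n m where "0 < n" "!!v. 0 < m v" "algebra_isomorphic K (matrix_algebra n A) (leavitt_path_algebra K (hair_extension E m) (hair_weight w))"
proof -
 interpret equiv_reg K A L F Phi G Gam eta zet iA iL by fact
 let ?X = "F reg"
 interpret X: endo_bimodule K L A ?X "%x a. Phi reg reg (rmul a) x" by (rule endo_bimodule_reg)
 note XM = X.P.left_module_axioms
 obtain T p t where T: "finite T" "!!s. s : T ==> lmap L ?X (rmod L) (p s)"
 "!!s. s : T ==> t s <: ?X" "1[L] = sm L (%s. p s (t s)) (T :: 'u set)" by (rule swap.trace_one) blast
 obtain T' q y where T': "finite T'" "!!s. s : T' ==> lmap L ?X (rmod L) (q s)"
 "!!s. s : T' ==> y s <: ?X" "!!x. x <: ?X ==> x = sm ?X (%s. q s x *:[?X] y s) (T' :: 'u set)" by (rule dual_basis) blast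
 obtain f where f: "bij_betw f {0..<card T} T" using ex_bij_betw_nat_finite[OF T(1)] by blast
 define N where "N = card T"
 have fN: "f k : T" if "k < N" for k using f that by (auto simp: N_def bij_betw_def)
 have fb: "inj_on f {..<N}" "f ` {..<N} = T" using f by (auto simp: N_def bij_betw_def atLeast0LessThan)
 \<comment> \<open>\<open>N\<close> copies are enough to split off \<open>L\<close>; one more keeps
   the size of the matrices positive when \<open>T\<close> is empty.\<close>
 let ?n = "Suc N" and ?P = "pmod (Suc N) ?X"
 note PM = left_module_pow[OF XM, of "Suc N"]
 interpret P: left_module L ?P by (rule PM)
 have pL: "p s x <: L" if "s : T" "x <: ?X" for s x using lmapD(1)[OF T(2)[OF that(1)] that(2)] by (simp add: rmod_simps)
 have qL: "q s x <: L" if "s : T'" "x <: ?X" for s x using lmapD(1)[OF T'(2)[OF that(1)] that(2)] by (simp add: rmod_simps)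
 \<comment> \<open>The first \<open>N\<close> coordinates multiply \<open>l\<close> into the
   elements \<open>t\<close>; applying the functions \<open>p\<close> and adding gives back
   \<open>l\<close>, because \<open>T\<close> resolves \<open>1[L]\<close>.\<close>
 define i where "i l = (\<lambda>k\<in>{..<?n}. if k < N then l *:[?X] t (f k) else 0[?X])" for l
 define pr where "pr z = sm L (%k. p (f k) (z k)) {..<N}" for z
 have i: "lmap L (rmod L) ?P i" unfolding lmap_def rmod_simps
 proof (intro conjI ballI)
 show "i : car L ->: ?P" using T(3)[OF fN] by (auto simp: i_def pow_simps)
 fix x y assume "x <: L" "y <: L"
 thus "i (x +[L] y) = i x +[?P] i y" unfolding i_def pow_simps using T(3)[OF fN] by (intro restrict_ext) (simp add: X.P.smult_l_distr)
 next
 fix x y assume "x <: L" "y <: L"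
 thus "i (x *[L] y) = x *:[?P] i y" unfolding i_def pow_simps using T(3)[OF fN] by (intro restrict_ext) (simp add: X.P.smult_assoc)
 qed
 have pz: "p (f k) (z k) <: L" if "z <: ?P" "k < N" for z k using pL[OF fN[OF that(2)] pow_val[OF that(1)]] that(2) by simp
 have pr: "lmap L ?P (rmod L) pr" unfolding lmap_def rmod_simps
 proof (intro conjI ballI)
 show "pr : car ?P ->: L" using pz by (auto simp: pr_def)
 fix z x assume z: "z <: ?P" and x: "x <: ?P"
 have "pr (z +[?P] x) = sm L (%k. p (f k) (z k) +[L] p (f k) (x k)) {..<N}" unfolding pr_def
 proof (rule fam.B.finsum_cong'[OF refl])
 fix k assume "k : {..<N}"
 hence k: "k < N" "k < ?n" by auto
 show "p (f k) ((z +[?P] x) k) = p (f k) (z k) +[L] p (f k) (x k)"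
 using lmapD(2)[OF T(2)[OF fN[OF k(1)]] pow_val[OF z k(2)] pow_val[OF x k(2)]] k by (simp add: pow_simps(3) rmod_simps)
 qed (use pz[OF z] pz[OF x] in simp)
 also have "... = pr z +[L] pr x" unfolding pr_def using pz[OF z] pz[OF x] by (intro fam.B.finsum_addf) simp_all
 finally show "pr (z +[?P] x) = pr z +[L] pr x" .
 next
 fix l z assume l: "l <: L" and z: "z <: ?P"
 have "pr (l *:[?P] z) = sm L (%k. l *[L] p (f k) (z k)) {..<N}" unfolding pr_def
 proof (rule fam.B.finsum_cong'[OF refl])
 fix k assume "k : {..<N}"
 hence k: "k < N" "k < ?n" by auto
 show "p (f k) ((l *:[?P] z) k) = l *[L] p (f k) (z k)" using lmapD(3)[OF T(2)[OF fN[OF k(1)]] l pow_val[OF z k(2)]] k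
 by (simp add: pow_simps(4) rmod_simps)
 qed (use pz[OF z] l lv.U.mult_closed in simp)
 also have "... = l *[L] pr z" unfolding pr_def by (rule lv.U.mult_finsum[symmetric])
 (use l pz[OF z] in "simp_all add: lv.U.mult_closed lv.U.mult_r_distr")
 finally show "pr (l *:[?P] z) = l *[L] pr z" .
 qed
 have pri: "pr (i l) = l" if l: "l <: L" for l proof -
 have pt: "p s (t s) <: L" if "s : T" for s by (rule pL[OF that T(3)[OF that]])
 have "pr (i l) = sm L (%k. l *[L] p (f k) (t (f k))) {..<N}" unfolding pr_def
 proof (rule fam.B.finsum_cong'[OF refl])
 fix k assume "k : {..<N}"
 hence k: "k < N" by simp
 show "p (f k) (i l k) = l *[L] p (f k) (t (f k))"
 using lmapD(3)[OF T(2)[OF fN[OF k]] l T(3)[OF fN[OF k]]] k by (simp add: i_def rmod_simps)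
 qed (use l pt fN in "simp add: lv.U.mult_closed")
 also have "... = sm L (%s. l *[L] p s (t s)) (f ` {..<N})"
 by (rule fam.B.finsum_reindex[symmetric]) (use fb l pt in "auto simp: lv.U.mult_closed")
 also have "... = l *[L] sm L (%s. p s (t s)) T" unfolding fb(2) by (rule lv.U.mult_finsum[symmetric])
 (use l pt in "simp_all add: lv.U.mult_closed lv.U.mult_r_distr")
 finally show ?thesis using l unfolding T(4)[symmetric] by simp
 qed
 let ?I = "{..<?n} \<times> T'"
 \<comment> \<open>The elements of the dual basis, placed in each coordinate in turn.\<close>
 define g where "g = (%ks. uvec ?n ?X (fst ks) (y (snd ks)))"
 have gc: "g ks <: ?P" if "ks : ?I" for ks unfolding g_def using that T'(3) by (intro X.P.unit_vec_closed) auto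
 have gI: "g ` ?I <= car ?P" using gc by blast
 have gen: "car ?P <= P.lspan (g ` ?I)"
 proof
 fix z assume z: "z <: ?P"
 have "(sm ?P (%k. uvec ?n ?X k (z k)) {..<?n}) : P.lspan (g ` ?I)"
 proof (rule P.lspan_finsum[OF gI])
 fix k assume k: "k : {..<?n}"
 have zk: "z k <: ?X" using pow_val[OF z] k by simp
 have c: "q s (z k) *:[?X] y s <: ?X" if "s : T'" for s by (rule X.P.smult_closed[OF qL[OF that zk] T'(3)[OF that]])
 have "uvec ?n ?X k (z k) = uvec ?n ?X k (sm ?X (%s. q s (z k) *:[?X] y s) T')" using T'(4)[OF zk] by simp
 also have "... = sm ?P (%s. uvec ?n ?X k (q s (z k) *:[?X] y s)) T'"
 using c by (intro lmap_finsum[OF unit_vec_map[OF XM] XM PM]) blast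
 also have "... : P.lspan (g ` ?I)"
 proof (rule P.lspan_finsum[OF gI])
 fix s assume s: "s : T'"
 have "uvec ?n ?X k (y s) = g (k, s)" by (simp add: g_def)
 moreover have "g (k, s) : g ` ?I" using k s by blast
 ultimately have "uvec ?n ?X k (y s) : P.lspan (g ` ?I)" using P.lspan_mem[OF gI] by simp
 thus "uvec ?n ?X k (q s (z k) *:[?X] y s) : P.lspan (g ` ?I)" unfolding lmapD(3)[OF unit_vec_map[OF XM] qL[OF s zk] T'(3)[OF s]]
 by (rule P.lspan_smult[OF gI qL[OF s zk]])
 qed
 finally show "uvec ?n ?X k (z k) : P.lspan (g ` ?I)" .
 qed
 thus "z : P.lspan (g ` ?I)" using X.P.pow_decomp[OF z] by simp
 qed
 have hm: "lmap L ?P (rmod L) (%z. q (snd ks) (z (fst ks)))" if "ks : ?I" for ks proof -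
 have "fst ks < ?n" "snd ks : T'" using that by auto
 moreover have "lmap L ?P ?X (%z. z (fst ks))"
 using `fst ks < ?n` pow_val[OF _ `fst ks < ?n`, of _ ?X] by (simp add: lmap_def pow_simps(3,4))
 ultimately show ?thesis using lmap_compose[OF _ T'(2)] by blast
 qed
 have inj: "z = 0[?P]" if z: "z <: ?P" and 0: "!!ks. ks : ?I ==> q (snd ks) (z (fst ks)) = 0[L]" for z
 proof (rule pow_eqI[OF z P.M.zero_closed])
 fix k assume k: "k < ?n"
 have "z k = sm ?X (%s. q s (z k) *:[?X] y s) T'" by (rule T'(4)[OF pow_val[OF z k]])
 also have "... = 0[?X]"
 proof (rule X.P.M.add.finprod_one_eqI)
 fix s assume s: "s : T'"
 have "q s (z k) = 0[L]" using 0[of "(k, s)"] k s by simp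
 thus "q s (z k) *:[?X] y s = 0[?X]" using T'(3)[OF s] by simp
 qed
 finally show "z k = 0[?P] k" using k by (simp add: pow_simps(2))
 qed
 obtain m where "!!v. 0 < m v" "algebra_isomorphic K (matrix_algebra ?n A) (leavitt_path_algebra K (hair_extension E m) (hair_weight w))"
 proof (rule bimodule_hair[OF X.endo_bimodule_pow i pr, of "g ` ?I" ?I "%ks z. q (snd ks) (z (fst ks))"])
 show "finite (g ` ?I)" "finite ?I" using T'(1) by auto
 show "lmap L ?P (rmod L) (%z. q (snd ks) (z (fst ks)))" if "ks : ?I" for ks by (rule hm[OF that])
 show "z = 0[?P]" if "z <: ?P" "!!ks. ks : ?I ==> q (snd ks) (z (fst ks)) = 0[L]" for z by (rule inj[OF that])
 show "pr (i l) = l" if "l <: L" for l by (rule pri[OF that])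
 show "g ` ?I <= car ?P" by (rule gI)
 show "car ?P <= P.lspan (g ` ?I)" by (rule gen)
 qed blast
 thus ?thesis using that[of ?n m] by blast
qed

end

theorem theorem3p13:
  fixes K :: "'k ring" and A :: "('k, 'a) module"
    and E :: "('v, 'e) pre_digraph" and w :: "'e \<Rightarrow> nat"
  assumes "field K"
    and "unital_algebra K A"
    and "fin_digraph E"
    and "vertex_weighted_graph E w"
    and "module_universe TYPE('u) A"
    and "module_universe TYPE('u) (leavitt_path_algebra K E w)"
  shows "morita_equivalent TYPE('u) K A (leavitt_path_algebra K E w) \<longleftrightarrow>
    (\<exists>(n :: nat) (m :: 'v \<Rightarrow> nat). 0 < n \<and> (\<forall>v\<in>verts E. 0 < m v) \<and>
      algebra_isomorphic K (matrix_algebra n A)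
        (leavitt_path_algebra K (hair_extension E m) (hair_weight w)))"
proof
 interpret lpa_setup K E w by (intro lpa_setup.intro assms)
 have inf: "infinite (UNIV :: 'u set)" using assms(5) by (simp add: module_universe_def)
 {
 assume "morita_equivalent TYPE('u) K A L"
 then obtain F :: "('a, 'u) module => (_, 'u) module" and Phi G Gam eta zet where e: "equivalence K A L F Phi G Gam eta zet"
 by (rule morita_equivalentE[OF assms(2) unital_L])
 \<comment> \<open>The universe has room for copies of both regular modules, from which the bimodule
   of the equivalence is obtained.\<close>
 obtain iA :: "'a => 'u" where iA: "inj_on iA (car A)" using assms(5) by (auto simp: module_universe_def lepoll_def)
 obtain iL :: "_ => 'u" where iL: "inj_on iL (car L)" using assms(6) by (auto simp: module_universe_def lepoll_def)
 have "equiv_reg K A L F Phi G Gam eta zet iA iL" by (intro equiv_reg.intro equiv_reg_axioms.intro e iA iL)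
 thus "EX (n :: nat) (m :: 'v => nat). 0 < n & (ALL v:vs E. 0 < m v) &
 algebra_isomorphic K (matrix_algebra n A) (leavitt_path_algebra K (hair_extension E m) (hair_weight w))" by (rule equivalence_hair) blast
 next
 assume "EX (n :: nat) (m :: 'v => nat). 0 < n & (ALL v:vs E. 0 < m v) &
 algebra_isomorphic K (matrix_algebra n A) (leavitt_path_algebra K (hair_extension E m) (hair_weight w))"
 then obtain n m where n: "0 < n" and iso: "algebra_isomorphic K (matrix_algebra n A)
 (leavitt_path_algebra K (hair_extension E m) (hair_weight w))" by blast
 interpret hair K E w m by unfold_locales
 show "morita_equivalent TYPE('u) K A L" by (rule morita_equivalent_hair[OF assms(2) n inf iso])
 }
qed

end
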